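(* Let $R$ be a commutative noetherian ring. Let $H$ be a Hopf $R$-algebra such that $H^\circ$ is pure in $R^H$, and let $U$ be a Hopf subalgebra of $H^\circ$. Assume that both $H$ and $U$ have bijective antipodes and that $U$ satisfies the RL-condition with respect to $H$. Let $A$ be a right $U$-comodule algebra (hence a left $H$-module algebra via $ha=\sum a_0\langle a_1,h\rangle$). Let $U$ act on $A\# H$ by acting trivially on $A$ and via $\rightharpoonup$ on $H$, i.e. $f\cdot(a\# h)=a\#(f\rightharpoonup h)$. Then there is an isomorphism of $R$-algebras $$(A\# H)\# U\;\simeq\; A\otimes(H\# U).$$
   Context: Algebras are associative with unit; $\otimes=\otimes_R$. $R^H$ is the $R$-module of all maps $H\to R$. A submodule $N\subseteq M$ is pure if $N\otimes X\to M\otimes X$ is injective for every $R$-module $X$. $H^\circ=\{f\in\mathrm{Hom}_R(H,R): Hf\text{ is a finitely generated }R\text{-module}\}$, where $(hf)(k)=f(kh)$. If $R$ is noetherian and $H^\circ$ is pure in $R^H$, then $H^\circ$ is a Hopf algebra: its multiplication is convolution $(fg)(h)=\sum f(h_1)g(h_2)$ with unit $\epsilon$, its comultiplication $f\mapsto\sum f_1\otimes f_2$ is determined by $f(hk)=\sum f_1(h)f_2(k)$, its counit is $f\mapsto f(1)$, and its antipode is $f\mapsto f\circ S$. Write $\langle f,h\rangle=f(h)$. A Hopf subalgebra $U\subseteq H^\circ$ is required to be pure as an $R$-submodule of $H^\circ$. Left $H$-module algebra: an $R$-algebra $A$ that is a left $H$-module with $h(ab)=\sum(h_1a)(h_2b)$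 and $h1_A=\epsilon(h)1_A$. Right $U$-comodule algebra: an $R$-algebra $A$ that is a right $U$-comodule via $a\mapsto\sum a_0\otimes a_1\in A\otimes U$ with $ab\mapsto\sum a_0b_0\otimes a_1b_1$ and $1_A\mapsto 1_A\otimes 1_U$. Smash product: for a Hopf algebra $K$ and a left $K$-module algebra $A$, $A\# K$ is $A\otimes K$ with multiplication $(a\# h)(b\# k)=\sum a(h_1b)\# h_2k$. Actions: $H$ acts on the left of $U$ by $h\rightharpoonup f=\sum f_1\langle f_2,h\rangle$, making $U$ a left $H$-module algebra; $U$ acts on the left of $H$ by $f\rightharpoonup h=\sum h_1\langle f,h_2\rangle$, making $H$ a left $U$-module algebra, and on the right of $H$ by $h\leftharpoonup f=\sum\langle f,h_1\rangle h_2$. These define the smash products $U\# H$ and $H\# U$. Define $\lambda:H\# U\to\mathrm{End}_R(H)$, $\lambda(h\# f)(k)=h(f\rightharpoonup k)$, and $\rho:U\# H\to\mathrm{End}_R(H)$, $\rho(f\# h)(k)=(k\leftharpoonup f)h$. $U$ satisfies the RL-condition with respect to $H$ if $\rho(U\# 1)\subseteq\lambda(H\# U)$. *)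

theory Defs
  imports "HOL-Algebra.Module" "HOL-Algebra.AbelCoset" "HOL-Algebra.RingHom"
    "HOL-Algebra.Ring_Divisibility"
begin

section \<open>Modules and algebras over a commutative ring\<close>

text \<open>The library's \<open>algebra\<close> locale is restricted to commutative algebras.\<close>

locale assoc_algebra = module R M + ring M for R (structure) and M (structure) +
  assumes smult_mult_left:
      "\<lbrakk>r \<in> carrier R; x \<in> carrier M; y \<in> carrier M\<rbrakk>
        \<Longrightarrow> (r \<odot>\<^bsub>M\<^esub> x) \<otimes>\<^bsub>M\<^esub> y = r \<odot>\<^bsub>M\<^esub> (x \<otimes>\<^bsub>M\<^esub> y)"
    and smult_mult_right:
      "\<lbrakk>r \<in> carrier R; x \<in> carrier M; y \<in> carrier M\<rbrakk>
        \<Longrightarrow> x \<otimes>\<^bsub>M\<^esub> (r \<odot>\<^bsub>M\<^esub> y) = r \<odot>\<^bsub>M\<^esub> (x \<otimes>\<^bsub>M\<^esub> y)"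

definition self_module :: "('r, 's) ring_scheme \<Rightarrow> ('r, 'r) module" where
  "self_module R = \<lparr>carrier = carrier R, mult = mult R, one = one R,
     zero = zero R, add = add R, smult = mult R\<rparr>"

definition linear_maps ::
  "('r, 's) ring_scheme \<Rightarrow> ('r, 'm, 'x) module_scheme \<Rightarrow> ('r, 'n, 'y) module_scheme \<Rightarrow> ('m \<Rightarrow> 'n) set"
where
  "linear_maps R M N = {f \<in> carrier M \<rightarrow> carrier N.
     (\<forall>x\<in>carrier M. \<forall>y\<in>carrier M. f (x \<oplus>\<^bsub>M\<^esub> y) = f x \<oplus>\<^bsub>N\<^esub> f y) \<and>
     (\<forall>r\<in>carrier R. \<forall>x\<in>carrier M. f (r \<odot>\<^bsub>M\<^esub> x) = r \<odot>\<^bsub>N\<^esub> f x)}"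

definition algebra_homs ::
  "('r, 's) ring_scheme \<Rightarrow> ('r, 'm, 'x) module_scheme \<Rightarrow> ('r, 'n, 'y) module_scheme \<Rightarrow> ('m \<Rightarrow> 'n) set"
where
  "algebra_homs R A B = ring_hom A B \<inter> linear_maps R A B"

definition algebras_isomorphic ::
  "('r, 's) ring_scheme \<Rightarrow> ('r, 'm, 'x) module_scheme \<Rightarrow> ('r, 'n, 'y) module_scheme \<Rightarrow> bool"
where
  "algebras_isomorphic R A B \<longleftrightarrow> assoc_algebra R A \<and> assoc_algebra R B \<and>
     (\<exists>\<phi>\<in>algebra_homs R A B. bij_betw \<phi> (carrier A) (carrier B))"

definition submodule_span ::
  "('r, 's) ring_scheme \<Rightarrow> ('r, 'm, 'x) module_scheme \<Rightarrow> 'm set \<Rightarrow> 'm set"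
where
  "submodule_span R M S = \<Inter>{N. submodule N R M \<and> S \<subseteq> N}"

definition finitely_generated_submodule ::
  "('r, 's) ring_scheme \<Rightarrow> ('r, 'm, 'x) module_scheme \<Rightarrow> 'm set \<Rightarrow> bool"
where
  "finitely_generated_submodule R M N \<longleftrightarrow>
     (\<exists>S. finite S \<and> S \<subseteq> carrier M \<and> N = submodule_span R M S)"

text \<open>In the module constructions below that carry no multiplication, the record fields
  \<open>mult\<close> and \<open>one\<close> are left unspecified.\<close>

definition function_module :: "('r, 's) ring_scheme \<Rightarrow> 'i set \<Rightarrow> ('r, 'i \<Rightarrow> 'r) module" where
  "function_module R I = \<lparr>carrier = I \<rightarrow>\<^sub>E carrier R, mult = undefined, one = undefined,
     zero = (\<lambda>i\<in>I. \<zero>\<^bsub>R\<^esub>), add = (\<lambda>f g. \<lambda>i\<in>I. f i \<oplus>\<^bsub>R\<^esub> g i),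
     smult = (\<lambda>r f. \<lambda>i\<in>I. r \<otimes>\<^bsub>R\<^esub> f i)\<rparr>"

definition free_module :: "('r, 's) ring_scheme \<Rightarrow> 'i set \<Rightarrow> ('r, 'i \<Rightarrow> 'r) module" where
  "free_module R I = \<lparr>carrier = {f. (\<forall>i. f i \<in> carrier R) \<and> (\<forall>i. i \<notin> I \<longrightarrow> f i = \<zero>\<^bsub>R\<^esub>) \<and>
       finite {i. f i \<noteq> \<zero>\<^bsub>R\<^esub>}},
     mult = undefined, one = undefined,
     zero = (\<lambda>i. \<zero>\<^bsub>R\<^esub>), add = (\<lambda>f g i. f i \<oplus>\<^bsub>R\<^esub> g i), smult = (\<lambda>r f i. r \<otimes>\<^bsub>R\<^esub> f i)\<rparr>"

definition free_basis :: "('r, 's) ring_scheme \<Rightarrow> 'i \<Rightarrow> 'i \<Rightarrow> 'r" where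
  "free_basis R i = (\<lambda>j. if j = i then \<one>\<^bsub>R\<^esub> else \<zero>\<^bsub>R\<^esub>)"

definition quotient_module ::
  "('r, 's) ring_scheme \<Rightarrow> ('r, 'm, 'x) module_scheme \<Rightarrow> 'm set \<Rightarrow> ('r, 'm set) module"
where
  "quotient_module R M N = \<lparr>carrier = a_rcosets\<^bsub>M\<^esub> N, mult = undefined, one = undefined,
     zero = N, add = (\<lambda>X Y. X <+>\<^bsub>M\<^esub> Y), smult = (\<lambda>r X. \<Union>x\<in>X. N +>\<^bsub>M\<^esub> (r \<odot>\<^bsub>M\<^esub> x))\<rparr>"


section \<open>Tensor products\<close>

definition tensor_relations ::
  "('r, 's) ring_scheme \<Rightarrow> ('r, 'm, 'x) module_scheme \<Rightarrow> ('r, 'n, 'y) module_scheme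
    \<Rightarrow> ('m \<times> 'n \<Rightarrow> 'r) set"
where
  "tensor_relations R M N =
    (let F = free_module R (carrier M \<times> carrier N); e = free_basis R in submodule_span R F
     ({e (m \<oplus>\<^bsub>M\<^esub> m', n) \<ominus>\<^bsub>F\<^esub> (e (m, n) \<oplus>\<^bsub>F\<^esub> e (m', n)) | m m' n.
         m \<in> carrier M \<and> m' \<in> carrier M \<and> n \<in> carrier N} \<union>
      {e (m, n \<oplus>\<^bsub>N\<^esub> n') \<ominus>\<^bsub>F\<^esub> (e (m, n) \<oplus>\<^bsub>F\<^esub> e (m, n')) | m n n'.
         m \<in> carrier M \<and> n \<in> carrier N \<and> n' \<in> carrier N} \<union>
      {e (r \<odot>\<^bsub>M\<^esub> m, n) \<ominus>\<^bsub>F\<^esub> r \<odot>\<^bsub>F\<^esub> e (m, n) | r m n.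
         r \<in> carrier R \<and> m \<in> carrier M \<and> n \<in> carrier N} \<union>
      {e (m, r \<odot>\<^bsub>N\<^esub> n) \<ominus>\<^bsub>F\<^esub> r \<odot>\<^bsub>F\<^esub> e (m, n) | r m n.
         r \<in> carrier R \<and> m \<in> carrier M \<and> n \<in> carrier N}))"

definition tensor_module ::
  "('r, 's) ring_scheme \<Rightarrow> ('r, 'm, 'x) module_scheme \<Rightarrow> ('r, 'n, 'y) module_scheme
    \<Rightarrow> ('r, ('m \<times> 'n \<Rightarrow> 'r) set) module"
where
  "tensor_module R M N =
     quotient_module R (free_module R (carrier M \<times> carrier N)) (tensor_relations R M N)"

definition tensor ::
  "('r, 's) ring_scheme \<Rightarrow> ('r, 'm, 'x) module_scheme \<Rightarrow> ('r, 'n, 'y) module_scheme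
    \<Rightarrow> 'm \<Rightarrow> 'n \<Rightarrow> ('m \<times> 'n \<Rightarrow> 'r) set"
where
  "tensor R M N m n =
     tensor_relations R M N +>\<^bsub>free_module R (carrier M \<times> carrier N)\<^esub> free_basis R (m, n)"

text \<open>For a bilinear map \<open>\<beta>\<close> into \<open>P\<close>, \<open>tensor_lift R P \<beta>\<close> is the induced linear map, which sends
  \<open>\<Sum>m\<^sub>i \<otimes> n\<^sub>i\<close> to \<open>\<Sum>\<beta> m\<^sub>i n\<^sub>i\<close>. The value does not depend on the chosen representative.  A Sweedler
  expression \<open>\<Sum>\<beta>(h\<^sub>1, h\<^sub>2)\<close> is \<open>tensor_lift R P \<beta> (\<Delta> h)\<close>.\<close>

definition tensor_lift ::
  "('r, 's) ring_scheme \<Rightarrow> ('r, 'p, 'z) module_scheme \<Rightarrow> ('m \<Rightarrow> 'n \<Rightarrow> 'p)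
    \<Rightarrow> ('m \<times> 'n \<Rightarrow> 'r) set \<Rightarrow> 'p"
where
  "tensor_lift R P \<beta> t = (let f = (SOME f. f \<in> t) in
     \<Oplus>\<^bsub>P\<^esub>p\<in>{p. f p \<noteq> \<zero>\<^bsub>R\<^esub>}. f p \<odot>\<^bsub>P\<^esub> \<beta> (fst p) (snd p))"

definition tensor_map ::
  "('r, 's) ring_scheme \<Rightarrow> ('r, 'm, 'x) module_scheme \<Rightarrow> ('r, 'n, 'y) module_scheme
    \<Rightarrow> ('k \<Rightarrow> 'm) \<Rightarrow> ('l \<Rightarrow> 'n) \<Rightarrow> ('k \<times> 'l \<Rightarrow> 'r) set \<Rightarrow> ('m \<times> 'n \<Rightarrow> 'r) set"
where
  "tensor_map R M N \<phi> \<psi> =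
     tensor_lift R (tensor_module R M N) (\<lambda>k l. tensor R M N (\<phi> k) (\<psi> l))"

text \<open>The canonical map \<open>(L \<otimes> M) \<otimes> N \<rightarrow> L \<otimes> (M \<otimes> N)\<close>.\<close>

definition tensor_assoc ::
  "('r, 's) ring_scheme \<Rightarrow> ('r, 'l, 'x) module_scheme \<Rightarrow> ('r, 'm, 'y) module_scheme
    \<Rightarrow> ('r, 'n, 'z) module_scheme
    \<Rightarrow> (('l \<times> 'm \<Rightarrow> 'r) set \<times> 'n \<Rightarrow> 'r) set \<Rightarrow> ('l \<times> ('m \<times> 'n \<Rightarrow> 'r) set \<Rightarrow> 'r) set"
where
  "tensor_assoc R L M N =
    (let MN = tensor_module R M N; T = tensor_module R L MN in
      tensor_lift R T (\<lambda>u n. tensor_lift R T (\<lambda>l m. tensor R L MN l (tensor R M N m n)) u))"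

definition tensor_algebra ::
  "('r, 's) ring_scheme \<Rightarrow> ('r, 'm, 'x) module_scheme \<Rightarrow> ('r, 'n, 'y) module_scheme
    \<Rightarrow> ('r, ('m \<times> 'n \<Rightarrow> 'r) set) module"
where
  "tensor_algebra R A B = (let T = tensor_module R A B in
     T\<lparr>mult := (\<lambda>s t. tensor_lift R T (\<lambda>a b. tensor_lift R T
           (\<lambda>a' b'. tensor R A B (a \<otimes>\<^bsub>A\<^esub> a') (b \<otimes>\<^bsub>B\<^esub> b')) t) s),
       one := tensor R A B \<one>\<^bsub>A\<^esub> \<one>\<^bsub>B\<^esub>\<rparr>)"

text \<open>In HOL one cannot quantify over the carrier type of the test module \<open>X\<close> inside a formula. The
  type used here contains an isomorphic copy of every finitely generated \<open>R\<close>-module (a quotient of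
  some \<open>R\<^sup>n\<close>).  This suffices for injectivity for all modules of all types, as an element of a tensor
  product and a proof of its vanishing involve only finitely many elements of \<open>X\<close>;
  see \<open>pure_submodule_inj\<close> below.\<close>

definition pure_submodule ::
  "('r, 's) ring_scheme \<Rightarrow> 'm set \<Rightarrow> ('r, 'm, 'x) module_scheme \<Rightarrow> bool"
where
  "pure_submodule R N M \<longleftrightarrow> submodule N R M \<and>
     (\<forall>X :: ('r, (nat \<Rightarrow> 'r) set) module. module R X \<longrightarrow>
        inj_on (tensor_map R M X (\<lambda>n. n) (\<lambda>x. x))
          (carrier (tensor_module R (M\<lparr>carrier := N\<rparr>) X)))"


section \<open>Purity does not depend on the type of the test modules\<close>

lemma submodule_span_sub:
  assumes "submodule N R M" "S \<subseteq> N"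
  shows "submodule_span R M S \<subseteq> N"
  using assms by (auto simp: submodule_span_def)

lemma submodule_span_inc: "S \<subseteq> submodule_span R M S"
  by (auto simp: submodule_span_def)

lemma (in module) submodule_span_is_submodule:
  assumes "S \<subseteq> carrier M"
  shows "submodule (submodule_span R M S) R M"
proof (rule submoduleI)
  have c: "submodule (carrier M) R M" by (rule carrier_is_submodule)
  show "submodule_span R M S \<subseteq> carrier M"
    using submodule_span_sub[OF c assms] .
  show "\<zero>\<^bsub>M\<^esub> \<in> submodule_span R M S"
    unfolding submodule_span_def using subgroup.one_closed[OF submodule.axioms(1)] by fastforce
  fix a b assume a: "a \<in> submodule_span R M S" and b: "b \<in> submodule_span R M S"
  then show "\<ominus>\<^bsub>M\<^esub> a \<in> submodule_span R M S" "a \<oplus>\<^bsub>M\<^esub> b \<in> submodule_span R M S"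
    unfolding submodule_span_def by (auto intro: submoduleE(3,5))
next
  fix a x assume "a \<in> carrier R" "x \<in> submodule_span R M S"
  then show "a \<odot>\<^bsub>M\<^esub> x \<in> submodule_span R M S"
    unfolding submodule_span_def by (auto intro: submoduleE(4))
qed

lemma free_module_simps [simp]:
  "zero (free_module R I) = (\<lambda>i. \<zero>\<^bsub>R\<^esub>)"
  "add (free_module R I) f g = (\<lambda>i. f i \<oplus>\<^bsub>R\<^esub> g i)"
  "smult (free_module R I) r f = (\<lambda>i. r \<otimes>\<^bsub>R\<^esub> f i)"
  by (simp_all add: free_module_def)

lemma free_module_carrier:
  "f \<in> carrier (free_module R I) \<longleftrightarrow> (\<forall>i. f i \<in> carrier R) \<and>
     (\<forall>i. i \<notin> I \<longrightarrow> f i = \<zero>\<^bsub>R\<^esub>) \<and> finite {i. f i \<noteq> \<zero>\<^bsub>R\<^esub>}"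
  by (simp add: free_module_def)

context cring
begin

lemma free_module_add_closed:
  assumes "f \<in> carrier (free_module R I)" "g \<in> carrier (free_module R I)"
  shows "(\<lambda>i. f i \<oplus> g i) \<in> carrier (free_module R I)"
proof -
  have "{i. f i \<oplus> g i \<noteq> \<zero>} \<subseteq> {i. f i \<noteq> \<zero>} \<union> {i. g i \<noteq> \<zero>}"
    by auto
  then show ?thesis
    using assms unfolding free_module_carrier by (auto intro: finite_subset)
qed

lemma free_module_smult_closed:
  assumes "f \<in> carrier (free_module R I)" "r \<in> carrier R"
  shows "(\<lambda>i. r \<otimes> f i) \<in> carrier (free_module R I)"
proof -
  have "{i. r \<otimes> f i \<noteq> \<zero>} \<subseteq> {i. f i \<noteq> \<zero>}"
    using assms by auto
  then show ?thesis
    using assms unfolding free_module_carrier by (auto intro: finite_subset)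
qed

lemma free_module_neg_closed:
  assumes "f \<in> carrier (free_module R I)"
  shows "(\<lambda>i. \<ominus> f i) \<in> carrier (free_module R I)"
proof -
  have "{i. \<ominus> f i \<noteq> \<zero>} \<subseteq> {i. f i \<noteq> \<zero>}"
    using assms by auto
  then show ?thesis
    using assms unfolding free_module_carrier by (auto intro: finite_subset)
qed

lemma free_module_module: "module R (free_module R I)"
proof (rule moduleI)
  show "abelian_group (free_module R I)"
  proof (rule abelian_groupI)
    fix x assume x: "x \<in> carrier (free_module R I)"
    show "\<exists>y\<in>carrier (free_module R I). y \<oplus>\<^bsub>free_module R I\<^esub> x = \<zero>\<^bsub>free_module R I\<^esub>"
      by (rule bexI[OF _ free_module_neg_closed[OF x]])
        (use x in \<open>auto simp: free_module_carrier l_neg\<close>)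
  qed (auto simp: free_module_add_closed, auto simp: free_module_carrier a_ac fun_eq_iff)
qed (auto simp: is_cring free_module_smult_closed, auto simp: free_module_carrier l_distr r_distr m_assoc fun_eq_iff)

lemma free_module_a_inv:
  assumes "f \<in> carrier (free_module R I)"
  shows "\<ominus>\<^bsub>free_module R I\<^esub> f = (\<lambda>i. \<ominus> f i)"
proof -
  interpret F: module R "free_module R I" by (rule free_module_module)
  show ?thesis
    by (rule F.minus_equality)
      (use assms in \<open>auto simp: free_module_neg_closed free_module_carrier l_neg fun_eq_iff\<close>)
qed

lemma free_module_minus:
  assumes "f \<in> carrier (free_module R I)" "g \<in> carrier (free_module R I)"
  shows "f \<ominus>\<^bsub>free_module R I\<^esub> g = (\<lambda>i. f i \<ominus> g i)"
  using assms by (simp add: a_minus_def free_module_a_inv)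

lemma free_basis_closed:
  assumes "i \<in> I"
  shows "free_basis R i \<in> carrier (free_module R I)"
proof -
  have "{j. free_basis R i j \<noteq> \<zero>} \<subseteq> {i}" by (auto simp: free_basis_def)
  then show ?thesis
    using assms by (auto simp: free_module_carrier free_basis_def intro: finite_subset)
qed

lemma free_module_expand:
  assumes f: "f \<in> carrier (free_module R I)"
  shows "(\<Oplus>\<^bsub>free_module R I\<^esub>p\<in>{p. f p \<noteq> \<zero>}. f p \<odot>\<^bsub>free_module R I\<^esub> free_basis R p) = f"
proof -
  interpret F: module R "free_module R I" by (rule free_module_module)
  have *: "(\<Oplus>\<^bsub>free_module R I\<^esub>p\<in>S. f p \<odot>\<^bsub>free_module R I\<^esub> free_basis R p) =
      (\<lambda>p. if p \<in> S then f p else \<zero>)" if "finite S" "S \<subseteq> I" for S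
    using that
  proof (induction S)
    case empty
    then show ?case by simp
  next
    case (insert p S)
    then show ?case
      using f by (subst F.finsum_insert)
        (auto simp: free_module_carrier free_basis_def free_basis_closed
          free_module_smult_closed fun_eq_iff intro!: F.smult_closed free_basis_closed
          simp del: free_module_simps(3), auto simp: free_basis_def free_module_carrier)
  qed
  have "finite {p. f p \<noteq> \<zero>}" "{p. f p \<noteq> \<zero>} \<subseteq> I"
    using f by (auto simp: free_module_carrier)
  from *[OF this] show ?thesis by auto
qed


end

context module
begin

lemma submodule_abelian_subgroup:
  assumes "submodule K R M"
  shows "abelian_subgroup K M"
  by (rule abelian_subgroupI3)
    (use assms in \<open>auto simp: additive_subgroup_def submodule_def M.abelian_group_axioms\<close>)

lemma coset_smult:
  assumes K: "submodule K R M" and r: "r \<in> carrier R" and x: "x \<in> carrier M"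
  shows "(\<Union>y\<in>K +>\<^bsub>M\<^esub> x. K +>\<^bsub>M\<^esub> (r \<odot>\<^bsub>M\<^esub> y)) = K +>\<^bsub>M\<^esub> (r \<odot>\<^bsub>M\<^esub> x)"
proof -
  interpret K: abelian_subgroup K M by (rule submodule_abelian_subgroup[OF K])
  have "K +>\<^bsub>M\<^esub> (r \<odot>\<^bsub>M\<^esub> y) = K +>\<^bsub>M\<^esub> (r \<odot>\<^bsub>M\<^esub> x)" if y: "y \<in> K +>\<^bsub>M\<^esub> x" for y
  proof -
    from y obtain k where k: "k \<in> K" "y = k \<oplus>\<^bsub>M\<^esub> x"
      by (auto simp: a_r_coset_def r_coset_def)
    have "r \<odot>\<^bsub>M\<^esub> y = (r \<odot>\<^bsub>M\<^esub> k) \<oplus>\<^bsub>M\<^esub> (r \<odot>\<^bsub>M\<^esub> x)"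
      using k r x K.a_subset by (auto simp: smult_r_distr)
    moreover have "r \<odot>\<^bsub>M\<^esub> k \<in> K"
      using submoduleE(4)[OF K] r k by auto
    ultimately have "r \<odot>\<^bsub>M\<^esub> y \<in> K +>\<^bsub>M\<^esub> (r \<odot>\<^bsub>M\<^esub> x)"
      by (auto simp: a_r_coset_def r_coset_def)
    then show ?thesis
      using K.a_repr_independence' r x by auto
  qed
  moreover have "x \<in> K +>\<^bsub>M\<^esub> x"
    using K.a_rcos_self[OF x] .
  ultimately show ?thesis by blast
qed

lemma quotient_simps:
  assumes K: "submodule K R M"
  shows "zero (quotient_module R M K) = K"
    and "x \<in> carrier M \<Longrightarrow> K +>\<^bsub>M\<^esub> x \<in> carrier (quotient_module R M K)"
    and "\<lbrakk>x \<in> carrier M; y \<in> carrier M\<rbrakk> \<Longrightarrow>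
      (K +>\<^bsub>M\<^esub> x) \<oplus>\<^bsub>quotient_module R M K\<^esub> (K +>\<^bsub>M\<^esub> y) = K +>\<^bsub>M\<^esub> (x \<oplus>\<^bsub>M\<^esub> y)"
    and "\<lbrakk>r \<in> carrier R; x \<in> carrier M\<rbrakk> \<Longrightarrow>
      r \<odot>\<^bsub>quotient_module R M K\<^esub> (K +>\<^bsub>M\<^esub> x) = K +>\<^bsub>M\<^esub> (r \<odot>\<^bsub>M\<^esub> x)"
    and "carrier (quotient_module R M K) = (\<lambda>x. K +>\<^bsub>M\<^esub> x) ` carrier M"
proof -
  interpret K: abelian_subgroup K M by (rule submodule_abelian_subgroup[OF K])
  show "zero (quotient_module R M K) = K" by (simp add: quotient_module_def)
  show "carrier (quotient_module R M K) = (\<lambda>x. K +>\<^bsub>M\<^esub> x) ` carrier M"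
    by (auto simp: quotient_module_def A_RCOSETS_def RCOSETS_def a_r_coset_def)
  then show "x \<in> carrier M \<Longrightarrow> K +>\<^bsub>M\<^esub> x \<in> carrier (quotient_module R M K)" by simp
  show "\<lbrakk>x \<in> carrier M; y \<in> carrier M\<rbrakk> \<Longrightarrow>
      (K +>\<^bsub>M\<^esub> x) \<oplus>\<^bsub>quotient_module R M K\<^esub> (K +>\<^bsub>M\<^esub> y) = K +>\<^bsub>M\<^esub> (x \<oplus>\<^bsub>M\<^esub> y)"
    by (simp add: quotient_module_def K.a_rcos_sum)
  show "\<lbrakk>r \<in> carrier R; x \<in> carrier M\<rbrakk> \<Longrightarrow>
      r \<odot>\<^bsub>quotient_module R M K\<^esub> (K +>\<^bsub>M\<^esub> x) = K +>\<^bsub>M\<^esub> (r \<odot>\<^bsub>M\<^esub> x)"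
    using coset_smult[OF K] by (simp add: quotient_module_def)
qed

lemma quotient_is_module:
  assumes K: "submodule K R M"
  shows "module R (quotient_module R M K)"
proof -
  interpret K: abelian_subgroup K M by (rule submodule_abelian_subgroup[OF K])
  note q = quotient_simps[OF K]
  have K0: "K = K +>\<^bsub>M\<^esub> \<zero>\<^bsub>M\<^esub>" by (simp add: K.a_subset)
  show ?thesis
  proof (rule moduleI)
    show "abelian_group (quotient_module R M K)"
    proof (rule abelian_groupI)
      show "\<zero>\<^bsub>quotient_module R M K\<^esub> \<in> carrier (quotient_module R M K)"
        using q(1) q(2)[of "\<zero>\<^bsub>M\<^esub>"] K0 by simp
      fix x assume "x \<in> carrier (quotient_module R M K)"
      then obtain a where a: "a \<in> carrier M" "x = K +>\<^bsub>M\<^esub> a" by (auto simp: q(5))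
      show "\<zero>\<^bsub>quotient_module R M K\<^esub> \<oplus>\<^bsub>quotient_module R M K\<^esub> x = x"
        using q(3)[of "\<zero>\<^bsub>M\<^esub>" a] q(1) a K0 by simp
      show "\<exists>y\<in>carrier (quotient_module R M K). y \<oplus>\<^bsub>quotient_module R M K\<^esub> x = \<zero>\<^bsub>quotient_module R M K\<^esub>"
        by (rule bexI[of _ "K +>\<^bsub>M\<^esub> (\<ominus>\<^bsub>M\<^esub> a)"])
          (use q a K0 in \<open>auto simp: M.l_neg\<close>)
    qed (auto simp: q(5) q(3) M.a_ac)
  qed (auto simp: R.is_cring q(5) q(3) q(4) smult_l_distr smult_r_distr smult_assoc1)
qed

lemma quotient_finsum:
  assumes K: "submodule K R M" and "finite S" "f \<in> S \<rightarrow> carrier M"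
  shows "(\<Oplus>\<^bsub>quotient_module R M K\<^esub>p\<in>S. K +>\<^bsub>M\<^esub> f p) = K +>\<^bsub>M\<^esub> (\<Oplus>\<^bsub>M\<^esub>p\<in>S. f p)"
proof -
  interpret K: abelian_subgroup K M by (rule submodule_abelian_subgroup[OF K])
  interpret Q: module R "quotient_module R M K" by (rule quotient_is_module[OF K])
  note q = quotient_simps[OF K]
  from assms(2,3) show ?thesis
  proof (induction S)
    case empty
    then show ?case by (simp add: q(1) K.a_subset)
  next
    case (insert p S)
    then show ?case
      by (subst Q.finsum_insert) (auto simp: q(2,3) Pi_def)
  qed
qed

lemma quotient_eq_iff:
  assumes K: "submodule K R M" and "x \<in> carrier M" "y \<in> carrier M"
  shows "K +>\<^bsub>M\<^esub> x = K +>\<^bsub>M\<^esub> y \<longleftrightarrow> x \<ominus>\<^bsub>M\<^esub> y \<in> K"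
proof -
  interpret K: abelian_subgroup K M by (rule submodule_abelian_subgroup[OF K])
  have "x \<in> K +>\<^bsub>M\<^esub> y \<longleftrightarrow> x \<ominus>\<^bsub>M\<^esub> y \<in> K"
    using K.a_rcos_module[OF assms(3,2)] by (simp add: a_minus_def)
  moreover have "x \<in> K +>\<^bsub>M\<^esub> y \<longleftrightarrow> K +>\<^bsub>M\<^esub> x = K +>\<^bsub>M\<^esub> y"
    using K.a_repr_independence' K.a_rcos_self assms by metis
  ultimately show ?thesis by simp
qed

end

text \<open>The generators of \<open>tensor_relations\<close>, written pointwise so as not to mention the free module.\<close>

definition bil_gens ::
  "('r, 's) ring_scheme \<Rightarrow> ('r, 'm, 'x) module_scheme \<Rightarrow> ('r, 'n, 'y) module_scheme
    \<Rightarrow> ('m \<times> 'n \<Rightarrow> 'r) set"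
where
  "bil_gens R M N =
     {(\<lambda>p. free_basis R (m \<oplus>\<^bsub>M\<^esub> m', n) p \<ominus>\<^bsub>R\<^esub> (free_basis R (m, n) p \<oplus>\<^bsub>R\<^esub> free_basis R (m', n) p)) | m m' n.
         m \<in> carrier M \<and> m' \<in> carrier M \<and> n \<in> carrier N} \<union>
      {(\<lambda>p. free_basis R (m, n \<oplus>\<^bsub>N\<^esub> n') p \<ominus>\<^bsub>R\<^esub> (free_basis R (m, n) p \<oplus>\<^bsub>R\<^esub> free_basis R (m, n') p)) | m n n'.
         m \<in> carrier M \<and> n \<in> carrier N \<and> n' \<in> carrier N} \<union>
      {(\<lambda>p. free_basis R (r \<odot>\<^bsub>M\<^esub> m, n) p \<ominus>\<^bsub>R\<^esub> r \<otimes>\<^bsub>R\<^esub> free_basis R (m, n) p) | r m n.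
         r \<in> carrier R \<and> m \<in> carrier M \<and> n \<in> carrier N} \<union>
      {(\<lambda>p. free_basis R (m, r \<odot>\<^bsub>N\<^esub> n) p \<ominus>\<^bsub>R\<^esub> r \<otimes>\<^bsub>R\<^esub> free_basis R (m, n) p) | r m n.
         r \<in> carrier R \<and> m \<in> carrier M \<and> n \<in> carrier N}"

context cring
begin

lemma tensor_relations_eq:
  assumes "module R M" "module R N"
  shows "tensor_relations R M N =
      submodule_span R (free_module R (carrier M \<times> carrier N)) (bil_gens R M N)" (is ?A)
    and "bil_gens R M N \<subseteq> carrier (free_module R (carrier M \<times> carrier N))" (is ?B)
proof -
  let ?F = "free_module R (carrier M \<times> carrier N)"
  interpret M: module R M by fact
  interpret N: module R N by fact
  interpret F: module R ?F by (rule free_module_module)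
  have b: "free_basis R (m, n) \<in> carrier ?F" if "m \<in> carrier M" "n \<in> carrier N" for m n
    by (rule free_basis_closed) (use that in auto)
  have add: "(\<lambda>p. f p \<oplus> g p) \<in> carrier ?F" if "f \<in> carrier ?F" "g \<in> carrier ?F" for f g
    by (rule free_module_add_closed) (use that in auto)
  have sm: "(\<lambda>p. r \<otimes> f p) \<in> carrier ?F" if "r \<in> carrier R" "f \<in> carrier ?F" for f r
    by (rule free_module_smult_closed) (use that in auto)
  have mi: "(\<lambda>p. f p \<ominus> g p) \<in> carrier ?F" if "f \<in> carrier ?F" "g \<in> carrier ?F" for f g
    using F.minus_closed[OF that] free_module_minus[OF that] by simp
  have "{free_basis R (m \<oplus>\<^bsub>M\<^esub> m', n) \<ominus>\<^bsub>?F\<^esub> (free_basis R (m, n) \<oplus>\<^bsub>?F\<^esub> free_basis R (m', n)) | m m' n.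
         m \<in> carrier M \<and> m' \<in> carrier M \<and> n \<in> carrier N} \<union>
      {free_basis R (m, n \<oplus>\<^bsub>N\<^esub> n') \<ominus>\<^bsub>?F\<^esub> (free_basis R (m, n) \<oplus>\<^bsub>?F\<^esub> free_basis R (m, n')) | m n n'.
         m \<in> carrier M \<and> n \<in> carrier N \<and> n' \<in> carrier N} \<union>
      {free_basis R (r \<odot>\<^bsub>M\<^esub> m, n) \<ominus>\<^bsub>?F\<^esub> r \<odot>\<^bsub>?F\<^esub> free_basis R (m, n) | r m n.
         r \<in> carrier R \<and> m \<in> carrier M \<and> n \<in> carrier N} \<union>
      {free_basis R (m, r \<odot>\<^bsub>N\<^esub> n) \<ominus>\<^bsub>?F\<^esub> r \<odot>\<^bsub>?F\<^esub> free_basis R (m, n) | r m n.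
         r \<in> carrier R \<and> m \<in> carrier M \<and> n \<in> carrier N} = bil_gens R M N"
    unfolding bil_gens_def
    by (intro arg_cong2[where f="(\<union>)"] Collect_cong;
        simp add: free_module_minus b add sm cong: rev_conj_cong)
  then show ?A unfolding tensor_relations_def Let_def by simp
  show ?B unfolding bil_gens_def by (auto intro!: mi b add sm)
qed

lemma tensor_relations_submodule:
  assumes "module R M" "module R N"
  shows "submodule (tensor_relations R M N) R (free_module R (carrier M \<times> carrier N))"
proof -
  interpret F: module R "free_module R (carrier M \<times> carrier N)" by (rule free_module_module)
  show ?thesis
    using F.submodule_span_is_submodule tensor_relations_eq[OF assms] by simp
qed

lemma tensor_relations_gens:
  assumes "module R M" "module R N"
  shows "bil_gens R M N \<subseteq> tensor_relations R M N"
  using tensor_relations_eq[OF assms] submodule_span_inc by metis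

lemma tensor_relations_least:
  assumes "module R M" "module R N"
    and "submodule K R (free_module R (carrier M \<times> carrier N))" "bil_gens R M N \<subseteq> K"
  shows "tensor_relations R M N \<subseteq> K"
  using tensor_relations_eq[OF assms(1,2)] submodule_span_sub[OF assms(3,4)] by metis

lemma free_submoduleI:
  assumes "K \<subseteq> carrier (free_module R I)" "(\<lambda>i. \<zero>) \<in> K"
    and "\<And>f g. f \<in> K \<Longrightarrow> g \<in> K \<Longrightarrow> (\<lambda>i. f i \<oplus> g i) \<in> K"
    and sm: "\<And>r f. r \<in> carrier R \<Longrightarrow> f \<in> K \<Longrightarrow> (\<lambda>i. r \<otimes> f i) \<in> K"
  shows "submodule K R (free_module R I)"
proof -
  interpret F: module R "free_module R I" by (rule free_module_module)
  show ?thesis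
  proof (rule F.submoduleI)
    fix f assume f: "f \<in> K"
    then have "f \<in> carrier (free_module R I)" using assms by auto
    then have "\<ominus>\<^bsub>free_module R I\<^esub> f = (\<lambda>i. (\<ominus> \<one>) \<otimes> f i)"
      by (auto simp: free_module_a_inv free_module_carrier l_minus)
    then show "\<ominus>\<^bsub>free_module R I\<^esub> f \<in> K" using sm f by simp
  qed (use assms in auto)
qed

lemma free_submoduleD:
  assumes "submodule K R (free_module R I)"
  shows "K \<subseteq> carrier (free_module R I)" "(\<lambda>i. \<zero>) \<in> K"
    and "\<And>f g. f \<in> K \<Longrightarrow> g \<in> K \<Longrightarrow> (\<lambda>i. f i \<oplus> g i) \<in> K"
    and "\<And>r f. r \<in> carrier R \<Longrightarrow> f \<in> K \<Longrightarrow> (\<lambda>i. r \<otimes> f i) \<in> K"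
proof -
  interpret F: module R "free_module R I" by (rule free_module_module)
  show "K \<subseteq> carrier (free_module R I)" using F.submoduleE(1)[OF assms] .
  show "(\<lambda>i. \<zero>) \<in> K" using subgroup.one_closed[OF submodule.axioms(1)[OF assms]] by simp
  show "\<And>f g. f \<in> K \<Longrightarrow> g \<in> K \<Longrightarrow> (\<lambda>i. f i \<oplus> g i) \<in> K"
    using F.submoduleE(5)[OF assms] by simp
  show "\<And>r f. r \<in> carrier R \<Longrightarrow> f \<in> K \<Longrightarrow> (\<lambda>i. r \<otimes> f i) \<in> K"
    using F.submoduleE(4)[OF assms] by simp
qed

lemma free_module_mono: "I \<subseteq> J \<Longrightarrow> carrier (free_module R I) \<subseteq> carrier (free_module R J)"
  unfolding subset_iff free_module_carrier by blast

lemma tensor_relations_mono: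
  assumes "module R M" "module R X" "submodule N R M" "submodule Y R X"
  shows "tensor_relations R (M\<lparr>carrier := N\<rparr>) (X\<lparr>carrier := Y\<rparr>) \<subseteq> tensor_relations R M X"
proof -
  let ?M = "M\<lparr>carrier := N\<rparr>" and ?X = "X\<lparr>carrier := Y\<rparr>"
  have m: "module R ?M" "module R ?X"
    using assms submodule.submodule_is_module by auto
  have sub: "N \<subseteq> carrier M" "Y \<subseteq> carrier X"
    using assms by (auto dest: module.submoduleE(1)[rotated])
  note D = free_submoduleD[OF tensor_relations_submodule[OF assms(1,2)]]
  note D' = free_submoduleD[OF module.carrier_is_submodule[OF free_module_module]]
  have "bil_gens R ?M ?X \<subseteq> bil_gens R M X"
    using sub unfolding bil_gens_def by (intro Un_mono) (simp; blast)+
  then have "bil_gens R ?M ?X \<subseteq> tensor_relations R M X \<inter> carrier (free_module R (N \<times> Y))"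
    using tensor_relations_gens[OF assms(1,2)] tensor_relations_eq(2)[OF m] by auto
  moreover have "submodule (tensor_relations R M X \<inter> carrier (free_module R (N \<times> Y))) R (free_module R (N \<times> Y))"
    by (rule free_submoduleI) (auto intro: D D')
  ultimately show ?thesis
    using tensor_relations_least[OF m, of "tensor_relations R M X \<inter> carrier (free_module R (N \<times> Y))"]
    by simp
qed

lemma tensor_map_inclusion:
  assumes M: "module R M" and X: "module R X"
    and sub: "N \<subseteq> carrier M" and fN: "f \<in> carrier (free_module R (N \<times> carrier X))"
    and f: "(SOME f. f \<in> t) = f"
  shows "tensor_map R M X (\<lambda>n. n) (\<lambda>x. x) t =
    tensor_relations R M X +>\<^bsub>free_module R (carrier M \<times> carrier X)\<^esub> f"
proof -
  let ?F = "free_module R (carrier M \<times> carrier X)" and ?K = "tensor_relations R M X"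
  interpret F: module R ?F by (rule free_module_module)
  note K = tensor_relations_submodule[OF M X]
  interpret Q: module R "tensor_module R M X"
    unfolding tensor_module_def by (rule F.quotient_is_module[OF K])
  have fM: "f \<in> carrier ?F"
    using fN free_module_mono[of "N \<times> carrier X" "carrier M \<times> carrier X"] sub by auto
  have S: "finite {p. f p \<noteq> \<zero>}" "{p. f p \<noteq> \<zero>} \<subseteq> carrier M \<times> carrier X" "\<And>p. f p \<in> carrier R"
    using fM unfolding free_module_carrier by blast+
  have "tensor_map R M X (\<lambda>n. n) (\<lambda>x. x) t =
      (\<Oplus>\<^bsub>tensor_module R M X\<^esub>p\<in>{p. f p \<noteq> \<zero>}.
         f p \<odot>\<^bsub>tensor_module R M X\<^esub> tensor R M X (fst p) (snd p))"
    by (simp add: tensor_map_def tensor_lift_def f)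
  also have "\<dots> = (\<Oplus>\<^bsub>tensor_module R M X\<^esub>p\<in>{p. f p \<noteq> \<zero>}.
         ?K +>\<^bsub>?F\<^esub> (f p \<odot>\<^bsub>?F\<^esub> free_basis R p))"
  proof (rule Q.finsum_cong')
    fix p assume p: "p \<in> {p. f p \<noteq> \<zero>}"
    then have b: "free_basis R p \<in> carrier ?F"
      using S(2) by (intro free_basis_closed) blast
    then show "f p \<odot>\<^bsub>tensor_module R M X\<^esub> tensor R M X (fst p) (snd p) =
        ?K +>\<^bsub>?F\<^esub> (f p \<odot>\<^bsub>?F\<^esub> free_basis R p)"
      using F.quotient_simps(4)[OF K S(3) b] by (simp add: tensor_module_def tensor_def)
  next
    show "(\<lambda>p. ?K +>\<^bsub>?F\<^esub> (f p \<odot>\<^bsub>?F\<^esub> free_basis R p)) \<in> {p. f p \<noteq> \<zero>} \<rightarrow> carrier (tensor_module R M X)"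
    proof
      fix p assume "p \<in> {p. f p \<noteq> \<zero>}"
      then have b: "free_basis R p \<in> carrier ?F"
        using S(2) by (intro free_basis_closed) blast
      show "?K +>\<^bsub>?F\<^esub> (f p \<odot>\<^bsub>?F\<^esub> free_basis R p) \<in> carrier (tensor_module R M X)"
        unfolding tensor_module_def
        by (rule F.quotient_simps(2)[OF K F.smult_closed[OF S(3) b]])
    qed
  qed simp
  also have "\<dots> = ?K +>\<^bsub>?F\<^esub> (\<Oplus>\<^bsub>?F\<^esub>p\<in>{p. f p \<noteq> \<zero>}. f p \<odot>\<^bsub>?F\<^esub> free_basis R p)"
    unfolding tensor_module_def
  proof (rule F.quotient_finsum[OF K S(1)], rule Pi_I)
    fix p assume "p \<in> {p. f p \<noteq> \<zero>}"
    then have b: "free_basis R p \<in> carrier ?F"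
      using S(2) by (intro free_basis_closed) blast
    show "f p \<odot>\<^bsub>?F\<^esub> free_basis R p \<in> carrier ?F"
      by (rule F.smult_closed[OF S(3) b])
  qed
  also have "\<dots> = ?K +>\<^bsub>?F\<^esub> f"
    by (simp only: free_module_expand[OF fM])
  finally show ?thesis .
qed

lemma tensor_inclusion_inj_iff:
  assumes M: "module R M" and X: "module R X" and N: "submodule N R M"
  shows "inj_on (tensor_map R M X (\<lambda>n. n) (\<lambda>x. x)) (carrier (tensor_module R (M\<lparr>carrier := N\<rparr>) X)) \<longleftrightarrow>
    tensor_relations R M X \<inter> carrier (free_module R (N \<times> carrier X))
      \<subseteq> tensor_relations R (M\<lparr>carrier := N\<rparr>) X" (is "inj_on ?i ?T \<longleftrightarrow> _")
proof -
  let ?F = "free_module R (carrier M \<times> carrier X)" and ?K = "tensor_relations R M X"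
  let ?G = "free_module R (N \<times> carrier X)" and ?L = "tensor_relations R (M\<lparr>carrier := N\<rparr>) X"
  interpret F: module R ?F by (rule free_module_module)
  interpret G: module R ?G by (rule free_module_module)
  have sub: "N \<subseteq> carrier M"
    using N M by (auto dest: module.submoduleE(1)[rotated])
  have N': "module R (M\<lparr>carrier := N\<rparr>)"
    using submodule.submodule_is_module[OF N M] .
  note K = tensor_relations_submodule[OF M X]
  have L: "submodule ?L R ?G"
    using tensor_relations_submodule[OF N' X] by simp
  interpret L: abelian_subgroup ?L ?G by (rule G.submodule_abelian_subgroup[OF L])
  interpret K: abelian_subgroup ?K ?F by (rule F.submodule_abelian_subgroup[OF K])
  have LK: "?L \<subseteq> ?K"
    using tensor_relations_mono[OF M X N module.carrier_is_submodule[OF X]] by simp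
  have GF: "carrier ?G \<subseteq> carrier ?F"
    using sub by (intro free_module_mono) auto
  have T: "?T = (\<lambda>f. ?L +>\<^bsub>?G\<^esub> f) ` carrier ?G"
    using G.quotient_simps(5)[OF L] by (simp add: tensor_module_def)
  have rep: "\<exists>g\<in>carrier ?G. t = ?L +>\<^bsub>?G\<^esub> g \<and> ?i t = ?K +>\<^bsub>?F\<^esub> g" if t: "t \<in> ?T" for t
  proof -
    obtain f where f: "f \<in> carrier ?G" "t = ?L +>\<^bsub>?G\<^esub> f" using t T by auto
    define g where "g = (SOME g. g \<in> t)"
    have "f \<in> t" using L.a_rcos_self[OF f(1)] f by simp
    then have g: "g \<in> t" unfolding g_def by (rule someI[of "\<lambda>g. g \<in> t"])
    then have gG: "g \<in> carrier ?G"
      using f G.a_r_coset_subset_G[OF L.a_subset f(1)] by auto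
    have "t = ?L +>\<^bsub>?G\<^esub> g"
      using G.a_repr_independence[OF _ f(1) L.a_subgroup] g f(2) by simp
    moreover have "?i t = ?K +>\<^bsub>?F\<^esub> g"
      by (rule tensor_map_inclusion[OF M X sub gG]) (simp add: g_def)
    ultimately show ?thesis using gG by blast
  qed
  have minus: "f \<ominus>\<^bsub>?G\<^esub> g = f \<ominus>\<^bsub>?F\<^esub> g" if "f \<in> carrier ?G" "g \<in> carrier ?G" for f g
  proof -
    have "f \<in> carrier ?F" "g \<in> carrier ?F" using that GF by auto
    then show ?thesis using that by (simp add: free_module_minus)
  qed
  show ?thesis
  proof
    assume inj: "inj_on ?i ?T"
    show "?K \<inter> carrier ?G \<subseteq> ?L"
    proof
      fix h assume h: "h \<in> ?K \<inter> carrier ?G"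
      let ?z = "\<zero>\<^bsub>?G\<^esub>"
      have z: "?z \<in> carrier ?G" by (rule G.zero_closed)
      have *: "?i (?L +>\<^bsub>?G\<^esub> u) = ?K" if u: "u \<in> ?K" "u \<in> carrier ?G" for u
      proof -
        obtain g where g: "g \<in> carrier ?G" "?L +>\<^bsub>?G\<^esub> u = ?L +>\<^bsub>?G\<^esub> g"
            "?i (?L +>\<^bsub>?G\<^esub> u) = ?K +>\<^bsub>?F\<^esub> g"
          using rep[of "?L +>\<^bsub>?G\<^esub> u"] T u by blast
        have "g \<ominus>\<^bsub>?G\<^esub> u \<in> ?K"
          using G.quotient_eq_iff[OF L g(1) u(2)] g(2) LK by auto
        then have "?K +>\<^bsub>?F\<^esub> g = ?K +>\<^bsub>?F\<^esub> u"
          using F.quotient_eq_iff[OF K, of g u] minus g(1) u(2) GF by auto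
        then show ?thesis using g(3) K.a_rcos_const[OF u(1)] by simp
      qed
      have "?z \<in> ?K" using LK L.zero_closed by auto
      then have "?L +>\<^bsub>?G\<^esub> h = ?L +>\<^bsub>?G\<^esub> ?z"
        using inj_onD[OF inj, of "?L +>\<^bsub>?G\<^esub> h" "?L +>\<^bsub>?G\<^esub> ?z"] * h z T by auto
      then have "?L +>\<^bsub>?G\<^esub> h = ?L"
        using L.a_rcos_const[OF L.zero_closed] by simp
      then show "h \<in> ?L" using L.a_rcos_self[of h] h by auto
    qed
  next
    assume sub: "?K \<inter> carrier ?G \<subseteq> ?L"
    show "inj_on ?i ?T"
    proof (rule inj_onI)
      fix s t assume st: "s \<in> ?T" "t \<in> ?T" "?i s = ?i t"
      obtain f g where f: "f \<in> carrier ?G" "s = ?L +>\<^bsub>?G\<^esub> f" "?i s = ?K +>\<^bsub>?F\<^esub> f"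
        and g: "g \<in> carrier ?G" "t = ?L +>\<^bsub>?G\<^esub> g" "?i t = ?K +>\<^bsub>?F\<^esub> g"
        using rep st by meson
      have "f \<ominus>\<^bsub>?F\<^esub> g \<in> ?K"
        using F.quotient_eq_iff[OF K, of f g] f g st(3) GF by auto
      then have "f \<ominus>\<^bsub>?G\<^esub> g \<in> ?L"
        using minus[OF f(1) g(1)] G.minus_closed[OF f(1) g(1)] sub by auto
      then show "s = t"
        using G.quotient_eq_iff[OF L f(1) g(1)] f g by simp
    qed
  qed
qed

text \<open>Pulling a relation back along an isomorphism of the second factor.\<close>

lemma tensor_relations_pull:
  fixes M :: "('a, 'm, 'z) module_scheme"
  assumes M: "module R M" and X: "module R X" and Y: "module R Y"
    and j: "j \<in> linear_maps R X Y" "bij_betw j (carrier X) (carrier Y)"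
    and f: "f \<in> tensor_relations R M Y"
  shows "(\<lambda>p. if snd p \<in> carrier X then f (fst p, j (snd p)) else \<zero>) \<in> tensor_relations R M X"
proof -
  interpret X: module R X by fact
  interpret Y: module R Y by fact
  define pull :: "('m \<times> _ \<Rightarrow> 'a) \<Rightarrow> 'm \<times> _ \<Rightarrow> 'a" where "pull = (\<lambda>f p. if snd p \<in> carrier X then f (fst p, j (snd p)) else \<zero>)"
  note D = free_submoduleD[OF tensor_relations_submodule[OF M X]]
  note E = free_submoduleD[OF module.carrier_is_submodule[OF free_module_module]]
  note sub = tensor_relations_gens[OF M X]
  let ?K = "{f \<in> carrier (free_module R (carrier M \<times> carrier Y)). pull f \<in> tensor_relations R M X}"
  have p0: "pull (\<lambda>i. \<zero>) = (\<lambda>i. \<zero>)" by (auto simp: pull_def)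
  have p1: "pull (\<lambda>i. f i \<oplus> g i) = (\<lambda>i. pull f i \<oplus> pull g i)" for f g
    by (auto simp: pull_def fun_eq_iff)
  have p2: "pull (\<lambda>i. r \<otimes> f i) = (\<lambda>i. r \<otimes> pull f i)" if "r \<in> carrier R" for r f
    using that by (auto simp: pull_def fun_eq_iff)
  have p3: "pull (\<lambda>i. f i \<ominus> g i) = (\<lambda>i. pull f i \<ominus> pull g i)" for f g
    by (auto simp: pull_def fun_eq_iff a_minus_def)
  have pb: "pull (free_basis R (m, j x)) = free_basis R (m, x)" if "x \<in> carrier X" for m x
    using that j(2) by (auto simp: pull_def fun_eq_iff free_basis_def bij_betw_def dest: inj_onD)
  have ja: "j (x \<oplus>\<^bsub>X\<^esub> y) = j x \<oplus>\<^bsub>Y\<^esub> j y" if "x \<in> carrier X" "y \<in> carrier X" for x y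
    using j that by (auto simp: linear_maps_def)
  have js: "j (r \<odot>\<^bsub>X\<^esub> x) = r \<odot>\<^bsub>Y\<^esub> j x" if "r \<in> carrier R" "x \<in> carrier X" for r x
    using j that by (auto simp: linear_maps_def)
  have Y_eq: "carrier Y = j ` carrier X" using j(2) by (auto simp: bij_betw_def)
  have "submodule ?K R (free_module R (carrier M \<times> carrier Y))"
    by (rule free_submoduleI) (auto simp only: p0 p1 p2 mem_Collect_eq intro: E D)
  moreover have "bil_gens R M Y \<subseteq> ?K"
  proof
    fix f assume f: "f \<in> bil_gens R M Y"
    then have "pull f \<in> bil_gens R M X"
    proof -
      consider
        (1) m m' x where "f = (\<lambda>p. free_basis R (m \<oplus>\<^bsub>M\<^esub> m', j x) p \<ominus> (free_basis R (m, j x) p \<oplus> free_basis R (m', j x) p))"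
            "m \<in> carrier M" "m' \<in> carrier M" "x \<in> carrier X"
        | (2) m x x' where "f = (\<lambda>p. free_basis R (m, j x \<oplus>\<^bsub>Y\<^esub> j x') p \<ominus> (free_basis R (m, j x) p \<oplus> free_basis R (m, j x') p))"
            "m \<in> carrier M" "x \<in> carrier X" "x' \<in> carrier X"
        | (3) r m x where "f = (\<lambda>p. free_basis R (r \<odot>\<^bsub>M\<^esub> m, j x) p \<ominus> r \<otimes> free_basis R (m, j x) p)"
            "r \<in> carrier R" "m \<in> carrier M" "x \<in> carrier X"
        | (4) r m x where "f = (\<lambda>p. free_basis R (m, r \<odot>\<^bsub>Y\<^esub> j x) p \<ominus> r \<otimes> free_basis R (m, j x) p)"
            "r \<in> carrier R" "m \<in> carrier M" "x \<in> carrier X"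
        using f unfolding bil_gens_def Y_eq by blast
      then show ?thesis
      proof cases
        case 1
        have "pull f = (\<lambda>p. free_basis R (m \<oplus>\<^bsub>M\<^esub> m', x) p \<ominus> (free_basis R (m, x) p \<oplus> free_basis R (m', x) p))"
          by (simp only: 1 p1 p3 pb)
        then show ?thesis using 1 unfolding bil_gens_def by blast
      next
        case 2
        have "pull f = (\<lambda>p. free_basis R (m, x \<oplus>\<^bsub>X\<^esub> x') p \<ominus> (free_basis R (m, x) p \<oplus> free_basis R (m, x') p))"
          by (simp only: 2 p1 p3 pb ja[symmetric] X.add.m_closed)
        then show ?thesis using 2 unfolding bil_gens_def by blast
      next
        case 3
        have "pull f = (\<lambda>p. free_basis R (r \<odot>\<^bsub>M\<^esub> m, x) p \<ominus> r \<otimes> free_basis R (m, x) p)"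
          by (simp only: 3 p2 p3 pb)
        then show ?thesis using 3 unfolding bil_gens_def by blast
      next
        case 4
        have "pull f = (\<lambda>p. free_basis R (m, r \<odot>\<^bsub>X\<^esub> x) p \<ominus> r \<otimes> free_basis R (m, x) p)"
          by (simp only: 4 p2 p3 pb js[symmetric] X.smult_closed)
        then show ?thesis using 4 unfolding bil_gens_def by blast
      qed
    qed
    then show "f \<in> ?K" using f sub tensor_relations_eq(2)[OF M Y] by auto
  qed
  ultimately have "tensor_relations R M Y \<subseteq> ?K"
    by (rule tensor_relations_least[OF M Y])
  then show ?thesis using f unfolding pull_def by auto
qed

lemma bil_gensI:
  "m \<in> carrier M \<Longrightarrow> m' \<in> carrier M \<Longrightarrow> n \<in> carrier N \<Longrightarrow>
    (\<lambda>p. free_basis R (m \<oplus>\<^bsub>M\<^esub> m', n) p \<ominus> (free_basis R (m, n) p \<oplus> free_basis R (m', n) p)) \<in> bil_gens R M N"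
  "m \<in> carrier M \<Longrightarrow> n \<in> carrier N \<Longrightarrow> n' \<in> carrier N \<Longrightarrow>
    (\<lambda>p. free_basis R (m, n \<oplus>\<^bsub>N\<^esub> n') p \<ominus> (free_basis R (m, n) p \<oplus> free_basis R (m, n') p)) \<in> bil_gens R M N"
  "r \<in> carrier R \<Longrightarrow> m \<in> carrier M \<Longrightarrow> n \<in> carrier N \<Longrightarrow>
    (\<lambda>p. free_basis R (r \<odot>\<^bsub>M\<^esub> m, n) p \<ominus> r \<otimes> free_basis R (m, n) p) \<in> bil_gens R M N"
  "r \<in> carrier R \<Longrightarrow> m \<in> carrier M \<Longrightarrow> n \<in> carrier N \<Longrightarrow>
    (\<lambda>p. free_basis R (m, r \<odot>\<^bsub>N\<^esub> n) p \<ominus> r \<otimes> free_basis R (m, n) p) \<in> bil_gens R M N"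
  unfolding bil_gens_def by blast+

lemma tensor_relations_finite:
  assumes M: "module R M" and X: "module R X" and f: "f \<in> tensor_relations R M X"
  shows "\<exists>S. finite S \<and> S \<subseteq> carrier X \<and> f \<in> tensor_relations R M (X\<lparr>carrier := submodule_span R X S\<rparr>)"
proof -
  interpret X: module R X by fact
  let ?Z = "\<lambda>S. X\<lparr>carrier := submodule_span R X S\<rparr>"
  let ?F = "free_module R (carrier M \<times> carrier X)"
  let ?K = "{f \<in> carrier ?F. \<exists>S. finite S \<and> S \<subseteq> carrier X \<and> f \<in> tensor_relations R M (?Z S)}"
  have sp: "submodule (submodule_span R X S) R X" if "S \<subseteq> carrier X" for S
    by (rule X.submodule_span_is_submodule[OF that])
  have Z: "module R (?Z S)" if "S \<subseteq> carrier X" for S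
    using submodule.submodule_is_module[OF sp[OF that] X] .
  have mono: "tensor_relations R M (?Z S) \<subseteq> tensor_relations R M (?Z S')"
    if "S \<subseteq> S'" "S' \<subseteq> carrier X" for S S'
  proof -
    have "submodule_span R X S \<subseteq> submodule_span R X S'"
      using that by (auto simp: submodule_span_def)
    then have "submodule (submodule_span R X S) R (?Z S')"
      using sp[of S] sp[of S'] that
      by (intro module.module_incl_imp_submodule[OF Z]) (auto intro: Z)
    from tensor_relations_mono[OF M Z[OF that(2)] module.carrier_is_submodule[OF M] this]
    show ?thesis by simp
  qed
  note E = free_submoduleD[OF module.carrier_is_submodule[OF free_module_module]]
  note D = free_submoduleD[OF tensor_relations_submodule[OF M Z]]
  have "submodule ?K R ?F"
  proof (rule free_submoduleI)
    show "(\<lambda>i. \<zero>) \<in> ?K" using D(2)[of "{}"] E(2) by auto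
    fix f g assume f: "f \<in> ?K" and g: "g \<in> ?K"
    then obtain S S' where S: "finite S" "S \<subseteq> carrier X" "f \<in> tensor_relations R M (?Z S)"
      "finite S'" "S' \<subseteq> carrier X" "g \<in> tensor_relations R M (?Z S')" by auto
    then have "f \<in> tensor_relations R M (?Z (S \<union> S'))" "g \<in> tensor_relations R M (?Z (S \<union> S'))"
      using mono[of S "S \<union> S'"] mono[of S' "S \<union> S'"] by auto
    then have "(\<lambda>i. f i \<oplus> g i) \<in> tensor_relations R M (?Z (S \<union> S'))"
      using D(3)[of "S \<union> S'"] S by auto
    then show "(\<lambda>i. f i \<oplus> g i) \<in> ?K" using E(3) f g S by (auto intro!: exI[of _ "S \<union> S'"])
  next
    fix r f assume r: "r \<in> carrier R" and "f \<in> ?K"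
    then obtain S where S: "f \<in> carrier ?F" "finite S" "S \<subseteq> carrier X" "f \<in> tensor_relations R M (?Z S)"
      by auto
    show "(\<lambda>i. r \<otimes> f i) \<in> ?K"
      using D(4)[OF S(3) r S(4)] E(4)[OF r S(1)] S(2,3) by auto
  qed auto
  moreover have "bil_gens R M X \<subseteq> ?K"
  proof
    fix f assume f: "f \<in> bil_gens R M X"
    have "\<exists>S. finite S \<and> S \<subseteq> carrier X \<and> f \<in> bil_gens R M (?Z S)"
    proof -
      have in1: "x \<in> submodule_span R X {x, y}" "y \<in> submodule_span R X {x, y}" for x y
        using submodule_span_inc[of "{x, y}" R X] by auto
      consider
        (1) m m' x where "f = (\<lambda>p. free_basis R (m \<oplus>\<^bsub>M\<^esub> m', x) p \<ominus> (free_basis R (m, x) p \<oplus> free_basis R (m', x) p))"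
            "m \<in> carrier M" "m' \<in> carrier M" "x \<in> carrier X"
        | (2) m x x' where "f = (\<lambda>p. free_basis R (m, x \<oplus>\<^bsub>X\<^esub> x') p \<ominus> (free_basis R (m, x) p \<oplus> free_basis R (m, x') p))"
            "m \<in> carrier M" "x \<in> carrier X" "x' \<in> carrier X"
        | (3) r m x where "f = (\<lambda>p. free_basis R (r \<odot>\<^bsub>M\<^esub> m, x) p \<ominus> r \<otimes> free_basis R (m, x) p)"
            "r \<in> carrier R" "m \<in> carrier M" "x \<in> carrier X"
        | (4) r m x where "f = (\<lambda>p. free_basis R (m, r \<odot>\<^bsub>X\<^esub> x) p \<ominus> r \<otimes> free_basis R (m, x) p)"
            "r \<in> carrier R" "m \<in> carrier M" "x \<in> carrier X"
        using f unfolding bil_gens_def by blast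
      then show ?thesis
      proof cases
        case 1
        show ?thesis
          using 1 in1[of x x] bil_gensI(1)[where M=M and N="?Z {x, x}"]
          by (intro exI[of _ "{x, x}"]) simp
      next
        case 2
        show ?thesis
          using 2 in1(1)[of x x'] in1(2)[of x' x] bil_gensI(2)[where M=M and N="?Z {x, x'}"]
          by (intro exI[of _ "{x, x'}"]) simp
      next
        case 3
        show ?thesis
          using 3 in1[of x x] bil_gensI(3)[where M=M and N="?Z {x, x}"]
          by (intro exI[of _ "{x, x}"]) simp
      next
        case 4
        show ?thesis
          using 4 in1[of x x] bil_gensI(4)[where M=M and N="?Z {x, x}"]
          by (intro exI[of _ "{x, x}"]) simp
      qed
    qed
    then obtain S where S: "finite S" "S \<subseteq> carrier X" "f \<in> bil_gens R M (?Z S)" by blast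
    then show "f \<in> ?K"
      using f tensor_relations_eq(2)[OF M X] tensor_relations_gens[OF M Z[OF S(2)]] by auto
  qed
  ultimately have "tensor_relations R M X \<subseteq> ?K"
    by (rule tensor_relations_least[OF M X])
  then show ?thesis using f by auto
qed


lemma fg_module_embeds:
  assumes X: "module R X" and S: "finite S" "S \<subseteq> carrier X"
  shows "\<exists>j :: _ \<Rightarrow> (nat \<Rightarrow> 'a) set. inj_on j (submodule_span R X S)"
proof -
  interpret X: module R X by fact
  obtain n s where s: "S = s ` {i :: nat. i < n}"
    using finite_imp_nat_seg_image_inj_on[OF S(1)] by metis
  have sX: "s i \<in> carrier X" if "i < n" for i using s S(2) that by auto
  let ?e = "\<lambda>c. \<Oplus>\<^bsub>X\<^esub>i\<in>{i. i < n}. c i \<odot>\<^bsub>X\<^esub> s i"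
  define C where "C = (\<lambda>x. {c. c \<in> UNIV \<rightarrow> carrier R \<and> ?e c = x})"
  have mem: "(\<lambda>i. c i \<odot>\<^bsub>X\<^esub> s i) \<in> {i. i < n} \<rightarrow> carrier X" if "c \<in> UNIV \<rightarrow> carrier R" for c
    using that sX by auto
  have add: "?e (\<lambda>i. c i \<oplus> d i) = ?e c \<oplus>\<^bsub>X\<^esub> ?e d"
    if c: "c \<in> UNIV \<rightarrow> carrier R" and d: "d \<in> UNIV \<rightarrow> carrier R" for c d
  proof -
    have "?e (\<lambda>i. c i \<oplus> d i) = (\<Oplus>\<^bsub>X\<^esub>i\<in>{i. i < n}. c i \<odot>\<^bsub>X\<^esub> s i \<oplus>\<^bsub>X\<^esub> d i \<odot>\<^bsub>X\<^esub> s i)"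
      by (rule X.finsum_cong') (use c d sX in \<open>auto simp: X.smult_l_distr Pi_iff\<close>)
    also have "\<dots> = ?e c \<oplus>\<^bsub>X\<^esub> ?e d"
      by (rule X.finsum_addf[OF mem[OF c] mem[OF d]])
    finally show ?thesis .
  qed
  have sm: "?e (\<lambda>i. r \<otimes> c i) = r \<odot>\<^bsub>X\<^esub> ?e c"
    if c: "c \<in> UNIV \<rightarrow> carrier R" and r: "r \<in> carrier R" for c r
  proof -
    have "?e (\<lambda>i. r \<otimes> c i) = (\<Oplus>\<^bsub>X\<^esub>i\<in>{i. i < n}. r \<odot>\<^bsub>X\<^esub> (c i \<odot>\<^bsub>X\<^esub> s i))"
      by (rule X.finsum_cong') (use c r sX in \<open>auto simp: X.smult_assoc1 Pi_iff\<close>)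
    also have "\<dots> = r \<odot>\<^bsub>X\<^esub> ?e c"
      using X.finsum_smult_ldistr[OF _ r mem[OF c]] by simp
    finally show ?thesis .
  qed
  have eX: "?e c \<in> carrier X" if "c \<in> UNIV \<rightarrow> carrier R" for c
    by (rule X.finsum_closed[OF mem[OF that]])
  let ?V = "?e ` (UNIV \<rightarrow> carrier R)"
  have V: "submodule ?V R X"
  proof (rule X.submoduleI)
    show "?V \<subseteq> carrier X" using eX by auto
    have "?e (\<lambda>i. \<zero>) = (\<Oplus>\<^bsub>X\<^esub>i\<in>{i. i < n}. \<zero>\<^bsub>X\<^esub>)"
      by (rule X.finsum_cong') (use sX in auto)
    then have "?e (\<lambda>i. \<zero>) = \<zero>\<^bsub>X\<^esub>" by simp
    then show "\<zero>\<^bsub>X\<^esub> \<in> ?V" by (intro image_eqI[of _ _ "\<lambda>i. \<zero>"]) auto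
    fix x assume "x \<in> ?V"
    then obtain c where c: "c \<in> UNIV \<rightarrow> carrier R" "x = ?e c" by auto
    have "\<ominus>\<^bsub>X\<^esub> x = (\<ominus> \<one>) \<odot>\<^bsub>X\<^esub> x"
      using X.smult_l_minus[of \<one> x] c eX by simp
    then have "\<ominus>\<^bsub>X\<^esub> x = ?e (\<lambda>i. (\<ominus> \<one>) \<otimes> c i)"
      using sm[OF c(1), of "\<ominus> \<one>"] c by simp
    then show "\<ominus>\<^bsub>X\<^esub> x \<in> ?V" using c(1) by (intro image_eqI[of _ _ "\<lambda>i. (\<ominus> \<one>) \<otimes> c i"]) auto
    fix y assume "y \<in> ?V"
    then obtain d where d: "d \<in> UNIV \<rightarrow> carrier R" "y = ?e d" by auto
    show "x \<oplus>\<^bsub>X\<^esub> y \<in> ?V"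
      using add[OF c(1) d(1)] c d by (intro image_eqI[of _ _ "\<lambda>i. c i \<oplus> d i"]) (auto simp: Pi_iff)
  next
    fix r x assume r: "r \<in> carrier R" and "x \<in> ?V"
    then obtain c where c: "c \<in> UNIV \<rightarrow> carrier R" "x = ?e c" by auto
    show "r \<odot>\<^bsub>X\<^esub> x \<in> ?V"
      using sm[OF c(1) r] c r by (intro image_eqI[of _ _ "\<lambda>i. r \<otimes> c i"]) (auto simp: Pi_iff)
  qed
  have "S \<subseteq> ?V"
  proof
    fix x assume "x \<in> S"
    then obtain k where k: "k < n" "x = s k" using s by auto
    have "?e (free_basis R k) = (\<Oplus>\<^bsub>X\<^esub>i\<in>{i. i < n}. if k = i then s i else \<zero>\<^bsub>X\<^esub>)"
      by (rule X.finsum_cong') (use sX in \<open>auto simp: free_basis_def\<close>)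
    also have "\<dots> = s k"
      by (rule X.finsum_singleton) (use k sX in auto)
    finally show "x \<in> ?V"
      using k by (intro image_eqI[of _ _ "free_basis R k"]) (auto simp: free_basis_def)
  qed
  with V have "submodule_span R X S \<subseteq> ?V" by (rule submodule_span_sub)
  moreover have "inj_on C ?V"
    unfolding C_def by (rule inj_onI) blast
  ultimately show ?thesis using inj_on_subset by blast
qed

lemma transport_module:
  assumes Z: "module R Z" and j: "inj_on j (carrier Z)"
  obtains Y :: "('a, 'y) module"
  where "module R Y" "j \<in> linear_maps R Z Y" "bij_betw j (carrier Z) (carrier Y)"
    "inv_into (carrier Z) j \<in> linear_maps R Y Z"
    "bij_betw (inv_into (carrier Z) j) (carrier Y) (carrier Z)"
proof -
  interpret Z: module R Z by fact
  let ?i = "inv_into (carrier Z) j"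
  define Y :: "('a, 'y) module" where
    "Y = \<lparr>carrier = j ` carrier Z, mult = undefined, one = undefined, zero = j \<zero>\<^bsub>Z\<^esub>,
       add = (\<lambda>u v. j (?i u \<oplus>\<^bsub>Z\<^esub> ?i v)), smult = (\<lambda>r u. j (r \<odot>\<^bsub>Z\<^esub> ?i u))\<rparr>"
  have Ys: "carrier Y = j ` carrier Z" "zero Y = j \<zero>\<^bsub>Z\<^esub>"
    "\<And>x y. x \<in> carrier Z \<Longrightarrow> y \<in> carrier Z \<Longrightarrow> j x \<oplus>\<^bsub>Y\<^esub> j y = j (x \<oplus>\<^bsub>Z\<^esub> y)"
    "\<And>r x. x \<in> carrier Z \<Longrightarrow> r \<odot>\<^bsub>Y\<^esub> j x = j (r \<odot>\<^bsub>Z\<^esub> x)"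
    using j by (simp_all add: Y_def)
  have Y: "module R Y"
  proof (rule moduleI)
    show "abelian_group Y"
    proof (rule abelian_groupI)
      fix u assume "u \<in> carrier Y"
      then obtain x where x: "x \<in> carrier Z" "u = j x" using Ys(1) by auto
      show "\<exists>v\<in>carrier Y. v \<oplus>\<^bsub>Y\<^esub> u = \<zero>\<^bsub>Y\<^esub>"
        by (rule bexI[of _ "j (\<ominus>\<^bsub>Z\<^esub> x)"]) (use x Ys in \<open>auto simp: Z.l_neg\<close>)
    qed (auto simp: Ys Z.a_ac)
  qed (auto simp: Ys is_cring Z.smult_l_distr Z.smult_r_distr Z.smult_assoc1)
  show thesis
  proof (rule that[OF Y])
    show "j \<in> linear_maps R Z Y" by (auto simp: linear_maps_def Ys)
    show "bij_betw j (carrier Z) (carrier Y)" using j by (simp add: bij_betw_def Ys)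
    then show "bij_betw ?i (carrier Y) (carrier Z)" by (rule bij_betw_inv_into)
    show "?i \<in> linear_maps R Y Z" using j by (auto simp: linear_maps_def Ys)
  qed
qed

lemma pure_submodule_inj:
  assumes M: "module R M" and pure: "pure_submodule R N M" and X: "module R X"
  shows "inj_on (tensor_map R M X (\<lambda>n. n) (\<lambda>x. x)) (carrier (tensor_module R (M\<lparr>carrier := N\<rparr>) X))"
proof -
  interpret X: module R X by fact
  have N: "submodule N R M" using pure by (simp add: pure_submodule_def)
  have N': "module R (M\<lparr>carrier := N\<rparr>)" using submodule.submodule_is_module[OF N M] .
  have "f \<in> tensor_relations R (M\<lparr>carrier := N\<rparr>) X"
    if f: "f \<in> tensor_relations R M X" "f \<in> carrier (free_module R (N \<times> carrier X))" for f
  proof -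
    obtain S0 where S0: "finite S0" "S0 \<subseteq> carrier X"
      "f \<in> tensor_relations R M (X\<lparr>carrier := submodule_span R X S0\<rparr>)"
      using tensor_relations_finite[OF M X f(1)] by blast
    define Z where "Z = X\<lparr>carrier := submodule_span R X S0\<rparr>"
    have sub: "submodule (submodule_span R X S0) R X"
      by (rule X.submodule_span_is_submodule[OF S0(2)])
    have Z: "module R Z"
      unfolding Z_def using submodule.submodule_is_module[OF sub X] .
    obtain j :: "_ \<Rightarrow> (nat \<Rightarrow> 'a) set" where j: "inj_on j (submodule_span R X S0)"
      using fg_module_embeds[OF X S0(1,2)] by blast
    then have j': "inj_on j (carrier Z)" by (simp add: Z_def)
    let ?i = "inv_into (carrier Z) j"
    obtain Y :: "('a, (nat \<Rightarrow> 'a) set) module" where Y: "module R Y"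
      "j \<in> linear_maps R Z Y" "bij_betw j (carrier Z) (carrier Y)"
      "?i \<in> linear_maps R Y Z" "bij_betw ?i (carrier Y) (carrier Z)"
      using transport_module[OF Z j'] by blast
    have fMZ: "f \<in> carrier (free_module R (carrier M \<times> carrier Z))"
      using free_submoduleD(1)[OF tensor_relations_submodule[OF M Z]] S0(3) by (auto simp: Z_def)
    define g where "g = (\<lambda>p. if snd p \<in> carrier Y then f (fst p, ?i (snd p)) else \<zero>)"
    have gK: "g \<in> tensor_relations R M Y"
      unfolding g_def by (rule tensor_relations_pull[OF M Y(1) Z Y(4,5)]) (use S0(3) in \<open>simp add: Z_def\<close>)
    have "g \<in> carrier (free_module R (carrier M \<times> carrier Y))"
      using free_submoduleD(1)[OF tensor_relations_submodule[OF M Y(1)]] gK by auto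
    then have "g \<in> carrier (free_module R (N \<times> carrier Y))"
      using f(2) unfolding free_module_carrier g_def by auto
    moreover have "inj_on (tensor_map R M Y (\<lambda>n. n) (\<lambda>x. x)) (carrier (tensor_module R (M\<lparr>carrier := N\<rparr>) Y))"
      using pure Y(1) by (auto simp: pure_submodule_def)
    ultimately have gL: "g \<in> tensor_relations R (M\<lparr>carrier := N\<rparr>) Y"
      using tensor_inclusion_inj_iff[OF M Y(1) N] gK by auto
    have "(\<lambda>p. if snd p \<in> carrier Z then g (fst p, j (snd p)) else \<zero>) = f"
    proof
      fix p
      show "(if snd p \<in> carrier Z then g (fst p, j (snd p)) else \<zero>) = f p"
      proof (cases "snd p \<in> carrier Z")
        case True
        then have "j (snd p) \<in> carrier Y" using Y(3) by (auto simp: bij_betw_def)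
        then show ?thesis using True j' by (simp add: g_def)
      next
        case False
        then have "p \<notin> carrier M \<times> carrier Z" by (cases p) auto
        then have "f p = \<zero>" using fMZ unfolding free_module_carrier by blast
        then show ?thesis using False by simp
      qed
    qed
    then have "f \<in> tensor_relations R (M\<lparr>carrier := N\<rparr>) Z"
      using tensor_relations_pull[OF N' Z Y(1-3) gL] by simp
    then show ?thesis
      using tensor_relations_mono[OF N' X module.carrier_is_submodule[OF N'] sub]
      by (auto simp: Z_def)
  qed
  then show ?thesis
    using tensor_inclusion_inj_iff[OF M X N] by blast
qed

end


section \<open>Hopf algebras, comodule algebras and smash products\<close>

record ('r, 'h) hopf = "('r, 'h) module" +
  comult :: "'h \<Rightarrow> ('h \<times> 'h \<Rightarrow> 'r) set"
  counit :: "'h \<Rightarrow> 'r"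
  antipode :: "'h \<Rightarrow> 'h"

locale hopf_algebra = assoc_algebra R H
  for R :: "('r, 's) ring_scheme" (structure)
    and H :: "('r, 'h, 'x) hopf_scheme" (structure) +
  assumes comult_hom: "comult H \<in> algebra_homs R H (tensor_algebra R H H)"
    and counit_hom: "counit H \<in> algebra_homs R H (self_module R)"
    and coassoc: "h \<in> carrier H \<Longrightarrow>
      tensor_assoc R H H H (tensor_map R (tensor_module R H H) H (comult H) (\<lambda>k. k) (comult H h)) =
      tensor_map R H (tensor_module R H H) (\<lambda>k. k) (comult H) (comult H h)"
    and counit_left: "h \<in> carrier H \<Longrightarrow>
      tensor_lift R H (\<lambda>h1 h2. counit H h1 \<odot>\<^bsub>H\<^esub> h2) (comult H h) = h"
    and counit_right: "h \<in> carrier H \<Longrightarrow>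
      tensor_lift R H (\<lambda>h1 h2. counit H h2 \<odot>\<^bsub>H\<^esub> h1) (comult H h) = h"
    and antipode_linear: "antipode H \<in> linear_maps R H H"
    and antipode_left: "h \<in> carrier H \<Longrightarrow>
      tensor_lift R H (\<lambda>h1 h2. antipode H h1 \<otimes>\<^bsub>H\<^esub> h2) (comult H h) = counit H h \<odot>\<^bsub>H\<^esub> \<one>\<^bsub>H\<^esub>"
    and antipode_right: "h \<in> carrier H \<Longrightarrow>
      tensor_lift R H (\<lambda>h1 h2. h1 \<otimes>\<^bsub>H\<^esub> antipode H h2) (comult H h) = counit H h \<odot>\<^bsub>H\<^esub> \<one>\<^bsub>H\<^esub>"

definition bijective_antipode :: "('r, 'h, 'x) hopf_scheme \<Rightarrow> bool" where
  "bijective_antipode H \<longleftrightarrow> bij_betw (antipode H) (carrier H) (carrier H)"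

locale right_comodule_algebra = assoc_algebra R A
  for R :: "('r, 's) ring_scheme" (structure) and K :: "('r, 'k, 'x) hopf_scheme"
    and A :: "('r, 'a, 'y) module_scheme" (structure)
    and coact :: "'a \<Rightarrow> ('a \<times> 'k \<Rightarrow> 'r) set" +
  assumes coact_hom: "coact \<in> algebra_homs R A (tensor_algebra R A K)"
    and coact_coassoc: "a \<in> carrier A \<Longrightarrow>
      tensor_assoc R A K K (tensor_map R (tensor_module R A K) K coact (\<lambda>k. k) (coact a)) =
      tensor_map R A (tensor_module R K K) (\<lambda>b. b) (comult K) (coact a)"
    and coact_counit: "a \<in> carrier A \<Longrightarrow>
      tensor_lift R A (\<lambda>a0 a1. counit K a1 \<odot>\<^bsub>A\<^esub> a0) (coact a) = a"

text \<open>\<open>A # K\<close> for an action \<open>act\<close> of \<open>K\<close> on \<open>A\<close>, with product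
  \<open>(a # h) (b # k) = \<Sum>a (h\<^sub>1 b) # h\<^sub>2 k\<close> and unit \<open>1 # 1\<close>.\<close>

definition smash_product ::
  "('r, 's) ring_scheme \<Rightarrow> ('r, 'a, 'x) module_scheme \<Rightarrow> ('r, 'k, 'y) hopf_scheme
    \<Rightarrow> ('k \<Rightarrow> 'a \<Rightarrow> 'a) \<Rightarrow> ('r, ('a \<times> 'k \<Rightarrow> 'r) set) module"
where
  "smash_product R A K act = (let T = tensor_module R A K in
     T\<lparr>mult := (\<lambda>s t. tensor_lift R T (\<lambda>a h. tensor_lift R T (\<lambda>b k. tensor_lift R T
           (\<lambda>h1 h2. tensor R A K (a \<otimes>\<^bsub>A\<^esub> act h1 b) (h2 \<otimes>\<^bsub>K\<^esub> k)) (comult K h)) t) s),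
       one := tensor R A K \<one>\<^bsub>A\<^esub> \<one>\<^bsub>K\<^esub>\<rparr>)"


section \<open>The finite dual and its Hopf subalgebras\<close>

definition translate :: "('r, 'h, 'x) module_scheme \<Rightarrow> 'h \<Rightarrow> ('h \<Rightarrow> 'r) \<Rightarrow> 'h \<Rightarrow> 'r" where
  "translate H h f = (\<lambda>k\<in>carrier H. f (k \<otimes>\<^bsub>H\<^esub> h))"

definition finite_dual_set ::
  "('r, 's) ring_scheme \<Rightarrow> ('r, 'h, 'x) module_scheme \<Rightarrow> ('h \<Rightarrow> 'r) set"
where
  "finite_dual_set R H = {f \<in> linear_maps R H (self_module R) \<inter> extensional (carrier H).
     finitely_generated_submodule R (function_module R (carrier H))
       ((\<lambda>h. translate H h f) ` carrier H)}"

text \<open>The comultiplication of \<open>f\<close> is the unique tensor \<open>\<Sum>f\<^sub>1 \<otimes> f\<^sub>2\<close> with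
  \<open>f (h k) = \<Sum>f\<^sub>1 h f\<^sub>2 k\<close>.\<close>

definition finite_dual ::
  "('r, 's) ring_scheme \<Rightarrow> ('r, 'h, 'x) hopf_scheme \<Rightarrow> ('r, 'h \<Rightarrow> 'r) hopf"
where
  "finite_dual R H =
    (let F = function_module R (carrier H); D = F\<lparr>carrier := finite_dual_set R H\<rparr> in
     \<lparr>carrier = finite_dual_set R H,
      mult = (\<lambda>f g. \<lambda>h\<in>carrier H.
        tensor_lift R (self_module R) (\<lambda>h1 h2. f h1 \<otimes>\<^bsub>R\<^esub> g h2) (comult H h)),
      one = (\<lambda>h\<in>carrier H. counit H h),
      zero = zero F, add = add F, smult = smult F,
      comult = (\<lambda>f. THE t. t \<in> carrier (tensor_module R D D) \<and>
        (\<forall>h\<in>carrier H. \<forall>k\<in>carrier H. f (h \<otimes>\<^bsub>H\<^esub> k) =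
           tensor_lift R (self_module R) (\<lambda>f1 f2. f1 h \<otimes>\<^bsub>R\<^esub> f2 k) t)),
      counit = (\<lambda>f. f \<one>\<^bsub>H\<^esub>),
      antipode = (\<lambda>f. \<lambda>h\<in>carrier H. f (antipode H h))\<rparr>)"

definition hopf_subalgebra ::
  "('r, 's) ring_scheme \<Rightarrow> 'k set \<Rightarrow> ('r, 'k, 'x) hopf_scheme \<Rightarrow> bool"
where
  "hopf_subalgebra R U K \<longleftrightarrow> pure_submodule R U K \<and>
     \<one>\<^bsub>K\<^esub> \<in> U \<and> (\<forall>f\<in>U. \<forall>g\<in>U. f \<otimes>\<^bsub>K\<^esub> g \<in> U) \<and>
     comult K ` U \<subseteq> tensor_map R K K (\<lambda>u. u) (\<lambda>u. u) `
       carrier (tensor_module R (K\<lparr>carrier := U\<rparr>) (K\<lparr>carrier := U\<rparr>)) \<and>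
     antipode K ` U \<subseteq> U"

text \<open>A Hopf subalgebra as a Hopf algebra in its own right.  By purity \<open>U \<otimes> U \<rightarrow> K \<otimes> K\<close> is injective,
  so that the comultiplication of \<open>K\<close> corestricts uniquely to \<open>U \<otimes> U\<close>.\<close>

definition restrict_hopf ::
  "('r, 's) ring_scheme \<Rightarrow> ('r, 'k, 'x) hopf_scheme \<Rightarrow> 'k set \<Rightarrow> ('r, 'k, 'x) hopf_scheme"
where
  "restrict_hopf R K U = K\<lparr>carrier := U,
     comult := (\<lambda>f. THE t. t \<in> carrier (tensor_module R (K\<lparr>carrier := U\<rparr>) (K\<lparr>carrier := U\<rparr>)) \<and>
       tensor_map R K K (\<lambda>u. u) (\<lambda>u. u) t = comult K f)\<rparr>"


section \<open>Actions and the RL-condition\<close>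

text \<open>\<open>f \<rightharpoonup> h = \<Sum>h\<^sub>1 \<langle>f, h\<^sub>2\<rangle>\<close> and \<open>h \<leftharpoonup> f = \<Sum>\<langle>f, h\<^sub>1\<rangle> h\<^sub>2\<close>.\<close>

definition hit_left ::
  "('r, 's) ring_scheme \<Rightarrow> ('r, 'h, 'x) hopf_scheme \<Rightarrow> ('h \<Rightarrow> 'r) \<Rightarrow> 'h \<Rightarrow> 'h"
where
  "hit_left R H f h = tensor_lift R H (\<lambda>h1 h2. f h2 \<odot>\<^bsub>H\<^esub> h1) (comult H h)"

definition hit_right ::
  "('r, 's) ring_scheme \<Rightarrow> ('r, 'h, 'x) hopf_scheme \<Rightarrow> 'h \<Rightarrow> ('h \<Rightarrow> 'r) \<Rightarrow> 'h"
where
  "hit_right R H h f = tensor_lift R H (\<lambda>h1 h2. f h1 \<odot>\<^bsub>H\<^esub> h2) (comult H h)"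

text \<open>For a right comodule over a Hopf algebra of functionals on \<open>H\<close>:
  \<open>h a = \<Sum>a\<^sub>0 \<langle>a\<^sub>1, h\<rangle>\<close>.  Applied to the comodule \<open>U\<close> this is \<open>h \<rightharpoonup> f = \<Sum>f\<^sub>1 \<langle>f\<^sub>2, h\<rangle>\<close>.\<close>

definition coaction_action ::
  "('r, 's) ring_scheme \<Rightarrow> ('r, 'a, 'x) module_scheme
    \<Rightarrow> ('a \<Rightarrow> ('a \<times> ('h \<Rightarrow> 'r) \<Rightarrow> 'r) set) \<Rightarrow> 'h \<Rightarrow> 'a \<Rightarrow> 'a"
where
  "coaction_action R A coact h a = tensor_lift R A (\<lambda>a0 a1. a1 h \<odot>\<^bsub>A\<^esub> a0) (coact a)"

definition smash_lambda ::
  "('r, 's) ring_scheme \<Rightarrow> ('r, 'h, 'x) hopf_scheme \<Rightarrow> ('h \<times> ('h \<Rightarrow> 'r) \<Rightarrow> 'r) set \<Rightarrow> 'h \<Rightarrow> 'h"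
where
  "smash_lambda R H t = (\<lambda>k\<in>carrier H.
     tensor_lift R H (\<lambda>h f. h \<otimes>\<^bsub>H\<^esub> hit_left R H f k) t)"

definition smash_rho ::
  "('r, 's) ring_scheme \<Rightarrow> ('r, 'h, 'x) hopf_scheme \<Rightarrow> (('h \<Rightarrow> 'r) \<times> 'h \<Rightarrow> 'r) set \<Rightarrow> 'h \<Rightarrow> 'h"
where
  "smash_rho R H t = (\<lambda>k\<in>carrier H.
     tensor_lift R H (\<lambda>f h. hit_right R H k f \<otimes>\<^bsub>H\<^esub> h) t)"

text \<open>Of the smash product \<open>U # H\<close> only the underlying module \<open>U \<otimes> H\<close> and its elements \<open>f # 1\<close>
  enter here.\<close>

definition RL_condition ::
  "('r, 's) ring_scheme \<Rightarrow> ('r, 'h, 'x) hopf_scheme \<Rightarrow> ('r, 'h \<Rightarrow> 'r, 'y) hopf_scheme \<Rightarrow> bool"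
where
  "RL_condition R H U \<longleftrightarrow>
     smash_rho R H ` {tensor R U H f \<one>\<^bsub>H\<^esub> | f. f \<in> carrier U} \<subseteq>
     smash_lambda R H ` carrier (smash_product R H U (hit_left R H))"

end

theory Submission
  imports Defs
begin

text \<open>Write \<open>B = H # U\<close>. Since \<open>R\<close> is noetherian and \<open>U\<close> is pure in \<open>R\<^sup>H\<close>, the map
  \<open>H \<otimes> U \<rightarrow> H\<^sup>H\<close> is injective, and together with the inverse antipode of \<open>H\<close> this makes
  \<open>\<lambda> : B \<rightarrow> End H\<close> injective. So identities in \<open>B\<close> can be checked on operators, and the RL-condition
  yields a linear map \<open>v : U \<rightarrow> B\<close> (called \<open>rho_lift\<close>) with \<open>\<lambda> (v f) = \<rho> (f # 1)\<close>. It satisfies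
  \<open>v (f g) = v g v f\<close> and \<open>v g (h # f) = \<Sum>((h \<leftharpoonup> g\<^sub>1) # f) v g\<^sub>2\<close>, and it has the convolution inverse
  \<open>w = v \<circ> S\<^sup>-\<^sup>1\<close> (called \<open>rho_lift_inv\<close>).  Associativity identifies \<open>(A # H) # U\<close> with \<open>A \<otimes> B\<close> under the
  product \<open>(a \<otimes> x) (b \<otimes> y) = \<Sum>a b\<^sub>0 \<otimes> (x \<leftharpoonup> b\<^sub>1) y\<close>, where \<open>(h # f) \<leftharpoonup> g = (h \<leftharpoonup> g) # f\<close>. The map
  \<open>a \<otimes> x \<mapsto> \<Sum>a\<^sub>0 \<otimes> v(a\<^sub>1) x\<close> turns the ordinary product of \<open>A \<otimes> B\<close> into this one, and its inverse is
  \<open>a \<otimes> x \<mapsto> \<Sum>a\<^sub>0 \<otimes> w(a\<^sub>1) x\<close>.\<close>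

section \<open>Linear and bilinear maps\<close>

text \<open>The right action of U on \<open>B\<close> is inner: z \<leftharpoonup> g = \<Sum> v(g_1)
  z w(g_2). A product twisted by an inner action can be untwisted, and the RL-condition places the
  implementing map \<open>v\<close> in \<open>B\<close> itself instead of in the endomorphisms of H.
  Since f g acts from the right as k \<mapsto> (k \<leftharpoonup> f) \<leftharpoonup> g,
  \<open>v\<close> reverses products, so its convolution inverse needs the inverse of the antipode
  of U rather than the antipode. Neither \<open>B\<close> nor (A # H) # U is shown to be associative
  by a Sweedler computation. \<open>B\<close> inherits the laws of composition of operators through
  \<lambda>, and the iterated smash product those of A \<otimes> B through the bijection. The
  obstacle lies earlier. The comultiplications of \<open>H\<^sup>\<circ>\<close> and of U are
  definite descriptions, whose tensors must first be shown to exist and to be unique, and equality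
  in U \<otimes> M can be tested at points of H only once purity and the noetherian condition have
  embedded it into \<open>M\<^sup>H\<close>. Moreover \<open>tensor_lift\<close> evaluates a chosen
  representative, so integrands have to be proved bilinear before their sums can be
  manipulated.\<close>

definition bilinear_maps ::
  "('r, 's) ring_scheme \<Rightarrow> ('r, 'm, 'x) module_scheme \<Rightarrow> ('r, 'n, 'y) module_scheme
    \<Rightarrow> ('r, 'p, 'z) module_scheme \<Rightarrow> ('m \<Rightarrow> 'n \<Rightarrow> 'p) set"
where
  "bilinear_maps R M N P = {\<beta>. (\<forall>m\<in>carrier M. \<beta> m \<in> linear_maps R N P) \<and>
     (\<forall>n\<in>carrier N. (\<lambda>m. \<beta> m n) \<in> linear_maps R M P)}"

lemma linear_mapsI:
  assumes "\<And>x. x \<in> carrier M \<Longrightarrow> f x \<in> carrier N"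
    and "\<And>x y. x \<in> carrier M \<Longrightarrow> y \<in> carrier M \<Longrightarrow> f (x \<oplus>\<^bsub>M\<^esub> y) = f x \<oplus>\<^bsub>N\<^esub> f y"
    and "\<And>r x. r \<in> carrier R \<Longrightarrow> x \<in> carrier M \<Longrightarrow> f (r \<odot>\<^bsub>M\<^esub> x) = r \<odot>\<^bsub>N\<^esub> f x"
  shows "f \<in> linear_maps R M N"
  using assms by (auto simp: linear_maps_def)

lemma linear_mapsD:
  assumes "f \<in> linear_maps R M N"
  shows "\<And>x. x \<in> carrier M \<Longrightarrow> f x \<in> carrier N"
    and "\<And>x y. x \<in> carrier M \<Longrightarrow> y \<in> carrier M \<Longrightarrow> f (x \<oplus>\<^bsub>M\<^esub> y) = f x \<oplus>\<^bsub>N\<^esub> f y"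
    and "\<And>r x. r \<in> carrier R \<Longrightarrow> x \<in> carrier M \<Longrightarrow> f (r \<odot>\<^bsub>M\<^esub> x) = r \<odot>\<^bsub>N\<^esub> f x"
  using assms by (auto simp: linear_maps_def)

lemma bilinear_mapsI:
  assumes "\<And>m. m \<in> carrier M \<Longrightarrow> (\<lambda>n. \<beta> m n) \<in> linear_maps R N P"
    and "\<And>n. n \<in> carrier N \<Longrightarrow> (\<lambda>m. \<beta> m n) \<in> linear_maps R M P"
  shows "\<beta> \<in> bilinear_maps R M N P"
  using assms by (auto simp: bilinear_maps_def)

lemma bilinear_mapsD:
  assumes "\<beta> \<in> bilinear_maps R M N P"
  shows "\<And>m. m \<in> carrier M \<Longrightarrow> \<beta> m \<in> linear_maps R N P"
    and "\<And>n. n \<in> carrier N \<Longrightarrow> (\<lambda>m. \<beta> m n) \<in> linear_maps R M P"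
    and "\<And>m n. m \<in> carrier M \<Longrightarrow> n \<in> carrier N \<Longrightarrow> \<beta> m n \<in> carrier P"
  using assms by (auto simp: bilinear_maps_def linear_maps_def)

lemma linear_maps_id: "(\<lambda>x. x) \<in> linear_maps R M M"
  by (rule linear_mapsI) auto

lemma linear_maps_comp:
  "f \<in> linear_maps R N P \<Longrightarrow> g \<in> linear_maps R M N \<Longrightarrow> (\<lambda>x. f (g x)) \<in> linear_maps R M P"
  by (auto simp: linear_maps_def Pi_iff)

text \<open>Functions are total while linearity concerns the carrier only. This replaces a function
  by one that agrees with it there, for instance when a functional is cut off by
  \<open>restrict\<close>.\<close>

lemma linear_maps_eqI:
  assumes M: "module R M" and f: "f \<in> linear_maps R M N"
    and eq: "\<And>x. x \<in> carrier M \<Longrightarrow> f x = g x"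
  shows "g \<in> linear_maps R M N"
proof -
  interpret M: module R M by fact
  note f = linear_mapsD[OF f]
  show ?thesis
  proof (rule linear_mapsI)
    show "g x \<in> carrier N" if "x \<in> carrier M" for x
      using f(1)[OF that] eq[OF that] by simp
    show "g (x \<oplus>\<^bsub>M\<^esub> y) = g x \<oplus>\<^bsub>N\<^esub> g y" if "x \<in> carrier M" "y \<in> carrier M" for x y
      using f(2)[OF that] eq that M.a_closed by metis
    show "g (r \<odot>\<^bsub>M\<^esub> x) = r \<odot>\<^bsub>N\<^esub> g x" if "r \<in> carrier R" "x \<in> carrier M" for r x
      using f(3)[OF that] eq that M.smult_closed by metis
  qed
qed

lemma linear_maps_zero:
  assumes "module R M" "module R N" "f \<in> linear_maps R M N"
  shows "f \<zero>\<^bsub>M\<^esub> = \<zero>\<^bsub>N\<^esub>"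
proof -
  interpret M: module R M by fact
  interpret N: module R N by fact
  have "f \<zero>\<^bsub>M\<^esub> = f (\<zero>\<^bsub>R\<^esub> \<odot>\<^bsub>M\<^esub> \<zero>\<^bsub>M\<^esub>)" by simp
  also have "\<dots> = \<zero>\<^bsub>R\<^esub> \<odot>\<^bsub>N\<^esub> f \<zero>\<^bsub>M\<^esub>" using linear_mapsD(3)[OF assms(3)] by blast
  also have "\<dots> = \<zero>\<^bsub>N\<^esub>" using linear_mapsD(1)[OF assms(3)] by simp
  finally show ?thesis .
qed

lemma linear_maps_minus:
  assumes "module R M" "module R N" "f \<in> linear_maps R M N" "x \<in> carrier M" "y \<in> carrier M"
  shows "f (x \<ominus>\<^bsub>M\<^esub> y) = f x \<ominus>\<^bsub>N\<^esub> f y"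
proof -
  interpret M: module R M by fact
  interpret N: module R N by fact
  note f = linear_mapsD[OF assms(3)]
  have "\<ominus>\<^bsub>M\<^esub> y = (\<ominus>\<^bsub>R\<^esub> \<one>\<^bsub>R\<^esub>) \<odot>\<^bsub>M\<^esub> y"
    using assms by (simp add: M.smult_l_minus)
  then have "f (\<ominus>\<^bsub>M\<^esub> y) = \<ominus>\<^bsub>N\<^esub> f y"
    using assms f by (simp add: N.smult_l_minus)
  then show ?thesis
    using assms f by (simp add: a_minus_def)
qed

lemma linear_maps_finsum:
  assumes "module R M" "module R N" "f \<in> linear_maps R M N" "finite I" "x \<in> I \<rightarrow> carrier M"
  shows "f (\<Oplus>\<^bsub>M\<^esub>i\<in>I. x i) = (\<Oplus>\<^bsub>N\<^esub>i\<in>I. f (x i))"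
proof -
  interpret M: module R M by fact
  interpret N: module R N by fact
  note f = linear_mapsD[OF assms(3)]
  show ?thesis
    using assms(4,5)
  proof (induction I)
    case empty
    then show ?case using linear_maps_zero[OF assms(1-3)] by simp
  next
    case (insert i I)
    then have "f (\<Oplus>\<^bsub>M\<^esub>j\<in>I. x j) = (\<Oplus>\<^bsub>N\<^esub>j\<in>I. f (x j))" by auto
    moreover have "(\<lambda>j. f (x j)) \<in> I \<rightarrow> carrier N" "f (x i) \<in> carrier N"
      using insert.prems f(1) by (simp_all add: Pi_iff)
    ultimately show ?case
      using insert f(2) by (simp add: M.finsum_closed)
  qed
qed

lemma linear_maps_inv_into:
  assumes "module R M" "f \<in> linear_maps R M N" "bij_betw f (carrier M) (carrier N)"
  shows "inv_into (carrier M) f \<in> linear_maps R N M"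
proof -
  interpret M: module R M by fact
  let ?g = "inv_into (carrier M) f"
  have inj: "inj_on f (carrier M)" and surj: "f ` carrier M = carrier N"
    using assms(3) by (auto simp: bij_betw_def)
  have g: "?g y \<in> carrier M" "f (?g y) = y" if "y \<in> carrier N" for y
    using that surj by (auto simp: inv_into_into f_inv_into_f)
  note f = linear_mapsD[OF assms(2)]
  show ?thesis
  proof (rule linear_mapsI)
    fix x y assume "x \<in> carrier N" "y \<in> carrier N"
    then show "?g (x \<oplus>\<^bsub>N\<^esub> y) = ?g x \<oplus>\<^bsub>M\<^esub> ?g y"
      using g f by (intro inv_into_f_eq[OF inj]) auto
  next
    fix r x assume "r \<in> carrier R" "x \<in> carrier N"
    then show "?g (r \<odot>\<^bsub>N\<^esub> x) = r \<odot>\<^bsub>M\<^esub> ?g x"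
      using g f by (intro inv_into_f_eq[OF inj]) auto
  qed (use g in auto)
qed

lemma self_module_simps [simp]:
  "carrier (self_module R) = carrier R" "add (self_module R) = add R" "zero (self_module R) = zero R"
  "mult (self_module R) = mult R" "one (self_module R) = one R" "smult (self_module R) = mult R"
  by (simp_all add: self_module_def)

text \<open>\<open>tensor_algebra\<close>, \<open>smash_product\<close>, \<open>finite_dual\<close>
  and \<open>restrict_hopf\<close> share their linear part with a plain module and differ from it
  only in the other fields, so their module axioms are obtained here.\<close>

lemma module_cong:
  assumes M: "module R M" and "carrier M' = carrier M" "add M' = add M" "zero M' = zero M" "smult M' = smult M"
  shows "module R M'"
proof -
  interpret M: module R M by fact
  have "abelian_group M'"
    by (rule abelian_groupI) (use M.a_ac M.l_neg in \<open>auto simp: assms(2-)\<close>)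
  then show ?thesis
    by (intro moduleI)
      (auto simp: assms(2-) M.is_cring M.smult_l_distr M.smult_r_distr M.smult_assoc1)
qed

lemma linear_maps_cong:
  assumes "carrier M' = carrier M" "add M' = add M" "smult M' = smult M"
    "carrier N' = carrier N" "add N' = add N" "smult N' = smult N"
  shows "linear_maps R M' N' = linear_maps R M N"
  using assms by (simp add: linear_maps_def)

context cring
begin

lemma self_module: "module R (self_module R)"
proof -
  have "abelian_group (self_module R)"
    by (rule abelian_groupI) (use a_ac l_neg in auto)
  then show ?thesis
    by (intro moduleI) (auto simp: is_cring l_distr r_distr m_assoc)
qed

lemma linear_maps_smult:
  assumes "module R N" "r \<in> carrier R" "f \<in> linear_maps R M N"
  shows "(\<lambda>x. r \<odot>\<^bsub>N\<^esub> f x) \<in> linear_maps R M N"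
proof -
  interpret N: module R N by fact
  note f = linear_mapsD[OF assms(3)]
  show ?thesis
  proof (rule linear_mapsI)
    fix s x assume s: "s \<in> carrier R" "x \<in> carrier M"
    then have "r \<odot>\<^bsub>N\<^esub> (s \<odot>\<^bsub>N\<^esub> f x) = (r \<otimes> s) \<odot>\<^bsub>N\<^esub> f x" using assms f by (simp add: N.smult_assoc1)
    also have "\<dots> = s \<odot>\<^bsub>N\<^esub> (r \<odot>\<^bsub>N\<^esub> f x)"
      using s assms(2) f by (subst m_comm) (auto simp add: N.smult_assoc1)
    finally show "r \<odot>\<^bsub>N\<^esub> f (s \<odot>\<^bsub>M\<^esub> x) = s \<odot>\<^bsub>N\<^esub> (r \<odot>\<^bsub>N\<^esub> f x)" using f s by simp
  qed (use assms f in \<open>auto simp: N.smult_r_distr\<close>)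
qed

lemma linear_maps_smult_left:
  assumes "module R N" "n \<in> carrier N" "f \<in> linear_maps R M (self_module R)"
  shows "(\<lambda>x. f x \<odot>\<^bsub>N\<^esub> n) \<in> linear_maps R M N"
proof -
  interpret N: module R N by fact
  show ?thesis
    by (rule linear_mapsI) (use assms linear_mapsD[OF assms(3)] in \<open>auto simp: N.smult_l_distr N.smult_assoc1\<close>)
qed

lemma linear_maps_add:
  assumes "module R N" "f \<in> linear_maps R M N" "g \<in> linear_maps R M N"
  shows "(\<lambda>x. f x \<oplus>\<^bsub>N\<^esub> g x) \<in> linear_maps R M N"
proof -
  interpret N: module R N by fact
  show ?thesis
    by (rule linear_mapsI)
      (use linear_mapsD[OF assms(2)] linear_mapsD[OF assms(3)] in \<open>auto simp: N.smult_r_distr N.a_ac\<close>)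
qed

section \<open>The universal property of the tensor product\<close>

text \<open>The formula inside \<open>tensor_lift\<close>, taken at a given element of the free
  module, so that it can be proved linear before any representative is chosen.\<close>

definition free_lift :: "('a, 'p, 'z) module_scheme \<Rightarrow> ('m \<Rightarrow> 'n \<Rightarrow> 'p) \<Rightarrow> ('m \<times> 'n \<Rightarrow> 'a) \<Rightarrow> 'p" where
  "free_lift P \<beta> f = (\<Oplus>\<^bsub>P\<^esub>p\<in>{p. f p \<noteq> \<zero>}. f p \<odot>\<^bsub>P\<^esub> \<beta> (fst p) (snd p))"

lemma free_moduleD:
  assumes "f \<in> carrier (free_module R I)"
  shows "f i \<in> carrier R" "finite {i. f i \<noteq> \<zero>}" "{i. f i \<noteq> \<zero>} \<subseteq> I"
proof -
  have *: "\<forall>i. f i \<in> carrier R" "\<forall>i. i \<notin> I \<longrightarrow> f i = \<zero>" "finite {i. f i \<noteq> \<zero>}"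
    using assms unfolding free_module_carrier by simp_all
  show "f i \<in> carrier R" using *(1) by (rule spec)
  show "finite {i. f i \<noteq> \<zero>}" by (rule *(3))
  show "{i. f i \<noteq> \<zero>} \<subseteq> I"
  proof
    fix i assume "i \<in> {i. f i \<noteq> \<zero>}"
    then show "i \<in> I" using *(2) by fast
  qed
qed

text \<open>\<open>free_lift\<close> sums over the support of its argument, which changes under
  addition and scaling. Additivity needs a common finite index set, and enlarging the support only
  adds zero terms.\<close>

lemma free_lift_superset:
  assumes P: "module R P" and \<beta>: "\<And>m n. (m, n) \<in> I \<Longrightarrow> \<beta> m n \<in> carrier P"
    and f: "f \<in> carrier (free_module R I)"
    and S: "finite S" "{p. f p \<noteq> \<zero>} \<subseteq> S" "S \<subseteq> I"
  shows "free_lift P \<beta> f = (\<Oplus>\<^bsub>P\<^esub>p\<in>S. f p \<odot>\<^bsub>P\<^esub> \<beta> (fst p) (snd p))"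
proof -
  interpret P: module R P by fact
  have f': "\<And>p. f p \<in> carrier R" using f by (auto simp: free_module_carrier)
  show ?thesis
    unfolding free_lift_def
  proof (rule P.add.finprod_mono_neutral_cong_left)
    fix i assume "i \<in> S - {p. f p \<noteq> \<zero>}"
    then have "f i = \<zero>" "\<beta> (fst i) (snd i) \<in> carrier P" using S(3) \<beta>[of "fst i" "snd i"] by auto
    then show "f i \<odot>\<^bsub>P\<^esub> \<beta> (fst i) (snd i) = \<zero>\<^bsub>P\<^esub>" by simp
  next
    show "(\<lambda>p. f p \<odot>\<^bsub>P\<^esub> \<beta> (fst p) (snd p)) \<in> S \<rightarrow> carrier P"
      using S \<beta> f' by force
  qed (use S in auto)
qed

lemma free_lift_linear:
  assumes P: "module R P" and \<beta>: "\<And>m n. (m, n) \<in> I \<Longrightarrow> \<beta> m n \<in> carrier P"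
  shows "free_lift P \<beta> \<in> linear_maps R (free_module R I) P"
proof -
  interpret P: module R P by fact
  have car: "f p \<in> carrier R" and fin: "finite {p. f p \<noteq> \<zero>}" and sub: "{p. f p \<noteq> \<zero>} \<subseteq> I"
    if "f \<in> carrier (free_module R I)" for f p
    using free_moduleD[OF that] by auto
  note sup = free_lift_superset[OF P \<beta>]
  have \<beta>': "\<beta> (fst p) (snd p) \<in> carrier P" if "p \<in> I" for p
    using \<beta>[of "fst p" "snd p"] that by simp
  have mem': "f p \<odot>\<^bsub>P\<^esub> \<beta> (fst p) (snd p) \<in> carrier P"
    if "f \<in> carrier (free_module R I)" "p \<in> I" for f p
    by (rule P.smult_closed[OF car[OF that(1)] \<beta>'[OF that(2)]])
  have mem: "(\<lambda>p. f p \<odot>\<^bsub>P\<^esub> \<beta> (fst p) (snd p)) \<in> S \<rightarrow> carrier P"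
    if "f \<in> carrier (free_module R I)" "S \<subseteq> I" for f S
    using mem'[OF that(1)] that(2) by (intro Pi_I) blast
  show ?thesis
  proof (rule linear_mapsI)
    fix f assume f: "f \<in> carrier (free_module R I)"
    show "free_lift P \<beta> f \<in> carrier P"
      unfolding free_lift_def by (rule P.finsum_closed[OF mem[OF f sub[OF f]]])
  next
    fix f g assume f: "f \<in> carrier (free_module R I)" and g: "g \<in> carrier (free_module R I)"
    let ?S = "{p. f p \<noteq> \<zero>} \<union> {p. g p \<noteq> \<zero>}"
    have S: "finite ?S" "?S \<subseteq> I" using fin sub f g by auto
    have fg: "(\<lambda>p. f p \<oplus> g p) \<in> carrier (free_module R I)"
      by (rule free_module_add_closed[OF f g])
    have "free_lift P \<beta> (\<lambda>p. f p \<oplus> g p) = (\<Oplus>\<^bsub>P\<^esub>p\<in>?S. (f p \<oplus> g p) \<odot>\<^bsub>P\<^esub> \<beta> (fst p) (snd p))"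
      by (rule sup[OF _ fg S(1) _ S(2)]) auto
    also have "\<dots> = (\<Oplus>\<^bsub>P\<^esub>p\<in>?S. f p \<odot>\<^bsub>P\<^esub> \<beta> (fst p) (snd p) \<oplus>\<^bsub>P\<^esub> g p \<odot>\<^bsub>P\<^esub> \<beta> (fst p) (snd p))"
    proof (rule P.finsum_cong')
      show "(\<lambda>p. f p \<odot>\<^bsub>P\<^esub> \<beta> (fst p) (snd p) \<oplus>\<^bsub>P\<^esub> g p \<odot>\<^bsub>P\<^esub> \<beta> (fst p) (snd p)) \<in> ?S \<rightarrow> carrier P"
        using mem'[OF f] mem'[OF g] S(2) by (intro Pi_I P.a_closed) blast+
      fix p assume "p \<in> ?S"
      then have "\<beta> (fst p) (snd p) \<in> carrier P" using \<beta>' S(2) by blast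
      then show "(f p \<oplus> g p) \<odot>\<^bsub>P\<^esub> \<beta> (fst p) (snd p) = f p \<odot>\<^bsub>P\<^esub> \<beta> (fst p) (snd p) \<oplus>\<^bsub>P\<^esub> g p \<odot>\<^bsub>P\<^esub> \<beta> (fst p) (snd p)"
        using car f g by (simp add: P.smult_l_distr)
    qed simp
    also have "\<dots> = (\<Oplus>\<^bsub>P\<^esub>p\<in>?S. f p \<odot>\<^bsub>P\<^esub> \<beta> (fst p) (snd p)) \<oplus>\<^bsub>P\<^esub> (\<Oplus>\<^bsub>P\<^esub>p\<in>?S. g p \<odot>\<^bsub>P\<^esub> \<beta> (fst p) (snd p))"
      by (rule P.finsum_addf[OF mem[OF f S(2)] mem[OF g S(2)]])
    also have "\<dots> = free_lift P \<beta> f \<oplus>\<^bsub>P\<^esub> free_lift P \<beta> g"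
      by (subst (1 2) sup[OF _ _ S(1) _ S(2)]) (use f g in auto)
    finally show "free_lift P \<beta> (f \<oplus>\<^bsub>free_module R I\<^esub> g) = free_lift P \<beta> f \<oplus>\<^bsub>P\<^esub> free_lift P \<beta> g" by simp
  next
    fix r f assume r: "r \<in> carrier R" and f: "f \<in> carrier (free_module R I)"
    let ?S = "{p. f p \<noteq> \<zero>}"
    note S = fin[OF f] sub[OF f]
    have rf: "(\<lambda>p. r \<otimes> f p) \<in> carrier (free_module R I)"
      by (rule free_module_smult_closed[OF f r])
    have "free_lift P \<beta> (\<lambda>p. r \<otimes> f p) = (\<Oplus>\<^bsub>P\<^esub>p\<in>?S. (r \<otimes> f p) \<odot>\<^bsub>P\<^esub> \<beta> (fst p) (snd p))"
      by (rule sup[OF _ rf S(1) _ S(2)]) (use r in auto)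
    also have "\<dots> = (\<Oplus>\<^bsub>P\<^esub>p\<in>?S. r \<odot>\<^bsub>P\<^esub> (f p \<odot>\<^bsub>P\<^esub> \<beta> (fst p) (snd p)))"
    proof (rule P.finsum_cong')
      show "(\<lambda>p. r \<odot>\<^bsub>P\<^esub> (f p \<odot>\<^bsub>P\<^esub> \<beta> (fst p) (snd p))) \<in> ?S \<rightarrow> carrier P"
        using mem'[OF f] r S(2) by (intro Pi_I P.smult_closed[OF r]) blast
      fix p assume "p \<in> ?S"
      then have "\<beta> (fst p) (snd p) \<in> carrier P" using \<beta>' S(2) by blast
      then show "(r \<otimes> f p) \<odot>\<^bsub>P\<^esub> \<beta> (fst p) (snd p) = r \<odot>\<^bsub>P\<^esub> (f p \<odot>\<^bsub>P\<^esub> \<beta> (fst p) (snd p))"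
        using car f r by (simp add: P.smult_assoc1)
    qed simp
    also have "\<dots> = r \<odot>\<^bsub>P\<^esub> (\<Oplus>\<^bsub>P\<^esub>p\<in>?S. f p \<odot>\<^bsub>P\<^esub> \<beta> (fst p) (snd p))"
      using P.finsum_smult_ldistr[OF S(1) r mem[OF f S(2)]] by simp
    finally show "free_lift P \<beta> (r \<odot>\<^bsub>free_module R I\<^esub> f) = r \<odot>\<^bsub>P\<^esub> free_lift P \<beta> f"
      by (simp add: free_lift_def)
  qed
qed

lemma free_lift_basis:
  assumes P: "module R P" and "\<beta> m n \<in> carrier P"
  shows "free_lift P \<beta> (free_basis R (m, n)) = \<beta> m n"
proof -
  interpret P: module R P by fact
  have "free_basis R (m, n) \<in> carrier (free_module R {(m, n)})"
    by (rule free_basis_closed) simp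
  moreover have "{p. free_basis R (m, n) p \<noteq> \<zero>} \<subseteq> {(m, n)}"
    by (auto simp: free_basis_def)
  ultimately show ?thesis
    using free_lift_superset[OF P, of "{(m, n)}" \<beta> "free_basis R (m, n)" "{(m, n)}"] assms(2)
    by (simp add: free_basis_def)
qed

lemma tensor_module_module:
  assumes "module R M" "module R N"
  shows "module R (tensor_module R M N)"
  unfolding tensor_module_def
  by (rule module.quotient_is_module[OF free_module_module tensor_relations_submodule[OF assms]])

text \<open>The elements killed by the lift form a submodule of the free module, and bilinearity of
  \<beta> puts the generating relations into it.\<close>

lemma free_lift_relations:
  assumes M: "module R M" and N: "module R N" and P: "module R P"
    and \<beta>: "\<beta> \<in> bilinear_maps R M N P" and f: "f \<in> tensor_relations R M N"
  shows "free_lift P \<beta> f = \<zero>\<^bsub>P\<^esub>"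
proof -
  interpret M: module R M by fact
  interpret N: module R N by fact
  interpret P: module R P by fact
  let ?F = "free_module R (carrier M \<times> carrier N)"
  interpret F: module R ?F by (rule free_module_module)
  let ?K = "{f \<in> carrier ?F. free_lift P \<beta> f = \<zero>\<^bsub>P\<^esub>}"
  have \<beta>': "\<beta> m n \<in> carrier P" if "(m, n) \<in> carrier M \<times> carrier N" for m n
    using that bilinear_mapsD(3)[OF \<beta>] by auto
  have lin: "free_lift P \<beta> \<in> linear_maps R ?F P" by (rule free_lift_linear[OF P \<beta>'])
  note L = linear_mapsD[OF lin, simplified]
  note D = free_submoduleD[OF F.carrier_is_submodule]
  have L0: "free_lift P \<beta> (\<lambda>i. \<zero>) = \<zero>\<^bsub>P\<^esub>"
    using linear_maps_zero[OF F.module_axioms P lin] by simp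
  have Lm: "free_lift P \<beta> (\<lambda>i. f i \<ominus> g i) = free_lift P \<beta> f \<ominus>\<^bsub>P\<^esub> free_lift P \<beta> g"
    if "f \<in> carrier ?F" "g \<in> carrier ?F" for f g
    using linear_maps_minus[OF F.module_axioms P lin that] free_module_minus[OF that] by simp
  have Lb: "free_lift P \<beta> (free_basis R (m, n)) = \<beta> m n" if "m \<in> carrier M" "n \<in> carrier N" for m n
    by (rule free_lift_basis[OF P]) (use that \<beta>' in auto)
  have b: "free_basis R (m, n) \<in> carrier ?F" if "m \<in> carrier M" "n \<in> carrier N" for m n
    by (rule free_basis_closed) (use that in auto)
  note add = D(3) and sm = D(4)
  have P0: "x \<ominus>\<^bsub>P\<^esub> x = \<zero>\<^bsub>P\<^esub>" if "x \<in> carrier P" for x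
    using that by (simp add: a_minus_def P.r_neg)
  note \<beta>s = linear_mapsD(2,3)[OF bilinear_mapsD(1)[OF \<beta>]] linear_mapsD(2,3)[OF bilinear_mapsD(2)[OF \<beta>]]
  have "submodule ?K R ?F"
  proof (rule free_submoduleI)
    show "(\<lambda>i. \<zero>) \<in> ?K" using L0 D(2) by simp
  qed (use D L in auto)
  moreover have "bil_gens R M N \<subseteq> ?K"
  proof
    fix f assume f: "f \<in> bil_gens R M N"
    have "f \<in> carrier ?F" using tensor_relations_eq(2)[OF M N] f by auto
    moreover have "free_lift P \<beta> f = \<zero>\<^bsub>P\<^esub>"
      using f unfolding bil_gens_def
      by (auto simp: Lm b add sm L Lb \<beta>s \<beta>' P0)
    ultimately show "f \<in> ?K" by simp
  qed
  ultimately have "tensor_relations R M N \<subseteq> ?K" by (rule tensor_relations_least[OF M N])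
  then show ?thesis using f by auto
qed

lemma tensor_module_carrier:
  assumes "module R M" "module R N"
  shows "carrier (tensor_module R M N) =
    (\<lambda>f. tensor_relations R M N +>\<^bsub>free_module R (carrier M \<times> carrier N)\<^esub> f) `
      carrier (free_module R (carrier M \<times> carrier N))"
  unfolding tensor_module_def
  by (rule module.quotient_simps(5)[OF free_module_module tensor_relations_submodule[OF assms]])

text \<open>The representative picked by \<open>SOME\<close> differs from \<open>f\<close> by a
  relation, and the lift kills relations. Everything later about \<open>tensor_lift\<close> rests on
  this independence.\<close>

lemma tensor_lift_coset:
  assumes M: "module R M" and N: "module R N" and P: "module R P"
    and \<beta>: "\<beta> \<in> bilinear_maps R M N P" and f: "f \<in> carrier (free_module R (carrier M \<times> carrier N))"
  shows "tensor_lift R P \<beta> (tensor_relations R M N +>\<^bsub>free_module R (carrier M \<times> carrier N)\<^esub> f) = free_lift P \<beta> f"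
proof -
  let ?F = "free_module R (carrier M \<times> carrier N)" and ?K = "tensor_relations R M N"
  interpret F: module R ?F by (rule free_module_module)
  interpret P: module R P by fact
  note K = tensor_relations_submodule[OF M N]
  interpret K: abelian_subgroup ?K ?F by (rule F.submodule_abelian_subgroup[OF K])
  have \<beta>': "\<beta> m n \<in> carrier P" if "(m, n) \<in> carrier M \<times> carrier N" for m n
    using that bilinear_mapsD(3)[OF \<beta>] by auto
  have lin: "free_lift P \<beta> \<in> linear_maps R ?F P" by (rule free_lift_linear[OF P \<beta>'])
  let ?t = "?K +>\<^bsub>?F\<^esub> f"
  define g where "g = (SOME g. g \<in> ?t)"
  have "g \<in> ?t" unfolding g_def by (rule someI[of "\<lambda>g. g \<in> ?t" f]) (rule K.a_rcos_self[OF f])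
  then obtain k where k: "k \<in> ?K" "g = k \<oplus>\<^bsub>?F\<^esub> f"
    by (auto simp: a_r_coset_def r_coset_def)
  have "free_lift P \<beta> g = free_lift P \<beta> k \<oplus>\<^bsub>P\<^esub> free_lift P \<beta> f"
    using linear_mapsD(2)[OF lin] k f K.a_subset by blast
  then have "free_lift P \<beta> g = free_lift P \<beta> f"
    using free_lift_relations[OF M N P \<beta> k(1)] linear_mapsD(1)[OF lin f] by simp
  then show ?thesis by (simp add: tensor_lift_def free_lift_def g_def)
qed

lemma tensor_lift_linear:
  assumes M: "module R M" and N: "module R N" and P: "module R P"
    and \<beta>: "\<beta> \<in> bilinear_maps R M N P"
  shows "tensor_lift R P \<beta> \<in> linear_maps R (tensor_module R M N) P"
proof -
  let ?F = "free_module R (carrier M \<times> carrier N)" and ?K = "tensor_relations R M N"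
  interpret F: module R ?F by (rule free_module_module)
  note K = tensor_relations_submodule[OF M N]
  note q = F.quotient_simps[OF K]
  note c = tensor_lift_coset[OF M N P \<beta>]
  have \<beta>': "\<beta> m n \<in> carrier P" if "(m, n) \<in> carrier M \<times> carrier N" for m n
    using that bilinear_mapsD(3)[OF \<beta>] by auto
  have lin: "free_lift P \<beta> \<in> linear_maps R ?F P" by (rule free_lift_linear[OF P \<beta>'])
  note L = linear_mapsD[OF lin]
  have ex: "\<exists>f\<in>carrier ?F. t = ?K +>\<^bsub>?F\<^esub> f" if "t \<in> carrier (quotient_module R ?F ?K)" for t
    using that unfolding q(5) by blast
  show ?thesis
    unfolding tensor_module_def
  proof (rule linear_mapsI)
    fix s assume "s \<in> carrier (quotient_module R ?F ?K)"
    then obtain f where f: "f \<in> carrier ?F" "s = ?K +>\<^bsub>?F\<^esub> f" using ex by blast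
    show "tensor_lift R P \<beta> s \<in> carrier P"
      unfolding f(2) c[OF f(1)] by (rule L(1)[OF f(1)])
    show "tensor_lift R P \<beta> (r \<odot>\<^bsub>quotient_module R ?F ?K\<^esub> s) = r \<odot>\<^bsub>P\<^esub> tensor_lift R P \<beta> s"
      if r: "r \<in> carrier R" for r
      unfolding f(2) q(4)[OF r f(1)] c[OF f(1)] c[OF F.smult_closed[OF r f(1)]] by (rule L(3)[OF r f(1)])
    fix t assume "t \<in> carrier (quotient_module R ?F ?K)"
    then obtain g where g: "g \<in> carrier ?F" "t = ?K +>\<^bsub>?F\<^esub> g" using ex by blast
    show "tensor_lift R P \<beta> (s \<oplus>\<^bsub>quotient_module R ?F ?K\<^esub> t) = tensor_lift R P \<beta> s \<oplus>\<^bsub>P\<^esub> tensor_lift R P \<beta> t"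
      unfolding f(2) g(2) q(3)[OF f(1) g(1)] c[OF f(1)] c[OF g(1)] c[OF F.a_closed[OF f(1) g(1)]]
      by (rule L(2)[OF f(1) g(1)])
  qed
qed

lemma tensor_lift_tensor:
  assumes M: "module R M" and N: "module R N" and P: "module R P"
    and \<beta>: "\<beta> \<in> bilinear_maps R M N P" and mn: "m \<in> carrier M" "n \<in> carrier N"
  shows "tensor_lift R P \<beta> (tensor R M N m n) = \<beta> m n"
proof -
  have "free_basis R (m, n) \<in> carrier (free_module R (carrier M \<times> carrier N))"
    by (rule free_basis_closed) (use mn in auto)
  from tensor_lift_coset[OF M N P \<beta> this] show ?thesis
    unfolding tensor_def
    by (rule trans) (rule free_lift_basis[where \<beta> = \<beta>, OF P bilinear_mapsD(3)[OF \<beta> mn]])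
qed

lemma tensor_bilinear:
  assumes M: "module R M" and N: "module R N"
  shows "tensor R M N \<in> bilinear_maps R M N (tensor_module R M N)"
proof -
  let ?F = "free_module R (carrier M \<times> carrier N)" and ?K = "tensor_relations R M N"
  interpret M: module R M by fact
  interpret N: module R N by fact
  interpret F: module R ?F by (rule free_module_module)
  note K = tensor_relations_submodule[OF M N]
  note q = F.quotient_simps[OF K]
  note gens = subsetD[OF tensor_relations_gens[OF M N]]
  have b: "free_basis R (m, n) \<in> carrier ?F" if "m \<in> carrier M" "n \<in> carrier N" for m n
    by (rule free_basis_closed) (use that in auto)
  have eq: "?K +>\<^bsub>?F\<^esub> f = ?K +>\<^bsub>?F\<^esub> g"
    if "(\<lambda>p. f p \<ominus> g p) \<in> bil_gens R M N" "f \<in> carrier ?F" "g \<in> carrier ?F" for f g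
    using F.quotient_eq_iff[OF K that(2,3)] free_module_minus[OF that(2,3)] gens[OF that(1)] by simp
  have sb: "r \<odot>\<^bsub>?F\<^esub> free_basis R (m, n) \<in> carrier ?F" if "m \<in> carrier M" "n \<in> carrier N" "r \<in> carrier R" for m n r
    using b that by (intro F.smult_closed)
  have ab: "free_basis R (m, n) \<oplus>\<^bsub>?F\<^esub> free_basis R (m', n') \<in> carrier ?F"
    if "m \<in> carrier M" "n \<in> carrier N" "m' \<in> carrier M" "n' \<in> carrier N" for m n m' n'
    using b that by (intro F.a_closed)
  show ?thesis
    unfolding tensor_module_def tensor_def
  proof (intro bilinear_mapsI linear_mapsI)
    fix m n n' assume mn: "m \<in> carrier M" "n \<in> carrier N" "n' \<in> carrier N"
    show "?K +>\<^bsub>?F\<^esub> free_basis R (m, n \<oplus>\<^bsub>N\<^esub> n') =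
      (?K +>\<^bsub>?F\<^esub> free_basis R (m, n)) \<oplus>\<^bsub>quotient_module R ?F ?K\<^esub> (?K +>\<^bsub>?F\<^esub> free_basis R (m, n'))"
      unfolding q(3)[OF b[OF mn(1,2)] b[OF mn(1,3)]]
      using eq[OF _ b[OF mn(1) N.a_closed[OF mn(2,3)]] ab[OF mn(1,2) mn(1,3)]] bil_gensI(2)[OF mn] by simp
  next
    fix m m' n assume mn: "m \<in> carrier M" "m' \<in> carrier M" "n \<in> carrier N"
    show "?K +>\<^bsub>?F\<^esub> free_basis R (m \<oplus>\<^bsub>M\<^esub> m', n) =
      (?K +>\<^bsub>?F\<^esub> free_basis R (m, n)) \<oplus>\<^bsub>quotient_module R ?F ?K\<^esub> (?K +>\<^bsub>?F\<^esub> free_basis R (m', n))"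
      unfolding q(3)[OF b[OF mn(1,3)] b[OF mn(2,3)]]
      using eq[OF _ b[OF M.a_closed[OF mn(1,2)] mn(3)] ab[OF mn(1,3) mn(2,3)]] bil_gensI(1)[OF mn] by simp
  next
    fix m r n assume mn: "r \<in> carrier R" "m \<in> carrier M" "n \<in> carrier N"
    show "?K +>\<^bsub>?F\<^esub> free_basis R (m, r \<odot>\<^bsub>N\<^esub> n) =
      r \<odot>\<^bsub>quotient_module R ?F ?K\<^esub> (?K +>\<^bsub>?F\<^esub> free_basis R (m, n))"
      unfolding q(4)[OF mn(1) b[OF mn(2,3)]]
      using eq[OF _ b[OF mn(2) N.smult_closed[OF mn(1,3)]] sb[OF mn(2,3,1)]] bil_gensI(4)[OF mn] by simp
    show "?K +>\<^bsub>?F\<^esub> free_basis R (r \<odot>\<^bsub>M\<^esub> m, n) =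
      r \<odot>\<^bsub>quotient_module R ?F ?K\<^esub> (?K +>\<^bsub>?F\<^esub> free_basis R (m, n))"
      unfolding q(4)[OF mn(1) b[OF mn(2,3)]]
      using eq[OF _ b[OF M.smult_closed[OF mn(1,2)] mn(3)] sb[OF mn(2,3,1)]] bil_gensI(3)[OF mn] by simp
  qed (rule q(2)[OF b]; assumption)+
qed

lemma tensor_closed:
  assumes "module R M" "module R N" "m \<in> carrier M" "n \<in> carrier N"
  shows "tensor R M N m n \<in> carrier (tensor_module R M N)"
  using bilinear_mapsD(3)[OF tensor_bilinear[OF assms(1,2)]] assms by blast

text \<open>The coefficients are moved into the left factor, so that an element becomes a sum of
  pure tensors without scalars; hence \<open>tensor_induct\<close> has no case for scalar
  multiples.\<close>

lemma tensor_expand: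
  assumes M: "module R M" and N: "module R N" and t: "t \<in> carrier (tensor_module R M N)"
  obtains S c where "finite S" "S \<subseteq> carrier M \<times> carrier N" "c \<in> S \<rightarrow> carrier R"
    "t = (\<Oplus>\<^bsub>tensor_module R M N\<^esub>p\<in>S. tensor R M N (c p \<odot>\<^bsub>M\<^esub> fst p) (snd p))"
proof -
  let ?F = "free_module R (carrier M \<times> carrier N)" and ?K = "tensor_relations R M N"
  interpret F: module R ?F by (rule free_module_module)
  interpret M: module R M by fact
  interpret T: module R "tensor_module R M N" by (rule tensor_module_module[OF M N])
  note K = tensor_relations_submodule[OF M N]
  note q = F.quotient_simps[OF K]
  obtain f where f: "f \<in> carrier ?F" "t = ?K +>\<^bsub>?F\<^esub> f"
    using t tensor_module_carrier[OF M N] by auto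
  let ?S = "{p. f p \<noteq> \<zero>}"
  have S: "finite ?S" "?S \<subseteq> carrier M \<times> carrier N" "f \<in> ?S \<rightarrow> carrier R"
    using free_moduleD[OF f(1)] by simp_all
  have b: "free_basis R p \<in> carrier ?F" "f p \<odot>\<^bsub>?F\<^esub> free_basis R p \<in> carrier ?F" if "p \<in> ?S" for p
  proof -
    show 1: "free_basis R p \<in> carrier ?F" by (rule free_basis_closed) (use S(2) that in blast)
    have "f p \<in> carrier R" by (rule funcset_mem[OF S(3) that])
    then show "f p \<odot>\<^bsub>?F\<^esub> free_basis R p \<in> carrier ?F" by (rule F.smult_closed[OF _ 1])
  qed
  have "t = ?K +>\<^bsub>?F\<^esub> (\<Oplus>\<^bsub>?F\<^esub>p\<in>?S. f p \<odot>\<^bsub>?F\<^esub> free_basis R p)"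
    by (simp only: f free_module_expand[OF f(1)])
  also have "\<dots> = (\<Oplus>\<^bsub>tensor_module R M N\<^esub>p\<in>?S. ?K +>\<^bsub>?F\<^esub> (f p \<odot>\<^bsub>?F\<^esub> free_basis R p))"
    unfolding tensor_module_def
    by (rule F.quotient_finsum[OF K S(1), symmetric]) (rule Pi_I[OF b(2)])
  also have "\<dots> = (\<Oplus>\<^bsub>tensor_module R M N\<^esub>p\<in>?S. tensor R M N (f p \<odot>\<^bsub>M\<^esub> fst p) (snd p))"
  proof (rule T.finsum_cong')
    have p: "f p \<in> carrier R" "fst p \<in> carrier M" "snd p \<in> carrier N" if "p \<in> ?S" for p
      using funcset_mem[OF S(3) that] subsetD[OF S(2) that] by (simp_all add: mem_Times_iff)
    show "(\<lambda>p. tensor R M N (f p \<odot>\<^bsub>M\<^esub> fst p) (snd p)) \<in> ?S \<rightarrow> carrier (tensor_module R M N)"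
      by (rule Pi_I) (intro tensor_closed[OF M N] M.smult_closed p)
    fix p assume pS: "p \<in> ?S"
    have "?K +>\<^bsub>?F\<^esub> (f p \<odot>\<^bsub>?F\<^esub> free_basis R p) = f p \<odot>\<^bsub>tensor_module R M N\<^esub> tensor R M N (fst p) (snd p)"
      using q(4)[OF p(1)[OF pS] b(1)[OF pS]] by (simp add: tensor_module_def tensor_def)
    then show "?K +>\<^bsub>?F\<^esub> (f p \<odot>\<^bsub>?F\<^esub> free_basis R p) = tensor R M N (f p \<odot>\<^bsub>M\<^esub> fst p) (snd p)"
      using linear_mapsD(3)[OF bilinear_mapsD(2)[OF tensor_bilinear[OF M N]]] p[OF pS] by simp
  qed simp
  finally show thesis using that[OF S] by simp
qed

lemma tensor_induct [consumes 3, case_names zero tensor add]: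
  assumes M: "module R M" and N: "module R N" and t: "t \<in> carrier (tensor_module R M N)"
    and zero: "Q \<zero>\<^bsub>tensor_module R M N\<^esub>"
    and tensor: "\<And>m n. m \<in> carrier M \<Longrightarrow> n \<in> carrier N \<Longrightarrow> Q (tensor R M N m n)"
    and add: "\<And>s t. s \<in> carrier (tensor_module R M N) \<Longrightarrow> t \<in> carrier (tensor_module R M N) \<Longrightarrow>
      Q s \<Longrightarrow> Q t \<Longrightarrow> Q (s \<oplus>\<^bsub>tensor_module R M N\<^esub> t)"
  shows "Q t"
proof -
  interpret M: module R M by fact
  interpret T: module R "tensor_module R M N" by (rule tensor_module_module[OF M N])
  obtain S c where S: "finite S" "S \<subseteq> carrier M \<times> carrier N" "c \<in> S \<rightarrow> carrier R"
    "t = (\<Oplus>\<^bsub>tensor_module R M N\<^esub>p\<in>S. tensor R M N (c p \<odot>\<^bsub>M\<^esub> fst p) (snd p))"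
    using tensor_expand[OF M N t] .
  have "Q (\<Oplus>\<^bsub>tensor_module R M N\<^esub>p\<in>S. tensor R M N (c p \<odot>\<^bsub>M\<^esub> fst p) (snd p))"
    using S(1-3)
  proof (induction S)
    case empty
    then show ?case using zero by simp
  next
    case (insert p S)
    have mem: "c q \<odot>\<^bsub>M\<^esub> fst q \<in> carrier M" "snd q \<in> carrier N" if "q \<in> insert p S" for q
    proof -
      have "c q \<in> carrier R" "q \<in> carrier M \<times> carrier N"
        using funcset_mem[OF insert.prems(2) that] subsetD[OF insert.prems(1) that] .
      then show "c q \<odot>\<^bsub>M\<^esub> fst q \<in> carrier M" "snd q \<in> carrier N" by (simp_all add: mem_Times_iff)
    qed
    note cl = tensor_closed[OF M N mem]
    have "(\<Oplus>\<^bsub>tensor_module R M N\<^esub>q\<in>insert p S. tensor R M N (c q \<odot>\<^bsub>M\<^esub> fst q) (snd q)) =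
      tensor R M N (c p \<odot>\<^bsub>M\<^esub> fst p) (snd p) \<oplus>\<^bsub>tensor_module R M N\<^esub>
      (\<Oplus>\<^bsub>tensor_module R M N\<^esub>q\<in>S. tensor R M N (c q \<odot>\<^bsub>M\<^esub> fst q) (snd q))"
      by (rule T.finsum_insert[OF insert.hyps]) (simp_all add: cl)
    moreover have "Q \<dots>"
    proof (rule add)
      show "Q (\<Oplus>\<^bsub>tensor_module R M N\<^esub>q\<in>S. tensor R M N (c q \<odot>\<^bsub>M\<^esub> fst q) (snd q))"
        using insert.IH insert.prems by auto
      show "(\<Oplus>\<^bsub>tensor_module R M N\<^esub>q\<in>S. tensor R M N (c q \<odot>\<^bsub>M\<^esub> fst q) (snd q)) \<in> carrier (tensor_module R M N)"
        by (rule T.finsum_closed) (simp add: cl)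
    qed (simp_all add: mem cl tensor)
    ultimately show ?case by simp
  qed
  then show ?thesis using S(4) by simp
qed

lemma tensor_ext:
  assumes M: "module R M" and N: "module R N" and P: "module R P"
    and f: "f \<in> linear_maps R (tensor_module R M N) P" and g: "g \<in> linear_maps R (tensor_module R M N) P"
    and eq: "\<And>m n. m \<in> carrier M \<Longrightarrow> n \<in> carrier N \<Longrightarrow> f (tensor R M N m n) = g (tensor R M N m n)"
    and t: "t \<in> carrier (tensor_module R M N)"
  shows "f t = g t"
  using M N t
proof (induction t rule: tensor_induct)
  case zero
  then show ?case
    using linear_maps_zero[OF tensor_module_module[OF M N] P f]
      linear_maps_zero[OF tensor_module_module[OF M N] P g] by simp
next
  case (tensor m n)
  then show ?case by (rule eq)
next
  case (add s t)
  then show ?case using linear_mapsD(2)[OF f] linear_mapsD(2)[OF g] by simp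
qed

text \<open>\<gamma> is bilinear because it agrees with \<beta> on the carriers, so bilinearity has
  to be proved for one of the two integrands only. This is the rule for rewriting inside a Sweedler
  sum.\<close>

lemma tensor_lift_cong:
  assumes M: "module R M" and N: "module R N" and P: "module R P"
    and \<beta>: "\<beta> \<in> bilinear_maps R M N P"
    and eq: "\<And>m n. m \<in> carrier M \<Longrightarrow> n \<in> carrier N \<Longrightarrow> \<beta> m n = \<gamma> m n"
    and t: "t \<in> carrier (tensor_module R M N)"
  shows "tensor_lift R P \<beta> t = tensor_lift R P \<gamma> t"
proof -
  have \<gamma>: "\<gamma> \<in> bilinear_maps R M N P"
  proof (rule bilinear_mapsI)
    show "\<gamma> m \<in> linear_maps R N P" if "m \<in> carrier M" for m
      by (rule linear_maps_eqI[OF N bilinear_mapsD(1)[OF \<beta> that]]) (rule eq[OF that])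
    show "(\<lambda>m. \<gamma> m n) \<in> linear_maps R M P" if "n \<in> carrier N" for n
      by (rule linear_maps_eqI[OF M bilinear_mapsD(2)[OF \<beta> that]]) (rule eq[OF _ that])
  qed
  show ?thesis
  proof (rule tensor_ext[OF M N P tensor_lift_linear[OF M N P \<beta>] tensor_lift_linear[OF M N P \<gamma>] _ t])
    fix m n assume "m \<in> carrier M" "n \<in> carrier N"
    then show "tensor_lift R P \<beta> (tensor R M N m n) = tensor_lift R P \<gamma> (tensor R M N m n)"
      using tensor_lift_tensor[OF M N P \<beta>] tensor_lift_tensor[OF M N P \<gamma>] eq by simp
  qed
qed

lemma linear_maps_tensor_lift:
  assumes M: "module R M" and N: "module R N" and P: "module R P" and Q: "module R Q"
    and \<beta>: "\<beta> \<in> bilinear_maps R M N P" and \<phi>: "\<phi> \<in> linear_maps R P Q"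
    and t: "t \<in> carrier (tensor_module R M N)"
  shows "\<phi> (tensor_lift R P \<beta> t) = tensor_lift R Q (\<lambda>m n. \<phi> (\<beta> m n)) t"
proof -
  have b: "(\<lambda>m n. \<phi> (\<beta> m n)) \<in> bilinear_maps R M N Q"
    by (rule bilinear_mapsI; rule linear_maps_comp[OF \<phi>]) (use bilinear_mapsD[OF \<beta>] in auto)
  show ?thesis
    by (rule tensor_ext[OF M N Q linear_maps_comp[OF \<phi> tensor_lift_linear[OF M N P \<beta>]]
        tensor_lift_linear[OF M N Q b] _ t])
      (simp add: tensor_lift_tensor[OF M N P \<beta>] tensor_lift_tensor[OF M N Q b])
qed

text \<open>Here the tensor stays fixed and the integrand varies, as in nested Sweedler sums, where
  the inner integrand depends on the outer variables. By \<open>tensor_ext\<close> the linearity in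
  the parameter can be checked on pure tensors.\<close>

lemma tensor_lift_linear_param:
  assumes L: "module R L" and M: "module R M" and N: "module R N" and P: "module R P"
    and \<beta>: "\<And>x. x \<in> carrier L \<Longrightarrow> \<beta> x \<in> bilinear_maps R M N P"
    and lin: "\<And>m n. m \<in> carrier M \<Longrightarrow> n \<in> carrier N \<Longrightarrow> (\<lambda>x. \<beta> x m n) \<in> linear_maps R L P"
    and t: "t \<in> carrier (tensor_module R M N)"
  shows "(\<lambda>x. tensor_lift R P (\<beta> x) t) \<in> linear_maps R L P"
proof -
  interpret L: module R L by fact
  interpret P: module R P by fact
  note lift = tensor_lift_linear[OF M N P \<beta>]
  show ?thesis
  proof (rule linear_mapsI)
    fix x assume x: "x \<in> carrier L"
    show "tensor_lift R P (\<beta> x) t \<in> carrier P"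
      using linear_mapsD(1)[OF lift[OF x] t] .
  next
    fix x y assume xy: "x \<in> carrier L" "y \<in> carrier L"
    have xy': "x \<oplus>\<^bsub>L\<^esub> y \<in> carrier L" using xy by simp
    show "tensor_lift R P (\<beta> (x \<oplus>\<^bsub>L\<^esub> y)) t = tensor_lift R P (\<beta> x) t \<oplus>\<^bsub>P\<^esub> tensor_lift R P (\<beta> y) t"
    proof (rule tensor_ext[OF M N P lift[OF xy'] linear_maps_add[OF P lift[OF xy(1)] lift[OF xy(2)]] _ t])
      fix m n assume mn: "m \<in> carrier M" "n \<in> carrier N"
      show "tensor_lift R P (\<beta> (x \<oplus>\<^bsub>L\<^esub> y)) (tensor R M N m n) =
        tensor_lift R P (\<beta> x) (tensor R M N m n) \<oplus>\<^bsub>P\<^esub> tensor_lift R P (\<beta> y) (tensor R M N m n)"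
        unfolding tensor_lift_tensor[OF M N P \<beta>[OF xy'] mn] tensor_lift_tensor[OF M N P \<beta>[OF xy(1)] mn]
          tensor_lift_tensor[OF M N P \<beta>[OF xy(2)] mn]
        by (rule linear_mapsD(2)[OF lin[OF mn] xy])
    qed
  next
    fix r x assume x: "r \<in> carrier R" "x \<in> carrier L"
    have x': "r \<odot>\<^bsub>L\<^esub> x \<in> carrier L" using x by simp
    show "tensor_lift R P (\<beta> (r \<odot>\<^bsub>L\<^esub> x)) t = r \<odot>\<^bsub>P\<^esub> tensor_lift R P (\<beta> x) t"
    proof (rule tensor_ext[OF M N P lift[OF x'] linear_maps_smult[OF P x(1) lift[OF x(2)]] _ t])
      fix m n assume mn: "m \<in> carrier M" "n \<in> carrier N"
      show "tensor_lift R P (\<beta> (r \<odot>\<^bsub>L\<^esub> x)) (tensor R M N m n) =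
        r \<odot>\<^bsub>P\<^esub> tensor_lift R P (\<beta> x) (tensor R M N m n)"
        unfolding tensor_lift_tensor[OF M N P \<beta>[OF x'] mn] tensor_lift_tensor[OF M N P \<beta>[OF x(2)] mn]
        by (rule linear_mapsD(3)[OF lin[OF mn] x])
    qed
  qed
qed

text \<open>The exchange of two independent Sweedler sums. For fixed \<open>s\<close> both sides are
  linear in \<open>t\<close>, so \<open>t\<close> may be taken to be a pure tensor, where the sum
  over \<open>t\<close> collapses to a single term.\<close>

lemma tensor_lift_swap:
  assumes M: "module R M" and N: "module R N" and M': "module R M'" and N': "module R N'" and P: "module R P"
    and \<mu>1: "\<And>a b. a \<in> carrier M \<Longrightarrow> b \<in> carrier N \<Longrightarrow> \<mu> a b \<in> bilinear_maps R M' N' P"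
    and \<mu>2: "\<And>c d. c \<in> carrier M' \<Longrightarrow> d \<in> carrier N' \<Longrightarrow> (\<lambda>a b. \<mu> a b c d) \<in> bilinear_maps R M N P"
    and s: "s \<in> carrier (tensor_module R M N)" and t: "t \<in> carrier (tensor_module R M' N')"
  shows "tensor_lift R P (\<lambda>a b. tensor_lift R P (\<mu> a b) t) s =
    tensor_lift R P (\<lambda>c d. tensor_lift R P (\<lambda>a b. \<mu> a b c d) s) t"
proof -
  have 1: "(\<lambda>a b. tensor_lift R P (\<mu> a b) u) \<in> bilinear_maps R M N P"
    if u: "u \<in> carrier (tensor_module R M' N')" for u
    by (intro bilinear_mapsI tensor_lift_linear_param[OF _ M' N' P] M N u \<mu>1
        bilinear_mapsD(1,2)[OF \<mu>2]; assumption)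
  have 2: "(\<lambda>c d. tensor_lift R P (\<lambda>a b. \<mu> a b c d) s) \<in> bilinear_maps R M' N' P"
    by (intro bilinear_mapsI tensor_lift_linear_param[OF _ M N P] M' N' s \<mu>2
        bilinear_mapsD(1,2)[OF \<mu>1]; assumption)
  have T': "module R (tensor_module R M' N')" by (rule tensor_module_module[OF M' N'])
  have 3: "(\<lambda>u. tensor_lift R P (\<lambda>a b. tensor_lift R P (\<mu> a b) u) s) \<in> linear_maps R (tensor_module R M' N') P"
    by (intro tensor_lift_linear_param[OF T' M N P] 1 s tensor_lift_linear[OF M' N' P \<mu>1])
  show ?thesis
  proof (rule tensor_ext[OF M' N' P 3 tensor_lift_linear[OF M' N' P 2] _ t])
    fix c d assume cd: "c \<in> carrier M'" "d \<in> carrier N'"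
    show "tensor_lift R P (\<lambda>a b. tensor_lift R P (\<mu> a b) (tensor R M' N' c d)) s =
      tensor_lift R P (\<lambda>c d. tensor_lift R P (\<lambda>a b. \<mu> a b c d) s) (tensor R M' N' c d)"
      unfolding tensor_lift_tensor[OF M' N' P 2 cd]
      by (rule tensor_lift_cong[OF M N P 1[OF tensor_closed[OF M' N' cd]] _ s])
        (rule tensor_lift_tensor[OF M' N' P \<mu>1 cd])
  qed
qed

end

section \<open>Finitely generated modules over noetherian rings\<close>

context module
begin

lemma submodule_props:
  assumes "submodule N R M"
  shows "N \<subseteq> carrier M" "\<zero>\<^bsub>M\<^esub> \<in> N"
    and "\<And>x y. x \<in> N \<Longrightarrow> y \<in> N \<Longrightarrow> x \<oplus>\<^bsub>M\<^esub> y \<in> N"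
    and "\<And>r x. r \<in> carrier R \<Longrightarrow> x \<in> N \<Longrightarrow> r \<odot>\<^bsub>M\<^esub> x \<in> N"
    and "\<And>x y. x \<in> N \<Longrightarrow> y \<in> N \<Longrightarrow> x \<ominus>\<^bsub>M\<^esub> y \<in> N"
proof -
  note E = submoduleE[OF assms]
  show "N \<subseteq> carrier M" by (rule E(1))
  show "\<zero>\<^bsub>M\<^esub> \<in> N" using subgroup.one_closed[OF submodule.axioms(1)[OF assms]] by simp
  show "\<And>x y. x \<in> N \<Longrightarrow> y \<in> N \<Longrightarrow> x \<oplus>\<^bsub>M\<^esub> y \<in> N" by (rule E(5))
  show "\<And>r x. r \<in> carrier R \<Longrightarrow> x \<in> N \<Longrightarrow> r \<odot>\<^bsub>M\<^esub> x \<in> N" by (rule E(4))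
  show "\<And>x y. x \<in> N \<Longrightarrow> y \<in> N \<Longrightarrow> x \<ominus>\<^bsub>M\<^esub> y \<in> N"
    unfolding a_minus_def by (rule E(5)[OF _ E(3)])
qed

lemma submoduleI':
  assumes "N \<subseteq> carrier M" "\<zero>\<^bsub>M\<^esub> \<in> N"
    and "\<And>x y. x \<in> N \<Longrightarrow> y \<in> N \<Longrightarrow> x \<oplus>\<^bsub>M\<^esub> y \<in> N"
    and sm: "\<And>r x. r \<in> carrier R \<Longrightarrow> x \<in> N \<Longrightarrow> r \<odot>\<^bsub>M\<^esub> x \<in> N"
  shows "submodule N R M"
proof (rule submoduleI)
  fix x assume x: "x \<in> N"
  then have "x \<in> carrier M" using assms(1) by auto
  then have "\<ominus>\<^bsub>M\<^esub> x = (\<ominus> \<one>) \<odot>\<^bsub>M\<^esub> x" by (simp add: smult_l_minus)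
  then show "\<ominus>\<^bsub>M\<^esub> x \<in> N" using sm[of "\<ominus> \<one>" x] x by simp
qed (use assms in auto)

lemma submodule_Int:
  assumes "submodule N R M" "submodule N' R M"
  shows "submodule (N \<inter> N') R M"
  by (rule submoduleI') (use submodule_props[OF assms(1)] submodule_props[OF assms(2)] in auto)

lemma submodule_vimage:
  assumes N: "module R N" and f: "f \<in> linear_maps R N M" and K: "submodule K R M"
  shows "submodule {x \<in> carrier N. f x \<in> K} R N"
proof -
  interpret N: module R N by fact
  note f' = linear_mapsD[OF f] and K' = submodule_props[OF K]
  have "f \<zero>\<^bsub>N\<^esub> \<in> K" using linear_maps_zero[OF N module_axioms f] K'(2) by simp
  then show ?thesis by (intro N.submoduleI') (simp_all add: f' K' subset_iff)
qed

lemma submodule_image: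
  assumes N: "module R N" and f: "f \<in> linear_maps R N M" and K: "submodule K R N"
  shows "submodule (f ` K) R M"
proof -
  interpret N: module R N by fact
  note f' = linear_mapsD[OF f] and K' = N.submodule_props[OF K]
  show ?thesis
  proof (rule submoduleI')
    show "f ` K \<subseteq> carrier M" using f'(1) K'(1) by auto
    show "\<zero>\<^bsub>M\<^esub> \<in> f ` K" using linear_maps_zero[OF N module_axioms f] imageI[OF K'(2), of f] by simp
  next
    fix x y assume "x \<in> f ` K" "y \<in> f ` K"
    then obtain a b where ab: "a \<in> K" "b \<in> K" "x = f a" "y = f b" by auto
    then have "x \<oplus>\<^bsub>M\<^esub> y = f (a \<oplus>\<^bsub>N\<^esub> b)" using f'(2)[of a b] K'(1) by (simp add: subset_iff)
    then show "x \<oplus>\<^bsub>M\<^esub> y \<in> f ` K" using K'(3) ab by auto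
  next
    fix r x assume r: "r \<in> carrier R" and "x \<in> f ` K"
    then obtain a where a: "a \<in> K" "x = f a" by auto
    then have "r \<odot>\<^bsub>M\<^esub> x = f (r \<odot>\<^bsub>N\<^esub> a)" using f'(3)[of r a] K'(1) r by (simp add: subset_iff)
    then show "r \<odot>\<^bsub>M\<^esub> x \<in> f ` K" using K'(4) a r by auto
  qed
qed

lemma submodule_span_empty: "submodule_span R M {} = {\<zero>\<^bsub>M\<^esub>}"
proof
  have "submodule {\<zero>\<^bsub>M\<^esub>} R M" by (rule submoduleI') auto
  then show "submodule_span R M {} \<subseteq> {\<zero>\<^bsub>M\<^esub>}" by (rule submodule_span_sub) simp
  show "{\<zero>\<^bsub>M\<^esub>} \<subseteq> submodule_span R M {}"
    using submodule_props(2)[OF submodule_span_is_submodule[of "{}"]] by simp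
qed

lemma submodule_span_mono: "S \<subseteq> T \<Longrightarrow> submodule_span R M S \<subseteq> submodule_span R M T"
  by (auto simp: submodule_span_def)

lemma submodule_sum:
  assumes "submodule N R M" "submodule N' R M"
  shows "submodule {x \<oplus>\<^bsub>M\<^esub> y |x y. x \<in> N \<and> y \<in> N'} R M"
proof -
  note D = submodule_props[OF assms(1)] and D' = submodule_props[OF assms(2)]
  show ?thesis
  proof (rule submoduleI')
    show "{x \<oplus>\<^bsub>M\<^esub> y |x y. x \<in> N \<and> y \<in> N'} \<subseteq> carrier M" using D(1) D'(1) by auto
    show "\<zero>\<^bsub>M\<^esub> \<in> {x \<oplus>\<^bsub>M\<^esub> y |x y. x \<in> N \<and> y \<in> N'}"
      using D(2) D'(2) by (intro CollectI exI[of _ "\<zero>\<^bsub>M\<^esub>"]) simp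
  next
    fix u v assume "u \<in> {x \<oplus>\<^bsub>M\<^esub> y |x y. x \<in> N \<and> y \<in> N'}" "v \<in> {x \<oplus>\<^bsub>M\<^esub> y |x y. x \<in> N \<and> y \<in> N'}"
    then obtain a b c d where abcd: "a \<in> N" "b \<in> N'" "c \<in> N" "d \<in> N'" "u = a \<oplus>\<^bsub>M\<^esub> b" "v = c \<oplus>\<^bsub>M\<^esub> d" by blast
    then have "a \<in> carrier M" "b \<in> carrier M" "c \<in> carrier M" "d \<in> carrier M" using D(1) D'(1) by auto
    then have "u \<oplus>\<^bsub>M\<^esub> v = (a \<oplus>\<^bsub>M\<^esub> c) \<oplus>\<^bsub>M\<^esub> (b \<oplus>\<^bsub>M\<^esub> d)" using abcd by (simp add: M.a_ac)
    moreover have "a \<oplus>\<^bsub>M\<^esub> c \<in> N" "b \<oplus>\<^bsub>M\<^esub> d \<in> N'" using D(3) D'(3) abcd by auto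
    ultimately show "u \<oplus>\<^bsub>M\<^esub> v \<in> {x \<oplus>\<^bsub>M\<^esub> y |x y. x \<in> N \<and> y \<in> N'}" by blast
  next
    fix r u assume r: "r \<in> carrier R" and "u \<in> {x \<oplus>\<^bsub>M\<^esub> y |x y. x \<in> N \<and> y \<in> N'}"
    then obtain a b where ab: "a \<in> N" "b \<in> N'" "u = a \<oplus>\<^bsub>M\<^esub> b" by blast
    then have "a \<in> carrier M" "b \<in> carrier M" using D(1) D'(1) by auto
    then have "r \<odot>\<^bsub>M\<^esub> u = r \<odot>\<^bsub>M\<^esub> a \<oplus>\<^bsub>M\<^esub> r \<odot>\<^bsub>M\<^esub> b" using ab r by (simp add: smult_r_distr)
    moreover have "r \<odot>\<^bsub>M\<^esub> a \<in> N" "r \<odot>\<^bsub>M\<^esub> b \<in> N'" using D(4) D'(4) ab r by auto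
    ultimately show "r \<odot>\<^bsub>M\<^esub> u \<in> {x \<oplus>\<^bsub>M\<^esub> y |x y. x \<in> N \<and> y \<in> N'}" by blast
  qed
qed

lemma submodule_sum_incl:
  assumes "submodule N R M" "submodule N' R M"
  shows "N \<subseteq> {x \<oplus>\<^bsub>M\<^esub> y |x y. x \<in> N \<and> y \<in> N'}" "N' \<subseteq> {x \<oplus>\<^bsub>M\<^esub> y |x y. x \<in> N \<and> y \<in> N'}"
proof -
  note D = submodule_props[OF assms(1)] and D' = submodule_props[OF assms(2)]
  show "N \<subseteq> {x \<oplus>\<^bsub>M\<^esub> y |x y. x \<in> N \<and> y \<in> N'}"
  proof
    fix x assume x: "x \<in> N"
    then have "x = x \<oplus>\<^bsub>M\<^esub> \<zero>\<^bsub>M\<^esub>" using D(1) by (simp add: subset_iff)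
    then show "x \<in> {x \<oplus>\<^bsub>M\<^esub> y |x y. x \<in> N \<and> y \<in> N'}" using x D'(2) by blast
  qed
  show "N' \<subseteq> {x \<oplus>\<^bsub>M\<^esub> y |x y. x \<in> N \<and> y \<in> N'}"
  proof
    fix x assume x: "x \<in> N'"
    then have "x = \<zero>\<^bsub>M\<^esub> \<oplus>\<^bsub>M\<^esub> x" using D'(1) by (simp add: subset_iff)
    then show "x \<in> {x \<oplus>\<^bsub>M\<^esub> y |x y. x \<in> N \<and> y \<in> N'}" using x D(2) by blast
  qed
qed

lemma submodule_multiples:
  assumes "s \<in> carrier M"
  shows "submodule {r \<odot>\<^bsub>M\<^esub> s |r. r \<in> carrier R} R M"
proof -
  have eq: "{r \<odot>\<^bsub>M\<^esub> s |r. r \<in> carrier R} = (\<lambda>r. r \<odot>\<^bsub>M\<^esub> s) ` carrier (self_module R)" by auto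
  have lin: "(\<lambda>r. r \<odot>\<^bsub>M\<^esub> s) \<in> linear_maps R (self_module R) M"
    by (rule linear_mapsI) (use assms in \<open>auto simp: smult_l_distr smult_assoc1\<close>)
  show ?thesis
    unfolding eq by (rule submodule_image[OF self_module lin module.carrier_is_submodule[OF self_module]])
qed

lemma submodule_span_insertE:
  assumes s: "s \<in> carrier M" and S: "S \<subseteq> carrier M" and x: "x \<in> submodule_span R M (insert s S)"
  obtains r u where "r \<in> carrier R" "u \<in> submodule_span R M S" "x = r \<odot>\<^bsub>M\<^esub> s \<oplus>\<^bsub>M\<^esub> u"
proof -
  note A = submodule_multiples[OF s] and B = submodule_span_is_submodule[OF S]
  have "s = \<one> \<odot>\<^bsub>M\<^esub> s" using s by simp
  then have "s \<in> {r \<odot>\<^bsub>M\<^esub> s |r. r \<in> carrier R}" by blast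
  then have "insert s S \<subseteq> {x \<oplus>\<^bsub>M\<^esub> y |x y. x \<in> {r \<odot>\<^bsub>M\<^esub> s |r. r \<in> carrier R} \<and> y \<in> submodule_span R M S}"
    using submodule_sum_incl[OF A B] submodule_span_inc[of S R M] by blast
  then have "x \<in> {x \<oplus>\<^bsub>M\<^esub> y |x y. x \<in> {r \<odot>\<^bsub>M\<^esub> s |r. r \<in> carrier R} \<and> y \<in> submodule_span R M S}"
    using submodule_span_sub[OF submodule_sum[OF A B]] x by blast
  then show thesis using that by blast
qed

lemma finite_submodule_span:
  assumes "finite S" "S \<subseteq> carrier M" "x \<in> submodule_span R M S"
  shows "\<exists>c. c \<in> S \<rightarrow> carrier R \<and> x = (\<Oplus>\<^bsub>M\<^esub>s\<in>S. c s \<odot>\<^bsub>M\<^esub> s)"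
  using assms
proof (induction S arbitrary: x)
  case empty
  then show ?case by (simp add: submodule_span_empty)
next
  case (insert s S)
  obtain r u where ru: "r \<in> carrier R" "u \<in> submodule_span R M S" "x = r \<odot>\<^bsub>M\<^esub> s \<oplus>\<^bsub>M\<^esub> u"
    using submodule_span_insertE[of s S x] insert.prems by auto
  then obtain c where c: "c \<in> S \<rightarrow> carrier R" "u = (\<Oplus>\<^bsub>M\<^esub>s\<in>S. c s \<odot>\<^bsub>M\<^esub> s)"
    using insert.IH[of u] insert.prems by auto
  let ?c = "c(s := r)"
  have c': "?c \<in> insert s S \<rightarrow> carrier R" using c(1) ru(1) by auto
  have mem: "?c t \<odot>\<^bsub>M\<^esub> t \<in> carrier M" if "t \<in> insert s S" for t
    using funcset_mem[OF c' that] insert.prems(1) that by (intro smult_closed) auto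
  have "(\<Oplus>\<^bsub>M\<^esub>t\<in>S. ?c t \<odot>\<^bsub>M\<^esub> t) = u"
    unfolding c(2) by (rule M.finsum_cong') (use insert.hyps c(1) insert.prems(1) in \<open>auto intro!: smult_closed\<close>)
  then have "(\<Oplus>\<^bsub>M\<^esub>t\<in>insert s S. ?c t \<odot>\<^bsub>M\<^esub> t) = x"
    using M.finsum_insert[OF insert.hyps, of "\<lambda>t. ?c t \<odot>\<^bsub>M\<^esub> t"] mem ru(3) by (simp del: fun_upd_apply) simp
  then show ?case using c' by blast
qed

end

context cring
begin

text \<open>Makes the noetherian condition, which speaks of ideals, available in the language of
  submodules and spans.\<close>

lemma submodule_self_iff_ideal: "submodule I R (self_module R) \<longleftrightarrow> ideal I R"
proof
  assume I: "submodule I R (self_module R)"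
  note D = module.submodule_props[OF self_module I, simplified]
  have "subgroup I (add_monoid R)"
    using submodule.axioms(1)[OF I] by (simp add: self_module_def subgroup_def m_inv_def)
  then show "ideal I R"
  proof (intro idealI ring_axioms)
    fix a x assume a: "a \<in> I" "x \<in> carrier R"
    then show "x \<otimes> a \<in> I" by (rule D(4)[rotated])
    moreover have "a \<in> carrier R" using a D(1) by auto
    ultimately show "a \<otimes> x \<in> I" using m_comm[of a x] a(2) by simp
  qed
next
  assume "ideal I R"
  then interpret I: ideal I R .
  show "submodule I R (self_module R)"
    by (rule module.submoduleI'[OF self_module])
      (simp_all add: I.a_closed I.I_l_closed I.zero_closed I.a_subset)
qed

lemma noetherian_submodule_self:
  assumes "noetherian_ring R" "submodule I R (self_module R)"
  obtains A where "finite A" "A \<subseteq> I" "A \<subseteq> carrier R" "I = submodule_span R (self_module R) A"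
proof -
  have "ideal I R" using assms(2) by (simp add: submodule_self_iff_ideal)
  then obtain A where A: "A \<subseteq> carrier R" "finite A" "I = Idl A"
    using noetherian_ring.finetely_gen[OF assms(1)] by metis
  have AI: "A \<subseteq> I" using A genideal_self by auto
  have "submodule (submodule_span R (self_module R) A) R (self_module R)"
    by (rule module.submodule_span_is_submodule[OF self_module]) (simp add: A)
  then have "ideal (submodule_span R (self_module R) A) R" by (simp add: submodule_self_iff_ideal)
  then have "I \<subseteq> submodule_span R (self_module R) A"
    unfolding A(3) by (rule genideal_minimal) (rule submodule_span_inc)
  then show thesis
    using that[OF A(2) AI A(1)] submodule_span_sub[OF assms(2) AI] by blast
qed

text \<open>Induction on the generators of the surrounding span. For the new generator s, the
  coefficients of s in elements of N form a finitely generated ideal. Finitely many elements of N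
  realise its generators, and subtracting a combination of them from an element of N leaves an
  element of N in the span of the old generators.\<close>

lemma noetherian_submodule_fg:
  assumes noeth: "noetherian_ring R" and M: "module R M"
    and "finite S" "S \<subseteq> carrier M" "submodule N R M" "N \<subseteq> submodule_span R M S"
  shows "finitely_generated_submodule R M N"
proof -
  interpret M: module R M by fact
  show ?thesis
    using assms(3-)
  proof (induction S arbitrary: N)
    case empty
    then have "N = submodule_span R M {}"
      using M.submodule_props(2)[OF empty.prems(2)] M.submodule_span_empty by auto
    then show ?case unfolding finitely_generated_submodule_def by blast
  next
    case (insert s S)
    have s: "s \<in> carrier M" and S: "S \<subseteq> carrier M" using insert.prems by auto
    note N = M.submodule_props[OF insert.prems(2)]
    note sp = M.submodule_span_is_submodule[OF S]
    note D = M.submodule_props[OF sp]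
    \<comment> \<open>Stated for an arbitrary submodule because it serves twice: for
      \<open>N\<close>, and for the span of the elements of \<open>N\<close> that lift the ideal
      generators.\<close>
    have coeffs: "submodule {r \<in> carrier R. \<exists>u\<in>submodule_span R M S. r \<odot>\<^bsub>M\<^esub> s \<oplus>\<^bsub>M\<^esub> u \<in> L} R (self_module R)"
      (is "submodule ?C _ _") if L: "submodule L R M" for L
    proof (rule module.submoduleI'[OF self_module])
      show "?C \<subseteq> carrier (self_module R)" by auto
      show "\<zero>\<^bsub>self_module R\<^esub> \<in> ?C" using s M.submodule_props(2)[OF L] D(2) by (auto intro!: bexI[of _ "\<zero>\<^bsub>M\<^esub>"])
    next
      fix x y assume "x \<in> ?C" "y \<in> ?C"
      then obtain u v where uv: "x \<in> carrier R" "y \<in> carrier R" "u \<in> submodule_span R M S" "v \<in> submodule_span R M S"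
        "x \<odot>\<^bsub>M\<^esub> s \<oplus>\<^bsub>M\<^esub> u \<in> L" "y \<odot>\<^bsub>M\<^esub> s \<oplus>\<^bsub>M\<^esub> v \<in> L" by auto
      then have "u \<in> carrier M" "v \<in> carrier M" using D(1) by auto
      then have "(x \<oplus> y) \<odot>\<^bsub>M\<^esub> s \<oplus>\<^bsub>M\<^esub> (u \<oplus>\<^bsub>M\<^esub> v) = (x \<odot>\<^bsub>M\<^esub> s \<oplus>\<^bsub>M\<^esub> u) \<oplus>\<^bsub>M\<^esub> (y \<odot>\<^bsub>M\<^esub> s \<oplus>\<^bsub>M\<^esub> v)"
        using uv(1,2) s by (simp add: M.smult_l_distr M.a_ac)
      then have "(x \<oplus> y) \<odot>\<^bsub>M\<^esub> s \<oplus>\<^bsub>M\<^esub> (u \<oplus>\<^bsub>M\<^esub> v) \<in> L" using M.submodule_props(3)[OF L uv(5,6)] by simp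
      then show "x \<oplus>\<^bsub>self_module R\<^esub> y \<in> ?C" using uv(1,2) D(3)[OF uv(3,4)] by auto
    next
      fix r x assume r: "r \<in> carrier R" and "x \<in> ?C"
      then obtain u where u: "x \<in> carrier R" "u \<in> submodule_span R M S" "x \<odot>\<^bsub>M\<^esub> s \<oplus>\<^bsub>M\<^esub> u \<in> L" by auto
      then have "u \<in> carrier M" using D(1) by auto
      then have "(r \<otimes> x) \<odot>\<^bsub>M\<^esub> s \<oplus>\<^bsub>M\<^esub> r \<odot>\<^bsub>M\<^esub> u = r \<odot>\<^bsub>M\<^esub> (x \<odot>\<^bsub>M\<^esub> s \<oplus>\<^bsub>M\<^esub> u)"
        using u(1) s r by (simp add: M.smult_r_distr M.smult_assoc1)
      then have "(r \<otimes> x) \<odot>\<^bsub>M\<^esub> s \<oplus>\<^bsub>M\<^esub> r \<odot>\<^bsub>M\<^esub> u \<in> L" using M.submodule_props(4)[OF L r u(3)] by simp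
      then show "r \<odot>\<^bsub>self_module R\<^esub> x \<in> ?C" using u(1) r D(4)[OF r u(2)] by auto
    qed
    obtain A where A: "finite A" "A \<subseteq> {r \<in> carrier R. \<exists>u\<in>submodule_span R M S. r \<odot>\<^bsub>M\<^esub> s \<oplus>\<^bsub>M\<^esub> u \<in> N}"
      "{r \<in> carrier R. \<exists>u\<in>submodule_span R M S. r \<odot>\<^bsub>M\<^esub> s \<oplus>\<^bsub>M\<^esub> u \<in> N} = submodule_span R (self_module R) A"
      by (rule noetherian_submodule_self[OF noeth coeffs[OF insert.prems(2)]])
    have "\<forall>a\<in>A. \<exists>u. u \<in> submodule_span R M S \<and> a \<odot>\<^bsub>M\<^esub> s \<oplus>\<^bsub>M\<^esub> u \<in> N" using A(2) by auto
    then obtain u where u: "\<And>a. a \<in> A \<Longrightarrow> u a \<in> submodule_span R M S" "\<And>a. a \<in> A \<Longrightarrow> a \<odot>\<^bsub>M\<^esub> s \<oplus>\<^bsub>M\<^esub> u a \<in> N"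
      by metis
    \<comment> \<open>One element of \<open>N\<close> over each generator of the coefficient
      ideal.\<close>
    define B where "B = (\<lambda>a. a \<odot>\<^bsub>M\<^esub> s \<oplus>\<^bsub>M\<^esub> u a) ` A"
    have B: "B \<subseteq> N" "finite B" using u(2) A(1) by (auto simp: B_def)
    have "finitely_generated_submodule R M (N \<inter> submodule_span R M S)"
      by (rule insert.IH[OF S M.submodule_Int[OF insert.prems(2) sp]]) simp
    then obtain T where T: "finite T" "T \<subseteq> carrier M" "N \<inter> submodule_span R M S = submodule_span R M T"
      unfolding finitely_generated_submodule_def by blast
    have TN: "T \<subseteq> N" using T(3) submodule_span_inc[of T R M] by blast
    have BT: "B \<union> T \<subseteq> carrier M" using B(1) N(1) T(2) by auto
    note X = M.submodule_props[OF M.submodule_span_is_submodule[OF BT]]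
    have spB: "submodule (submodule_span R M B) R M"
      by (rule M.submodule_span_is_submodule) (use BT in simp)
    have "N \<subseteq> submodule_span R M (B \<union> T)"
    proof
      fix x assume x: "x \<in> N"
      then have "x \<in> submodule_span R M (insert s S)" using insert.prems(3) by auto
      then obtain r v where rv: "r \<in> carrier R" "v \<in> submodule_span R M S" "x = r \<odot>\<^bsub>M\<^esub> s \<oplus>\<^bsub>M\<^esub> v"
        by (rule M.submodule_span_insertE[OF s S])
      then have "r \<in> submodule_span R (self_module R) A" using A(3) x by auto
      moreover have "A \<subseteq> {r \<in> carrier R. \<exists>u\<in>submodule_span R M S. r \<odot>\<^bsub>M\<^esub> s \<oplus>\<^bsub>M\<^esub> u \<in> submodule_span R M B}"
      proof
        fix a assume a: "a \<in> A"
        then have "a \<odot>\<^bsub>M\<^esub> s \<oplus>\<^bsub>M\<^esub> u a \<in> submodule_span R M B"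
          using submodule_span_inc[of B R M] by (auto simp: B_def)
        then show "a \<in> {r \<in> carrier R. \<exists>u\<in>submodule_span R M S. r \<odot>\<^bsub>M\<^esub> s \<oplus>\<^bsub>M\<^esub> u \<in> submodule_span R M B}"
          using A(2) a u(1)[OF a] by blast
      qed
      ultimately have "r \<in> {r \<in> carrier R. \<exists>u\<in>submodule_span R M S. r \<odot>\<^bsub>M\<^esub> s \<oplus>\<^bsub>M\<^esub> u \<in> submodule_span R M B}"
        using submodule_span_sub[OF coeffs[OF spB]] by blast
      \<comment> \<open>The coefficient r of \<open>x\<close> is also attained inside the span of
        \<open>B\<close>. Thus \<open>x\<close> and \<open>?y\<close> contain the same multiple of
        \<open>s\<close>, which cancels in the difference.\<close>
      then obtain w where w: "w \<in> submodule_span R M S" "r \<odot>\<^bsub>M\<^esub> s \<oplus>\<^bsub>M\<^esub> w \<in> submodule_span R M B" by blast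
      let ?y = "r \<odot>\<^bsub>M\<^esub> s \<oplus>\<^bsub>M\<^esub> w"
      have yN: "?y \<in> N" using w(2) submodule_span_sub[OF insert.prems(2) B(1)] by blast
      have c: "v \<in> carrier M" "w \<in> carrier M" using D(1) rv(2) w(1) by auto
      have "x \<ominus>\<^bsub>M\<^esub> ?y = v \<ominus>\<^bsub>M\<^esub> w"
        using rv(1,3) c s by (simp add: a_minus_def M.minus_add M.a_ac M.r_neg1 M.r_neg2 M.r_neg M.l_neg)
      then have "x \<ominus>\<^bsub>M\<^esub> ?y \<in> submodule_span R M T"
        using N(5)[OF x yN] D(5)[OF rv(2) w(1)] T(3) by auto
      then have "x \<ominus>\<^bsub>M\<^esub> ?y \<in> submodule_span R M (B \<union> T)" "?y \<in> submodule_span R M (B \<union> T)"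
        using M.submodule_span_mono[of T "B \<union> T"] M.submodule_span_mono[of B "B \<union> T"] w(2) by auto
      then have "(x \<ominus>\<^bsub>M\<^esub> ?y) \<oplus>\<^bsub>M\<^esub> ?y \<in> submodule_span R M (B \<union> T)" by (rule X(3))
      moreover have "(x \<ominus>\<^bsub>M\<^esub> ?y) \<oplus>\<^bsub>M\<^esub> ?y = x"
        using x yN N(1) by (simp add: a_minus_def M.a_assoc M.l_neg subset_iff)
      ultimately show "x \<in> submodule_span R M (B \<union> T)" by simp
    qed
    moreover have "submodule_span R M (B \<union> T) \<subseteq> N"
      by (rule submodule_span_sub[OF insert.prems(2)]) (use B(1) TN in auto)
    ultimately show ?case
      unfolding finitely_generated_submodule_def using BT B(2) T(1) by (metis finite_UnI subset_antisym)
  qed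
qed

section \<open>Tensor products with modules of functions\<close>

lemma function_module_simps:
  "carrier (function_module R I) = I \<rightarrow>\<^sub>E carrier R"
  "zero (function_module R I) = (\<lambda>i\<in>I. \<zero>)"
  "f \<oplus>\<^bsub>function_module R I\<^esub> g = (\<lambda>i\<in>I. f i \<oplus> g i)"
  "r \<odot>\<^bsub>function_module R I\<^esub> f = (\<lambda>i\<in>I. r \<otimes> f i)"
  by (simp_all add: function_module_def)

lemma function_module_module: "module R (function_module R I)"
proof (rule moduleI)
  show "abelian_group (function_module R I)"
  proof (rule abelian_groupI)
    fix f assume f: "f \<in> carrier (function_module R I)"
    show "\<exists>g\<in>carrier (function_module R I). g \<oplus>\<^bsub>function_module R I\<^esub> f = \<zero>\<^bsub>function_module R I\<^esub>"
    proof (rule bexI)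
      show "(\<lambda>i\<in>I. \<ominus> f i) \<oplus>\<^bsub>function_module R I\<^esub> f = \<zero>\<^bsub>function_module R I\<^esub>"
        using f by (auto simp: function_module_simps fun_eq_iff l_neg PiE_def Pi_def)
    qed (use f in \<open>auto simp: function_module_simps\<close>)
  qed (auto simp: function_module_simps fun_eq_iff PiE_def Pi_def extensional_def a_ac)
qed (auto simp: is_cring function_module_simps fun_eq_iff PiE_def Pi_def extensional_def l_distr r_distr m_assoc)

lemma function_module_eval:
  assumes "x \<in> I"
  shows "(\<lambda>f. f x) \<in> linear_maps R (function_module R I) (self_module R)"
  by (rule linear_mapsI) (use assms in \<open>auto simp: function_module_simps\<close>)

lemma function_eval_bilinear:
  assumes M: "module R M" and x: "x \<in> I"
  shows "(\<lambda>f m. f x \<odot>\<^bsub>M\<^esub> m) \<in> bilinear_maps R (function_module R I) M M"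
proof (rule bilinear_mapsI)
  show "(\<lambda>f. f x \<odot>\<^bsub>M\<^esub> m) \<in> linear_maps R (function_module R I) M" if "m \<in> carrier M" for m
    by (rule linear_maps_smult_left[OF M that function_module_eval[OF x]])
  show "(\<lambda>m. f x \<odot>\<^bsub>M\<^esub> m) \<in> linear_maps R M M" if "f \<in> carrier (function_module R I)" for f
    by (rule linear_maps_smult[OF M linear_mapsD(1)[OF function_module_eval[OF x] that, simplified] linear_maps_id])
qed

text \<open>Over a noetherian ring \<open>R\<^sup>X \<otimes> M \<rightarrow> M\<^sup>X\<close> is injective. The proof removes the generators
  \<open>m \<in> J\<close> from a representation \<open>\<Sum>f\<^sub>m \<otimes> m\<close> one at a time: the values of \<open>f\<^sub>m\<close> lie in the
  finitely generated ideal of all \<open>r\<close> with \<open>r m\<close> in the span of the remaining generators.\<close>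

lemma function_tensor_inj:
  fixes I :: "'i set"
  assumes noeth: "noetherian_ring R" and M: "module R M"
    and t: "t \<in> carrier (tensor_module R (function_module R I) M)"
    and ev: "\<And>x. x \<in> I \<Longrightarrow> tensor_lift R M (\<lambda>f m. f x \<odot>\<^bsub>M\<^esub> m) t = \<zero>\<^bsub>M\<^esub>"
  shows "t = \<zero>\<^bsub>tensor_module R (function_module R I) M\<^esub>"
proof -
  define F where "F = function_module R I"
  define T where "T = tensor_module R F M"
  have F: "module R F" unfolding F_def by (rule function_module_module)
  interpret F: module R F by (rule F)
  interpret M: module R M by (rule M)
  interpret T: module R T unfolding T_def by (rule tensor_module_module[OF F M])
  have bil: "tensor R F M \<in> bilinear_maps R F M T" unfolding T_def by (rule tensor_bilinear[OF F M])
  note b1 = linear_mapsD[OF bilinear_mapsD(1)[OF bil]] and b2 = linear_mapsD[OF bilinear_mapsD(2)[OF bil]]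
  define E where "E x = tensor_lift R M (\<lambda>f m. f x \<odot>\<^bsub>M\<^esub> m)" for x :: 'i
  have E: "E x \<in> linear_maps R T M" if "x \<in> I" for x
    unfolding E_def T_def F_def
    by (rule tensor_lift_linear[OF function_module_module M M function_eval_bilinear[OF M that]])
  have Et: "E x (tensor R F M f m) = f x \<odot>\<^bsub>M\<^esub> m" if "x \<in> I" "f \<in> carrier F" "m \<in> carrier M" for x f m
    unfolding E_def F_def
    by (rule tensor_lift_tensor[OF function_module_module M M function_eval_bilinear[OF M that(1)]])
      (use that in \<open>auto simp: F_def\<close>)
  \<comment> \<open>The tensors whose right factors can be taken from \<open>J\<close>.\<close>
  define W where "W J = submodule_span R T {tensor R F M f m |f m. f \<in> carrier F \<and> m \<in> J}" for J
  have genT: "{tensor R F M f m |f m. f \<in> carrier F \<and> m \<in> J} \<subseteq> carrier T" if "J \<subseteq> carrier M" for J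
    using bilinear_mapsD(3)[OF bil] that by blast
  have W: "submodule (W J) R T" if "J \<subseteq> carrier M" for J
    unfolding W_def by (rule T.submodule_span_is_submodule[OF genT[OF that]])
  have gen: "tensor R F M f m \<in> W J" if "f \<in> carrier F" "m \<in> J" for f m J
    unfolding W_def using that submodule_span_inc[of "{tensor R F M f m |f m. f \<in> carrier F \<and> m \<in> J}" R T] by blast
  have W_span: "tensor R F M f v \<in> W J"
    if J: "J \<subseteq> carrier M" and f: "f \<in> carrier F" and v: "v \<in> submodule_span R M J" for f v J
  proof -
    have "submodule {v \<in> carrier M. tensor R F M f v \<in> W J} R M"
      by (rule T.submodule_vimage[OF M bilinear_mapsD(1)[OF bil f] W[OF J]])
    moreover have "J \<subseteq> {v \<in> carrier M. tensor R F M f v \<in> W J}" using J gen[OF f] by auto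
    ultimately show ?thesis using submodule_span_sub v by blast
  qed
  have E_span: "E x w \<in> submodule_span R M J" if J: "J \<subseteq> carrier M" and w: "w \<in> W J" and x: "x \<in> I" for x w J
  proof -
    note sp = M.submodule_span_is_submodule[OF J]
    have "submodule {w \<in> carrier T. E x w \<in> submodule_span R M J} R T"
      by (rule M.submodule_vimage[OF T.module_axioms E[OF x] sp])
    moreover have "{tensor R F M f m |f m. f \<in> carrier F \<and> m \<in> J} \<subseteq> {w \<in> carrier T. E x w \<in> submodule_span R M J}"
    proof
      fix w assume "w \<in> {tensor R F M f m |f m. f \<in> carrier F \<and> m \<in> J}"
      then obtain f m where fm: "f \<in> carrier F" "m \<in> J" "w = tensor R F M f m" by blast
      have m: "m \<in> carrier M" "m \<in> submodule_span R M J" using fm(2) J submodule_span_inc[of J R M] by auto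
      have "f x \<in> carrier R" using fm(1) x by (auto simp: F_def function_module_simps)
      then have "E x w \<in> submodule_span R M J"
        unfolding fm(3) Et[OF x fm(1) m(1)] using M.submodule_props(4)[OF sp _ m(2)] by blast
      then show "w \<in> {w \<in> carrier T. E x w \<in> submodule_span R M J}"
        using genT[OF J] fm by blast
    qed
    ultimately show ?thesis using submodule_span_sub w unfolding W_def by blast
  qed
  \<comment> \<open>Induction on the generators of an ideal that contains the values of f. Writing f
    = a r + u pointwise turns f \<otimes> m into r \<otimes> (a m) + u \<otimes> m, where a m lies
    in the span of \<open>J\<close>. The functions r and u come from pointwise choices, which is
    possible because \<open>F\<close> consists of all functions on \<open>I\<close>.\<close>
  have ideal_valued: "tensor R F M f m \<in> W J"
    if J: "J \<subseteq> carrier M" and m: "m \<in> carrier M" and A: "finite A" "A \<subseteq> {r \<in> carrier R. r \<odot>\<^bsub>M\<^esub> m \<in> submodule_span R M J}"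
      and f: "f \<in> carrier F" "\<And>x. x \<in> I \<Longrightarrow> f x \<in> submodule_span R (self_module R) A" for f m J A
    using A f
  proof (induction A arbitrary: f)
    case empty
    then have "f x = \<zero>" if "x \<in> I" for x
      using module.submodule_span_empty[OF self_module] that by simp
    then have "f = \<zero>\<^bsub>F\<^esub>" using empty(2) by (auto simp: F_def function_module_simps fun_eq_iff PiE_def extensional_def)
    then have "tensor R F M f m = \<zero>\<^bsub>T\<^esub>"
      using linear_maps_zero[OF F T.module_axioms bilinear_mapsD(2)[OF bil m]] by simp
    then show ?case using T.submodule_props(2)[OF W[OF J]] by simp
  next
    case (insert a A)
    have a: "a \<in> carrier R" "A \<subseteq> carrier R" "a \<odot>\<^bsub>M\<^esub> m \<in> submodule_span R M J" using insert.prems(1) by auto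
    have "\<exists>r u. r \<in> carrier R \<and> u \<in> submodule_span R (self_module R) A \<and> f x = r \<otimes> a \<oplus> u" if "x \<in> I" for x
      using module.submodule_span_insertE[OF self_module, of a A "f x"] insert.prems(3)[OF that] a
      by (metis self_module_simps(1,2,6))
    then obtain r u where ru: "\<And>x. x \<in> I \<Longrightarrow> r x \<in> carrier R"
      "\<And>x. x \<in> I \<Longrightarrow> u x \<in> submodule_span R (self_module R) A" "\<And>x. x \<in> I \<Longrightarrow> f x = r x \<otimes> a \<oplus> u x"
      by metis
    have uR: "u x \<in> carrier R" if "x \<in> I" for x
      using ru(2)[OF that] module.submodule_props(1)[OF self_module module.submodule_span_is_submodule[OF self_module, of A]] a
      by auto
    have g: "restrict r I \<in> carrier F" and h: "restrict u I \<in> carrier F"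
      using ru(1) uR by (auto simp: F_def function_module_simps)
    have "f = (a \<odot>\<^bsub>F\<^esub> restrict r I) \<oplus>\<^bsub>F\<^esub> restrict u I"
      using insert.prems(2) ru(1,3) a(1)
      by (auto simp: F_def function_module_simps fun_eq_iff PiE_def extensional_def m_comm)
    then have "tensor R F M f m = tensor R F M (restrict r I) (a \<odot>\<^bsub>M\<^esub> m) \<oplus>\<^bsub>T\<^esub> tensor R F M (restrict u I) m"
      using b2(2)[OF m F.smult_closed[OF a(1) g] h] b2(3)[OF m a(1) g] b1(3)[OF g a(1) m] by simp
    moreover have "tensor R F M (restrict u I) m \<in> W J"
    proof (rule insert.IH[OF _ h])
      show "A \<subseteq> {r \<in> carrier R. r \<odot>\<^bsub>M\<^esub> m \<in> submodule_span R M J}" using insert.prems(1) by blast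
      show "restrict u I x \<in> submodule_span R (self_module R) A" if "x \<in> I" for x
        unfolding restrict_apply'[OF that] by (rule ru(2)[OF that])
    qed
    ultimately show ?case
      using T.submodule_props(3)[OF W[OF J] W_span[OF J g a(3)]] by simp
  qed
  have key: "w = \<zero>\<^bsub>T\<^esub>" if "finite J" "J \<subseteq> carrier M" "w \<in> W J" "\<And>x. x \<in> I \<Longrightarrow> E x w = \<zero>\<^bsub>M\<^esub>" for J w
    using that
  proof (induction J arbitrary: w)
    case empty
    then show ?case by (simp add: W_def T.submodule_span_empty)
  next
    case (insert m J)
    have m: "m \<in> carrier M" and J: "J \<subseteq> carrier M" using insert.prems(1) by auto
    have im: "submodule ((\<lambda>f. tensor R F M f m) ` carrier F) R T"
      by (rule T.submodule_image[OF F bilinear_mapsD(2)[OF bil m] F.carrier_is_submodule])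
    have "{tensor R F M f m' |f m'. f \<in> carrier F \<and> m' \<in> insert m J} \<subseteq>
        {x \<oplus>\<^bsub>T\<^esub> y |x y. x \<in> (\<lambda>f. tensor R F M f m) ` carrier F \<and> y \<in> W J}"
    proof
      fix v assume "v \<in> {tensor R F M f m' |f m'. f \<in> carrier F \<and> m' \<in> insert m J}"
      then obtain f m' where fm': "f \<in> carrier F" "m' \<in> insert m J" "v = tensor R F M f m'" by blast
      show "v \<in> {x \<oplus>\<^bsub>T\<^esub> y |x y. x \<in> (\<lambda>f. tensor R F M f m) ` carrier F \<and> y \<in> W J}"
      proof (cases "m' = m")
        case True
        then show ?thesis using subsetD[OF T.submodule_sum_incl(1)[OF im W[OF J]]] fm'(1,3) by simp
      next
        case False
        then have "v \<in> W J" using gen[OF fm'(1)] fm'(2,3) by simp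
        then show ?thesis by (rule subsetD[OF T.submodule_sum_incl(2)[OF im W[OF J]]])
      qed
    qed
    then have "w \<in> {x \<oplus>\<^bsub>T\<^esub> y |x y. x \<in> (\<lambda>f. tensor R F M f m) ` carrier F \<and> y \<in> W J}"
      using submodule_span_sub[OF T.submodule_sum[OF im W[OF J]]] insert.prems(2) unfolding W_def by blast
    then obtain f w' where fw: "f \<in> carrier F" "w' \<in> W J" "w = tensor R F M f m \<oplus>\<^bsub>T\<^esub> w'" by blast
    note sp = M.submodule_span_is_submodule[OF J]
    let ?I = "{r \<in> carrier R. r \<odot>\<^bsub>M\<^esub> m \<in> submodule_span R M J}"
    have lin: "(\<lambda>r. r \<odot>\<^bsub>M\<^esub> m) \<in> linear_maps R (self_module R) M"
      by (rule linear_maps_smult_left[OF M m linear_maps_id])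
    have "submodule ?I R (self_module R)"
      using M.submodule_vimage[OF self_module lin sp] by simp
    then obtain A where A: "finite A" "A \<subseteq> ?I" "?I = submodule_span R (self_module R) A"
      by (rule noetherian_submodule_self[OF noeth])
    have w'T: "w' \<in> carrier T" using T.submodule_props(1)[OF W[OF J]] fw(2) by auto
    have fmT: "tensor R F M f m \<in> carrier T" by (rule bilinear_mapsD(3)[OF bil fw(1) m])
    have "f x \<in> ?I" if x: "x \<in> I" for x
    proof -
      have fx: "f x \<in> carrier R" using fw(1) x by (auto simp: F_def function_module_simps)
      have "f x \<odot>\<^bsub>M\<^esub> m \<oplus>\<^bsub>M\<^esub> E x w' = \<zero>\<^bsub>M\<^esub>"
        using insert.prems(3)[OF x] linear_mapsD(2)[OF E[OF x] fmT w'T] Et[OF x fw(1) m] fw(3) by simp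
      then have "f x \<odot>\<^bsub>M\<^esub> m = \<ominus>\<^bsub>M\<^esub> E x w'"
        using M.minus_equality[of "f x \<odot>\<^bsub>M\<^esub> m" "E x w'"] fx m linear_mapsD(1)[OF E[OF x] w'T] by simp
      then have "f x \<odot>\<^bsub>M\<^esub> m \<in> submodule_span R M J"
        using M.submoduleE(3)[OF sp E_span[OF J fw(2) x]] by (rule ssubst)
      then show ?thesis using fx by blast
    qed
    then have "tensor R F M f m \<in> W J"
      by (intro ideal_valued[OF J m A(1,2) fw(1)]) (unfold A(3))
    then have "w \<in> W J" unfolding fw(3) by (rule T.submodule_props(3)[OF W[OF J] _ fw(2)])
    then show ?case by (rule insert.IH[OF J]) (rule insert.prems(3))
  qed
  have W_mono: "W J \<subseteq> W J'" if "J \<subseteq> J'" for J J'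
    unfolding W_def by (rule T.submodule_span_mono) (use that in blast)
  have "\<exists>J. finite J \<and> J \<subseteq> carrier M \<and> t \<in> W J"
    using F M t[folded F_def]
  proof (induction t rule: tensor_induct)
    case zero
    then show ?case using T.submodule_props(2)[OF W[of "{}"]] unfolding T_def by blast
  next
    case (tensor f m)
    then show ?case using gen[of f m "{m}"] by (intro exI[of _ "{m}"]) simp
  next
    case (add s t)
    then obtain J J' where J: "finite J" "J \<subseteq> carrier M" "s \<in> W J" "finite J'" "J' \<subseteq> carrier M" "t \<in> W J'"
      by blast
    have "s \<oplus>\<^bsub>T\<^esub> t \<in> W (J \<union> J')"
      by (rule T.submodule_props(3)[OF W]) (use J W_mono[of J "J \<union> J'"] W_mono[of J' "J \<union> J'"] in auto)
    then show ?case
      using J by (intro exI[of _ "J \<union> J'"]) (simp add: T_def)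
  qed
  then obtain J where J: "finite J" "J \<subseteq> carrier M" "t \<in> W J" by blast
  have "t = \<zero>\<^bsub>T\<^esub>" by (rule key[OF J]) (simp add: E_def ev)
  then show ?thesis by (simp add: T_def F_def)
qed

end

section \<open>Functoriality and purity\<close>

text \<open>Tensor products read only the carrier, the addition and the scalars. They coincide for
  records that differ in products or Hopf data, such as H \<otimes> C and the smash product built on
  it.\<close>

lemma tensor_module_cong:
  assumes "carrier M' = carrier M" "add M' = add M" "smult M' = smult M"
    "carrier N' = carrier N" "add N' = add N" "smult N' = smult N"
  shows "tensor_module R M' N' = tensor_module R M N" "tensor R M' N' = tensor R M N"
  by (simp_all add: tensor_module_def tensor_def tensor_relations_def assms fun_eq_iff)

text \<open>Like \<open>tensor_lift\<close>, evaluated at a chosen representative; the value is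
  independent of the choice once \<phi> kills the submodule.\<close>

definition quotient_lift :: "('m \<Rightarrow> 'p) \<Rightarrow> 'm set \<Rightarrow> 'p" where
  "quotient_lift \<phi> X = \<phi> (SOME x. x \<in> X)"

context module
begin

lemma quotient_proj_linear:
  assumes K: "submodule K R M"
  shows "(\<lambda>x. K +>\<^bsub>M\<^esub> x) \<in> linear_maps R M (quotient_module R M K)"
  using quotient_simps(2-4)[OF K] by (intro linear_mapsI) simp_all

lemma quotient_lift:
  assumes K: "submodule K R M" and P: "module R P" and \<phi>: "\<phi> \<in> linear_maps R M P"
    and zero: "\<And>x. x \<in> K \<Longrightarrow> \<phi> x = \<zero>\<^bsub>P\<^esub>"
  shows "x \<in> carrier M \<Longrightarrow> quotient_lift \<phi> (K +>\<^bsub>M\<^esub> x) = \<phi> x"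
    and "quotient_lift \<phi> \<in> linear_maps R (quotient_module R M K) P"
proof -
  interpret K: abelian_subgroup K M by (rule submodule_abelian_subgroup[OF K])
  interpret P: module R P by fact
  note q = quotient_simps[OF K] and f = linear_mapsD[OF \<phi>]
  show *: "quotient_lift \<phi> (K +>\<^bsub>M\<^esub> x) = \<phi> x" if x: "x \<in> carrier M" for x
  proof -
    define y where "y = (SOME y. y \<in> K +>\<^bsub>M\<^esub> x)"
    have "y \<in> K +>\<^bsub>M\<^esub> x"
      unfolding y_def by (rule someI[of "\<lambda>y. y \<in> K +>\<^bsub>M\<^esub> x" x]) (rule K.a_rcos_self[OF x])
    then obtain k where k: "k \<in> K" "y = k \<oplus>\<^bsub>M\<^esub> x"
      by (auto simp: a_r_coset_def r_coset_def)
    have "k \<in> carrier M" using k(1) K.a_subset by auto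
    then have "\<phi> y = \<zero>\<^bsub>P\<^esub> \<oplus>\<^bsub>P\<^esub> \<phi> x" unfolding k(2) using f(2) x zero[OF k(1)] by simp
    then show ?thesis using f(1)[OF x] by (simp add: quotient_lift_def y_def)
  qed
  show "quotient_lift \<phi> \<in> linear_maps R (quotient_module R M K) P"
  proof (rule linear_mapsI)
    fix s assume "s \<in> carrier (quotient_module R M K)"
    then obtain x where x: "x \<in> carrier M" "s = K +>\<^bsub>M\<^esub> x" unfolding q(5) by blast
    show "quotient_lift \<phi> s \<in> carrier P"
      unfolding x(2) *[OF x(1)] by (rule f(1)[OF x(1)])
    show "quotient_lift \<phi> (r \<odot>\<^bsub>quotient_module R M K\<^esub> s) = r \<odot>\<^bsub>P\<^esub> quotient_lift \<phi> s" if r: "r \<in> carrier R" for r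
      unfolding x(2) q(4)[OF r x(1)] *[OF x(1)] *[OF smult_closed[OF r x(1)]] by (rule f(3)[OF r x(1)])
    fix t assume "t \<in> carrier (quotient_module R M K)"
    then obtain y where y: "y \<in> carrier M" "t = K +>\<^bsub>M\<^esub> y" unfolding q(5) by blast
    show "quotient_lift \<phi> (s \<oplus>\<^bsub>quotient_module R M K\<^esub> t) = quotient_lift \<phi> s \<oplus>\<^bsub>P\<^esub> quotient_lift \<phi> t"
      unfolding x(2) y(2) q(3)[OF x(1) y(1)] *[OF x(1)] *[OF y(1)] *[OF M.a_closed[OF x(1) y(1)]]
      by (rule f(2)[OF x(1) y(1)])
  qed
qed

end

context cring
begin

lemma bilinear_maps_comp:
  assumes "\<beta> \<in> bilinear_maps R M N P" "\<phi> \<in> linear_maps R K M" "\<psi> \<in> linear_maps R L N"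
  shows "(\<lambda>k l. \<beta> (\<phi> k) (\<psi> l)) \<in> bilinear_maps R K L P"
  by (rule bilinear_mapsI)
    (rule linear_maps_comp[OF bilinear_mapsD(1)[OF assms(1)] assms(3)] linear_maps_comp[OF bilinear_mapsD(2)[OF assms(1)] assms(2)];
      erule linear_mapsD(1)[OF assms(2)] linear_mapsD(1)[OF assms(3)])+

lemma tensor_map_bilinear:
  assumes "module R M" "module R N" "\<phi> \<in> linear_maps R K M" "\<psi> \<in> linear_maps R L N"
  shows "(\<lambda>k l. tensor R M N (\<phi> k) (\<psi> l)) \<in> bilinear_maps R K L (tensor_module R M N)"
  by (rule bilinear_maps_comp[OF tensor_bilinear[OF assms(1,2)] assms(3,4)])

lemma tensor_map_linear:
  assumes "module R K" "module R L" "module R M" "module R N"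
    and "\<phi> \<in> linear_maps R K M" "\<psi> \<in> linear_maps R L N"
  shows "tensor_map R M N \<phi> \<psi> \<in> linear_maps R (tensor_module R K L) (tensor_module R M N)"
  unfolding tensor_map_def
  by (rule tensor_lift_linear[OF assms(1,2) tensor_module_module[OF assms(3,4)] tensor_map_bilinear[OF assms(3-6)]])

lemma tensor_map_tensor:
  assumes "module R K" "module R L" "module R M" "module R N"
    and "\<phi> \<in> linear_maps R K M" "\<psi> \<in> linear_maps R L N" "k \<in> carrier K" "l \<in> carrier L"
  shows "tensor_map R M N \<phi> \<psi> (tensor R K L k l) = tensor R M N (\<phi> k) (\<psi> l)"
  unfolding tensor_map_def
  by (rule tensor_lift_tensor[OF assms(1,2) tensor_module_module[OF assms(3,4)] tensor_map_bilinear[OF assms(3-6)] assms(7,8)])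

lemma tensor_lift_tensor_map:
  assumes "module R K" "module R L" "module R M" "module R N" "module R P"
    and "\<phi> \<in> linear_maps R K M" "\<psi> \<in> linear_maps R L N" "\<beta> \<in> bilinear_maps R M N P"
    and t: "t \<in> carrier (tensor_module R K L)"
  shows "tensor_lift R P \<beta> (tensor_map R M N \<phi> \<psi> t) = tensor_lift R P (\<lambda>k l. \<beta> (\<phi> k) (\<psi> l)) t"
proof (rule tensor_ext[OF assms(1,2,5) linear_maps_comp[OF tensor_lift_linear[OF assms(3-5,8)] tensor_map_linear[OF assms(1-4,6,7)]]
      tensor_lift_linear[OF assms(1,2,5) bilinear_maps_comp[OF assms(8,6,7)]] _ t])
  fix k l assume kl: "k \<in> carrier K" "l \<in> carrier L"
  show "tensor_lift R P \<beta> (tensor_map R M N \<phi> \<psi> (tensor R K L k l)) =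
    tensor_lift R P (\<lambda>k l. \<beta> (\<phi> k) (\<psi> l)) (tensor R K L k l)"
    unfolding tensor_map_tensor[OF assms(1-4,6,7) kl]
      tensor_lift_tensor[OF assms(1,2,5) bilinear_maps_comp[OF assms(8,6,7)] kl]
    by (rule tensor_lift_tensor[OF assms(3-5,8) linear_mapsD(1)[OF assms(6) kl(1)] linear_mapsD(1)[OF assms(7) kl(2)]])
qed

definition tensor_flip ::
  "('a, 'm, 'x) module_scheme \<Rightarrow> ('a, 'n, 'y) module_scheme \<Rightarrow> ('m \<times> 'n \<Rightarrow> 'a) set \<Rightarrow> ('n \<times> 'm \<Rightarrow> 'a) set" where
  "tensor_flip M N = tensor_lift R (tensor_module R N M) (\<lambda>m n. tensor R N M n m)"

lemma bilinear_maps_flip: "\<beta> \<in> bilinear_maps R M N P \<Longrightarrow> (\<lambda>n m. \<beta> m n) \<in> bilinear_maps R N M P"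
  by (auto simp: bilinear_maps_def)

lemma tensor_flip_linear:
  assumes "module R M" "module R N"
  shows "tensor_flip M N \<in> linear_maps R (tensor_module R M N) (tensor_module R N M)"
  unfolding tensor_flip_def
  by (rule tensor_lift_linear[OF assms tensor_module_module[OF assms(2,1)] bilinear_maps_flip[OF tensor_bilinear[OF assms(2,1)]]])

lemma tensor_flip_tensor:
  assumes "module R M" "module R N" "m \<in> carrier M" "n \<in> carrier N"
  shows "tensor_flip M N (tensor R M N m n) = tensor R N M n m"
  unfolding tensor_flip_def
  by (rule tensor_lift_tensor[OF assms(1,2) tensor_module_module[OF assms(2,1)] bilinear_maps_flip[OF tensor_bilinear[OF assms(2,1)]] assms(3,4)])

lemma tensor_lift_flip:
  assumes M: "module R M" and N: "module R N" and P: "module R P" and \<beta>: "\<beta> \<in> bilinear_maps R N M P"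
    and t: "t \<in> carrier (tensor_module R M N)"
  shows "tensor_lift R P \<beta> (tensor_flip M N t) = tensor_lift R P (\<lambda>m n. \<beta> n m) t"
proof -
  have "tensor_lift R P \<beta> (tensor_flip M N t) = tensor_lift R P (\<lambda>m n. tensor_lift R P \<beta> (tensor R N M n m)) t"
    unfolding tensor_flip_def
    by (rule linear_maps_tensor_lift[OF M N tensor_module_module[OF N M] P bilinear_maps_flip[OF tensor_bilinear[OF N M]]
          tensor_lift_linear[OF N M P \<beta>] t])
  also have "\<dots> = tensor_lift R P (\<lambda>m n. \<beta> n m) t"
    by (rule tensor_lift_cong[OF M N P _ _ t, symmetric, OF bilinear_maps_flip[OF \<beta>]])
      (rule tensor_lift_tensor[OF N M P \<beta>, symmetric])
  finally show ?thesis .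
qed

lemma tensor_flip_flip:
  assumes M: "module R M" and N: "module R N" and t: "t \<in> carrier (tensor_module R M N)"
  shows "tensor_flip N M (tensor_flip M N t) = t"
  by (rule tensor_ext[OF M N tensor_module_module[OF M N]
        linear_maps_comp[OF tensor_flip_linear[OF N M] tensor_flip_linear[OF M N]] linear_maps_id _ t])
    (simp add: tensor_flip_tensor[OF M N] tensor_flip_tensor[OF N M])

text \<open>Purity as triviality of a kernel. The separate record \<open>C\<close> is there because
  U and \<open>H\<^sup>\<circ>\<close> occur with their Hopf data, whereas purity speaks of the
  ambient record with its carrier cut down to \<open>N\<close>.\<close>

lemma pure_submodule_eval_inj:
  assumes F: "module R F" and pure: "pure_submodule R N F" and M: "module R M"
    and C: "carrier C = N" "add C = add F" "smult C = smult F"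
    and t: "t \<in> carrier (tensor_module R C M)"
    and zero: "tensor_map R F M (\<lambda>x. x) (\<lambda>x. x) t = \<zero>\<^bsub>tensor_module R F M\<^esub>"
  shows "t = \<zero>\<^bsub>tensor_module R C M\<^esub>"
proof -
  let ?N = "F\<lparr>carrier := N\<rparr>"
  have sub: "submodule N R F" using pure by (simp add: pure_submodule_def)
  have N: "module R ?N" by (rule submodule.submodule_is_module[OF sub F])
  have TC: "tensor_module R C M = tensor_module R ?N M"
    by (rule tensor_module_cong(1)) (simp_all add: C)
  interpret T: module R "tensor_module R ?N M" by (rule tensor_module_module[OF N M])
  have incl: "(\<lambda>x. x) \<in> linear_maps R ?N F"
    by (rule linear_mapsI) (use module.submoduleE(1)[OF F sub] in auto)
  have "tensor_map R F M (\<lambda>x. x) (\<lambda>x. x) \<zero>\<^bsub>tensor_module R ?N M\<^esub> = \<zero>\<^bsub>tensor_module R F M\<^esub>"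
    by (rule linear_maps_zero[OF T.module_axioms tensor_module_module[OF F M] tensor_map_linear[OF N M F M incl linear_maps_id]])
  then show ?thesis
    using inj_onD[OF pure_submodule_inj[OF F pure M]] zero t unfolding TC by simp
qed

text \<open>A composite of two injections: N \<otimes> M into \<open>R\<^sup>I\<close> \<otimes> M
  by purity, and from there into \<open>M\<^sup>I\<close> by the noetherian condition.\<close>

lemma function_submodule_tensor_inj:
  fixes I :: "'i set"
  assumes noeth: "noetherian_ring R"
    and pure: "pure_submodule R N (function_module R I)" and M: "module R M"
    and C: "carrier C = N" "add C = add (function_module R I)" "smult C = smult (function_module R I)"
    and t: "t \<in> carrier (tensor_module R C M)"
    and ev: "\<And>x. x \<in> I \<Longrightarrow> tensor_lift R M (\<lambda>f m. f x \<odot>\<^bsub>M\<^esub> m) t = \<zero>\<^bsub>M\<^esub>"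
  shows "t = \<zero>\<^bsub>tensor_module R C M\<^esub>"
proof -
  let ?F = "function_module R I"
  let ?N = "?F\<lparr>carrier := N\<rparr>"
  note F = function_module_module[of I]
  have sub: "submodule N R ?F" using pure by (simp add: pure_submodule_def)
  have N: "module R ?N" by (rule submodule.submodule_is_module[OF sub F])
  have t': "t \<in> carrier (tensor_module R ?N M)"
    using t tensor_module_cong(1)[of C ?N M M R] C by simp
  have incl: "(\<lambda>x. x) \<in> linear_maps R ?N ?F"
    by (rule linear_mapsI) (use module.submoduleE(1)[OF F sub] in auto)
  show ?thesis
  proof (rule pure_submodule_eval_inj[OF F pure M C t], rule function_tensor_inj[OF noeth M])
    show "tensor_map R ?F M (\<lambda>x. x) (\<lambda>x. x) t \<in> carrier (tensor_module R ?F M)"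
      by (rule linear_mapsD(1)[OF tensor_map_linear[OF N M F M incl linear_maps_id] t'])
    fix x assume x: "x \<in> I"
    show "tensor_lift R M (\<lambda>f m. f x \<odot>\<^bsub>M\<^esub> m) (tensor_map R ?F M (\<lambda>x. x) (\<lambda>x. x) t) = \<zero>\<^bsub>M\<^esub>"
      unfolding tensor_lift_tensor_map[OF N M F M M incl linear_maps_id function_eval_bilinear[OF M x] t']
      by (rule ev[OF x])
  qed
qed

text \<open>Evaluating the left factor at x leaves an element of \<open>C\<close>, which is a
  function determined by its values. Hence pairs of points separate C \<otimes> C. This is the
  uniqueness behind the definite descriptions of the comultiplications.\<close>

lemma function_eval_tensor_inj:
  assumes C: "module R C" and ev_lin: "\<And>x. x \<in> I \<Longrightarrow> (\<lambda>f. f x) \<in> linear_maps R C (self_module R)"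
    and ext: "carrier C \<subseteq> extensional I"
    and inj: "\<And>t. t \<in> carrier (tensor_module R C C) \<Longrightarrow>
      (\<And>x. x \<in> I \<Longrightarrow> tensor_lift R C (\<lambda>f m. f x \<odot>\<^bsub>C\<^esub> m) t = \<zero>\<^bsub>C\<^esub>) \<Longrightarrow> t = \<zero>\<^bsub>tensor_module R C C\<^esub>"
    and t: "s \<in> carrier (tensor_module R C C)" "t \<in> carrier (tensor_module R C C)"
    and ev: "\<And>x y. x \<in> I \<Longrightarrow> y \<in> I \<Longrightarrow> tensor_lift R (self_module R) (\<lambda>f g. f x \<otimes> g y) s =
      tensor_lift R (self_module R) (\<lambda>f g. f x \<otimes> g y) t"
  shows "s = t"
proof -
  interpret C: module R C by (rule C)
  interpret T: module R "tensor_module R C C" by (rule tensor_module_module[OF C C])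
  let ?d = "s \<ominus>\<^bsub>tensor_module R C C\<^esub> t"
  have d: "?d \<in> carrier (tensor_module R C C)" using t by simp
  have bil: "(\<lambda>f m. f x \<odot>\<^bsub>C\<^esub> m) \<in> bilinear_maps R C C C" if x: "x \<in> I" for x
  proof (rule bilinear_mapsI)
    show "(\<lambda>f. f x \<odot>\<^bsub>C\<^esub> m) \<in> linear_maps R C C" if "m \<in> carrier C" for m
      by (rule linear_maps_smult_left[OF C that ev_lin[OF x]])
    show "(\<lambda>m. f x \<odot>\<^bsub>C\<^esub> m) \<in> linear_maps R C C" if "f \<in> carrier C" for f
      by (rule linear_maps_smult[OF C linear_mapsD(1)[OF ev_lin[OF x] that, simplified] linear_maps_id])
  qed
  have bil2: "(\<lambda>f m. f x \<otimes> m y) \<in> bilinear_maps R C C (self_module R)" if x: "x \<in> I" and y: "y \<in> I" for x y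
  proof (rule bilinear_mapsI)
    show "(\<lambda>f. f x \<otimes> m y) \<in> linear_maps R C (self_module R)" if "m \<in> carrier C" for m
      using linear_maps_smult_left[OF self_module _ ev_lin[OF x]] linear_mapsD(1)[OF ev_lin[OF y] that] by simp
    show "(\<lambda>m. f x \<otimes> m y) \<in> linear_maps R C (self_module R)" if "f \<in> carrier C" for f
      using linear_maps_smult[OF self_module linear_mapsD(1)[OF ev_lin[OF x] that, simplified] ev_lin[OF y]] by simp
  qed
  have "?d = \<zero>\<^bsub>tensor_module R C C\<^esub>"
  proof (rule inj[OF d])
    fix x assume x: "x \<in> I"
    let ?e = "tensor_lift R C (\<lambda>f m. f x \<odot>\<^bsub>C\<^esub> m) ?d"
    have e: "?e \<in> carrier C" by (rule linear_mapsD(1)[OF tensor_lift_linear[OF C C C bil[OF x]] d])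
    show "?e = \<zero>\<^bsub>C\<^esub>"
    proof (rule extensionalityI)
      show "?e \<in> extensional I" "\<zero>\<^bsub>C\<^esub> \<in> extensional I" using e C.zero_closed ext by blast+
      fix y assume y: "y \<in> I"
      have "?e y = tensor_lift R (self_module R) (\<lambda>f m. (f x \<odot>\<^bsub>C\<^esub> m) y) ?d"
        by (rule linear_maps_tensor_lift[OF C C C self_module bil[OF x] ev_lin[OF y] d])
      also have "\<dots> = tensor_lift R (self_module R) (\<lambda>f m. f x \<otimes> m y) ?d"
        by (rule tensor_lift_cong[OF C C self_module bil2[OF x y] _ d, symmetric])
          (use linear_mapsD(3)[OF ev_lin[OF y]] linear_mapsD(1)[OF ev_lin[OF x]] in simp)
      also have "\<dots> = tensor_lift R (self_module R) (\<lambda>f m. f x \<otimes> m y) s \<ominus>\<^bsub>self_module R\<^esub>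
          tensor_lift R (self_module R) (\<lambda>f m. f x \<otimes> m y) t"
        by (rule linear_maps_minus[OF T.module_axioms self_module tensor_lift_linear[OF C C self_module bil2[OF x y]] t])
      also have "\<dots> = \<zero>"
        using ev[OF x y] linear_mapsD(1)[OF tensor_lift_linear[OF C C self_module bil2[OF x y]] t(2)]
          abelian_group.r_neg[OF module.axioms(2)[OF self_module]] by (simp add: a_minus_def)
      also have "\<zero> = \<zero>\<^bsub>C\<^esub> y"
        using linear_maps_zero[OF C self_module ev_lin[OF y]] by simp
      finally show "?e y = \<zero>\<^bsub>C\<^esub> y" .
    qed
  qed
  moreover have "s = ?d \<oplus>\<^bsub>tensor_module R C C\<^esub> t"
    using t by (simp add: a_minus_def T.a_assoc T.l_neg)
  ultimately show "s = t" using t by simp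
qed

end

section \<open>The comultiplication of the finite dual\<close>

lemma (in module) finitely_generated_image:
  assumes N: "module R N" and \<phi>: "\<phi> \<in> linear_maps R N M" and fg: "finitely_generated_submodule R N K"
  shows "finitely_generated_submodule R M (\<phi> ` K)"
proof -
  obtain S where S: "finite S" "S \<subseteq> carrier N" "K = submodule_span R N S"
    using fg by (auto simp: finitely_generated_submodule_def)
  have SM: "\<phi> ` S \<subseteq> carrier M" using S(2) linear_mapsD(1)[OF \<phi>] by blast
  note K = module.submodule_span_is_submodule[OF N S(2), folded S(3)]
  have "submodule_span R M (\<phi> ` S) \<subseteq> \<phi> ` K"
    by (rule submodule_span_sub[OF submodule_image[OF N \<phi> K]])
      (use submodule_span_inc[of S R N] S(3) in auto)
  moreover have "S \<subseteq> {x \<in> carrier N. \<phi> x \<in> submodule_span R M (\<phi> ` S)}"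
    using S(2) submodule_span_inc[of "\<phi> ` S" R M] by blast
  then have "K \<subseteq> {x \<in> carrier N. \<phi> x \<in> submodule_span R M (\<phi> ` S)}"
    unfolding S(3)
    by (rule submodule_span_sub[OF submodule_vimage[OF N \<phi> submodule_span_is_submodule[OF SM]]])
  ultimately have "\<phi> ` K = submodule_span R M (\<phi> ` S)" by blast
  then show ?thesis
    unfolding finitely_generated_submodule_def using SM S(1) by blast
qed

context assoc_algebra
begin

abbreviation "fun_space \<equiv> function_module R (carrier M)"

lemma linear_right_mult: "x \<in> carrier M \<Longrightarrow> (\<lambda>y. y \<otimes>\<^bsub>M\<^esub> x) \<in> linear_maps R M M"
  by (rule linear_mapsI) (simp_all add: l_distr smult_mult_left)

lemma linear_left_mult: "x \<in> carrier M \<Longrightarrow> (\<lambda>y. x \<otimes>\<^bsub>M\<^esub> y) \<in> linear_maps R M M"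
  by (rule linear_mapsI) (simp_all add: r_distr smult_mult_right)

lemma mult_bilinear: "(\<lambda>x y. x \<otimes>\<^bsub>M\<^esub> y) \<in> bilinear_maps R M M M"
  by (rule bilinear_mapsI) (simp_all add: linear_right_mult linear_left_mult)

lemma translate_apply: "k \<in> carrier M \<Longrightarrow> translate M h f k = f (k \<otimes>\<^bsub>M\<^esub> h)"
  by (simp add: translate_def)

lemma translate_linear:
  assumes f: "f \<in> linear_maps R M (self_module R)"
  shows "(\<lambda>h. translate M h f) \<in> linear_maps R M fun_space"
proof -
  note f = linear_mapsD[OF f, simplified]
  show ?thesis
    by (rule linear_mapsI)
      (auto simp: translate_def R.function_module_simps f r_distr smult_mult_right fun_eq_iff)
qed

lemma left_translate_linear:
  assumes k: "k \<in> carrier M"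
  shows "(\<lambda>f. \<lambda>h\<in>carrier M. f (k \<otimes>\<^bsub>M\<^esub> h)) \<in> linear_maps R fun_space fun_space"
  by (rule linear_mapsI) (use k in \<open>auto simp: function_module_simps fun_eq_iff\<close>)

lemma finite_dual_setD:
  assumes "f \<in> finite_dual_set R M"
  shows "f \<in> linear_maps R M (self_module R)" "f \<in> extensional (carrier M)"
    "finitely_generated_submodule R fun_space ((\<lambda>h. translate M h f) ` carrier M)"
  using assms by (simp_all add: finite_dual_set_def)

lemma finite_dual_setI:
  assumes "f \<in> linear_maps R M (self_module R)" "f \<in> extensional (carrier M)"
    "finitely_generated_submodule R fun_space ((\<lambda>h. translate M h f) ` carrier M)"
  shows "f \<in> finite_dual_set R M"
  using assms by (simp add: finite_dual_set_def)

text \<open>The right translates of a right translate of \<open>f\<close> are again right translates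
  of \<open>f\<close>. They form a submodule of a finitely generated module, which is finitely
  generated over a noetherian ring.\<close>

lemma finite_dual_translate:
  assumes noeth: "noetherian_ring R" and f: "f \<in> finite_dual_set R M" and h: "h \<in> carrier M"
  shows "translate M h f \<in> finite_dual_set R M"
proof (rule finite_dual_setI)
  note F = R.function_module_module[of "carrier M"]
  note f' = finite_dual_setD[OF f]
  have "(\<lambda>k. f (k \<otimes>\<^bsub>M\<^esub> h)) \<in> linear_maps R M (self_module R)"
    by (rule linear_maps_comp[OF f'(1) linear_right_mult[OF h]])
  then show "translate M h f \<in> linear_maps R M (self_module R)"
    by (rule linear_maps_eqI[OF module_axioms]) (simp add: translate_apply)
  show "translate M h f \<in> extensional (carrier M)" by (simp add: translate_def)
  obtain S where S: "finite S" "S \<subseteq> carrier fun_space"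
    "(\<lambda>h. translate M h f) ` carrier M = submodule_span R fun_space S"
    using f'(3) by (auto simp: finitely_generated_submodule_def)
  have eq: "translate M k (translate M h f) = translate M (k \<otimes>\<^bsub>M\<^esub> h) f" if "k \<in> carrier M" for k
    using that h by (auto simp: translate_def fun_eq_iff m_assoc)
  have im: "(\<lambda>k. translate M k (translate M h f)) ` carrier M = (\<lambda>k. translate M (k \<otimes>\<^bsub>M\<^esub> h) f) ` carrier M"
    by (rule image_cong) (simp_all add: eq)
  have "submodule ((\<lambda>k. translate M (k \<otimes>\<^bsub>M\<^esub> h) f) ` carrier M) R fun_space"
    by (rule module.submodule_image[OF F module_axioms linear_maps_comp[OF translate_linear[OF f'(1)] linear_right_mult[OF h]]
          carrier_is_submodule])
  moreover have "(\<lambda>k. translate M (k \<otimes>\<^bsub>M\<^esub> h) f) ` carrier M \<subseteq> submodule_span R fun_space S"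
    unfolding S(3)[symmetric] using h by auto
  ultimately show "finitely_generated_submodule R fun_space ((\<lambda>k. translate M k (translate M h f)) ` carrier M)"
    unfolding im by (rule R.noetherian_submodule_fg[OF noeth F S(1,2)])
qed

text \<open>Left and right translations commute, so the right translates of the new functional are
  the image of those of \<open>f\<close> under a single linear map.\<close>

lemma finite_dual_left_translate:
  assumes f: "f \<in> finite_dual_set R M" and k: "k \<in> carrier M"
  shows "(\<lambda>h\<in>carrier M. f (k \<otimes>\<^bsub>M\<^esub> h)) \<in> finite_dual_set R M"
proof (rule finite_dual_setI)
  note F = R.function_module_module[of "carrier M"]
  note f' = finite_dual_setD[OF f]
  have "(\<lambda>h. f (k \<otimes>\<^bsub>M\<^esub> h)) \<in> linear_maps R M (self_module R)"
    by (rule linear_maps_comp[OF f'(1) linear_left_mult[OF k]])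
  then show "(\<lambda>h\<in>carrier M. f (k \<otimes>\<^bsub>M\<^esub> h)) \<in> linear_maps R M (self_module R)"
    by (rule linear_maps_eqI[OF module_axioms]) simp
  have "translate M h (\<lambda>h\<in>carrier M. f (k \<otimes>\<^bsub>M\<^esub> h)) = (\<lambda>m\<in>carrier M. translate M h f (k \<otimes>\<^bsub>M\<^esub> m))"
    if "h \<in> carrier M" for h
    using that k by (auto simp: translate_def fun_eq_iff m_assoc)
  then have "(\<lambda>h. translate M h (\<lambda>h\<in>carrier M. f (k \<otimes>\<^bsub>M\<^esub> h))) ` carrier M =
      (\<lambda>g. \<lambda>m\<in>carrier M. g (k \<otimes>\<^bsub>M\<^esub> m)) ` ((\<lambda>h. translate M h f) ` carrier M)"
    unfolding image_image by (intro image_cong) simp_all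
  then show "finitely_generated_submodule R fun_space
      ((\<lambda>h. translate M h (\<lambda>h\<in>carrier M. f (k \<otimes>\<^bsub>M\<^esub> h))) ` carrier M)"
    using module.finitely_generated_image[OF F F left_translate_linear[OF k] f'(3)] by simp
qed simp

text \<open>The right translates of \<open>f\<close> are combinations of finitely many \<open>s \<in> S \<subseteq> H\<^sup>\<circ>\<close>, which gives
  \<open>f (k h) = \<Sum>s k c\<^sub>s h\<close> with functions \<open>c\<^sub>s\<close>. All left translates of \<open>f\<close> lie in \<open>H\<^sup>\<circ>\<close>, so that
  \<open>\<Sum>s \<otimes> c\<^sub>s\<close> vanishes in \<open>H\<^sup>\<circ> \<otimes> R\<^sup>H/H\<^sup>\<circ>\<close>, and the \<open>c\<^sub>s\<close> can be chosen in \<open>H\<^sup>\<circ>\<close>.\<close>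

lemma finite_dual_comult_exists:
  assumes noeth: "noetherian_ring R" and pure: "pure_submodule R (finite_dual_set R M) fun_space"
    and D_def: "D = fun_space\<lparr>carrier := finite_dual_set R M\<rparr>"
    and f: "f \<in> finite_dual_set R M"
  shows "\<exists>t\<in>carrier (tensor_module R D D). \<forall>h\<in>carrier M. \<forall>k\<in>carrier M.
    f (h \<otimes>\<^bsub>M\<^esub> k) = tensor_lift R (self_module R) (\<lambda>f1 f2. f1 h \<otimes>\<^bsub>R\<^esub> f2 k) t"
proof -
  note F = R.function_module_module[of "carrier M"]
  interpret F: module R fun_space by (rule F)
  let ?HD = "finite_dual_set R M"
  have sub: "submodule ?HD R fun_space" using pure by (simp add: pure_submodule_def)
  have D: "module R D" unfolding D_def by (rule submodule.submodule_is_module[OF sub F])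
  interpret D: module R D by (rule D)
  have Dc: "carrier D = ?HD" "add D = add fun_space" "smult D = smult fun_space" by (simp_all add: D_def)
  have DF: "(\<lambda>x. x) \<in> linear_maps R D fun_space"
    by (rule linear_mapsI) (use F.submoduleE(1)[OF sub] in \<open>auto simp: D_def\<close>)
  note evF = R.function_module_eval
  have evD: "(\<lambda>f. f h) \<in> linear_maps R D (self_module R)" if "h \<in> carrier M" for h
    using linear_maps_comp[OF evF[OF that] DF] .
  let ?X = "quotient_module R fun_space ?HD"
  have X: "module R ?X" by (rule F.quotient_is_module[OF sub])
  interpret X: module R ?X by (rule X)
  let ?cls = "\<lambda>g. ?HD +>\<^bsub>fun_space\<^esub> g"
  have cls: "?cls \<in> linear_maps R fun_space ?X" by (rule F.quotient_proj_linear[OF sub])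
  have cls0: "?cls g = \<zero>\<^bsub>?X\<^esub>" if "g \<in> ?HD" for g
  proof -
    interpret K: abelian_subgroup ?HD fun_space by (rule F.submodule_abelian_subgroup[OF sub])
    show ?thesis using K.a_rcos_const[OF that] F.quotient_simps(1)[OF sub] by simp
  qed
  have bil: "(\<lambda>f1 f2. f1 h \<odot>\<^bsub>P\<^esub> f2) \<in> bilinear_maps R D P P" if "h \<in> carrier M" "module R P"
    for h and P :: "('a, 'q, 'w) module_scheme"
    using R.bilinear_maps_comp[OF R.function_eval_bilinear[OF that(2,1)] DF linear_maps_id] .
  obtain S where S: "finite S" "S \<subseteq> carrier fun_space"
    "(\<lambda>h. translate M h f) ` carrier M = submodule_span R fun_space S"
    using finite_dual_setD(3)[OF f] by (auto simp: finitely_generated_submodule_def)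
  have SD: "S \<subseteq> ?HD"
  proof
    fix s assume "s \<in> S"
    then have "s \<in> (\<lambda>h. translate M h f) ` carrier M"
      unfolding S(3) by (rule subsetD[OF submodule_span_inc])
    then obtain h where h: "h \<in> carrier M" "s = translate M h f" by blast
    show "s \<in> ?HD" unfolding h(2) by (rule finite_dual_translate[OF noeth f h(1)])
  qed
  \<comment> \<open>Coefficients of the translate by h in the generators \<open>S\<close>. They are
    chosen separately for each h, so as functions of h they lie only in \<open>R\<^sup>H\<close> and
    need not even be linear.\<close>
  define c where "c h = (SOME c. c \<in> S \<rightarrow> carrier R \<and> translate M h f = (\<Oplus>\<^bsub>fun_space\<^esub>s\<in>S. c s \<odot>\<^bsub>fun_space\<^esub> s))" for h
  have c': "c h \<in> S \<rightarrow> carrier R \<and> translate M h f = (\<Oplus>\<^bsub>fun_space\<^esub>s\<in>S. c h s \<odot>\<^bsub>fun_space\<^esub> s)" if "h \<in> carrier M" for h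
  proof -
    have "translate M h f \<in> submodule_span R fun_space S" unfolding S(3)[symmetric] using that by (rule imageI)
    from F.finite_submodule_span[OF S(1,2) this] show ?thesis unfolding c_def by (rule someI_ex)
  qed
  note c = c'[THEN conjunct1] c'[THEN conjunct2]
  define C where "C s = (\<lambda>h\<in>carrier M. c h s)" for s
  have C: "C s \<in> carrier fun_space" if "s \<in> S" for s
    using funcset_mem[OF c(1) that] by (auto simp: C_def function_module_def)
  have DFm: "module R (tensor_module R D fun_space)" by (rule R.tensor_module_module[OF D F])
  interpret DF: module R "tensor_module R D fun_space" by (rule DFm)
  \<comment> \<open>A tensor that represents the function (h, k) \<mapsto> f(h k) but has its right
    factors in \<open>R\<^sup>H\<close>; the rest of the proof replaces it by one in D \<otimes>
    D.\<close>
  define t where "t = (\<Oplus>\<^bsub>tensor_module R D fun_space\<^esub>s\<in>S. tensor R D fun_space s (C s))"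
  have sC: "(\<lambda>s. tensor R D fun_space s (C s)) \<in> S \<rightarrow> carrier (tensor_module R D fun_space)"
    by (rule Pi_I, rule R.tensor_closed[OF D F _ C]) (use SD Dc in auto)
  have t: "t \<in> carrier (tensor_module R D fun_space)" unfolding t_def by (rule DF.finsum_closed[OF sC])
  have bilt: "(\<lambda>d g. d h \<otimes>\<^bsub>R\<^esub> g k) \<in> bilinear_maps R D fun_space (self_module R)"
    if "h \<in> carrier M" "k \<in> carrier M" for h k
    using R.bilinear_maps_comp[OF bil[OF that(1) R.self_module] linear_maps_id evF[OF that(2)]] by simp
  have ft: "tensor_lift R (self_module R) (\<lambda>d g. d h \<otimes>\<^bsub>R\<^esub> g k) t = f (h \<otimes>\<^bsub>M\<^esub> k)"
    if h: "h \<in> carrier M" and k: "k \<in> carrier M" for h k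
  proof -
    interpret S: module R "self_module R" by (rule R.self_module)
    have cs: "c k s \<in> carrier R" if "s \<in> S" for s using c(1)[OF k] that by auto
    have sh: "s h \<in> carrier R" if "s \<in> S" for s
      using linear_mapsD(1)[OF evF[OF h]] S(2) that by auto
    have "tensor_lift R (self_module R) (\<lambda>d g. d h \<otimes>\<^bsub>R\<^esub> g k) t =
      (\<Oplus>\<^bsub>self_module R\<^esub>s\<in>S. tensor_lift R (self_module R) (\<lambda>d g. d h \<otimes>\<^bsub>R\<^esub> g k) (tensor R D fun_space s (C s)))"
      unfolding t_def
      by (rule linear_maps_finsum[OF DFm R.self_module R.tensor_lift_linear[OF D F R.self_module bilt[OF h k]] S(1) sC])
    also have "\<dots> = (\<Oplus>\<^bsub>self_module R\<^esub>s\<in>S. (c k s \<odot>\<^bsub>fun_space\<^esub> s) h)"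
    proof (rule S.finsum_cong')
      fix s assume s: "s \<in> S"
      have "s \<in> carrier D" using s SD Dc by auto
      then have "tensor_lift R (self_module R) (\<lambda>d g. d h \<otimes>\<^bsub>R\<^esub> g k) (tensor R D fun_space s (C s)) = s h \<otimes>\<^bsub>R\<^esub> C s k"
        by (rule R.tensor_lift_tensor[OF D F R.self_module bilt[OF h k] _ C[OF s]])
      then show "tensor_lift R (self_module R) (\<lambda>d g. d h \<otimes>\<^bsub>R\<^esub> g k) (tensor R D fun_space s (C s)) = (c k s \<odot>\<^bsub>fun_space\<^esub> s) h"
        using R.m_comm[OF cs[OF s] sh[OF s]] h k by (simp add: C_def R.function_module_simps)
    qed (use cs sh h in \<open>auto simp: R.function_module_simps\<close>)
    also have "\<dots> = (\<Oplus>\<^bsub>fun_space\<^esub>s\<in>S. c k s \<odot>\<^bsub>fun_space\<^esub> s) h"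
      by (rule linear_maps_finsum[OF F R.self_module evF[OF h] S(1), symmetric])
        (use cs S(2) in \<open>auto intro!: F.smult_closed\<close>)
    also have "\<dots> = f (h \<otimes>\<^bsub>M\<^esub> k)"
      using c(2)[OF k] h by (simp add: translate_apply flip: c(2)[OF k])
    finally show ?thesis .
  qed
  define u where "u = tensor_map R D ?X (\<lambda>x. x) ?cls t"
  have u: "u \<in> carrier (tensor_module R D ?X)"
    unfolding u_def by (rule linear_mapsD(1)[OF R.tensor_map_linear[OF D F D X linear_maps_id cls] t])
  have u0: "u = \<zero>\<^bsub>tensor_module R D ?X\<^esub>"
  proof (rule R.function_submodule_tensor_inj[OF noeth pure X Dc u])
    fix h assume h: "h \<in> carrier M"
    let ?g = "tensor_lift R fun_space (\<lambda>d g. d h \<odot>\<^bsub>fun_space\<^esub> g) t"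
    have gF: "?g \<in> carrier fun_space" by (rule linear_mapsD(1)[OF R.tensor_lift_linear[OF D F F bil[OF h F]] t])
    have "?g = (\<lambda>k\<in>carrier M. f (h \<otimes>\<^bsub>M\<^esub> k))"
    proof (rule extensionalityI)
      show "?g \<in> extensional (carrier M)" using gF by (auto simp: R.function_module_simps PiE_def)
      fix k assume k: "k \<in> carrier M"
      have "?g k = tensor_lift R (self_module R) (\<lambda>d g. (d h \<odot>\<^bsub>fun_space\<^esub> g) k) t"
        by (rule linear_maps_tensor_lift[OF D F F R.self_module bil[OF h F] evF[OF k] t])
      also have "\<dots> = f (h \<otimes>\<^bsub>M\<^esub> k)"
        using ft[OF h k] k by (simp add: R.function_module_simps)
      finally show "?g k = (\<lambda>k\<in>carrier M. f (h \<otimes>\<^bsub>M\<^esub> k)) k" using k by simp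
    qed simp
    then have g: "?g \<in> ?HD" using finite_dual_left_translate[OF f h] by simp
    have "tensor_lift R ?X (\<lambda>d x. d h \<odot>\<^bsub>?X\<^esub> x) u = tensor_lift R ?X (\<lambda>d g. d h \<odot>\<^bsub>?X\<^esub> ?cls g) t"
      unfolding u_def by (rule R.tensor_lift_tensor_map[OF D F D X X linear_maps_id cls bil[OF h X] t])
    also have "\<dots> = tensor_lift R ?X (\<lambda>d g. ?cls (d h \<odot>\<^bsub>fun_space\<^esub> g)) t"
      by (rule R.tensor_lift_cong[OF D F X R.bilinear_maps_comp[OF bil[OF h X] linear_maps_id cls] _ t])
        (use linear_mapsD(3)[OF cls] linear_mapsD(1)[OF evD[OF h]] in simp)
    also have "\<dots> = ?cls ?g"
      by (rule linear_maps_tensor_lift[OF D F F X bil[OF h F] cls t, symmetric])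
    also have "\<dots> = \<zero>\<^bsub>?X\<^esub>" by (rule cls0[OF g])
    finally show "tensor_lift R ?X (\<lambda>d x. d h \<odot>\<^bsub>?X\<^esub> x) u = \<zero>\<^bsub>?X\<^esub>" .
  qed
  \<comment> \<open>Instead of exactness of D \<otimes> D \<rightarrow> D \<otimes>
    \<open>R\<^sup>H\<close> \<rightarrow> D \<otimes> X, only its shadow in the functions on H
    \<times> H is used. \<open>W\<close> is the image of D \<otimes> D there. Modulo
    \<open>W\<close> the pairing \<open>pr\<close> kills right factors in
    \<open>H\<^sup>\<circ>\<close>, so it factors through the quotient X, and u = 0 forces the
    function represented by \<open>t\<close> into \<open>W\<close>.\<close>
  let ?G = "function_module R (carrier M \<times> carrier M)"
  note G = R.function_module_module[of "carrier M \<times> carrier M"]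
  interpret G: module R ?G by (rule G)
  define pr where "pr d g = (\<lambda>(h, k)\<in>carrier M \<times> carrier M. d h \<otimes>\<^bsub>R\<^esub> g k)" for d g :: "'c \<Rightarrow> 'a"
  have prF: "pr \<in> bilinear_maps R fun_space fun_space ?G"
    by (intro bilinear_mapsI linear_mapsI)
      (auto simp: pr_def R.function_module_simps fun_eq_iff R.l_distr R.r_distr R.m_ac PiE_def Pi_def)
  note prDF = R.bilinear_maps_comp[OF prF DF linear_maps_id]
  note prDD = R.bilinear_maps_comp[OF prF DF DF]
  have DDm: "module R (tensor_module R D D)" by (rule R.tensor_module_module[OF D D])
  define W where "W = tensor_lift R ?G pr ` carrier (tensor_module R D D)"
  have W: "submodule W R ?G"
    unfolding W_def
    by (rule G.submodule_image[OF DDm R.tensor_lift_linear[OF D D G prDD] module.carrier_is_submodule[OF DDm]])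
  let ?Q = "quotient_module R ?G W"
  have Q: "module R ?Q" by (rule G.quotient_is_module[OF W])
  interpret Q: module R ?Q by (rule Q)
  let ?q = "\<lambda>g. W +>\<^bsub>?G\<^esub> g"
  have q: "?q \<in> linear_maps R ?G ?Q" by (rule G.quotient_proj_linear[OF W])
  interpret W: abelian_subgroup W ?G by (rule G.submodule_abelian_subgroup[OF W])
  define \<phi> where "\<phi> d g = ?q (pr d g)" for d g
  have \<phi>1: "\<phi> d \<in> linear_maps R fun_space ?Q" if "d \<in> carrier D" for d
    unfolding \<phi>_def by (rule linear_maps_comp[OF q bilinear_mapsD(1)[OF prDF that]])
  have \<phi>2: "(\<lambda>d. \<phi> d g) \<in> linear_maps R D ?Q" if "g \<in> carrier fun_space" for g
    unfolding \<phi>_def by (rule linear_maps_comp[OF q bilinear_mapsD(2)[OF prDF that]])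
  have \<phi>0: "\<phi> d g = \<zero>\<^bsub>?Q\<^esub>" if d: "d \<in> carrier D" and g: "g \<in> ?HD" for d g
  proof -
    have g': "g \<in> carrier D" using g Dc by simp
    have "pr d g = tensor_lift R ?G pr (tensor R D D d g)"
      by (rule R.tensor_lift_tensor[OF D D G prDD d g', symmetric])
    then have "pr d g \<in> W" unfolding W_def using R.tensor_closed[OF D D d g'] by blast
    then show ?thesis unfolding \<phi>_def using W.a_rcos_const G.quotient_simps(1)[OF W] by simp
  qed
  have ql1: "quotient_lift (\<phi> d) (?cls g) = \<phi> d g" if "d \<in> carrier D" "g \<in> carrier fun_space" for d g
    by (rule F.quotient_lift(1)[OF sub Q \<phi>1[OF that(1)] \<phi>0[OF that(1)] that(2)])
  have ql2: "quotient_lift (\<phi> d) \<in> linear_maps R ?X ?Q" if "d \<in> carrier D" for d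
    by (rule F.quotient_lift(2)[OF sub Q \<phi>1[OF that] \<phi>0[OF that]])
  have bilQ: "(\<lambda>d. quotient_lift (\<phi> d)) \<in> bilinear_maps R D ?X ?Q"
  proof (rule bilinear_mapsI)
    show "quotient_lift (\<phi> d) \<in> linear_maps R ?X ?Q" if "d \<in> carrier D" for d
      by (rule ql2[OF that])
    show "(\<lambda>d. quotient_lift (\<phi> d) x) \<in> linear_maps R D ?Q" if x: "x \<in> carrier ?X" for x
    proof -
      obtain g where g: "g \<in> carrier fun_space" "x = ?cls g" using x F.quotient_simps(5)[OF sub] by blast
      show ?thesis
        unfolding g(2) by (rule linear_maps_eqI[OF D \<phi>2[OF g(1)]]) (rule ql1[OF _ g(1), symmetric])
    qed
  qed
  have "?q (tensor_lift R ?G pr t) = tensor_lift R ?Q (\<lambda>d g. ?q (pr d g)) t"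
    by (rule linear_maps_tensor_lift[OF D F G Q prDF q t])
  also have "\<dots> = tensor_lift R ?Q (\<lambda>d g. quotient_lift (\<phi> d) (?cls g)) t"
    by (rule R.tensor_lift_cong[OF D F Q _ _ t, symmetric, OF R.bilinear_maps_comp[OF bilQ linear_maps_id cls]])
      (simp add: ql1 \<phi>_def)
  also have "\<dots> = tensor_lift R ?Q (\<lambda>d. quotient_lift (\<phi> d)) u"
    unfolding u_def by (rule R.tensor_lift_tensor_map[OF D F D X Q linear_maps_id cls bilQ t, symmetric])
  also have "\<dots> = \<zero>\<^bsub>?Q\<^esub>"
    unfolding u0 by (rule linear_maps_zero[OF R.tensor_module_module[OF D X] Q R.tensor_lift_linear[OF D X Q bilQ]])
  finally have "?q (tensor_lift R ?G pr t) = W" by (simp add: G.quotient_simps(1)[OF W])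
  moreover have ptG: "tensor_lift R ?G pr t \<in> carrier ?G"
    by (rule linear_mapsD(1)[OF R.tensor_lift_linear[OF D F G prDF] t])
  ultimately have "tensor_lift R ?G pr t \<in> W" using W.a_rcos_self[OF ptG] by simp
  then obtain s where s: "s \<in> carrier (tensor_module R D D)" "tensor_lift R ?G pr t = tensor_lift R ?G pr s"
    unfolding W_def by blast
  have pr_ev: "tensor_lift R ?G pr v (h, k) = tensor_lift R (self_module R) (\<lambda>d g. d h \<otimes>\<^bsub>R\<^esub> g k) v"
    if "h \<in> carrier M" "k \<in> carrier M" "module R Y" "pr \<in> bilinear_maps R D Y ?G" "v \<in> carrier (tensor_module R D Y)"
    for h k v and Y :: "('a, 'c \<Rightarrow> 'a, 'w) module_scheme"
    using linear_maps_tensor_lift[OF D that(3) G R.self_module that(4) evF[of "(h, k)"] that(5)] that(1,2)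
    by (simp add: pr_def)
  have "f (h \<otimes>\<^bsub>M\<^esub> k) = tensor_lift R (self_module R) (\<lambda>f1 f2. f1 h \<otimes>\<^bsub>R\<^esub> f2 k) s"
    if "h \<in> carrier M" "k \<in> carrier M" for h k
    using pr_ev[OF that D prDD s(1)] pr_ev[OF that F prDF t] ft[OF that] s(2) by simp
  then show ?thesis using s(1) by blast
qed

end

section \<open>Sweedler calculus\<close>

lemma bilinear_maps_linear:
  "\<beta> \<in> bilinear_maps R M N P \<Longrightarrow> \<phi> \<in> linear_maps R P Q \<Longrightarrow> (\<lambda>m n. \<phi> (\<beta> m n)) \<in> bilinear_maps R M N Q"
  by (rule bilinear_mapsI; rule linear_maps_comp, assumption, erule (1) bilinear_mapsD)

context cring
begin

section \<open>Trilinear maps, reassociation and coassociativity\<close>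

definition trilinear_maps ::
  "('a, 'l, 'x) module_scheme \<Rightarrow> ('a, 'm, 'y) module_scheme \<Rightarrow> ('a, 'n, 'z) module_scheme
    \<Rightarrow> ('a, 'p, 'w) module_scheme \<Rightarrow> ('l \<Rightarrow> 'm \<Rightarrow> 'n \<Rightarrow> 'p) set"
where
  "trilinear_maps L M N P = {\<tau>. (\<forall>l\<in>carrier L. \<tau> l \<in> bilinear_maps R M N P) \<and>
     (\<forall>m\<in>carrier M. \<forall>n\<in>carrier N. (\<lambda>l. \<tau> l m n) \<in> linear_maps R L P)}"

lemma trilinear_mapsI:
  assumes "\<And>l. l \<in> carrier L \<Longrightarrow> \<tau> l \<in> bilinear_maps R M N P"
    and "\<And>m n. m \<in> carrier M \<Longrightarrow> n \<in> carrier N \<Longrightarrow> (\<lambda>l. \<tau> l m n) \<in> linear_maps R L P"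
  shows "\<tau> \<in> trilinear_maps L M N P"
  using assms by (simp add: trilinear_maps_def)

lemma trilinear_mapsD:
  assumes "\<tau> \<in> trilinear_maps L M N P"
  shows "\<And>l. l \<in> carrier L \<Longrightarrow> \<tau> l \<in> bilinear_maps R M N P"
    and "\<And>m n. m \<in> carrier M \<Longrightarrow> n \<in> carrier N \<Longrightarrow> (\<lambda>l. \<tau> l m n) \<in> linear_maps R L P"
  using assms by (simp_all add: trilinear_maps_def)

lemma trilinear_lift:
  assumes L: "module R L" and M: "module R M" and N: "module R N" and P: "module R P"
    and \<tau>: "\<tau> \<in> trilinear_maps L M N P"
  shows "n \<in> carrier N \<Longrightarrow> (\<lambda>l m. \<tau> l m n) \<in> bilinear_maps R L M P"
    and "(\<lambda>u n. tensor_lift R P (\<lambda>l m. \<tau> l m n) u) \<in> bilinear_maps R (tensor_module R L M) N P"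
    and "(\<lambda>l. tensor_lift R P (\<tau> l)) \<in> bilinear_maps R L (tensor_module R M N) P"
proof -
  note \<tau>1 = trilinear_mapsD(1)[OF \<tau>] and \<tau>2 = trilinear_mapsD(2)[OF \<tau>]
  have a: "(\<lambda>l m. \<tau> l m n) \<in> bilinear_maps R L M P" if "n \<in> carrier N" for n
    by (rule bilinear_mapsI[OF bilinear_mapsD(2)[OF \<tau>1 that] \<tau>2[OF _ that]])
  then show "n \<in> carrier N \<Longrightarrow> (\<lambda>l m. \<tau> l m n) \<in> bilinear_maps R L M P" .
  have b: "\<tau> l m \<in> linear_maps R N P" if "l \<in> carrier L" "m \<in> carrier M" for l m
    by (rule bilinear_mapsD(1)[OF \<tau>1[OF that(1)] that(2)])
  show "(\<lambda>u n. tensor_lift R P (\<lambda>l m. \<tau> l m n) u) \<in> bilinear_maps R (tensor_module R L M) N P"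
  proof (rule bilinear_mapsI)
    show "(\<lambda>n. tensor_lift R P (\<lambda>l m. \<tau> l m n) u) \<in> linear_maps R N P" if u: "u \<in> carrier (tensor_module R L M)" for u
      by (rule tensor_lift_linear_param[OF N L M P a b u])
    show "tensor_lift R P (\<lambda>l m. \<tau> l m n) \<in> linear_maps R (tensor_module R L M) P" if n: "n \<in> carrier N" for n
      by (rule tensor_lift_linear[OF L M P a[OF n]])
  qed
  show "(\<lambda>l. tensor_lift R P (\<tau> l)) \<in> bilinear_maps R L (tensor_module R M N) P"
    by (rule bilinear_mapsI) (rule tensor_lift_linear[OF M N P \<tau>1] tensor_lift_linear_param[OF L M N P \<tau>1 \<tau>2]; assumption)+
qed

lemma tensor_trilinear:
  assumes L: "module R L" and M: "module R M" and N: "module R N"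
  shows "(\<lambda>l m n. tensor R L (tensor_module R M N) l (tensor R M N m n))
      \<in> trilinear_maps L M N (tensor_module R L (tensor_module R M N))"
proof (rule trilinear_mapsI)
  note T = tensor_bilinear[OF L tensor_module_module[OF M N]]
  show "l \<in> carrier L \<Longrightarrow> (\<lambda>m n. tensor R L (tensor_module R M N) l (tensor R M N m n))
      \<in> bilinear_maps R M N (tensor_module R L (tensor_module R M N))" for l
    by (rule bilinear_maps_linear[OF tensor_bilinear[OF M N] bilinear_mapsD(1)[OF T]])
  show "m \<in> carrier M \<Longrightarrow> n \<in> carrier N \<Longrightarrow> (\<lambda>l. tensor R L (tensor_module R M N) l (tensor R M N m n))
      \<in> linear_maps R L (tensor_module R L (tensor_module R M N))" for m n
    by (rule bilinear_mapsD(2)[OF T tensor_closed[OF M N]])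
qed

lemma tensor_assoc:
  assumes L: "module R L" and M: "module R M" and N: "module R N"
  shows "tensor_assoc R L M N \<in> linear_maps R (tensor_module R (tensor_module R L M) N) (tensor_module R L (tensor_module R M N))"
    and "l \<in> carrier L \<Longrightarrow> m \<in> carrier M \<Longrightarrow> n \<in> carrier N \<Longrightarrow>
      tensor_assoc R L M N (tensor R (tensor_module R L M) N (tensor R L M l m) n) =
      tensor R L (tensor_module R M N) l (tensor R M N m n)"
proof -
  note LM = tensor_module_module[OF L M]
  note T = tensor_module_module[OF L tensor_module_module[OF M N]]
  note tri = trilinear_lift[OF L M N T tensor_trilinear[OF L M N]]
  show "tensor_assoc R L M N \<in> linear_maps R (tensor_module R (tensor_module R L M) N) (tensor_module R L (tensor_module R M N))"
    unfolding tensor_assoc_def Let_def by (rule tensor_lift_linear[OF LM N T tri(2)])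
  assume lmn: "l \<in> carrier L" "m \<in> carrier M" "n \<in> carrier N"
  show "tensor_assoc R L M N (tensor R (tensor_module R L M) N (tensor R L M l m) n) =
      tensor R L (tensor_module R M N) l (tensor R M N m n)"
    unfolding tensor_assoc_def Let_def
      tensor_lift_tensor[OF LM N T tri(2) tensor_closed[OF L M lmn(1,2)] lmn(3)]
    by (rule tensor_lift_tensor[OF L M T tri(1)[OF lmn(3)] lmn(1,2)])
qed

lemma tensor_assoc_ext:
  assumes L: "module R L" and M: "module R M" and N: "module R N" and P: "module R P"
    and f: "f \<in> linear_maps R (tensor_module R (tensor_module R L M) N) P"
    and g: "g \<in> linear_maps R (tensor_module R (tensor_module R L M) N) P"
    and eq: "\<And>l m n. l \<in> carrier L \<Longrightarrow> m \<in> carrier M \<Longrightarrow> n \<in> carrier N \<Longrightarrow>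
      f (tensor R (tensor_module R L M) N (tensor R L M l m) n) = g (tensor R (tensor_module R L M) N (tensor R L M l m) n)"
    and t: "t \<in> carrier (tensor_module R (tensor_module R L M) N)"
  shows "f t = g t"
proof (rule tensor_ext[OF tensor_module_module[OF L M] N P f g _ t])
  fix u n assume u: "u \<in> carrier (tensor_module R L M)" and n: "n \<in> carrier N"
  have lin: "(\<lambda>u. tensor R (tensor_module R L M) N u n) \<in> linear_maps R (tensor_module R L M) (tensor_module R (tensor_module R L M) N)"
    by (rule bilinear_mapsD(2)[OF tensor_bilinear[OF tensor_module_module[OF L M] N] n])
  show "f (tensor R (tensor_module R L M) N u n) = g (tensor R (tensor_module R L M) N u n)"
    by (rule tensor_ext[OF L M P linear_maps_comp[OF f lin] linear_maps_comp[OF g lin] eq[OF _ _ n] u])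
qed

lemma tensor_assoc_lift:
  assumes L: "module R L" and M: "module R M" and N: "module R N" and P: "module R P"
    and \<tau>: "\<tau> \<in> trilinear_maps L M N P"
    and t: "t \<in> carrier (tensor_module R (tensor_module R L M) N)"
  shows "tensor_lift R P (\<lambda>l. tensor_lift R P (\<tau> l)) (tensor_assoc R L M N t) =
      tensor_lift R P (\<lambda>u n. tensor_lift R P (\<lambda>l m. \<tau> l m n) u) t"
proof -
  note LM = tensor_module_module[OF L M] and MN = tensor_module_module[OF M N]
  note tri = trilinear_lift[OF L M N P \<tau>]
  show ?thesis
  proof (rule tensor_assoc_ext[OF L M N P linear_maps_comp[OF tensor_lift_linear[OF L MN P tri(3)] tensor_assoc(1)[OF L M N]]
        tensor_lift_linear[OF LM N P tri(2)] _ t])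
    fix l m n assume lm: "l \<in> carrier L" "m \<in> carrier M" and n: "n \<in> carrier N"
    show "tensor_lift R P (\<lambda>l. tensor_lift R P (\<tau> l)) (tensor_assoc R L M N (tensor R (tensor_module R L M) N (tensor R L M l m) n)) =
      tensor_lift R P (\<lambda>u n. tensor_lift R P (\<lambda>l m. \<tau> l m n) u) (tensor R (tensor_module R L M) N (tensor R L M l m) n)"
      unfolding tensor_assoc(2)[OF L M N lm n] tensor_lift_tensor[OF L MN P tri(3) lm(1) tensor_closed[OF M N lm(2) n]]
        tensor_lift_tensor[OF M N P trilinear_mapsD(1)[OF \<tau> lm(1)] lm(2) n]
        tensor_lift_tensor[OF LM N P tri(2) tensor_closed[OF L M lm] n]
        tensor_lift_tensor[OF L M P tri(1)[OF n] lm] ..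
  qed
qed

lemma tensor_assoc_bij:
  assumes L: "module R L" and M: "module R M" and N: "module R N"
  shows "bij_betw (tensor_assoc R L M N) (carrier (tensor_module R (tensor_module R L M) N))
    (carrier (tensor_module R L (tensor_module R M N)))"
proof -
  let ?LM = "tensor_module R L M" and ?MN = "tensor_module R M N"
  let ?S = "tensor_module R ?LM N" and ?T = "tensor_module R L ?MN"
  note LM = tensor_module_module[OF L M] and MN = tensor_module_module[OF M N]
  note S = tensor_module_module[OF LM N] and T = tensor_module_module[OF L MN]
  let ?\<sigma> = "\<lambda>l m n. tensor R ?LM N (tensor R L M l m) n"
  have \<sigma>1: "?\<sigma> l \<in> bilinear_maps R M N ?S" if "l \<in> carrier L" for l
    by (rule bilinear_maps_comp[OF tensor_bilinear[OF LM N] bilinear_mapsD(1)[OF tensor_bilinear[OF L M] that] linear_maps_id])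
  have \<sigma>2: "(\<lambda>l. ?\<sigma> l m n) \<in> linear_maps R L ?S" if "m \<in> carrier M" "n \<in> carrier N" for m n
    by (rule linear_maps_comp[OF bilinear_mapsD(2)[OF tensor_bilinear[OF LM N] that(2)] bilinear_mapsD(2)[OF tensor_bilinear[OF L M] that(1)]])
  have \<sigma>: "?\<sigma> \<in> trilinear_maps L M N ?S"
    by (rule trilinear_mapsI) (rule \<sigma>1 \<sigma>2; assumption)+
  note tri = trilinear_lift[OF L M N S \<sigma>]
  let ?g = "tensor_lift R ?S (\<lambda>l. tensor_lift R ?S (?\<sigma> l))" and ?f = "tensor_assoc R L M N"
  have g: "?g \<in> linear_maps R ?T ?S" by (rule tensor_lift_linear[OF L MN S tri(3)])
  note f = tensor_assoc[OF L M N]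
  have gt: "?g (tensor R L ?MN l (tensor R M N m n)) = ?\<sigma> l m n"
    if "l \<in> carrier L" "m \<in> carrier M" "n \<in> carrier N" for l m n
    by (rule trans[OF tensor_lift_tensor[OF L MN S tri(3) that(1) tensor_closed[OF M N that(2,3)]]
          tensor_lift_tensor[OF M N S \<sigma>1[OF that(1)] that(2,3)]])
  have gf: "?g (?f t) = t" if "t \<in> carrier ?S" for t
    by (rule tensor_assoc_ext[OF L M N S linear_maps_comp[OF g f(1)] linear_maps_id _ that])
      (simp add: f(2) gt)
  have fg: "?f (?g t) = t" if t: "t \<in> carrier ?T" for t
  proof (rule tensor_ext[OF L MN T linear_maps_comp[OF f(1) g] linear_maps_id _ t])
    fix l u assume l: "l \<in> carrier L" and u: "u \<in> carrier ?MN"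
    have lin: "tensor R L ?MN l \<in> linear_maps R ?MN ?T"
      by (rule bilinear_mapsD(1)[OF tensor_bilinear[OF L MN] l])
    show "?f (?g (tensor R L ?MN l u)) = tensor R L ?MN l u"
      by (rule tensor_ext[OF M N T linear_maps_comp[OF linear_maps_comp[OF f(1) g] lin] lin _ u])
        (simp add: gt[OF l] f(2)[OF l])
  qed
  show ?thesis
    by (rule bij_betw_byWitness[where f' = ?g]) (use gf fg linear_mapsD(1)[OF f(1)] linear_mapsD(1)[OF g] in auto)
qed

text \<open>The axioms express coassociativity as an equality of tensors. Applying a trilinear
  \<tau> to both sides gives the rule for regrouping nested sums. With A = K and \<rho> = \<Delta>
  it serves the coalgebra H, and with a coaction for \<rho> it serves the comodule algebra.\<close>

lemma coassoc_lift:
  assumes A: "module R A" and K: "module R K" and P: "module R P"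
    and \<rho>: "\<rho> \<in> linear_maps R A (tensor_module R A K)"
    and \<Delta>: "\<Delta> \<in> linear_maps R K (tensor_module R K K)"
    and a: "a \<in> carrier A"
    and eq: "tensor_assoc R A K K (tensor_map R (tensor_module R A K) K \<rho> (\<lambda>k. k) (\<rho> a)) =
      tensor_map R A (tensor_module R K K) (\<lambda>b. b) \<Delta> (\<rho> a)"
    and \<tau>: "\<tau> \<in> trilinear_maps A K K P"
  shows "tensor_lift R P (\<lambda>x y. tensor_lift R P (\<lambda>x1 x2. \<tau> x1 x2 y) (\<rho> x)) (\<rho> a) =
    tensor_lift R P (\<lambda>x y. tensor_lift R P (\<tau> x) (\<Delta> y)) (\<rho> a)"
proof -
  let ?AK = "tensor_module R A K" and ?KK = "tensor_module R K K"
  note AK = tensor_module_module[OF A K] and KK = tensor_module_module[OF K K]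
  note \<rho>a = linear_mapsD(1)[OF \<rho> a]
  note tri = trilinear_lift[OF A K K P \<tau>]
  have t: "tensor_map R ?AK K \<rho> (\<lambda>k. k) (\<rho> a) \<in> carrier (tensor_module R ?AK K)"
    by (rule linear_mapsD(1)[OF tensor_map_linear[OF A K AK K \<rho> linear_maps_id] \<rho>a])
  have "tensor_lift R P (\<lambda>x y. tensor_lift R P (\<lambda>x1 x2. \<tau> x1 x2 y) (\<rho> x)) (\<rho> a) =
    tensor_lift R P (\<lambda>u n. tensor_lift R P (\<lambda>l m. \<tau> l m n) u) (tensor_map R ?AK K \<rho> (\<lambda>k. k) (\<rho> a))"
    by (rule tensor_lift_tensor_map[OF A K AK K P \<rho> linear_maps_id tri(2) \<rho>a, symmetric])
  also have "\<dots> = tensor_lift R P (\<lambda>l. tensor_lift R P (\<tau> l)) (tensor_map R A ?KK (\<lambda>b. b) \<Delta> (\<rho> a))"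
    unfolding eq[symmetric] by (rule tensor_assoc_lift[OF A K K P \<tau> t, symmetric])
  also have "\<dots> = tensor_lift R P (\<lambda>x y. tensor_lift R P (\<tau> x) (\<Delta> y)) (\<rho> a)"
    by (rule tensor_lift_tensor_map[OF A K A KK P linear_maps_id \<Delta> tri(3) \<rho>a])
  finally show ?thesis .
qed

section \<open>Products on tensor modules\<close>

lemma tensor_algebra_simps:
  "carrier (tensor_algebra R A B) = carrier (tensor_module R A B)"
  "add (tensor_algebra R A B) = add (tensor_module R A B)"
  "zero (tensor_algebra R A B) = zero (tensor_module R A B)"
  "smult (tensor_algebra R A B) = smult (tensor_module R A B)"
  "one (tensor_algebra R A B) = tensor R A B \<one>\<^bsub>A\<^esub> \<one>\<^bsub>B\<^esub>"
  by (simp_all add: tensor_algebra_def Let_def)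

lemma linear_maps_tensor_algebra:
  "linear_maps R M (tensor_algebra R A B) = linear_maps R M (tensor_module R A B)"
  by (rule linear_maps_cong) (simp_all add: tensor_algebra_simps)

text \<open>The common shape of the products of \<open>tensor_algebra\<close> and
  \<open>smash_product\<close> and of \<open>star\<close>: an integrand in four variables, bilinear
  in each of two pairs, summed over two tensors.\<close>

lemma nested_lift_bilinear:
  assumes M: "module R M" and N: "module R N" and M': "module R M'" and N': "module R N'" and P: "module R P"
    and \<mu>1: "\<And>a b. a \<in> carrier M \<Longrightarrow> b \<in> carrier N \<Longrightarrow> \<mu> a b \<in> bilinear_maps R M' N' P"
    and \<mu>2: "\<And>c d. c \<in> carrier M' \<Longrightarrow> d \<in> carrier N' \<Longrightarrow> (\<lambda>a b. \<mu> a b c d) \<in> bilinear_maps R M N P"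
  shows "(\<lambda>s t. tensor_lift R P (\<lambda>a b. tensor_lift R P (\<mu> a b) t) s)
      \<in> bilinear_maps R (tensor_module R M N) (tensor_module R M' N') P" (is ?bil)
    and "t \<in> carrier (tensor_module R M' N') \<Longrightarrow> a \<in> carrier M \<Longrightarrow> b \<in> carrier N \<Longrightarrow>
      tensor_lift R P (\<lambda>a b. tensor_lift R P (\<mu> a b) t) (tensor R M N a b) = tensor_lift R P (\<mu> a b) t"
    and "t \<in> carrier (tensor_module R M' N') \<Longrightarrow> (\<lambda>a b. tensor_lift R P (\<mu> a b) t) \<in> bilinear_maps R M N P"
    and "a \<in> carrier M \<Longrightarrow> b \<in> carrier N \<Longrightarrow> c \<in> carrier M' \<Longrightarrow> d \<in> carrier N' \<Longrightarrow>
      tensor_lift R P (\<lambda>a b. tensor_lift R P (\<mu> a b) (tensor R M' N' c d)) (tensor R M N a b) = \<mu> a b c d"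
proof -
  have 1: "(\<lambda>a b. tensor_lift R P (\<mu> a b) u) \<in> bilinear_maps R M N P"
    if u: "u \<in> carrier (tensor_module R M' N')" for u
    by (intro bilinear_mapsI tensor_lift_linear_param[OF _ M' N' P] M N u \<mu>1
        bilinear_mapsD(1,2)[OF \<mu>2]; assumption)
  then show "t \<in> carrier (tensor_module R M' N') \<Longrightarrow> (\<lambda>a b. tensor_lift R P (\<mu> a b) t) \<in> bilinear_maps R M N P" .
  show "t \<in> carrier (tensor_module R M' N') \<Longrightarrow> a \<in> carrier M \<Longrightarrow> b \<in> carrier N \<Longrightarrow>
      tensor_lift R P (\<lambda>a b. tensor_lift R P (\<mu> a b) t) (tensor R M N a b) = tensor_lift R P (\<mu> a b) t"
    by (rule tensor_lift_tensor[OF M N P 1])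
  show "tensor_lift R P (\<lambda>a b. tensor_lift R P (\<mu> a b) (tensor R M' N' c d)) (tensor R M N a b) = \<mu> a b c d"
    if "a \<in> carrier M" "b \<in> carrier N" "c \<in> carrier M'" "d \<in> carrier N'"
    unfolding tensor_lift_tensor[OF M N P 1[OF tensor_closed[OF M' N' that(3,4)]] that(1,2)]
    by (rule tensor_lift_tensor[OF M' N' P \<mu>1[OF that(1,2)] that(3,4)])
  have T': "module R (tensor_module R M' N')" by (rule tensor_module_module[OF M' N'])
  show ?bil
  proof (rule bilinear_mapsI)
    show "(\<lambda>t. tensor_lift R P (\<lambda>a b. tensor_lift R P (\<mu> a b) t) s) \<in> linear_maps R (tensor_module R M' N') P"
      if s: "s \<in> carrier (tensor_module R M N)" for s
      by (intro tensor_lift_linear_param[OF T' M N P] 1 s tensor_lift_linear[OF M' N' P \<mu>1])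
    show "tensor_lift R P (\<lambda>a b. tensor_lift R P (\<mu> a b) t) \<in> linear_maps R (tensor_module R M N) P"
      if t: "t \<in> carrier (tensor_module R M' N')" for t
      by (rule tensor_lift_linear[OF M N P 1[OF t]])
  qed
qed

lemma tensor_ext2:
  assumes M: "module R M" and N: "module R N" and M': "module R M'" and N': "module R N'" and P: "module R P"
    and F: "F \<in> bilinear_maps R (tensor_module R M N) (tensor_module R M' N') P"
    and G: "G \<in> bilinear_maps R (tensor_module R M N) (tensor_module R M' N') P"
    and eq: "\<And>m n m' n'. m \<in> carrier M \<Longrightarrow> n \<in> carrier N \<Longrightarrow> m' \<in> carrier M' \<Longrightarrow> n' \<in> carrier N' \<Longrightarrow>
      F (tensor R M N m n) (tensor R M' N' m' n') = G (tensor R M N m n) (tensor R M' N' m' n')"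
    and s: "s \<in> carrier (tensor_module R M N)" and t: "t \<in> carrier (tensor_module R M' N')"
  shows "F s t = G s t"
proof (rule tensor_ext[OF M N P bilinear_mapsD(2)[OF F t] bilinear_mapsD(2)[OF G t] _ s])
  fix m n assume mn: "m \<in> carrier M" "n \<in> carrier N"
  note mn' = tensor_closed[OF M N mn]
  show "F (tensor R M N m n) t = G (tensor R M N m n) t"
    by (rule tensor_ext[OF M' N' P bilinear_mapsD(1)[OF F mn'] bilinear_mapsD(1)[OF G mn'] _ t]) (rule eq[OF mn])
qed

lemma tensor_algebra_mult_bil:
  assumes A: "module R A" and B: "module R B"
    and mA: "(\<lambda>x y. x \<otimes>\<^bsub>A\<^esub> y) \<in> bilinear_maps R A A A" and mB: "(\<lambda>x y. x \<otimes>\<^bsub>B\<^esub> y) \<in> bilinear_maps R B B B"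
  shows "a \<in> carrier A \<Longrightarrow> b \<in> carrier B \<Longrightarrow>
      (\<lambda>a' b'. tensor R A B (a \<otimes>\<^bsub>A\<^esub> a') (b \<otimes>\<^bsub>B\<^esub> b')) \<in> bilinear_maps R A B (tensor_module R A B)"
    and "a' \<in> carrier A \<Longrightarrow> b' \<in> carrier B \<Longrightarrow>
      (\<lambda>a b. tensor R A B (a \<otimes>\<^bsub>A\<^esub> a') (b \<otimes>\<^bsub>B\<^esub> b')) \<in> bilinear_maps R A B (tensor_module R A B)"
  by (rule bilinear_maps_comp[OF tensor_bilinear[OF A B] bilinear_mapsD(1)[OF mA] bilinear_mapsD(1)[OF mB]]; assumption)
    (rule bilinear_maps_comp[OF tensor_bilinear[OF A B] bilinear_mapsD(2)[OF mA] bilinear_mapsD(2)[OF mB]]; assumption)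

lemma tensor_algebra_mult:
  assumes A: "module R A" and B: "module R B"
    and mA: "(\<lambda>x y. x \<otimes>\<^bsub>A\<^esub> y) \<in> bilinear_maps R A A A" and mB: "(\<lambda>x y. x \<otimes>\<^bsub>B\<^esub> y) \<in> bilinear_maps R B B B"
  shows "(\<lambda>s t. s \<otimes>\<^bsub>tensor_algebra R A B\<^esub> t) \<in> bilinear_maps R (tensor_module R A B) (tensor_module R A B) (tensor_module R A B)"
    and "a \<in> carrier A \<Longrightarrow> b \<in> carrier B \<Longrightarrow> a' \<in> carrier A \<Longrightarrow> b' \<in> carrier B \<Longrightarrow>
      tensor R A B a b \<otimes>\<^bsub>tensor_algebra R A B\<^esub> tensor R A B a' b' = tensor R A B (a \<otimes>\<^bsub>A\<^esub> a') (b \<otimes>\<^bsub>B\<^esub> b')"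
proof -
  note AB = tensor_module_module[OF A B] and \<mu> = tensor_algebra_mult_bil[OF A B mA mB]
  have eq: "s \<otimes>\<^bsub>tensor_algebra R A B\<^esub> t = tensor_lift R (tensor_module R A B) (\<lambda>a b. tensor_lift R (tensor_module R A B)
      (\<lambda>a' b'. tensor R A B (a \<otimes>\<^bsub>A\<^esub> a') (b \<otimes>\<^bsub>B\<^esub> b')) t) s" for s t
    by (simp add: tensor_algebra_def Let_def)
  show "(\<lambda>s t. s \<otimes>\<^bsub>tensor_algebra R A B\<^esub> t) \<in> bilinear_maps R (tensor_module R A B) (tensor_module R A B) (tensor_module R A B)"
    unfolding eq by (rule nested_lift_bilinear(1)[OF A B A B AB \<mu>])
  assume ab: "a \<in> carrier A" "b \<in> carrier B" "a' \<in> carrier A" "b' \<in> carrier B"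
  show "tensor R A B a b \<otimes>\<^bsub>tensor_algebra R A B\<^esub> tensor R A B a' b' = tensor R A B (a \<otimes>\<^bsub>A\<^esub> a') (b \<otimes>\<^bsub>B\<^esub> b')"
    unfolding eq
    by (rule nested_lift_bilinear(4)[where \<mu> = "\<lambda>a b a' b'. tensor R A B (a \<otimes>\<^bsub>A\<^esub> a') (b \<otimes>\<^bsub>B\<^esub> b')", OF A B A B AB])
      (rule \<mu> ab; assumption?)+
qed

text \<open>Turns multiplicativity of a comultiplication or of a coaction into a rule for sums over
  a product; \<open>sw_mult\<close> and \<open>aw_mult\<close> are the two instances.\<close>

lemma tensor_lift_tensor_algebra_mult:
  assumes A: "module R A" and B: "module R B" and P: "module R P"
    and mA: "(\<lambda>x y. x \<otimes>\<^bsub>A\<^esub> y) \<in> bilinear_maps R A A A" and mB: "(\<lambda>x y. x \<otimes>\<^bsub>B\<^esub> y) \<in> bilinear_maps R B B B"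
    and \<beta>: "\<beta> \<in> bilinear_maps R A B P"
    and s: "s \<in> carrier (tensor_module R A B)" and t: "t \<in> carrier (tensor_module R A B)"
  shows "tensor_lift R P \<beta> (s \<otimes>\<^bsub>tensor_algebra R A B\<^esub> t) =
    tensor_lift R P (\<lambda>a b. tensor_lift R P (\<lambda>a' b'. \<beta> (a \<otimes>\<^bsub>A\<^esub> a') (b \<otimes>\<^bsub>B\<^esub> b')) t) s"
proof -
  note T = tensor_algebra_mult[OF A B mA mB]
  have \<nu>1: "(\<lambda>a' b'. \<beta> (a \<otimes>\<^bsub>A\<^esub> a') (b \<otimes>\<^bsub>B\<^esub> b')) \<in> bilinear_maps R A B P" if "a \<in> carrier A" "b \<in> carrier B" for a b
    by (rule bilinear_maps_comp[OF \<beta> bilinear_mapsD(1)[OF mA that(1)] bilinear_mapsD(1)[OF mB that(2)]])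
  have \<nu>2: "(\<lambda>a b. \<beta> (a \<otimes>\<^bsub>A\<^esub> a') (b \<otimes>\<^bsub>B\<^esub> b')) \<in> bilinear_maps R A B P" if "a' \<in> carrier A" "b' \<in> carrier B" for a' b'
    by (rule bilinear_maps_comp[OF \<beta> bilinear_mapsD(2)[OF mA that(1)] bilinear_mapsD(2)[OF mB that(2)]])
  have N1: "(\<lambda>s t. tensor_lift R P (\<lambda>a b. tensor_lift R P (\<lambda>a' b'. \<beta> (a \<otimes>\<^bsub>A\<^esub> a') (b \<otimes>\<^bsub>B\<^esub> b')) t) s)
      \<in> bilinear_maps R (tensor_module R A B) (tensor_module R A B) P"
    by (rule nested_lift_bilinear(1)[OF A B A B P]) (rule \<nu>1 \<nu>2; assumption)+
  show ?thesis
  proof (rule tensor_ext2[OF A B A B P bilinear_maps_linear[OF T(1) tensor_lift_linear[OF A B P \<beta>]] N1 _ s t])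
    fix a b a' b' assume ab: "a \<in> carrier A" "b \<in> carrier B" and ab': "a' \<in> carrier A" "b' \<in> carrier B"
    note m = bilinear_mapsD(3)[OF mA ab(1) ab'(1)] bilinear_mapsD(3)[OF mB ab(2) ab'(2)]
    show "tensor_lift R P \<beta> (tensor R A B a b \<otimes>\<^bsub>tensor_algebra R A B\<^esub> tensor R A B a' b') =
      tensor_lift R P (\<lambda>a b. tensor_lift R P (\<lambda>a' b'. \<beta> (a \<otimes>\<^bsub>A\<^esub> a') (b \<otimes>\<^bsub>B\<^esub> b')) (tensor R A B a' b')) (tensor R A B a b)"
      unfolding T(2)[OF ab ab'] tensor_lift_tensor[OF A B P \<beta> m]
      by (rule nested_lift_bilinear(4)[where \<mu> = "\<lambda>a b a' b'. \<beta> (a \<otimes>\<^bsub>A\<^esub> a') (b \<otimes>\<^bsub>B\<^esub> b')", OF A B A B P, symmetric])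
        (rule \<nu>1 \<nu>2 ab ab'; assumption?)+
  qed
qed

lemma smash_product_simps:
  "carrier (smash_product R A K act) = carrier (tensor_module R A K)"
  "add (smash_product R A K act) = add (tensor_module R A K)"
  "zero (smash_product R A K act) = zero (tensor_module R A K)"
  "smult (smash_product R A K act) = smult (tensor_module R A K)"
  "one (smash_product R A K act) = tensor R A K \<one>\<^bsub>A\<^esub> \<one>\<^bsub>K\<^esub>"
  by (simp_all add: smash_product_def Let_def)

lemma smash_product_module:
  assumes "module R A" "module R K"
  shows "module R (smash_product R A K act)"
  by (rule module_cong[OF tensor_module_module[OF assms]]) (simp_all add: smash_product_simps)

text \<open>Bilinearity of the structure maps makes the product bilinear and computable on pure
  tensors. Associativity and unit laws are obtained elsewhere: for \<open>B\<close> from the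
  faithful action on H, for the iterated product by transport.\<close>

lemma smash_product_mult:
  assumes A: "module R A" and K: "module R K"
    and mA: "(\<lambda>x y. x \<otimes>\<^bsub>A\<^esub> y) \<in> bilinear_maps R A A A" and mK: "(\<lambda>x y. x \<otimes>\<^bsub>K\<^esub> y) \<in> bilinear_maps R K K K"
    and \<Delta>: "comult K \<in> linear_maps R K (tensor_module R K K)" and act: "act \<in> bilinear_maps R K A A"
  shows "a \<in> carrier A \<Longrightarrow> b \<in> carrier A \<Longrightarrow> k \<in> carrier K \<Longrightarrow>
      (\<lambda>h1 h2. tensor R A K (a \<otimes>\<^bsub>A\<^esub> act h1 b) (h2 \<otimes>\<^bsub>K\<^esub> k)) \<in> bilinear_maps R K K (tensor_module R A K)" (is "_ \<Longrightarrow> _ \<Longrightarrow> _ \<Longrightarrow> ?inner a b k")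
    and "(\<lambda>s t. s \<otimes>\<^bsub>smash_product R A K act\<^esub> t) \<in>
      bilinear_maps R (tensor_module R A K) (tensor_module R A K) (tensor_module R A K)" (is ?bil)
    and "a \<in> carrier A \<Longrightarrow> h \<in> carrier K \<Longrightarrow> b \<in> carrier A \<Longrightarrow> k \<in> carrier K \<Longrightarrow>
      tensor R A K a h \<otimes>\<^bsub>smash_product R A K act\<^esub> tensor R A K b k =
      tensor_lift R (tensor_module R A K) (\<lambda>h1 h2. tensor R A K (a \<otimes>\<^bsub>A\<^esub> act h1 b) (h2 \<otimes>\<^bsub>K\<^esub> k)) (comult K h)"
proof -
  let ?T = "tensor_module R A K"
  note T = tensor_module_module[OF A K] and tens = tensor_bilinear[OF A K]
  note mA1 = bilinear_mapsD(1)[OF mA] and mA2 = bilinear_mapsD(2)[OF mA]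
  note mK1 = bilinear_mapsD(1)[OF mK] and mK2 = bilinear_mapsD(2)[OF mK]
  note act1 = bilinear_mapsD(1)[OF act] and act2 = bilinear_mapsD(2)[OF act] and actc = bilinear_mapsD(3)[OF act]
  note mAc = bilinear_mapsD(3)[OF mA] and mKc = bilinear_mapsD(3)[OF mK]
  show inner: "?inner a b k" if "a \<in> carrier A" "b \<in> carrier A" "k \<in> carrier K" for a b k
    by (rule bilinear_maps_comp[OF tens linear_maps_comp[OF mA1[OF that(1)] act2[OF that(2)]] mK2[OF that(3)]])
  define \<mu> where "\<mu> a h b k = tensor_lift R ?T (\<lambda>h1 h2. tensor R A K (a \<otimes>\<^bsub>A\<^esub> act h1 b) (h2 \<otimes>\<^bsub>K\<^esub> k)) (comult K h)" for a h b k
  have t1: "(\<lambda>x. tensor R A K (\<phi> x) k) \<in> linear_maps R X ?T" if "\<phi> \<in> linear_maps R X A" "k \<in> carrier K"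
    for \<phi> k and X :: "('a, 'u, 'w) module_scheme"
    by (rule linear_maps_comp[OF bilinear_mapsD(2)[OF tens that(2)] that(1)])
  have t2: "(\<lambda>x. tensor R A K a (\<psi> x)) \<in> linear_maps R X ?T" if "\<psi> \<in> linear_maps R X K" "a \<in> carrier A"
    for \<psi> a and X :: "('a, 'u, 'w) module_scheme"
    by (rule linear_maps_comp[OF bilinear_mapsD(1)[OF tens that(2)] that(1)])
  note \<Delta>c = linear_mapsD(1)[OF \<Delta>]
  have \<mu>1: "\<mu> a h \<in> bilinear_maps R A K ?T" if ah: "a \<in> carrier A" "h \<in> carrier K" for a h
  proof (rule bilinear_mapsI)
    show "\<mu> a h b \<in> linear_maps R K ?T" if "b \<in> carrier A" for b
      unfolding \<mu>_def
      by (rule tensor_lift_linear_param[OF K K K T inner[OF ah(1) that] t2[OF mK1] \<Delta>c[OF ah(2)]])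
        (simp_all add: mAc actc ah that)
    show "(\<lambda>b. \<mu> a h b k) \<in> linear_maps R A ?T" if "k \<in> carrier K" for k
      unfolding \<mu>_def
      by (rule tensor_lift_linear_param[OF A K K T inner[OF ah(1) _ that] t1[OF linear_maps_comp[OF mA1[OF ah(1)] act1]] \<Delta>c[OF ah(2)]])
        (simp_all add: mKc that)
  qed
  have \<mu>2: "(\<lambda>a h. \<mu> a h b k) \<in> bilinear_maps R A K ?T" if bk: "b \<in> carrier A" "k \<in> carrier K" for b k
  proof (rule bilinear_mapsI)
    show "(\<lambda>h. \<mu> a h b k) \<in> linear_maps R K ?T" if "a \<in> carrier A" for a
      unfolding \<mu>_def by (rule linear_maps_comp[OF tensor_lift_linear[OF K K T inner[OF that bk]] \<Delta>])
    show "(\<lambda>a. \<mu> a h b k) \<in> linear_maps R A ?T" if "h \<in> carrier K" for h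
      unfolding \<mu>_def
      by (rule tensor_lift_linear_param[OF A K K T inner[OF _ bk] t1[OF mA2] \<Delta>c[OF that]])
        (simp_all add: mKc actc bk)
  qed
  have eq: "s \<otimes>\<^bsub>smash_product R A K act\<^esub> t = tensor_lift R ?T (\<lambda>a h. tensor_lift R ?T (\<mu> a h) t) s" for s t
    by (simp add: smash_product_def Let_def \<mu>_def[abs_def])
  show ?bil
    unfolding eq by (rule nested_lift_bilinear(1)[OF A K A K T]) (rule \<mu>1 \<mu>2; assumption)+
  assume ah: "a \<in> carrier A" "h \<in> carrier K" "b \<in> carrier A" "k \<in> carrier K"
  show "tensor R A K a h \<otimes>\<^bsub>smash_product R A K act\<^esub> tensor R A K b k =
      tensor_lift R ?T (\<lambda>h1 h2. tensor R A K (a \<otimes>\<^bsub>A\<^esub> act h1 b) (h2 \<otimes>\<^bsub>K\<^esub> k)) (comult K h)"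
    unfolding eq \<mu>_def[symmetric]
    by (rule nested_lift_bilinear(4)[where \<mu> = \<mu>, OF A K A K T]) (rule \<mu>1 \<mu>2 ah; assumption?)+
qed

end

section \<open>Sums over the comultiplication of H\<close>

context hopf_algebra
begin

abbreviation "HH \<equiv> tensor_module R H H"
abbreviation "S \<equiv> antipode H"

lemma HH: "module R HH"
  by (rule R.tensor_module_module[OF module_axioms module_axioms])

lemma comult_linear: "comult H \<in> linear_maps R H HH"
  using comult_hom unfolding algebra_homs_def R.linear_maps_tensor_algebra by simp

lemma counit_linear: "counit H \<in> linear_maps R H (self_module R)"
  using counit_hom unfolding algebra_homs_def by simp

lemmas comult_closed [simp] = linear_mapsD(1)[OF comult_linear]
lemmas counit_closed [simp] = linear_mapsD(1)[OF counit_linear, simplified]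
lemmas antipode_closed [simp] = linear_mapsD(1)[OF antipode_linear]

lemma counit_mult: "h \<in> carrier H \<Longrightarrow> k \<in> carrier H \<Longrightarrow> counit H (h \<otimes>\<^bsub>H\<^esub> k) = counit H h \<otimes>\<^bsub>R\<^esub> counit H k"
  using counit_hom ring_hom_mult[of "counit H" H "self_module R" h k] by (simp add: algebra_homs_def)

lemma counit_one: "counit H \<one>\<^bsub>H\<^esub> = \<one>\<^bsub>R\<^esub>"
  using counit_hom ring_hom_one[of "counit H" H "self_module R"] by (simp add: algebra_homs_def)

lemma lin_mult1: "\<phi> \<in> linear_maps R X H \<Longrightarrow> b \<in> carrier H \<Longrightarrow> (\<lambda>x. \<phi> x \<otimes>\<^bsub>H\<^esub> b) \<in> linear_maps R X H"
  by (rule linear_maps_comp[OF linear_right_mult])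

lemma lin_mult2: "\<phi> \<in> linear_maps R X H \<Longrightarrow> b \<in> carrier H \<Longrightarrow> (\<lambda>x. b \<otimes>\<^bsub>H\<^esub> \<phi> x) \<in> linear_maps R X H"
  by (rule linear_maps_comp[OF linear_left_mult])

lemma lin_scalar1: "g \<in> linear_maps R X (self_module R) \<Longrightarrow> r \<in> carrier R \<Longrightarrow>
    (\<lambda>x. g x \<otimes>\<^bsub>R\<^esub> r) \<in> linear_maps R X (self_module R)"
  using R.linear_maps_smult_left[OF R.self_module, of r g X] by simp

lemma lin_scalar2: "g \<in> linear_maps R X (self_module R) \<Longrightarrow> r \<in> carrier R \<Longrightarrow>
    (\<lambda>x. r \<otimes>\<^bsub>R\<^esub> g x) \<in> linear_maps R X (self_module R)"
  using R.linear_maps_smult[OF R.self_module, of r g X] by simp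

lemma lin_smult1: "g \<in> linear_maps R X (self_module R) \<Longrightarrow> module R P \<Longrightarrow> h \<in> carrier P \<Longrightarrow>
    (\<lambda>x. g x \<odot>\<^bsub>P\<^esub> h) \<in> linear_maps R X P"
  by (rule R.linear_maps_smult_left)

lemma lin_smult2: "\<phi> \<in> linear_maps R X P \<Longrightarrow> module R P \<Longrightarrow> r \<in> carrier R \<Longrightarrow>
    (\<lambda>x. r \<odot>\<^bsub>P\<^esub> \<phi> x) \<in> linear_maps R X P"
  by (rule R.linear_maps_smult)

lemma lin_sw1: "module R P \<Longrightarrow> \<beta> \<in> bilinear_maps R H H P \<Longrightarrow> \<phi> \<in> linear_maps R X H \<Longrightarrow>
    (\<lambda>x. tensor_lift R P \<beta> (comult H (\<phi> x))) \<in> linear_maps R X P"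
  by (rule linear_maps_comp[OF R.tensor_lift_linear[OF module_axioms module_axioms] linear_maps_comp[OF comult_linear]])

lemma lin_sw2: "module R X \<Longrightarrow> module R P \<Longrightarrow> h \<in> carrier H \<Longrightarrow>
    (\<And>x. x \<in> carrier X \<Longrightarrow> \<beta> x \<in> bilinear_maps R H H P) \<Longrightarrow>
    (\<And>m n. m \<in> carrier H \<Longrightarrow> n \<in> carrier H \<Longrightarrow> (\<lambda>x. \<beta> x m n) \<in> linear_maps R X P) \<Longrightarrow>
    (\<lambda>x. tensor_lift R P (\<beta> x) (comult H h)) \<in> linear_maps R X P"
  by (rule R.tensor_lift_linear_param[OF _ module_axioms module_axioms]) simp_all

lemma lin_antipode: "\<phi> \<in> linear_maps R X H \<Longrightarrow> (\<lambda>x. S (\<phi> x)) \<in> linear_maps R X H"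
  by (rule linear_maps_comp[OF antipode_linear])

lemma lin_counit: "\<phi> \<in> linear_maps R X H \<Longrightarrow> (\<lambda>x. counit H (\<phi> x)) \<in> linear_maps R X (self_module R)"
  by (rule linear_maps_comp[OF counit_linear])

text \<open>Backward rules that follow the syntax of an integrand in one variable, so that
  \<open>intro\<close> can prove the bilinearity side conditions of the sum rules.\<close>

lemmas lin = linear_maps_id lin_mult1 lin_mult2 lin_scalar1 lin_scalar2 lin_smult1 lin_smult2
  lin_antipode lin_counit module_axioms R.self_module

lemma sw_closed: "module R P \<Longrightarrow> \<beta> \<in> bilinear_maps R H H P \<Longrightarrow> h \<in> carrier H \<Longrightarrow>
    tensor_lift R P \<beta> (comult H h) \<in> carrier P"
  by (rule linear_mapsD(1)[OF R.tensor_lift_linear[OF module_axioms module_axioms]]) simp_all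

lemma sw_cong:
  assumes "module R P" "\<beta> \<in> bilinear_maps R H H P" "h \<in> carrier H"
    and "\<And>h1 h2. h1 \<in> carrier H \<Longrightarrow> h2 \<in> carrier H \<Longrightarrow> \<beta> h1 h2 = \<gamma> h1 h2"
  shows "tensor_lift R P \<beta> (comult H h) = tensor_lift R P \<gamma> (comult H h)"
  by (rule R.tensor_lift_cong[OF module_axioms module_axioms assms(1,2,4)]) (simp_all add: assms(3))

lemma sw_linear:
  assumes "module R P" "module R Q" "\<beta> \<in> bilinear_maps R H H P" "\<phi> \<in> linear_maps R P Q" "h \<in> carrier H"
  shows "\<phi> (tensor_lift R P \<beta> (comult H h)) = tensor_lift R Q (\<lambda>h1 h2. \<phi> (\<beta> h1 h2)) (comult H h)"
  by (rule linear_maps_tensor_lift[OF module_axioms module_axioms assms(1-4)]) (simp add: assms(5))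

lemma sw_coassoc:
  assumes P: "module R P" and h: "h \<in> carrier H"
    and \<tau>: "\<And>x. x \<in> carrier H \<Longrightarrow> \<tau> x \<in> bilinear_maps R H H P"
      "\<And>y z. y \<in> carrier H \<Longrightarrow> z \<in> carrier H \<Longrightarrow> (\<lambda>x. \<tau> x y z) \<in> linear_maps R H P"
  shows "tensor_lift R P (\<lambda>x y. tensor_lift R P (\<lambda>x1 x2. \<tau> x1 x2 y) (comult H x)) (comult H h) =
    tensor_lift R P (\<lambda>x y. tensor_lift R P (\<tau> x) (comult H y)) (comult H h)"
  by (rule R.coassoc_lift[OF module_axioms module_axioms P comult_linear comult_linear h coassoc[OF h] R.trilinear_mapsI[OF \<tau>]])

lemma sw_mult:
  assumes P: "module R P" and \<beta>: "\<beta> \<in> bilinear_maps R H H P" and hk: "h \<in> carrier H" "k \<in> carrier H"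
  shows "tensor_lift R P \<beta> (comult H (h \<otimes>\<^bsub>H\<^esub> k)) =
    tensor_lift R P (\<lambda>h1 h2. tensor_lift R P (\<lambda>k1 k2. \<beta> (h1 \<otimes>\<^bsub>H\<^esub> k1) (h2 \<otimes>\<^bsub>H\<^esub> k2)) (comult H k)) (comult H h)"
proof -
  note H = module_axioms
  have "comult H (h \<otimes>\<^bsub>H\<^esub> k) = comult H h \<otimes>\<^bsub>tensor_algebra R H H\<^esub> comult H k"
    using comult_hom ring_hom_mult[of "comult H" H "tensor_algebra R H H" h k] hk by (simp add: algebra_homs_def)
  then show ?thesis
    using R.tensor_lift_tensor_algebra_mult[OF H H P mult_bilinear mult_bilinear \<beta> comult_closed comult_closed] hk by simp
qed

lemma sw_one:
  assumes P: "module R P" and \<beta>: "\<beta> \<in> bilinear_maps R H H P"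
  shows "tensor_lift R P \<beta> (comult H \<one>\<^bsub>H\<^esub>) = \<beta> \<one>\<^bsub>H\<^esub> \<one>\<^bsub>H\<^esub>"
proof -
  have "comult H \<one>\<^bsub>H\<^esub> = tensor R H H \<one>\<^bsub>H\<^esub> \<one>\<^bsub>H\<^esub>"
    using comult_hom ring_hom_one[of "comult H" H "tensor_algebra R H H"]
    by (simp add: algebra_homs_def R.tensor_algebra_simps)
  then show ?thesis
    using R.tensor_lift_tensor[OF module_axioms module_axioms P \<beta>, of "\<one>\<^bsub>H\<^esub>" "\<one>\<^bsub>H\<^esub>"] by simp
qed

lemma sw_counit_right:
  assumes P: "module R P" and \<phi>: "\<phi> \<in> linear_maps R H P" and h: "h \<in> carrier H"
  shows "tensor_lift R P (\<lambda>h1 h2. counit H h2 \<odot>\<^bsub>P\<^esub> \<phi> h1) (comult H h) = \<phi> h"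
proof -
  have b: "(\<lambda>h1 h2. counit H h2 \<odot>\<^bsub>H\<^esub> h1) \<in> bilinear_maps R H H H"
    by (intro bilinear_mapsI lin; simp)
  have "tensor_lift R P (\<lambda>h1 h2. \<phi> (counit H h2 \<odot>\<^bsub>H\<^esub> h1)) (comult H h) = \<phi> h"
    using sw_linear[OF module_axioms P b \<phi> h] counit_right[OF h] by simp
  moreover have "tensor_lift R P (\<lambda>h1 h2. \<phi> (counit H h2 \<odot>\<^bsub>H\<^esub> h1)) (comult H h) =
      tensor_lift R P (\<lambda>h1 h2. counit H h2 \<odot>\<^bsub>P\<^esub> \<phi> h1) (comult H h)"
    by (rule sw_cong[OF P bilinear_maps_linear[OF b \<phi>] h]) (simp add: linear_mapsD(3)[OF \<phi>])
  ultimately show ?thesis by simp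
qed

lemma sw_counit_left:
  assumes P: "module R P" and \<phi>: "\<phi> \<in> linear_maps R H P" and h: "h \<in> carrier H"
  shows "tensor_lift R P (\<lambda>h1 h2. counit H h1 \<odot>\<^bsub>P\<^esub> \<phi> h2) (comult H h) = \<phi> h"
proof -
  have b: "(\<lambda>h1 h2. counit H h1 \<odot>\<^bsub>H\<^esub> h2) \<in> bilinear_maps R H H H"
    by (intro bilinear_mapsI lin; simp)
  have "tensor_lift R P (\<lambda>h1 h2. \<phi> (counit H h1 \<odot>\<^bsub>H\<^esub> h2)) (comult H h) = \<phi> h"
    using sw_linear[OF module_axioms P b \<phi> h] counit_left[OF h] by simp
  moreover have "tensor_lift R P (\<lambda>h1 h2. \<phi> (counit H h1 \<odot>\<^bsub>H\<^esub> h2)) (comult H h) =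
      tensor_lift R P (\<lambda>h1 h2. counit H h1 \<odot>\<^bsub>P\<^esub> \<phi> h2) (comult H h)"
    by (rule sw_cong[OF P bilinear_maps_linear[OF b \<phi>] h]) (simp add: linear_mapsD(3)[OF \<phi>])
  ultimately show ?thesis by simp
qed

lemmas lin' = lin lin_sw1 lin_sw2

lemma sw_cong2:
  assumes "module R P" "\<gamma> \<in> bilinear_maps R H H P" "h \<in> carrier H"
    and "\<And>h1 h2. h1 \<in> carrier H \<Longrightarrow> h2 \<in> carrier H \<Longrightarrow> \<beta> h1 h2 = \<gamma> h1 h2"
  shows "tensor_lift R P \<beta> (comult H h) = tensor_lift R P \<gamma> (comult H h)"
  by (rule sw_cong[OF assms(1-3), symmetric]) (simp add: assms(4))

section \<open>The antipode reverses products\<close>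

lemma antipode_bil:
  "(\<lambda>a b. S a \<otimes>\<^bsub>H\<^esub> b) \<in> bilinear_maps R H H H"
  "(\<lambda>a b. a \<otimes>\<^bsub>H\<^esub> S b) \<in> bilinear_maps R H H H"
  by (intro bilinear_mapsI lin; simp)+

lemma antipode_one: "S \<one>\<^bsub>H\<^esub> = \<one>\<^bsub>H\<^esub>"
  using antipode_left[of "\<one>\<^bsub>H\<^esub>"] sw_one[OF module_axioms antipode_bil(1)] by (simp add: counit_one)

text \<open>Insert the counit of k in the form k_2 S(k_3). The sum becomes \<Sum> S(x_1 k_1) x_2 k_2
  S(k_3), and since the comultiplication is multiplicative its first part is \<Sum> S((x k_1)_1) (x
  k_1)_2, a counit value. This takes the place of uniqueness of inverses in the convolution algebra
  of maps from H \<otimes> H to H.\<close>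

lemma antipode_mult_aux:
  assumes x: "x \<in> carrier H" and k: "k \<in> carrier H"
  shows "tensor_lift R H (\<lambda>a b. S (a \<otimes>\<^bsub>H\<^esub> k) \<otimes>\<^bsub>H\<^esub> b) (comult H x) = counit H x \<odot>\<^bsub>H\<^esub> S k"
proof -
  note H = module_axioms
  have expand: "S (a \<otimes>\<^bsub>H\<^esub> k) \<otimes>\<^bsub>H\<^esub> b = tensor_lift R H (\<lambda>w d. tensor_lift R H
      (\<lambda>u v. (S (a \<otimes>\<^bsub>H\<^esub> u) \<otimes>\<^bsub>H\<^esub> (b \<otimes>\<^bsub>H\<^esub> v)) \<otimes>\<^bsub>H\<^esub> S d) (comult H w)) (comult H k)"
    if ab: "a \<in> carrier H" "b \<in> carrier H" for a b
  proof -
    have inner: "tensor_lift R H (\<lambda>v d. (S (a \<otimes>\<^bsub>H\<^esub> u) \<otimes>\<^bsub>H\<^esub> (b \<otimes>\<^bsub>H\<^esub> v)) \<otimes>\<^bsub>H\<^esub> S d) (comult H z) =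
        counit H z \<odot>\<^bsub>H\<^esub> (S (a \<otimes>\<^bsub>H\<^esub> u) \<otimes>\<^bsub>H\<^esub> b)"
      if uz: "u \<in> carrier H" "z \<in> carrier H" for u z
    proof -
      have "tensor_lift R H (\<lambda>v d. (S (a \<otimes>\<^bsub>H\<^esub> u) \<otimes>\<^bsub>H\<^esub> (b \<otimes>\<^bsub>H\<^esub> v)) \<otimes>\<^bsub>H\<^esub> S d) (comult H z) =
        tensor_lift R H (\<lambda>v d. (S (a \<otimes>\<^bsub>H\<^esub> u) \<otimes>\<^bsub>H\<^esub> b) \<otimes>\<^bsub>H\<^esub> (v \<otimes>\<^bsub>H\<^esub> S d)) (comult H z)"
        by (rule sw_cong[OF H _ uz(2)], (intro bilinear_mapsI lin; simp add: ab uz)) (simp add: ab uz m_assoc)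
      also have "\<dots> = (S (a \<otimes>\<^bsub>H\<^esub> u) \<otimes>\<^bsub>H\<^esub> b) \<otimes>\<^bsub>H\<^esub> tensor_lift R H (\<lambda>v d. v \<otimes>\<^bsub>H\<^esub> S d) (comult H z)"
        by (rule sw_linear[OF H H antipode_bil(2) linear_left_mult uz(2), symmetric]) (simp add: ab uz)
      also have "\<dots> = counit H z \<odot>\<^bsub>H\<^esub> (S (a \<otimes>\<^bsub>H\<^esub> u) \<otimes>\<^bsub>H\<^esub> b)"
        using ab uz by (simp add: antipode_right smult_mult_right)
      finally show ?thesis .
    qed
    have b: "(\<lambda>u z. counit H z \<odot>\<^bsub>H\<^esub> (S (a \<otimes>\<^bsub>H\<^esub> u) \<otimes>\<^bsub>H\<^esub> b)) \<in> bilinear_maps R H H H"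
      by (intro bilinear_mapsI lin; simp add: ab)
    have "S (a \<otimes>\<^bsub>H\<^esub> k) \<otimes>\<^bsub>H\<^esub> b = tensor_lift R H (\<lambda>u z. counit H z \<odot>\<^bsub>H\<^esub> (S (a \<otimes>\<^bsub>H\<^esub> u) \<otimes>\<^bsub>H\<^esub> b)) (comult H k)"
      by (rule sw_counit_right[OF H _ k, symmetric]) (intro lin ab)
    also have "\<dots> = tensor_lift R H (\<lambda>u z. tensor_lift R H
        (\<lambda>v d. (S (a \<otimes>\<^bsub>H\<^esub> u) \<otimes>\<^bsub>H\<^esub> (b \<otimes>\<^bsub>H\<^esub> v)) \<otimes>\<^bsub>H\<^esub> S d) (comult H z)) (comult H k)"
      by (rule sw_cong[OF H b k]) (simp add: inner)
    also have "\<dots> = tensor_lift R H (\<lambda>w d. tensor_lift R H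
      (\<lambda>u v. (S (a \<otimes>\<^bsub>H\<^esub> u) \<otimes>\<^bsub>H\<^esub> (b \<otimes>\<^bsub>H\<^esub> v)) \<otimes>\<^bsub>H\<^esub> S d) (comult H w)) (comult H k)"
      by (rule sw_coassoc[OF H k, symmetric]; (intro bilinear_mapsI lin)?; simp add: ab)
    finally show ?thesis .
  qed
  let ?\<mu> = "\<lambda>a b w d. tensor_lift R H (\<lambda>u v. (S (a \<otimes>\<^bsub>H\<^esub> u) \<otimes>\<^bsub>H\<^esub> (b \<otimes>\<^bsub>H\<^esub> v)) \<otimes>\<^bsub>H\<^esub> S d) (comult H w)"
  have \<mu>1: "?\<mu> a b \<in> bilinear_maps R H H H" if "a \<in> carrier H" "b \<in> carrier H" for a b
    by (intro bilinear_mapsI lin'; simp add: that)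
  have \<mu>2: "(\<lambda>a b. ?\<mu> a b w d) \<in> bilinear_maps R H H H" if "w \<in> carrier H" "d \<in> carrier H" for w d
    by (intro bilinear_mapsI lin'; simp add: that)
  have \<mu>: "tensor_lift R H (\<lambda>a b. ?\<mu> a b w d) (comult H x) = counit H w \<odot>\<^bsub>H\<^esub> (counit H x \<odot>\<^bsub>H\<^esub> S d)"
    if wd: "w \<in> carrier H" "d \<in> carrier H" for w d
  proof -
    have "tensor_lift R H (\<lambda>a b. ?\<mu> a b w d) (comult H x) =
        tensor_lift R H (\<lambda>p q. (S p \<otimes>\<^bsub>H\<^esub> q) \<otimes>\<^bsub>H\<^esub> S d) (comult H (x \<otimes>\<^bsub>H\<^esub> w))"
      by (rule sw_mult[OF H _ x wd(1), symmetric]) (intro bilinear_mapsI lin; simp add: wd)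
    also have "\<dots> = tensor_lift R H (\<lambda>p q. S p \<otimes>\<^bsub>H\<^esub> q) (comult H (x \<otimes>\<^bsub>H\<^esub> w)) \<otimes>\<^bsub>H\<^esub> S d"
      by (rule sw_linear[OF H H antipode_bil(1) linear_right_mult, symmetric]) (simp_all add: wd x)
    also have "\<dots> = counit H (x \<otimes>\<^bsub>H\<^esub> w) \<odot>\<^bsub>H\<^esub> S d"
      using wd x by (simp add: antipode_left smult_mult_left)
    also have "\<dots> = counit H w \<odot>\<^bsub>H\<^esub> (counit H x \<odot>\<^bsub>H\<^esub> S d)"
      using wd x by (simp add: counit_mult R.m_comm[of "counit H x"] smult_assoc1)
    finally show ?thesis .
  qed
  have "tensor_lift R H (\<lambda>a b. S (a \<otimes>\<^bsub>H\<^esub> k) \<otimes>\<^bsub>H\<^esub> b) (comult H x) =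
    tensor_lift R H (\<lambda>a b. tensor_lift R H (?\<mu> a b) (comult H k)) (comult H x)"
    by (rule sw_cong[OF H _ x], (intro bilinear_mapsI lin; simp add: k)) (rule expand)
  also have "\<dots> = tensor_lift R H (\<lambda>w d. tensor_lift R H (\<lambda>a b. ?\<mu> a b w d) (comult H x)) (comult H k)"
    by (rule R.tensor_lift_swap[OF H H H H H \<mu>1 \<mu>2]) (simp_all add: x k)
  also have "\<dots> = tensor_lift R H (\<lambda>w d. counit H w \<odot>\<^bsub>H\<^esub> (counit H x \<odot>\<^bsub>H\<^esub> S d)) (comult H k)"
    by (rule sw_cong2[OF H _ k \<mu>]) (intro bilinear_mapsI lin; simp add: x)
  also have "\<dots> = counit H x \<odot>\<^bsub>H\<^esub> S k"
    by (rule sw_counit_left[OF H _ k]) (intro lin; simp add: x)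
  finally show ?thesis .
qed

text \<open>The same insertion in the first argument gives S(h k) = \<Sum> S(h_1 k) h_2 S(h_3), and
  \<open>antipode_mult_aux\<close> evaluates the product of the first two factors.\<close>

lemma antipode_mult:
  assumes h: "h \<in> carrier H" and k: "k \<in> carrier H"
  shows "S (h \<otimes>\<^bsub>H\<^esub> k) = S k \<otimes>\<^bsub>H\<^esub> S h"
proof -
  note H = module_axioms
  have "S (h \<otimes>\<^bsub>H\<^esub> k) = tensor_lift R H (\<lambda>a y. counit H y \<odot>\<^bsub>H\<^esub> S (a \<otimes>\<^bsub>H\<^esub> k)) (comult H h)"
    by (rule sw_counit_right[OF H _ h, symmetric]) (intro lin k)
  also have "\<dots> = tensor_lift R H (\<lambda>a y. tensor_lift R H (\<lambda>b c. S (a \<otimes>\<^bsub>H\<^esub> k) \<otimes>\<^bsub>H\<^esub> (b \<otimes>\<^bsub>H\<^esub> S c)) (comult H y)) (comult H h)"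
  proof (rule sw_cong[OF H _ h])
    show "(\<lambda>a y. counit H y \<odot>\<^bsub>H\<^esub> S (a \<otimes>\<^bsub>H\<^esub> k)) \<in> bilinear_maps R H H H"
      by (intro bilinear_mapsI lin; simp add: k)
    fix a y assume ay: "a \<in> carrier H" "y \<in> carrier H"
    have "tensor_lift R H (\<lambda>b c. S (a \<otimes>\<^bsub>H\<^esub> k) \<otimes>\<^bsub>H\<^esub> (b \<otimes>\<^bsub>H\<^esub> S c)) (comult H y) =
        S (a \<otimes>\<^bsub>H\<^esub> k) \<otimes>\<^bsub>H\<^esub> tensor_lift R H (\<lambda>b c. b \<otimes>\<^bsub>H\<^esub> S c) (comult H y)"
      by (rule sw_linear[OF H H antipode_bil(2) linear_left_mult ay(2), symmetric]) (simp add: ay k)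
    also have "\<dots> = counit H y \<odot>\<^bsub>H\<^esub> S (a \<otimes>\<^bsub>H\<^esub> k)"
      using ay k by (simp add: antipode_right smult_mult_right)
    finally show "counit H y \<odot>\<^bsub>H\<^esub> S (a \<otimes>\<^bsub>H\<^esub> k) =
      tensor_lift R H (\<lambda>b c. S (a \<otimes>\<^bsub>H\<^esub> k) \<otimes>\<^bsub>H\<^esub> (b \<otimes>\<^bsub>H\<^esub> S c)) (comult H y)" by simp
  qed
  also have "\<dots> = tensor_lift R H (\<lambda>x c. tensor_lift R H (\<lambda>a b. S (a \<otimes>\<^bsub>H\<^esub> k) \<otimes>\<^bsub>H\<^esub> (b \<otimes>\<^bsub>H\<^esub> S c)) (comult H x)) (comult H h)"
    by (rule sw_coassoc[OF H h, symmetric]; (intro bilinear_mapsI lin)?; simp add: k)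
  also have "\<dots> = tensor_lift R H (\<lambda>x c. counit H x \<odot>\<^bsub>H\<^esub> (S k \<otimes>\<^bsub>H\<^esub> S c)) (comult H h)"
  proof (rule sw_cong2[OF H _ h])
    show "(\<lambda>x c. counit H x \<odot>\<^bsub>H\<^esub> (S k \<otimes>\<^bsub>H\<^esub> S c)) \<in> bilinear_maps R H H H"
      by (intro bilinear_mapsI lin; simp add: k)
    fix x c assume xc: "x \<in> carrier H" "c \<in> carrier H"
    have b: "(\<lambda>a b. S (a \<otimes>\<^bsub>H\<^esub> k) \<otimes>\<^bsub>H\<^esub> b) \<in> bilinear_maps R H H H"
      by (intro bilinear_mapsI lin; simp add: k)
    have "tensor_lift R H (\<lambda>a b. S (a \<otimes>\<^bsub>H\<^esub> k) \<otimes>\<^bsub>H\<^esub> (b \<otimes>\<^bsub>H\<^esub> S c)) (comult H x) =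
      tensor_lift R H (\<lambda>a b. (S (a \<otimes>\<^bsub>H\<^esub> k) \<otimes>\<^bsub>H\<^esub> b) \<otimes>\<^bsub>H\<^esub> S c) (comult H x)"
      by (rule sw_cong[OF H _ xc(1)], (intro bilinear_mapsI lin; simp add: k xc)) (simp add: m_assoc k xc)
    also have "\<dots> = tensor_lift R H (\<lambda>a b. S (a \<otimes>\<^bsub>H\<^esub> k) \<otimes>\<^bsub>H\<^esub> b) (comult H x) \<otimes>\<^bsub>H\<^esub> S c"
      by (rule sw_linear[OF H H b linear_right_mult xc(1), symmetric]) (simp add: xc)
    also have "\<dots> = counit H x \<odot>\<^bsub>H\<^esub> (S k \<otimes>\<^bsub>H\<^esub> S c)"
      using xc k by (simp add: antipode_mult_aux smult_mult_left)
    finally show "tensor_lift R H (\<lambda>a b. S (a \<otimes>\<^bsub>H\<^esub> k) \<otimes>\<^bsub>H\<^esub> (b \<otimes>\<^bsub>H\<^esub> S c)) (comult H x) =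
      counit H x \<odot>\<^bsub>H\<^esub> (S k \<otimes>\<^bsub>H\<^esub> S c)" .
  qed
  also have "\<dots> = S k \<otimes>\<^bsub>H\<^esub> S h"
    by (rule sw_counit_left[OF H _ h]) (intro lin; simp add: k)
  finally show ?thesis .
qed

section \<open>Functionals acting on H from both sides\<close>

abbreviation "Dual \<equiv> linear_maps R H (self_module R)"

lemma Dual_closed [simp]: "f \<in> Dual \<Longrightarrow> h \<in> carrier H \<Longrightarrow> f h \<in> carrier R"
  using linear_mapsD(1) by fastforce

lemma hit_bil:
  assumes "f \<in> Dual"
  shows "(\<lambda>h1 h2. f h2 \<odot>\<^bsub>H\<^esub> h1) \<in> bilinear_maps R H H H" "(\<lambda>h1 h2. f h1 \<odot>\<^bsub>H\<^esub> h2) \<in> bilinear_maps R H H H"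
  by (intro bilinear_mapsI lin assms; simp add: assms)+

lemma hit_left_linear: "f \<in> Dual \<Longrightarrow> hit_left R H f \<in> linear_maps R H H"
  unfolding hit_left_def by (rule lin_sw1[OF module_axioms hit_bil(1) linear_maps_id])

lemma hit_right_linear: "f \<in> Dual \<Longrightarrow> (\<lambda>h. hit_right R H h f) \<in> linear_maps R H H"
  unfolding hit_right_def by (rule lin_sw1[OF module_axioms hit_bil(2) linear_maps_id])

lemma hit_closed [simp]:
  "f \<in> Dual \<Longrightarrow> h \<in> carrier H \<Longrightarrow> hit_left R H f h \<in> carrier H"
  "f \<in> Dual \<Longrightarrow> h \<in> carrier H \<Longrightarrow> hit_right R H h f \<in> carrier H"
  using linear_mapsD(1)[OF hit_left_linear] linear_mapsD(1)[OF hit_right_linear] by simp_all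

lemma linear_hit_left:
  assumes f: "f \<in> Dual" and P: "module R P" and \<phi>: "\<phi> \<in> linear_maps R H P" and h: "h \<in> carrier H"
  shows "\<phi> (hit_left R H f h) = tensor_lift R P (\<lambda>h1 h2. f h2 \<odot>\<^bsub>P\<^esub> \<phi> h1) (comult H h)"
  unfolding hit_left_def sw_linear[OF module_axioms P hit_bil(1)[OF f] \<phi> h]
  by (rule sw_cong[OF P bilinear_maps_linear[OF hit_bil(1)[OF f] \<phi>] h]) (simp add: linear_mapsD(3)[OF \<phi>] f)

lemma linear_hit_right:
  assumes f: "f \<in> Dual" and P: "module R P" and \<phi>: "\<phi> \<in> linear_maps R H P" and h: "h \<in> carrier H"
  shows "\<phi> (hit_right R H h f) = tensor_lift R P (\<lambda>h1 h2. f h1 \<odot>\<^bsub>P\<^esub> \<phi> h2) (comult H h)"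
  unfolding hit_right_def sw_linear[OF module_axioms P hit_bil(2)[OF f] \<phi> h]
  by (rule sw_cong[OF P bilinear_maps_linear[OF hit_bil(2)[OF f] \<phi>] h]) (simp add: linear_mapsD(3)[OF \<phi>] f)

lemma hit_counit:
  assumes "h \<in> carrier H"
  shows "hit_left R H (counit H) h = h" "hit_right R H h (counit H) = h"
  unfolding hit_left_def hit_right_def using assms by (simp_all add: counit_left counit_right)

text \<open>Needed because the unit of \<open>H\<^sup>\<circ>\<close> is the counit cut off outside
  the carrier, a difference that the actions on H do not see.\<close>

lemma hit_restrict:
  assumes "h \<in> carrier H" "f \<in> Dual"
  shows "hit_left R H (restrict f (carrier H)) h = hit_left R H f h" "hit_right R H h (restrict f (carrier H)) = hit_right R H h f"
  unfolding hit_left_def hit_right_def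
  by (rule sw_cong2[OF module_axioms hit_bil(1)[OF assms(2)] assms(1)] sw_cong2[OF module_axioms hit_bil(2)[OF assms(2)] assms(1)]; simp)+

text \<open>By coassociativity both sides are \<Sum> g(k_1) f(k_3) k_2. In
  \<open>twist_rho_lift\<close> this brings two factors of a product under the same right
  action.\<close>

lemma hit_left_hit_right:
  assumes f: "f \<in> Dual" and g: "g \<in> Dual" and k: "k \<in> carrier H"
  shows "hit_right R H (hit_left R H f k) g = hit_left R H f (hit_right R H k g)"
proof -
  note H = module_axioms
  let ?\<tau> = "\<lambda>x y z. g x \<odot>\<^bsub>H\<^esub> (f z \<odot>\<^bsub>H\<^esub> y)"
  have "hit_right R H (hit_left R H f k) g = tensor_lift R H (\<lambda>k1 k2. f k2 \<odot>\<^bsub>H\<^esub> hit_right R H k1 g) (comult H k)"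
    by (rule linear_hit_left[OF f H hit_right_linear[OF g] k])
  also have "\<dots> = tensor_lift R H (\<lambda>k1 k2. tensor_lift R H (\<lambda>x y. ?\<tau> x y k2) (comult H k1)) (comult H k)"
  proof (rule sw_cong[OF H _ k])
    show "(\<lambda>k1 k2. f k2 \<odot>\<^bsub>H\<^esub> hit_right R H k1 g) \<in> bilinear_maps R H H H"
      by (intro bilinear_mapsI lin f hit_right_linear[OF g]; simp add: f g)
    fix x y assume "x \<in> carrier H" "y \<in> carrier H"
    then show "f y \<odot>\<^bsub>H\<^esub> hit_right R H x g = tensor_lift R H (\<lambda>a b. ?\<tau> a b y) (comult H x)"
      using linear_hit_right[OF g H lin_smult2[OF linear_maps_id H, of "f y"]] f by simp
  qed
  also have "\<dots> = tensor_lift R H (\<lambda>k1 k2. tensor_lift R H (?\<tau> k1) (comult H k2)) (comult H k)"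
    by (rule sw_coassoc[OF H k]; (intro bilinear_mapsI lin f g)?; simp add: f g)
  also have "\<dots> = tensor_lift R H (\<lambda>k1 k2. g k1 \<odot>\<^bsub>H\<^esub> hit_left R H f k2) (comult H k)"
  proof (rule sw_cong2[OF H _ k])
    show "(\<lambda>k1 k2. g k1 \<odot>\<^bsub>H\<^esub> hit_left R H f k2) \<in> bilinear_maps R H H H"
      by (intro bilinear_mapsI lin g hit_left_linear[OF f]; simp add: f g)
    fix x y assume xy: "x \<in> carrier H" "y \<in> carrier H"
    have b: "(\<lambda>a b. f b \<odot>\<^bsub>H\<^esub> a) \<in> bilinear_maps R H H H" by (rule hit_bil(1)[OF f])
    show "tensor_lift R H (?\<tau> x) (comult H y) = g x \<odot>\<^bsub>H\<^esub> hit_left R H f y"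
      unfolding hit_left_def
      by (rule sw_linear[OF H H b lin_smult2[OF linear_maps_id H] xy(2), symmetric]) (simp add: g xy)
  qed
  also have "\<dots> = hit_left R H f (hit_right R H k g)"
    by (rule linear_hit_right[OF g H hit_left_linear[OF f] k, symmetric])
  finally show ?thesis .
qed

definition conv :: "('h \<Rightarrow> 'r) \<Rightarrow> ('h \<Rightarrow> 'r) \<Rightarrow> 'h \<Rightarrow> 'r" where
  "conv f g = (\<lambda>h\<in>carrier H. tensor_lift R (self_module R) (\<lambda>h1 h2. f h1 \<otimes>\<^bsub>R\<^esub> g h2) (comult H h))"

lemma conv_bil: "f \<in> Dual \<Longrightarrow> g \<in> Dual \<Longrightarrow> (\<lambda>h1 h2. f h1 \<otimes>\<^bsub>R\<^esub> g h2) \<in> bilinear_maps R H H (self_module R)"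
  by (intro bilinear_mapsI lin; simp)

lemma conv_Dual:
  assumes "f \<in> Dual" "g \<in> Dual"
  shows "conv f g \<in> Dual"
  by (rule linear_maps_eqI[OF module_axioms lin_sw1[OF R.self_module conv_bil[OF assms] linear_maps_id]])
    (simp add: conv_def)

lemma smult_conv:
  assumes f: "f \<in> Dual" and g: "g \<in> Dual" and P: "module R P" and p: "p \<in> carrier P" and h: "h \<in> carrier H"
  shows "conv f g h \<odot>\<^bsub>P\<^esub> p = tensor_lift R P (\<lambda>x y. f x \<odot>\<^bsub>P\<^esub> (g y \<odot>\<^bsub>P\<^esub> p)) (comult H h)"
proof -
  have l: "(\<lambda>r. r \<odot>\<^bsub>P\<^esub> p) \<in> linear_maps R (self_module R) P"
    by (rule lin_smult1[OF linear_maps_id P p])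
  have "conv f g h \<odot>\<^bsub>P\<^esub> p = tensor_lift R P (\<lambda>x y. (f x \<otimes>\<^bsub>R\<^esub> g y) \<odot>\<^bsub>P\<^esub> p) (comult H h)"
    using sw_linear[OF R.self_module P conv_bil[OF f g] l h] h by (simp add: conv_def)
  also have "\<dots> = tensor_lift R P (\<lambda>x y. f x \<odot>\<^bsub>P\<^esub> (g y \<odot>\<^bsub>P\<^esub> p)) (comult H h)"
    by (rule sw_cong[OF P bilinear_maps_linear[OF conv_bil[OF f g] l] h])
      (simp add: module.smult_assoc1[OF P] f g p)
  finally show ?thesis .
qed

lemma hit_left_conv:
  assumes f: "f \<in> Dual" and g: "g \<in> Dual" and m: "m \<in> carrier H"
  shows "hit_left R H (conv f g) m = hit_left R H f (hit_left R H g m)"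
proof -
  note H = module_axioms and fg = conv_Dual[OF f g]
  let ?\<tau> = "\<lambda>x y z. f y \<odot>\<^bsub>H\<^esub> (g z \<odot>\<^bsub>H\<^esub> x)"
  have "hit_left R H (conv f g) m = tensor_lift R H (\<lambda>k1 k2. tensor_lift R H (?\<tau> k1) (comult H k2)) (comult H m)"
    unfolding hit_left_def by (rule sw_cong[OF H hit_bil(1)[OF fg] m]) (rule smult_conv[OF f g H])
  also have "\<dots> = tensor_lift R H (\<lambda>k1 k2. tensor_lift R H (\<lambda>x y. ?\<tau> x y k2) (comult H k1)) (comult H m)"
    by (rule sw_coassoc[OF H m, symmetric]; (intro bilinear_mapsI lin f g)?; simp add: f g)
  also have "\<dots> = tensor_lift R H (\<lambda>k1 k2. g k2 \<odot>\<^bsub>H\<^esub> hit_left R H f k1) (comult H m)"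
  proof (rule sw_cong2[OF H _ m])
    show "(\<lambda>k1 k2. g k2 \<odot>\<^bsub>H\<^esub> hit_left R H f k1) \<in> bilinear_maps R H H H"
      by (intro bilinear_mapsI lin g hit_left_linear[OF f]; simp add: f g)
    fix x y assume "x \<in> carrier H" "y \<in> carrier H"
    then show "tensor_lift R H (\<lambda>a b. ?\<tau> a b y) (comult H x) = g y \<odot>\<^bsub>H\<^esub> hit_left R H f x"
      using linear_hit_left[OF f H lin_smult2[OF linear_maps_id H, of "g y"]] g by simp
  qed
  also have "\<dots> = hit_left R H f (hit_left R H g m)"
    by (rule linear_hit_left[OF g H hit_left_linear[OF f] m, symmetric])
  finally show ?thesis .
qed

text \<open>Both sides are \<Sum> f(m_1) g(m_2) m_3. As operators on H the right hits compose in the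
  opposite order from the left ones, which is where \<open>rho_lift\<close> acquires its reversal of
  products.\<close>

lemma hit_right_conv:
  assumes f: "f \<in> Dual" and g: "g \<in> Dual" and m: "m \<in> carrier H"
  shows "hit_right R H m (conv f g) = hit_right R H (hit_right R H m f) g"
proof -
  note H = module_axioms and fg = conv_Dual[OF f g]
  let ?\<tau> = "\<lambda>x y z. f x \<odot>\<^bsub>H\<^esub> (g y \<odot>\<^bsub>H\<^esub> z)"
  have "hit_right R H m (conv f g) = tensor_lift R H (\<lambda>k1 k2. tensor_lift R H (\<lambda>x y. ?\<tau> x y k2) (comult H k1)) (comult H m)"
    unfolding hit_right_def by (rule sw_cong[OF H hit_bil(2)[OF fg] m]) (rule smult_conv[OF f g H])
  also have "\<dots> = tensor_lift R H (\<lambda>k1 k2. tensor_lift R H (?\<tau> k1) (comult H k2)) (comult H m)"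
    by (rule sw_coassoc[OF H m]; (intro bilinear_mapsI lin f g)?; simp add: f g)
  also have "\<dots> = tensor_lift R H (\<lambda>k1 k2. f k1 \<odot>\<^bsub>H\<^esub> hit_right R H k2 g) (comult H m)"
  proof (rule sw_cong2[OF H _ m])
    show "(\<lambda>k1 k2. f k1 \<odot>\<^bsub>H\<^esub> hit_right R H k2 g) \<in> bilinear_maps R H H H"
      by (intro bilinear_mapsI lin f hit_right_linear[OF g]; simp add: f g)
    fix x y assume xy: "x \<in> carrier H" "y \<in> carrier H"
    show "tensor_lift R H (?\<tau> x) (comult H y) = f x \<odot>\<^bsub>H\<^esub> hit_right R H y g"
      unfolding hit_right_def
      by (rule sw_linear[OF H H hit_bil(2)[OF g] lin_smult2[OF linear_maps_id H] xy(2), symmetric]) (simp add: f xy)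
  qed
  also have "\<dots> = hit_right R H (hit_right R H m f) g"
    by (rule linear_hit_right[OF f H hit_right_linear[OF g] m, symmetric])
  finally show ?thesis .
qed

text \<open>S reverses products and is injective, and it turns the flipped identities for T into the
  antipode axioms. In the last item coassociativity rewrites the sum as \<Sum> f(k_3) k_2 T(k_1),
  whose first two components collapse to the counit; it is the tool for recovering a tensor from its
  operator.\<close>

lemma antipode_inverse:
  assumes bij: "bij_betw S (carrier H) (carrier H)"
    and T_def: "T = inv_into (carrier H) S"
  shows "T \<in> linear_maps R H H"
    and "\<And>h. h \<in> carrier H \<Longrightarrow> S (T h) = h"
    and "\<And>h. h \<in> carrier H \<Longrightarrow> tensor_lift R H (\<lambda>a b. b \<otimes>\<^bsub>H\<^esub> T a) (comult H h) = counit H h \<odot>\<^bsub>H\<^esub> \<one>\<^bsub>H\<^esub>"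
    and "\<And>h. h \<in> carrier H \<Longrightarrow> tensor_lift R H (\<lambda>a b. T b \<otimes>\<^bsub>H\<^esub> a) (comult H h) = counit H h \<odot>\<^bsub>H\<^esub> \<one>\<^bsub>H\<^esub>"
    and "\<And>f k. f \<in> Dual \<Longrightarrow> k \<in> carrier H \<Longrightarrow>
      tensor_lift R H (\<lambda>k1 k2. hit_left R H f k2 \<otimes>\<^bsub>H\<^esub> T k1) (comult H k) = f k \<odot>\<^bsub>H\<^esub> \<one>\<^bsub>H\<^esub>"
proof -
  note H = module_axioms
  show T: "T \<in> linear_maps R H H"
    unfolding T_def by (rule linear_maps_inv_into[OF H antipode_linear bij])
  note Tc = linear_mapsD(1)[OF T]
  have linT: "(\<lambda>x. T (\<phi> x)) \<in> linear_maps R X H" if "\<phi> \<in> linear_maps R X H" for X :: "('r, 'q, 'w) module_scheme" and \<phi>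
    by (rule linear_maps_comp[OF T that])
  show ST: "S (T h) = h" if "h \<in> carrier H" for h
    unfolding T_def by (rule f_inv_into_f) (use that bij in \<open>auto simp: bij_betw_def\<close>)
  have inj: "x = y" if "S x = S y" "x \<in> carrier H" "y \<in> carrier H" for x y
    using that bij by (auto simp: bij_betw_def dest: inj_onD)
  have b1: "(\<lambda>a b. b \<otimes>\<^bsub>H\<^esub> T a) \<in> bilinear_maps R H H H" and b2: "(\<lambda>a b. T b \<otimes>\<^bsub>H\<^esub> a) \<in> bilinear_maps R H H H"
    by (intro bilinear_mapsI lin linT; simp add: Tc)+
  have S1: "S (counit H h \<odot>\<^bsub>H\<^esub> \<one>\<^bsub>H\<^esub>) = counit H h \<odot>\<^bsub>H\<^esub> \<one>\<^bsub>H\<^esub>" if "h \<in> carrier H" for h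
    using that by (simp add: linear_mapsD(3)[OF antipode_linear] antipode_one)
  show T1: "tensor_lift R H (\<lambda>a b. b \<otimes>\<^bsub>H\<^esub> T a) (comult H h) = counit H h \<odot>\<^bsub>H\<^esub> \<one>\<^bsub>H\<^esub>" if h: "h \<in> carrier H" for h
  proof (rule inj)
    have "S (tensor_lift R H (\<lambda>a b. b \<otimes>\<^bsub>H\<^esub> T a) (comult H h)) = tensor_lift R H (\<lambda>a b. S (b \<otimes>\<^bsub>H\<^esub> T a)) (comult H h)"
      by (rule sw_linear[OF H H b1 antipode_linear h])
    also have "\<dots> = tensor_lift R H (\<lambda>a b. a \<otimes>\<^bsub>H\<^esub> S b) (comult H h)"
      by (rule sw_cong2[OF H antipode_bil(2) h]) (simp add: antipode_mult Tc ST)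
    also have "\<dots> = S (counit H h \<odot>\<^bsub>H\<^esub> \<one>\<^bsub>H\<^esub>)" using h by (simp add: antipode_right S1)
    finally show "S (tensor_lift R H (\<lambda>a b. b \<otimes>\<^bsub>H\<^esub> T a) (comult H h)) = S (counit H h \<odot>\<^bsub>H\<^esub> \<one>\<^bsub>H\<^esub>)" .
  qed (simp_all add: h sw_closed[OF H b1])
  show "tensor_lift R H (\<lambda>a b. T b \<otimes>\<^bsub>H\<^esub> a) (comult H h) = counit H h \<odot>\<^bsub>H\<^esub> \<one>\<^bsub>H\<^esub>" if h: "h \<in> carrier H" for h
  proof (rule inj)
    have "S (tensor_lift R H (\<lambda>a b. T b \<otimes>\<^bsub>H\<^esub> a) (comult H h)) = tensor_lift R H (\<lambda>a b. S (T b \<otimes>\<^bsub>H\<^esub> a)) (comult H h)"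
      by (rule sw_linear[OF H H b2 antipode_linear h])
    also have "\<dots> = tensor_lift R H (\<lambda>a b. S a \<otimes>\<^bsub>H\<^esub> b) (comult H h)"
      by (rule sw_cong2[OF H antipode_bil(1) h]) (simp add: antipode_mult Tc ST)
    also have "\<dots> = S (counit H h \<odot>\<^bsub>H\<^esub> \<one>\<^bsub>H\<^esub>)" using h by (simp add: antipode_left S1)
    finally show "S (tensor_lift R H (\<lambda>a b. T b \<otimes>\<^bsub>H\<^esub> a) (comult H h)) = S (counit H h \<odot>\<^bsub>H\<^esub> \<one>\<^bsub>H\<^esub>)" .
  qed (simp_all add: h sw_closed[OF H b2])
  show "tensor_lift R H (\<lambda>k1 k2. hit_left R H f k2 \<otimes>\<^bsub>H\<^esub> T k1) (comult H k) = f k \<odot>\<^bsub>H\<^esub> \<one>\<^bsub>H\<^esub>"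
    if f: "f \<in> Dual" and k: "k \<in> carrier H" for f k
  proof -
    let ?\<tau> = "\<lambda>x y z. f z \<odot>\<^bsub>H\<^esub> (y \<otimes>\<^bsub>H\<^esub> T x)"
    have "tensor_lift R H (\<lambda>k1 k2. hit_left R H f k2 \<otimes>\<^bsub>H\<^esub> T k1) (comult H k) =
      tensor_lift R H (\<lambda>k1 k2. tensor_lift R H (?\<tau> k1) (comult H k2)) (comult H k)"
    proof (rule sw_cong[OF H _ k])
      show "(\<lambda>k1 k2. hit_left R H f k2 \<otimes>\<^bsub>H\<^esub> T k1) \<in> bilinear_maps R H H H"
        by (intro bilinear_mapsI lin linT hit_left_linear[OF f]; simp add: f Tc)
      fix x y assume xy: "x \<in> carrier H" "y \<in> carrier H"
      show "hit_left R H f y \<otimes>\<^bsub>H\<^esub> T x = tensor_lift R H (?\<tau> x) (comult H y)"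
        by (rule linear_hit_left[OF f H linear_right_mult[OF Tc[OF xy(1)]] xy(2)])
    qed
    also have "\<dots> = tensor_lift R H (\<lambda>k1 k2. tensor_lift R H (\<lambda>x y. ?\<tau> x y k2) (comult H k1)) (comult H k)"
      by (rule sw_coassoc[OF H k, symmetric]; (intro bilinear_mapsI lin linT f)?; simp add: f Tc)
    also have "\<dots> = tensor_lift R H (\<lambda>k1 k2. counit H k1 \<odot>\<^bsub>H\<^esub> (f k2 \<odot>\<^bsub>H\<^esub> \<one>\<^bsub>H\<^esub>)) (comult H k)"
    proof (rule sw_cong2[OF H _ k])
      show "(\<lambda>k1 k2. counit H k1 \<odot>\<^bsub>H\<^esub> (f k2 \<odot>\<^bsub>H\<^esub> \<one>\<^bsub>H\<^esub>)) \<in> bilinear_maps R H H H"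
        by (intro bilinear_mapsI lin f; simp add: f)
      fix x y assume xy: "x \<in> carrier H" "y \<in> carrier H"
      have "tensor_lift R H (\<lambda>a b. ?\<tau> a b y) (comult H x) = f y \<odot>\<^bsub>H\<^esub> (counit H x \<odot>\<^bsub>H\<^esub> \<one>\<^bsub>H\<^esub>)"
        unfolding T1[OF xy(1), symmetric]
        by (rule sw_linear[OF H H b1 lin_smult2[OF linear_maps_id H] xy(1), symmetric]) (simp add: f xy)
      also have "\<dots> = counit H x \<odot>\<^bsub>H\<^esub> (f y \<odot>\<^bsub>H\<^esub> \<one>\<^bsub>H\<^esub>)"
        using f xy by (simp add: R.m_comm flip: smult_assoc1)
      finally show "tensor_lift R H (\<lambda>a b. ?\<tau> a b y) (comult H x) = counit H x \<odot>\<^bsub>H\<^esub> (f y \<odot>\<^bsub>H\<^esub> \<one>\<^bsub>H\<^esub>)" .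
    qed
    also have "\<dots> = f k \<odot>\<^bsub>H\<^esub> \<one>\<^bsub>H\<^esub>"
      by (rule sw_counit_left[OF H lin_smult1[OF f H] k]) simp
    finally show ?thesis .
  qed
qed

end

lemma (in module) smult_left_commute:
  "r \<in> carrier R \<Longrightarrow> s \<in> carrier R \<Longrightarrow> x \<in> carrier M \<Longrightarrow> r \<odot>\<^bsub>M\<^esub> (s \<odot>\<^bsub>M\<^esub> x) = s \<odot>\<^bsub>M\<^esub> (r \<odot>\<^bsub>M\<^esub> x)"
  by (simp add: R.m_comm flip: smult_assoc1)

section \<open>The smash product \<open>H # U\<close>\<close>

text \<open>\<open>C\<close> stands for U with its Hopf structure. The assumptions are the facts
  about U that the computation needs, in a form that can be tested at points of H;
  \<open>dual_hopf_restrict\<close> derives them from the hypotheses on U. \<open>C_inj\<close> says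
  that H \<otimes> U embeds into \<open>H\<^sup>H\<close>, and \<open>RL\<close> is the RL-condition
  with both operators evaluated.\<close>

locale dual_hopf = hopf_algebra R H
  for R :: "('r, 's) ring_scheme" (structure)
    and H :: "('r, 'h, 'x) hopf_scheme" (structure) +
  fixes C :: "('r, 'h \<Rightarrow> 'r, 'z) hopf_scheme"
  assumes C: "module R C"
    and C_Dual: "f \<in> carrier C \<Longrightarrow> f \<in> Dual"
    and C_ext: "f \<in> carrier C \<Longrightarrow> f \<in> extensional (carrier H)"
    and C_eval: "h \<in> carrier H \<Longrightarrow> (\<lambda>f. f h) \<in> linear_maps R C (self_module R)"
    and C_mult_closed: "f \<in> carrier C \<Longrightarrow> g \<in> carrier C \<Longrightarrow> f \<otimes>\<^bsub>C\<^esub> g \<in> carrier C"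
    and C_mult: "f \<in> carrier C \<Longrightarrow> g \<in> carrier C \<Longrightarrow> f \<otimes>\<^bsub>C\<^esub> g = conv f g"
    and C_one_closed: "\<one>\<^bsub>C\<^esub> \<in> carrier C"
    and C_one: "\<one>\<^bsub>C\<^esub> = restrict (counit H) (carrier H)"
    and C_comult_linear: "comult C \<in> linear_maps R C (tensor_module R C C)"
    and C_comult: "f \<in> carrier C \<Longrightarrow> h \<in> carrier H \<Longrightarrow> k \<in> carrier H \<Longrightarrow>
      tensor_lift R (self_module R) (\<lambda>f1 f2. f1 h \<otimes>\<^bsub>R\<^esub> f2 k) (comult C f) = f (h \<otimes>\<^bsub>H\<^esub> k)"
    and C_antipode: "f \<in> carrier C \<Longrightarrow> h \<in> carrier H \<Longrightarrow> antipode C f h = f (antipode H h)"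
    and C_antipode_bij: "bij_betw (antipode C) (carrier C) (carrier C)"
    and antipode_bij: "bij_betw (antipode H) (carrier H) (carrier H)"
    and C_inj: "t \<in> carrier (tensor_module R H C) \<Longrightarrow>
      (\<And>k. k \<in> carrier H \<Longrightarrow> tensor_lift R H (\<lambda>h f. f k \<odot>\<^bsub>H\<^esub> h) t = \<zero>\<^bsub>H\<^esub>) \<Longrightarrow> t = \<zero>\<^bsub>tensor_module R H C\<^esub>"
    and RL: "f \<in> carrier C \<Longrightarrow> \<exists>t\<in>carrier (tensor_module R H C). \<forall>k\<in>carrier H.
      tensor_lift R H (\<lambda>h g. h \<otimes>\<^bsub>H\<^esub> hit_left R H g k) t = hit_right R H k f"
begin

lemmas H = module_axioms

abbreviation "HC \<equiv> tensor_module R H C"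
abbreviation "CC \<equiv> tensor_module R C C"

lemma HC: "module R HC" by (rule R.tensor_module_module[OF H C])
lemma CC: "module R CC" by (rule R.tensor_module_module[OF C C])

lemma C_eval_closed [simp]: "f \<in> carrier C \<Longrightarrow> h \<in> carrier H \<Longrightarrow> f h \<in> carrier R"
  using C_Dual by simp

lemmas C_comult_closed [simp] = linear_mapsD(1)[OF C_comult_linear]
declare C_Dual [simp] C_mult_closed [simp] C_one_closed [simp]

lemma C_eqI:
  assumes "f \<in> carrier C" "g \<in> carrier C" "\<And>h. h \<in> carrier H \<Longrightarrow> f h = g h"
  shows "f = g"
  by (rule extensionalityI[OF C_ext[OF assms(1)] C_ext[OF assms(2)] assms(3)])

text \<open>Elements of \<open>C\<close> are determined by their values on H, so linearity of a map
  into \<open>C\<close> can be checked after each evaluation.\<close>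

lemma C_linear_mapsI:
  assumes X: "module R X" and closed: "\<And>x. x \<in> carrier X \<Longrightarrow> \<phi> x \<in> carrier C"
    and lin: "\<And>h. h \<in> carrier H \<Longrightarrow> (\<lambda>x. \<phi> x h) \<in> linear_maps R X (self_module R)"
  shows "\<phi> \<in> linear_maps R X C"
proof -
  interpret X: module R X by (rule X)
  interpret C: module R C by (rule C)
  note ev = linear_mapsD[OF C_eval, simplified]
  note l = linear_mapsD[OF lin, simplified]
  show ?thesis
  proof (rule linear_mapsI)
    fix x y assume xy: "x \<in> carrier X" "y \<in> carrier X"
    show "\<phi> (x \<oplus>\<^bsub>X\<^esub> y) = \<phi> x \<oplus>\<^bsub>C\<^esub> \<phi> y"
      by (rule C_eqI) (simp_all add: closed xy ev(2) l(2))
  next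
    fix r x assume rx: "r \<in> carrier R" "x \<in> carrier X"
    show "\<phi> (r \<odot>\<^bsub>X\<^esub> x) = r \<odot>\<^bsub>C\<^esub> \<phi> x"
      by (rule C_eqI) (simp_all add: closed rx ev(3) l(3))
  qed (rule closed)
qed

lemma linC_hit_left: "k \<in> carrier H \<Longrightarrow> (\<lambda>f. hit_left R H f k) \<in> linear_maps R C H"
  unfolding hit_left_def by (rule lin_sw2[OF C H]) (simp_all add: hit_bil lin_smult1[OF C_eval H])

lemma linC_hit_right: "k \<in> carrier H \<Longrightarrow> (\<lambda>f. hit_right R H k f) \<in> linear_maps R C H"
  unfolding hit_right_def by (rule lin_sw2[OF C H]) (simp_all add: hit_bil lin_smult1[OF C_eval H])

lemma C_mult_apply: "f \<in> carrier C \<Longrightarrow> g \<in> carrier C \<Longrightarrow> h \<in> carrier H \<Longrightarrow>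
    (f \<otimes>\<^bsub>C\<^esub> g) h = tensor_lift R (self_module R) (\<lambda>h1 h2. f h1 \<otimes>\<^bsub>R\<^esub> g h2) (comult H h)"
  by (simp add: C_mult conv_def)

lemma linC_mult1: "g \<in> carrier C \<Longrightarrow> (\<lambda>f. f \<otimes>\<^bsub>C\<^esub> g) \<in> linear_maps R C C"
proof (rule C_linear_mapsI[OF C])
  fix h assume g: "g \<in> carrier C" and h: "h \<in> carrier H"
  have "(\<lambda>f. tensor_lift R (self_module R) (\<lambda>h1 h2. f h1 \<otimes>\<^bsub>R\<^esub> g h2) (comult H h)) \<in> linear_maps R C (self_module R)"
    by (rule lin_sw2[OF C R.self_module h]) (simp_all add: g conv_bil lin_scalar1[OF C_eval])
  then show "(\<lambda>f. (f \<otimes>\<^bsub>C\<^esub> g) h) \<in> linear_maps R C (self_module R)"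
    by (rule linear_maps_eqI[OF C]) (simp add: C_mult_apply g h)
qed simp

lemma linC_mult2: "f \<in> carrier C \<Longrightarrow> (\<lambda>g. f \<otimes>\<^bsub>C\<^esub> g) \<in> linear_maps R C C"
proof (rule C_linear_mapsI[OF C])
  fix h assume f: "f \<in> carrier C" and h: "h \<in> carrier H"
  have "(\<lambda>g. tensor_lift R (self_module R) (\<lambda>h1 h2. f h1 \<otimes>\<^bsub>R\<^esub> g h2) (comult H h)) \<in> linear_maps R C (self_module R)"
    by (rule lin_sw2[OF C R.self_module h]) (simp_all add: f conv_bil lin_scalar2[OF C_eval])
  then show "(\<lambda>g. (f \<otimes>\<^bsub>C\<^esub> g) h) \<in> linear_maps R C (self_module R)"
    by (rule linear_maps_eqI[OF C]) (simp add: C_mult_apply f h)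
qed simp

lemma C_mult_bil: "(\<lambda>f g. f \<otimes>\<^bsub>C\<^esub> g) \<in> bilinear_maps R C C C"
  by (rule bilinear_mapsI) (simp_all add: linC_mult1 linC_mult2)

lemma cw_cong:
  assumes "module R P" "\<beta> \<in> bilinear_maps R C C P" "f \<in> carrier C"
    and "\<And>f1 f2. f1 \<in> carrier C \<Longrightarrow> f2 \<in> carrier C \<Longrightarrow> \<beta> f1 f2 = \<gamma> f1 f2"
  shows "tensor_lift R P \<beta> (comult C f) = tensor_lift R P \<gamma> (comult C f)"
  by (rule R.tensor_lift_cong[OF C C assms(1,2,4)]) (simp_all add: assms(3))

lemma cw_linear:
  assumes "module R P" "module R Q" "\<beta> \<in> bilinear_maps R C C P" "\<phi> \<in> linear_maps R P Q" "f \<in> carrier C"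
  shows "\<phi> (tensor_lift R P \<beta> (comult C f)) = tensor_lift R Q (\<lambda>f1 f2. \<phi> (\<beta> f1 f2)) (comult C f)"
  by (rule linear_maps_tensor_lift[OF C C assms(1-4)]) (simp add: assms(5))

lemma C_eval_bil: "h \<in> carrier H \<Longrightarrow> k \<in> carrier H \<Longrightarrow>
    (\<lambda>f1 f2. f1 h \<otimes>\<^bsub>R\<^esub> f2 k) \<in> bilinear_maps R C C (self_module R)"
  by (intro bilinear_mapsI lin C_eval; simp)

lemma smult_comult:
  assumes P: "module R P" and p: "p \<in> carrier P" and f: "f \<in> carrier C" and h: "h \<in> carrier H" and k: "k \<in> carrier H"
  shows "f (h \<otimes>\<^bsub>H\<^esub> k) \<odot>\<^bsub>P\<^esub> p = tensor_lift R P (\<lambda>f1 f2. (f1 h \<otimes>\<^bsub>R\<^esub> f2 k) \<odot>\<^bsub>P\<^esub> p) (comult C f)"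
  unfolding C_comult[OF f h k, symmetric]
  by (rule cw_linear[OF R.self_module P C_eval_bil[OF h k] lin_smult1[OF linear_maps_id P p] f])

text \<open>The comultiplication of H is multiplicative and that of U is dual to the product of H,
  so f(k_2 m_2) k_1 m_1 = \<Sum> f_1(k_2) f_2(m_2) k_1 m_1. Two exchanges of sums then collect f_1
  with k and f_2 with m.\<close>

lemma hit_left_mult:
  assumes f: "f \<in> carrier C" and k: "k \<in> carrier H" and m: "m \<in> carrier H"
  shows "hit_left R H f (k \<otimes>\<^bsub>H\<^esub> m) =
    tensor_lift R H (\<lambda>f1 f2. hit_left R H f1 k \<otimes>\<^bsub>H\<^esub> hit_left R H f2 m) (comult C f)"
proof -
  let ?\<nu> = "\<lambda>k1 k2 m1 m2 f1 f2. (f1 k2 \<odot>\<^bsub>H\<^esub> k1) \<otimes>\<^bsub>H\<^esub> (f2 m2 \<odot>\<^bsub>H\<^esub> m1)"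
  let ?\<mu> = "\<lambda>k1 k2 f1 f2. (f1 k2 \<odot>\<^bsub>H\<^esub> k1) \<otimes>\<^bsub>H\<^esub> hit_left R H f2 m"
  have pure: "f (k2 \<otimes>\<^bsub>H\<^esub> m2) \<odot>\<^bsub>H\<^esub> (k1 \<otimes>\<^bsub>H\<^esub> m1) = tensor_lift R H (?\<nu> k1 k2 m1 m2) (comult C f)"
    if km: "k1 \<in> carrier H" "k2 \<in> carrier H" "m1 \<in> carrier H" "m2 \<in> carrier H" for k1 k2 m1 m2
    unfolding smult_comult[OF H m_closed[OF km(1,3)] f km(2,4)]
    by (rule cw_cong[OF H bilinear_maps_linear[OF C_eval_bil[OF km(2,4)] lin_smult1[OF linear_maps_id H m_closed[OF km(1,3)]]] f])
      (simp add: km smult_mult_left smult_mult_right smult_assoc1 smult_left_commute)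
  have "hit_left R H f (k \<otimes>\<^bsub>H\<^esub> m) = tensor_lift R H (\<lambda>k1 k2. tensor_lift R H
      (\<lambda>m1 m2. f (k2 \<otimes>\<^bsub>H\<^esub> m2) \<odot>\<^bsub>H\<^esub> (k1 \<otimes>\<^bsub>H\<^esub> m1)) (comult H m)) (comult H k)"
    unfolding hit_left_def by (rule sw_mult[OF H hit_bil(1)[OF C_Dual[OF f]] k m])
  also have "\<dots> = tensor_lift R H (\<lambda>k1 k2. tensor_lift R H (?\<mu> k1 k2) (comult C f)) (comult H k)"
  proof (rule sw_cong[OF H _ k])
    have lf: "(\<lambda>x. f (\<phi> x)) \<in> linear_maps R H (self_module R)" if "\<phi> \<in> linear_maps R H H" for \<phi>
      by (rule linear_maps_comp[OF C_Dual[OF f] that])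
    show "(\<lambda>k1 k2. tensor_lift R H (\<lambda>m1 m2. f (k2 \<otimes>\<^bsub>H\<^esub> m2) \<odot>\<^bsub>H\<^esub> (k1 \<otimes>\<^bsub>H\<^esub> m1)) (comult H m)) \<in> bilinear_maps R H H H"
      by (intro bilinear_mapsI lin' lf m; simp add: f)
    fix k1 k2 assume k12: "k1 \<in> carrier H" "k2 \<in> carrier H"
    have \<nu>1: "?\<nu> k1 k2 m1 m2 \<in> bilinear_maps R C C H" if "m1 \<in> carrier H" "m2 \<in> carrier H" for m1 m2
      by (intro bilinear_mapsI lin C_eval; simp add: k12 that)
    have \<nu>2: "(\<lambda>m1 m2. ?\<nu> k1 k2 m1 m2 f1 f2) \<in> bilinear_maps R H H H" if "f1 \<in> carrier C" "f2 \<in> carrier C" for f1 f2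
      by (intro bilinear_mapsI lin C_Dual; simp add: k12 that)
    have "tensor_lift R H (\<lambda>m1 m2. f (k2 \<otimes>\<^bsub>H\<^esub> m2) \<odot>\<^bsub>H\<^esub> (k1 \<otimes>\<^bsub>H\<^esub> m1)) (comult H m) =
      tensor_lift R H (\<lambda>m1 m2. tensor_lift R H (?\<nu> k1 k2 m1 m2) (comult C f)) (comult H m)"
      by (rule sw_cong[OF H _ m], (intro bilinear_mapsI lin lf; simp add: f k12)) (rule pure[OF k12])
    also have "\<dots> = tensor_lift R H (\<lambda>f1 f2. tensor_lift R H (\<lambda>m1 m2. ?\<nu> k1 k2 m1 m2 f1 f2) (comult H m)) (comult C f)"
      by (rule R.tensor_lift_swap[OF H H C C H]; (rule \<nu>1 \<nu>2; assumption)?; simp add: m f)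
    also have "\<dots> = tensor_lift R H (?\<mu> k1 k2) (comult C f)"
    proof (rule cw_cong[OF H _ f, symmetric])
      show "?\<mu> k1 k2 \<in> bilinear_maps R C C H"
        by (intro bilinear_mapsI lin C_eval linC_hit_left; simp add: k12 m)
      fix f1 f2 assume f12: "f1 \<in> carrier C" "f2 \<in> carrier C"
      show "?\<mu> k1 k2 f1 f2 = tensor_lift R H (\<lambda>m1 m2. ?\<nu> k1 k2 m1 m2 f1 f2) (comult H m)"
        unfolding hit_left_def
        by (rule sw_linear[OF H H hit_bil(1)[OF C_Dual[OF f12(2)]] linear_left_mult m]) (simp add: f12 k12)
    qed
    finally show "tensor_lift R H (\<lambda>m1 m2. f (k2 \<otimes>\<^bsub>H\<^esub> m2) \<odot>\<^bsub>H\<^esub> (k1 \<otimes>\<^bsub>H\<^esub> m1)) (comult H m) =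
      tensor_lift R H (?\<mu> k1 k2) (comult C f)" .
  qed
  also have "\<dots> = tensor_lift R H (\<lambda>f1 f2. tensor_lift R H (\<lambda>k1 k2. ?\<mu> k1 k2 f1 f2) (comult H k)) (comult C f)"
  proof (rule R.tensor_lift_swap[OF H H C C H])
    show "?\<mu> k1 k2 \<in> bilinear_maps R C C H" if "k1 \<in> carrier H" "k2 \<in> carrier H" for k1 k2
      by (intro bilinear_mapsI lin C_eval linC_hit_left; simp add: that m)
    show "(\<lambda>k1 k2. ?\<mu> k1 k2 f1 f2) \<in> bilinear_maps R H H H" if "f1 \<in> carrier C" "f2 \<in> carrier C" for f1 f2
      by (intro bilinear_mapsI lin C_Dual; simp add: that m)
  qed (simp_all add: k f)
  also have "\<dots> = tensor_lift R H (\<lambda>f1 f2. hit_left R H f1 k \<otimes>\<^bsub>H\<^esub> hit_left R H f2 m) (comult C f)"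
  proof (rule cw_cong[OF H _ f, symmetric])
    show "(\<lambda>f1 f2. hit_left R H f1 k \<otimes>\<^bsub>H\<^esub> hit_left R H f2 m) \<in> bilinear_maps R C C H"
      by (intro bilinear_mapsI lin linC_hit_left; simp add: k m)
    fix f1 f2 assume f12: "f1 \<in> carrier C" "f2 \<in> carrier C"
    show "hit_left R H f1 k \<otimes>\<^bsub>H\<^esub> hit_left R H f2 m = tensor_lift R H (\<lambda>k1 k2. ?\<mu> k1 k2 f1 f2) (comult H k)"
      unfolding hit_left_def[of R H f1 k]
      by (rule sw_linear[OF H H hit_bil(1)[OF C_Dual[OF f12(1)]] linear_right_mult k]) (simp add: f12 m)
  qed
  finally show ?thesis .
qed

text \<open>The mirror image of \<open>hit_left_mult\<close>, with the other component of each
  coproduct evaluated. \<open>twist_rho_lift\<close> uses it to carry the right action over to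
  \<open>B\<close>.\<close>

lemma hit_right_mult:
  assumes f: "f \<in> carrier C" and k: "k \<in> carrier H" and m: "m \<in> carrier H"
  shows "hit_right R H (k \<otimes>\<^bsub>H\<^esub> m) f =
    tensor_lift R H (\<lambda>f1 f2. hit_right R H k f1 \<otimes>\<^bsub>H\<^esub> hit_right R H m f2) (comult C f)"
proof -
  let ?\<nu> = "\<lambda>k1 k2 m1 m2 f1 f2. (f1 k1 \<odot>\<^bsub>H\<^esub> k2) \<otimes>\<^bsub>H\<^esub> (f2 m1 \<odot>\<^bsub>H\<^esub> m2)"
  let ?\<mu> = "\<lambda>k1 k2 f1 f2. (f1 k1 \<odot>\<^bsub>H\<^esub> k2) \<otimes>\<^bsub>H\<^esub> hit_right R H m f2"
  have pure: "f (k1 \<otimes>\<^bsub>H\<^esub> m1) \<odot>\<^bsub>H\<^esub> (k2 \<otimes>\<^bsub>H\<^esub> m2) = tensor_lift R H (?\<nu> k1 k2 m1 m2) (comult C f)"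
    if km: "k1 \<in> carrier H" "k2 \<in> carrier H" "m1 \<in> carrier H" "m2 \<in> carrier H" for k1 k2 m1 m2
    unfolding smult_comult[OF H m_closed[OF km(2,4)] f km(1,3)]
    by (rule cw_cong[OF H bilinear_maps_linear[OF C_eval_bil[OF km(1,3)] lin_smult1[OF linear_maps_id H m_closed[OF km(2,4)]]] f])
      (simp add: km smult_mult_left smult_mult_right smult_assoc1 smult_left_commute)
  have "hit_right R H (k \<otimes>\<^bsub>H\<^esub> m) f = tensor_lift R H (\<lambda>k1 k2. tensor_lift R H
      (\<lambda>m1 m2. f (k1 \<otimes>\<^bsub>H\<^esub> m1) \<odot>\<^bsub>H\<^esub> (k2 \<otimes>\<^bsub>H\<^esub> m2)) (comult H m)) (comult H k)"
    unfolding hit_right_def by (rule sw_mult[OF H hit_bil(2)[OF C_Dual[OF f]] k m])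
  also have "\<dots> = tensor_lift R H (\<lambda>k1 k2. tensor_lift R H (?\<mu> k1 k2) (comult C f)) (comult H k)"
  proof (rule sw_cong[OF H _ k])
    have lf: "(\<lambda>x. f (\<phi> x)) \<in> linear_maps R H (self_module R)" if "\<phi> \<in> linear_maps R H H" for \<phi>
      by (rule linear_maps_comp[OF C_Dual[OF f] that])
    show "(\<lambda>k1 k2. tensor_lift R H (\<lambda>m1 m2. f (k1 \<otimes>\<^bsub>H\<^esub> m1) \<odot>\<^bsub>H\<^esub> (k2 \<otimes>\<^bsub>H\<^esub> m2)) (comult H m)) \<in> bilinear_maps R H H H"
      by (intro bilinear_mapsI lin' lf m; simp add: f)
    fix k1 k2 assume k12: "k1 \<in> carrier H" "k2 \<in> carrier H"
    have \<nu>1: "?\<nu> k1 k2 m1 m2 \<in> bilinear_maps R C C H" if "m1 \<in> carrier H" "m2 \<in> carrier H" for m1 m2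
      by (intro bilinear_mapsI lin C_eval; simp add: k12 that)
    have \<nu>2: "(\<lambda>m1 m2. ?\<nu> k1 k2 m1 m2 f1 f2) \<in> bilinear_maps R H H H" if "f1 \<in> carrier C" "f2 \<in> carrier C" for f1 f2
      by (intro bilinear_mapsI lin C_Dual; simp add: k12 that)
    have "tensor_lift R H (\<lambda>m1 m2. f (k1 \<otimes>\<^bsub>H\<^esub> m1) \<odot>\<^bsub>H\<^esub> (k2 \<otimes>\<^bsub>H\<^esub> m2)) (comult H m) =
      tensor_lift R H (\<lambda>m1 m2. tensor_lift R H (?\<nu> k1 k2 m1 m2) (comult C f)) (comult H m)"
      by (rule sw_cong[OF H _ m], (intro bilinear_mapsI lin lf; simp add: f k12)) (rule pure[OF k12])
    also have "\<dots> = tensor_lift R H (\<lambda>f1 f2. tensor_lift R H (\<lambda>m1 m2. ?\<nu> k1 k2 m1 m2 f1 f2) (comult H m)) (comult C f)"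
      by (rule R.tensor_lift_swap[OF H H C C H]; (rule \<nu>1 \<nu>2; assumption)?; simp add: m f)
    also have "\<dots> = tensor_lift R H (?\<mu> k1 k2) (comult C f)"
    proof (rule cw_cong[OF H _ f, symmetric])
      show "?\<mu> k1 k2 \<in> bilinear_maps R C C H"
        by (intro bilinear_mapsI lin C_eval linC_hit_right; simp add: k12 m)
      fix f1 f2 assume f12: "f1 \<in> carrier C" "f2 \<in> carrier C"
      show "?\<mu> k1 k2 f1 f2 = tensor_lift R H (\<lambda>m1 m2. ?\<nu> k1 k2 m1 m2 f1 f2) (comult H m)"
        unfolding hit_right_def
        by (rule sw_linear[OF H H hit_bil(2)[OF C_Dual[OF f12(2)]] linear_left_mult m]) (simp add: f12 k12)
    qed
    finally show "tensor_lift R H (\<lambda>m1 m2. f (k1 \<otimes>\<^bsub>H\<^esub> m1) \<odot>\<^bsub>H\<^esub> (k2 \<otimes>\<^bsub>H\<^esub> m2)) (comult H m) =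
      tensor_lift R H (?\<mu> k1 k2) (comult C f)" .
  qed
  also have "\<dots> = tensor_lift R H (\<lambda>f1 f2. tensor_lift R H (\<lambda>k1 k2. ?\<mu> k1 k2 f1 f2) (comult H k)) (comult C f)"
  proof (rule R.tensor_lift_swap[OF H H C C H])
    show "?\<mu> k1 k2 \<in> bilinear_maps R C C H" if "k1 \<in> carrier H" "k2 \<in> carrier H" for k1 k2
      by (intro bilinear_mapsI lin C_eval linC_hit_right; simp add: that m)
    show "(\<lambda>k1 k2. ?\<mu> k1 k2 f1 f2) \<in> bilinear_maps R H H H" if "f1 \<in> carrier C" "f2 \<in> carrier C" for f1 f2
      by (intro bilinear_mapsI lin C_Dual; simp add: that m)
  qed (simp_all add: k f)
  also have "\<dots> = tensor_lift R H (\<lambda>f1 f2. hit_right R H k f1 \<otimes>\<^bsub>H\<^esub> hit_right R H m f2) (comult C f)"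
  proof (rule cw_cong[OF H _ f, symmetric])
    show "(\<lambda>f1 f2. hit_right R H k f1 \<otimes>\<^bsub>H\<^esub> hit_right R H m f2) \<in> bilinear_maps R C C H"
      by (intro bilinear_mapsI lin linC_hit_right; simp add: k m)
    fix f1 f2 assume f12: "f1 \<in> carrier C" "f2 \<in> carrier C"
    show "hit_right R H k f1 \<otimes>\<^bsub>H\<^esub> hit_right R H m f2 = tensor_lift R H (\<lambda>k1 k2. ?\<mu> k1 k2 f1 f2) (comult H k)"
      unfolding hit_right_def[of R H k f1]
      by (rule sw_linear[OF H H hit_bil(2)[OF C_Dual[OF f12(1)]] linear_right_mult k]) (simp add: f12 m)
  qed
  finally show ?thesis .
qed

section \<open>The representation of H # U on H\<close>

definition lam :: "('h \<times> ('h \<Rightarrow> 'r) \<Rightarrow> 'r) set \<Rightarrow> 'h \<Rightarrow> 'h" where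
  "lam t k = tensor_lift R H (\<lambda>h f. h \<otimes>\<^bsub>H\<^esub> hit_left R H f k) t"

lemma lam_bil: "k \<in> carrier H \<Longrightarrow> (\<lambda>h f. h \<otimes>\<^bsub>H\<^esub> hit_left R H f k) \<in> bilinear_maps R H C H"
  by (intro bilinear_mapsI lin linC_hit_left; simp)

lemma lam_linear1: "k \<in> carrier H \<Longrightarrow> (\<lambda>t. lam t k) \<in> linear_maps R HC H"
  unfolding lam_def by (rule R.tensor_lift_linear[OF H C H lam_bil])

lemma lam_linear2: "t \<in> carrier HC \<Longrightarrow> lam t \<in> linear_maps R H H"
  unfolding lam_def
  by (rule R.tensor_lift_linear_param[OF H H C H lam_bil]) (simp_all add: lin_mult2 hit_left_linear)

lemma lam_closed [simp]: "t \<in> carrier HC \<Longrightarrow> k \<in> carrier H \<Longrightarrow> lam t k \<in> carrier H"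
  by (rule linear_mapsD(1)[OF lam_linear2])

lemma lam_tensor: "h \<in> carrier H \<Longrightarrow> f \<in> carrier C \<Longrightarrow> k \<in> carrier H \<Longrightarrow>
    lam (tensor R H C h f) k = h \<otimes>\<^bsub>H\<^esub> hit_left R H f k"
  unfolding lam_def by (rule R.tensor_lift_tensor[OF H C H lam_bil])

text \<open>The inverse \<open>T\<close> of the antipode recovers the values of the second tensor factor from \<open>\<lambda>\<close>:
  \<open>\<Sum>\<lambda>(h \<otimes> f)(k\<^sub>2) T(k\<^sub>1) = f(k) h\<close>.\<close>

lemma lam_zero:
  assumes t: "t \<in> carrier HC" and zero: "\<And>k. k \<in> carrier H \<Longrightarrow> lam t k = \<zero>\<^bsub>H\<^esub>"
  shows "t = \<zero>\<^bsub>HC\<^esub>"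
proof (rule C_inj[OF t])
  fix k assume k: "k \<in> carrier H"
  define T where "T = inv_into (carrier H) (antipode H)"
  note T = antipode_inverse[OF antipode_bij T_def]
  note Tc = linear_mapsD(1)[OF T(1)]
  let ?\<mu> = "\<lambda>h f k1 k2. (h \<otimes>\<^bsub>H\<^esub> hit_left R H f k2) \<otimes>\<^bsub>H\<^esub> T k1"
  have \<mu>1: "?\<mu> h f \<in> bilinear_maps R H H H" if "h \<in> carrier H" "f \<in> carrier C" for h f
    by (intro bilinear_mapsI lin T(1) hit_left_linear; simp add: that Tc)
  have \<mu>2: "(\<lambda>h f. ?\<mu> h f k1 k2) \<in> bilinear_maps R H C H" if "k1 \<in> carrier H" "k2 \<in> carrier H" for k1 k2
    by (intro bilinear_mapsI lin linC_hit_left; simp add: that Tc)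
  have b: "(\<lambda>h f. f k \<odot>\<^bsub>H\<^esub> h) \<in> bilinear_maps R H C H"
    by (intro bilinear_mapsI lin C_eval; simp add: k)
  have "tensor_lift R H (\<lambda>h f. f k \<odot>\<^bsub>H\<^esub> h) t = tensor_lift R H (\<lambda>h f. tensor_lift R H (?\<mu> h f) (comult H k)) t"
  proof (rule R.tensor_lift_cong[OF H C H b _ t])
    fix h f assume hf: "h \<in> carrier H" "f \<in> carrier C"
    have b2: "(\<lambda>k1 k2. hit_left R H f k2 \<otimes>\<^bsub>H\<^esub> T k1) \<in> bilinear_maps R H H H"
      by (intro bilinear_mapsI lin T(1) hit_left_linear; simp add: hf Tc)
    have "f k \<odot>\<^bsub>H\<^esub> h = h \<otimes>\<^bsub>H\<^esub> tensor_lift R H (\<lambda>k1 k2. hit_left R H f k2 \<otimes>\<^bsub>H\<^esub> T k1) (comult H k)"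
      using hf k by (simp add: T(5) smult_mult_right)
    also have "\<dots> = tensor_lift R H (\<lambda>k1 k2. h \<otimes>\<^bsub>H\<^esub> (hit_left R H f k2 \<otimes>\<^bsub>H\<^esub> T k1)) (comult H k)"
      by (rule sw_linear[OF H H b2 linear_left_mult[OF hf(1)] k])
    also have "\<dots> = tensor_lift R H (?\<mu> h f) (comult H k)"
      by (rule sw_cong2[OF H \<mu>1[OF hf] k]) (simp add: m_assoc hf Tc)
    finally show "f k \<odot>\<^bsub>H\<^esub> h = tensor_lift R H (?\<mu> h f) (comult H k)" .
  qed
  also have "\<dots> = tensor_lift R H (\<lambda>k1 k2. tensor_lift R H (\<lambda>h f. ?\<mu> h f k1 k2) t) (comult H k)"
    by (rule R.tensor_lift_swap[OF H C H H H \<mu>1 \<mu>2 t]) (simp_all add: k)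
  also have "\<dots> = tensor_lift R H (\<lambda>k1 k2. \<zero>\<^bsub>H\<^esub>) (comult H k)"
  proof (rule sw_cong2[OF H _ k])
    show "(\<lambda>k1 k2. \<zero>\<^bsub>H\<^esub>) \<in> bilinear_maps R H H H"
      by (intro bilinear_mapsI linear_mapsI) simp_all
    fix k1 k2 assume k12: "k1 \<in> carrier H" "k2 \<in> carrier H"
    have "tensor_lift R H (\<lambda>h f. ?\<mu> h f k1 k2) t = lam t k2 \<otimes>\<^bsub>H\<^esub> T k1"
      unfolding lam_def
      by (rule linear_maps_tensor_lift[OF H C H H lam_bil[OF k12(2)] linear_right_mult[OF Tc[OF k12(1)]] t, symmetric])
    then show "tensor_lift R H (\<lambda>h f. ?\<mu> h f k1 k2) t = \<zero>\<^bsub>H\<^esub>"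
      by (simp add: zero k12 Tc)
  qed
  also have "\<dots> = \<zero>\<^bsub>H\<^esub>"
  proof -
    \<comment> \<open>The sum of the constant zero is read as the counit identity for the zero
      map.\<close>
    have "(\<lambda>x. \<zero>\<^bsub>H\<^esub>) \<in> linear_maps R H H" by (intro linear_mapsI) simp_all
    from sw_counit_left[OF H this k] show ?thesis
      using sw_cong2[OF H _ k, of "\<lambda>k1 k2. counit H k1 \<odot>\<^bsub>H\<^esub> \<zero>\<^bsub>H\<^esub>" "\<lambda>k1 k2. \<zero>\<^bsub>H\<^esub>"]
      by (simp add: bilinear_mapsI linear_mapsI)
  qed
  finally show "tensor_lift R H (\<lambda>h f. f k \<odot>\<^bsub>H\<^esub> h) t = \<zero>\<^bsub>H\<^esub>" .
qed

lemma lam_ext: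
  assumes s: "s \<in> carrier HC" and t: "t \<in> carrier HC" and eq: "\<And>k. k \<in> carrier H \<Longrightarrow> lam s k = lam t k"
  shows "s = t"
proof -
  interpret T: module R HC by (rule HC)
  have "s \<ominus>\<^bsub>HC\<^esub> t = \<zero>\<^bsub>HC\<^esub>"
  proof (rule lam_zero)
    fix k assume k: "k \<in> carrier H"
    have "lam (s \<ominus>\<^bsub>HC\<^esub> t) k = lam s k \<ominus>\<^bsub>H\<^esub> lam t k"
      by (rule linear_maps_minus[OF HC H lam_linear1[OF k] s t])
    then show "lam (s \<ominus>\<^bsub>HC\<^esub> t) k = \<zero>\<^bsub>H\<^esub>" using eq[OF k] t k by (simp add: a_minus_def r_neg)
  qed (simp add: s t)
  moreover have "s = (s \<ominus>\<^bsub>HC\<^esub> t) \<oplus>\<^bsub>HC\<^esub> t"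
    using s t by (simp add: a_minus_def T.a_assoc T.l_neg)
  ultimately show ?thesis using t by simp
qed

end

lemma assoc_algebraI:
  assumes B: "module R B"
    and mult: "(\<lambda>x y. x \<otimes>\<^bsub>B\<^esub> y) \<in> bilinear_maps R B B B"
    and one: "\<one>\<^bsub>B\<^esub> \<in> carrier B" "\<And>x. x \<in> carrier B \<Longrightarrow> \<one>\<^bsub>B\<^esub> \<otimes>\<^bsub>B\<^esub> x = x" "\<And>x. x \<in> carrier B \<Longrightarrow> x \<otimes>\<^bsub>B\<^esub> \<one>\<^bsub>B\<^esub> = x"
    and assoc: "\<And>x y z. x \<in> carrier B \<Longrightarrow> y \<in> carrier B \<Longrightarrow> z \<in> carrier B \<Longrightarrow>
      (x \<otimes>\<^bsub>B\<^esub> y) \<otimes>\<^bsub>B\<^esub> z = x \<otimes>\<^bsub>B\<^esub> (y \<otimes>\<^bsub>B\<^esub> z)"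
  shows "assoc_algebra R B"
proof -
  note m1 = linear_mapsD[OF bilinear_mapsD(1)[OF mult]] and m2 = linear_mapsD[OF bilinear_mapsD(2)[OF mult]]
  have "ring B"
    by (rule ringI[OF module.axioms(2)[OF B]]) (auto intro!: monoidI one assoc m1 m2)
  then show ?thesis
    by (intro assoc_algebra.intro assoc_algebra_axioms.intro B) (simp_all add: m1 m2)
qed

section \<open>The algebra H # U and the lift of the right action\<close>

context dual_hopf
begin

abbreviation "B \<equiv> smash_product R H C (hit_left R H)"

lemma lin_tensor1: "\<phi> \<in> linear_maps R X H \<Longrightarrow> f \<in> carrier C \<Longrightarrow> (\<lambda>x. tensor R H C (\<phi> x) f) \<in> linear_maps R X HC"
  by (rule linear_maps_comp[OF bilinear_mapsD(2)[OF R.tensor_bilinear[OF H C]]])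

lemma lin_tensor2: "\<psi> \<in> linear_maps R X C \<Longrightarrow> h \<in> carrier H \<Longrightarrow> (\<lambda>x. tensor R H C h (\<psi> x)) \<in> linear_maps R X HC"
  by (rule linear_maps_comp[OF bilinear_mapsD(1)[OF R.tensor_bilinear[OF H C]]])

lemma tensor_HC [simp]: "h \<in> carrier H \<Longrightarrow> f \<in> carrier C \<Longrightarrow> tensor R H C h f \<in> carrier HC"
  by (rule R.tensor_closed[OF H C])

lemma hit_left_bil: "hit_left R H \<in> bilinear_maps R C H H"
  by (rule bilinear_mapsI) (simp_all add: hit_left_linear linC_hit_left)

lemmas B_smash = R.smash_product_mult[OF H C mult_bilinear C_mult_bil C_comult_linear hit_left_bil]
lemmas inner_bil = B_smash(1) and B_mult_bil = B_smash(2) and B_mult_tensor = B_smash(3)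
lemmas B_closed [simp] = bilinear_mapsD(3)[OF B_mult_bil]

lemma hit_left_C_mult: "f \<in> carrier C \<Longrightarrow> g \<in> carrier C \<Longrightarrow> k \<in> carrier H \<Longrightarrow>
    hit_left R H (f \<otimes>\<^bsub>C\<^esub> g) k = hit_left R H f (hit_left R H g k)"
  by (simp add: C_mult hit_left_conv)

text \<open>On pure tensors this is \<Sum> a (f_1 \<rightharpoonup> b) (f_2 \<rightharpoonup> (g
  \<rightharpoonup> k)) = a (f \<rightharpoonup> (b (g \<rightharpoonup> k))): the product of U acts
  by composition, and H is a module algebra over U.\<close>

lemma lam_mult:
  assumes s: "s \<in> carrier HC" and t: "t \<in> carrier HC" and k: "k \<in> carrier H"
  shows "lam (s \<otimes>\<^bsub>B\<^esub> t) k = lam s (lam t k)"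
proof (rule R.tensor_ext2[OF H C H C H bilinear_maps_linear[OF B_mult_bil lam_linear1[OF k]] _ _ s t])
  show "(\<lambda>s t. lam s (lam t k)) \<in> bilinear_maps R HC HC H"
    by (rule bilinear_mapsI)
      (rule linear_maps_comp[OF lam_linear2 lam_linear1[OF k]] lam_linear1[OF lam_closed[OF _ k]]; assumption)+
  fix a f b g assume ab: "a \<in> carrier H" "f \<in> carrier C" "b \<in> carrier H" "g \<in> carrier C"
  have bk: "hit_left R H g k \<in> carrier H" using ab k by simp
  have "lam (tensor R H C a f \<otimes>\<^bsub>B\<^esub> tensor R H C b g) k =
    tensor_lift R H (\<lambda>f1 f2. lam (tensor R H C (a \<otimes>\<^bsub>H\<^esub> hit_left R H f1 b) (f2 \<otimes>\<^bsub>C\<^esub> g)) k) (comult C f)"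
    unfolding B_mult_tensor[OF ab]
    by (rule cw_linear[OF HC H inner_bil[OF ab(1,3,4)] lam_linear1[OF k] ab(2)])
  also have "\<dots> = tensor_lift R H (\<lambda>f1 f2. a \<otimes>\<^bsub>H\<^esub> (hit_left R H f1 b \<otimes>\<^bsub>H\<^esub> hit_left R H f2 (hit_left R H g k))) (comult C f)"
    by (rule cw_cong[OF H bilinear_maps_linear[OF inner_bil[OF ab(1,3,4)] lam_linear1[OF k]] ab(2)])
      (simp add: lam_tensor ab k hit_left_C_mult m_assoc)
  also have "\<dots> = a \<otimes>\<^bsub>H\<^esub> tensor_lift R H (\<lambda>f1 f2. hit_left R H f1 b \<otimes>\<^bsub>H\<^esub> hit_left R H f2 (hit_left R H g k)) (comult C f)"
    by (rule cw_linear[OF H H _ linear_left_mult[OF ab(1)] ab(2), symmetric])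
      (intro bilinear_mapsI lin linC_hit_left; simp add: ab bk)
  also have "\<dots> = a \<otimes>\<^bsub>H\<^esub> hit_left R H f (b \<otimes>\<^bsub>H\<^esub> hit_left R H g k)"
    by (simp only: hit_left_mult[OF ab(2,3) bk])
  also have "\<dots> = lam (tensor R H C a f) (lam (tensor R H C b g) k)"
    using ab k by (simp add: lam_tensor)
  finally show "lam (tensor R H C a f \<otimes>\<^bsub>B\<^esub> tensor R H C b g) k = lam (tensor R H C a f) (lam (tensor R H C b g) k)" .
qed

lemma hit_one: "k \<in> carrier H \<Longrightarrow> hit_left R H \<one>\<^bsub>C\<^esub> k = k" "k \<in> carrier H \<Longrightarrow> hit_right R H k \<one>\<^bsub>C\<^esub> = k"
  unfolding C_one by (simp_all add: hit_restrict counit_linear hit_counit)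

lemma lam_one: "k \<in> carrier H \<Longrightarrow> lam \<one>\<^bsub>B\<^esub> k = k"
  by (simp add: R.smash_product_simps lam_tensor hit_one)

lemma B_algebra: "assoc_algebra R B"
proof (rule assoc_algebraI)
  show "module R B" by (rule module_cong[OF HC]) (simp_all add: R.smash_product_simps)
  show "(\<lambda>x y. x \<otimes>\<^bsub>B\<^esub> y) \<in> bilinear_maps R B B B"
    using B_mult_bil by (simp add: bilinear_maps_def linear_maps_def R.smash_product_simps)
  show one: "\<one>\<^bsub>B\<^esub> \<in> carrier B" by (simp add: R.smash_product_simps)
  fix x assume "x \<in> carrier B"
  then have x: "x \<in> carrier HC" by (simp add: R.smash_product_simps)
  have o: "\<one>\<^bsub>B\<^esub> \<in> carrier HC" using one by (simp add: R.smash_product_simps)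
  show "\<one>\<^bsub>B\<^esub> \<otimes>\<^bsub>B\<^esub> x = x" by (rule lam_ext) (simp_all add: x o lam_mult lam_one)
  show "x \<otimes>\<^bsub>B\<^esub> \<one>\<^bsub>B\<^esub> = x" by (rule lam_ext) (simp_all add: x o lam_mult lam_one)
  fix y z assume "y \<in> carrier B" "z \<in> carrier B"
  then have yz: "y \<in> carrier HC" "z \<in> carrier HC" by (simp_all add: R.smash_product_simps)
  show "(x \<otimes>\<^bsub>B\<^esub> y) \<otimes>\<^bsub>B\<^esub> z = x \<otimes>\<^bsub>B\<^esub> (y \<otimes>\<^bsub>B\<^esub> z)"
    by (rule lam_ext) (simp_all add: x yz lam_mult)
qed

text \<open>By \<open>lam_ext\<close> there is only one candidate for the choice, which is why it
  turns out to be linear in f and compatible with products.\<close>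

definition rho_lift :: "('h \<Rightarrow> 'r) \<Rightarrow> ('h \<times> ('h \<Rightarrow> 'r) \<Rightarrow> 'r) set" where
  "rho_lift f = (SOME t. t \<in> carrier HC \<and> (\<forall>k\<in>carrier H. lam t k = hit_right R H k f))"

lemma rho_lift_closed [simp]: "f \<in> carrier C \<Longrightarrow> rho_lift f \<in> carrier HC"
  and lam_rho_lift: "f \<in> carrier C \<Longrightarrow> k \<in> carrier H \<Longrightarrow> lam (rho_lift f) k = hit_right R H k f"
proof -
  have *: "rho_lift f \<in> carrier HC \<and> (\<forall>k\<in>carrier H. lam (rho_lift f) k = hit_right R H k f)" if "f \<in> carrier C"
  proof -
    have "\<exists>t. t \<in> carrier HC \<and> (\<forall>k\<in>carrier H. lam t k = hit_right R H k f)"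
      using RL[OF that] unfolding lam_def by blast
    then show ?thesis unfolding rho_lift_def by (rule someI_ex)
  qed
  show "f \<in> carrier C \<Longrightarrow> rho_lift f \<in> carrier HC" using * by simp
  show "f \<in> carrier C \<Longrightarrow> k \<in> carrier H \<Longrightarrow> lam (rho_lift f) k = hit_right R H k f" using * by simp
qed

lemma rho_lift_linear: "rho_lift \<in> linear_maps R C HC"
proof -
  interpret C: module R C by (rule C)
  interpret HC: module R HC by (rule HC)
  note l = linear_mapsD[OF lam_linear1] and r = linear_mapsD[OF linC_hit_right]
  show ?thesis
  proof (rule linear_mapsI)
    fix f g assume fg: "f \<in> carrier C" "g \<in> carrier C"
    show "rho_lift (f \<oplus>\<^bsub>C\<^esub> g) = rho_lift f \<oplus>\<^bsub>HC\<^esub> rho_lift g"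
      by (rule lam_ext) (simp_all add: fg l(2) r(2) lam_rho_lift)
  next
    fix s f assume sf: "s \<in> carrier R" "f \<in> carrier C"
    show "rho_lift (s \<odot>\<^bsub>C\<^esub> f) = s \<odot>\<^bsub>HC\<^esub> rho_lift f"
      by (rule lam_ext) (simp_all add: sf l(3) r(3) lam_rho_lift)
  qed simp
qed

lemma rho_lift_mult: "f \<in> carrier C \<Longrightarrow> g \<in> carrier C \<Longrightarrow> rho_lift (f \<otimes>\<^bsub>C\<^esub> g) = rho_lift g \<otimes>\<^bsub>B\<^esub> rho_lift f"
  by (rule lam_ext) (simp_all add: lam_mult lam_rho_lift C_mult[symmetric], simp add: C_mult hit_right_conv)

lemma rho_lift_one: "rho_lift \<one>\<^bsub>C\<^esub> = \<one>\<^bsub>B\<^esub>"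
  by (rule lam_ext) (simp_all add: lam_one lam_rho_lift hit_one, simp add: R.smash_product_simps)

definition twist :: "('h \<times> ('h \<Rightarrow> 'r) \<Rightarrow> 'r) set \<Rightarrow> ('h \<Rightarrow> 'r) \<Rightarrow> ('h \<times> ('h \<Rightarrow> 'r) \<Rightarrow> 'r) set" where
  "twist z g = tensor_map R H C (\<lambda>h. hit_right R H h g) (\<lambda>f. f) z"

lemma twist_tensor: "h \<in> carrier H \<Longrightarrow> f \<in> carrier C \<Longrightarrow> g \<in> carrier C \<Longrightarrow>
    twist (tensor R H C h f) g = tensor R H C (hit_right R H h g) f"
  unfolding twist_def by (rule R.tensor_map_tensor[OF H C H C hit_right_linear linear_maps_id]) simp_all

lemma twist_linear1: "g \<in> carrier C \<Longrightarrow> (\<lambda>z. twist z g) \<in> linear_maps R HC HC"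
  unfolding twist_def by (rule R.tensor_map_linear[OF H C H C hit_right_linear linear_maps_id]) simp

lemma twist_linear2: "z \<in> carrier HC \<Longrightarrow> twist z \<in> linear_maps R C HC"
  unfolding twist_def tensor_map_def
  by (rule R.tensor_lift_linear_param[OF C H C HC R.tensor_map_bilinear[OF H C hit_right_linear linear_maps_id]])
    (simp_all add: lin_tensor1 linC_hit_right)

lemma twist_closed [simp]: "z \<in> carrier HC \<Longrightarrow> g \<in> carrier C \<Longrightarrow> twist z g \<in> carrier HC"
  by (rule linear_mapsD(1)[OF twist_linear2])

lemma lin_B1: "\<phi> \<in> linear_maps R X HC \<Longrightarrow> b \<in> carrier HC \<Longrightarrow> (\<lambda>x. \<phi> x \<otimes>\<^bsub>B\<^esub> b) \<in> linear_maps R X HC"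
  by (rule linear_maps_comp[OF bilinear_mapsD(2)[OF B_mult_bil]])

lemma lin_B2: "\<phi> \<in> linear_maps R X HC \<Longrightarrow> b \<in> carrier HC \<Longrightarrow> (\<lambda>x. b \<otimes>\<^bsub>B\<^esub> \<phi> x) \<in> linear_maps R X HC"
  by (rule linear_maps_comp[OF bilinear_mapsD(1)[OF B_mult_bil]])

lemma twist_rho_lift_bil: "z \<in> carrier HC \<Longrightarrow> (\<lambda>g1 g2. twist z g1 \<otimes>\<^bsub>B\<^esub> rho_lift g2) \<in> bilinear_maps R C C HC"
  by (intro bilinear_mapsI lin_B1 lin_B2 twist_linear2 rho_lift_linear; simp)

text \<open>Applied to k, with z = h # f, the left side is \<Sum> (h \<leftharpoonup> g_1) ((f
  \<rightharpoonup> k) \<leftharpoonup> g_2), since the two actions on H commute. By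
  \<open>hit_right_mult\<close> this is (h (f \<rightharpoonup> k)) \<leftharpoonup> g, the right
  side applied to k.\<close>

lemma twist_rho_lift:
  assumes z: "z \<in> carrier HC" and g: "g \<in> carrier C"
  shows "tensor_lift R HC (\<lambda>g1 g2. twist z g1 \<otimes>\<^bsub>B\<^esub> rho_lift g2) (comult C g) = rho_lift g \<otimes>\<^bsub>B\<^esub> z"
proof (rule R.tensor_ext[OF H C HC _ _ _ z])
  show "(\<lambda>z. tensor_lift R HC (\<lambda>g1 g2. twist z g1 \<otimes>\<^bsub>B\<^esub> rho_lift g2) (comult C g)) \<in> linear_maps R HC HC"
    by (rule R.tensor_lift_linear_param[OF HC C C HC twist_rho_lift_bil]) (simp_all add: g lin_B1 twist_linear1)
  show "(\<lambda>z. rho_lift g \<otimes>\<^bsub>B\<^esub> z) \<in> linear_maps R HC HC"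
    by (rule lin_B2[OF linear_maps_id]) (simp add: g)
  fix h f assume hf: "h \<in> carrier H" "f \<in> carrier C"
  let ?z = "tensor R H C h f"
  have z: "?z \<in> carrier HC" using hf by simp
  note b = twist_rho_lift_bil[OF z]
  show "tensor_lift R HC (\<lambda>g1 g2. twist ?z g1 \<otimes>\<^bsub>B\<^esub> rho_lift g2) (comult C g) = rho_lift g \<otimes>\<^bsub>B\<^esub> ?z"
  proof (rule lam_ext)
    show "tensor_lift R HC (\<lambda>g1 g2. twist ?z g1 \<otimes>\<^bsub>B\<^esub> rho_lift g2) (comult C g) \<in> carrier HC"
      by (rule linear_mapsD(1)[OF R.tensor_lift_linear[OF C C HC b]]) (simp add: g)
    show "rho_lift g \<otimes>\<^bsub>B\<^esub> ?z \<in> carrier HC" using z g by simp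
    fix k assume k: "k \<in> carrier H"
    have fk: "hit_left R H f k \<in> carrier H" using hf k by simp
    have "lam (tensor_lift R HC (\<lambda>g1 g2. twist ?z g1 \<otimes>\<^bsub>B\<^esub> rho_lift g2) (comult C g)) k =
      tensor_lift R H (\<lambda>g1 g2. lam (twist ?z g1 \<otimes>\<^bsub>B\<^esub> rho_lift g2) k) (comult C g)"
      by (rule cw_linear[OF HC H b lam_linear1[OF k] g])
    also have "\<dots> = tensor_lift R H (\<lambda>g1 g2. hit_right R H h g1 \<otimes>\<^bsub>H\<^esub> hit_right R H (hit_left R H f k) g2) (comult C g)"
      by (rule cw_cong[OF H bilinear_maps_linear[OF b lam_linear1[OF k]] g])
        (simp add: z hf k lam_mult lam_rho_lift twist_tensor lam_tensor hit_left_hit_right)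
    also have "\<dots> = hit_right R H (h \<otimes>\<^bsub>H\<^esub> hit_left R H f k) g"
      by (rule hit_right_mult[OF g hf(1) fk, symmetric])
    also have "\<dots> = lam (rho_lift g \<otimes>\<^bsub>B\<^esub> ?z) k"
      using hf k g z by (simp add: lam_mult lam_tensor lam_rho_lift)
    finally show "lam (tensor_lift R HC (\<lambda>g1 g2. twist ?z g1 \<otimes>\<^bsub>B\<^esub> rho_lift g2) (comult C g)) k = lam (rho_lift g \<otimes>\<^bsub>B\<^esub> ?z) k" .
  qed
qed

section \<open>The inverse antipode of U and the convolution inverse of the lift\<close>

definition antipode_inv :: "('h \<Rightarrow> 'r) \<Rightarrow> 'h \<Rightarrow> 'r" where
  "antipode_inv = inv_into (carrier C) (antipode C)"

lemma antipode_inv_closed [simp]: "f \<in> carrier C \<Longrightarrow> antipode_inv f \<in> carrier C"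
  using C_antipode_bij bij_betw_inv_into[of "antipode C" "carrier C" "carrier C"]
  unfolding antipode_inv_def by (auto simp: bij_betw_def)

text \<open>The antipode of U is composition with the antipode of H, so its inverse is composition
  with the inverse antipode of H; that the composite is again an element of U is supplied by
  bijectivity on U.\<close>

lemma antipode_inv_apply:
  assumes f: "f \<in> carrier C" and h: "h \<in> carrier H"
  shows "antipode_inv f h = f (inv_into (carrier H) (antipode H) h)"
proof -
  let ?T = "inv_into (carrier H) (antipode H)"
  note T = antipode_inverse[OF antipode_bij refl]
  have Th: "?T h \<in> carrier H" by (rule linear_mapsD(1)[OF T(1) h])
  have "antipode C (antipode_inv f) = f"
    unfolding antipode_inv_def by (rule bij_betw_inv_into_right[OF C_antipode_bij f])
  then have "f (?T h) = antipode_inv f (antipode H (?T h))"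
    using C_antipode[of "antipode_inv f" "?T h"] f Th by simp
  then show ?thesis using T(2)[OF h] by simp
qed

lemma antipode_inv_linear: "antipode_inv \<in> linear_maps R C C"
proof (rule C_linear_mapsI[OF C])
  fix h assume h: "h \<in> carrier H"
  let ?T = "inv_into (carrier H) (antipode H)"
  have "?T h \<in> carrier H"
    by (rule linear_mapsD(1)[OF antipode_inverse(1)[OF antipode_bij refl] h])
  then show "(\<lambda>f. antipode_inv f h) \<in> linear_maps R C (self_module R)"
    by (intro linear_maps_eqI[OF C C_eval]) (auto simp: antipode_inv_apply h)
qed simp

lemma antipode_inv_bil:
  "(\<lambda>g1 g2. g2 \<otimes>\<^bsub>C\<^esub> antipode_inv g1) \<in> bilinear_maps R C C C"
  "(\<lambda>g1 g2. antipode_inv g2 \<otimes>\<^bsub>C\<^esub> g1) \<in> bilinear_maps R C C C"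
  using R.bilinear_maps_comp[OF C_mult_bil linear_maps_id antipode_inv_linear, THEN R.bilinear_maps_flip]
    R.bilinear_maps_comp[OF C_mult_bil antipode_inv_linear linear_maps_id, THEN R.bilinear_maps_flip] .

text \<open>Let T be the inverse antipode of H. At a point k the two sums become \<Sum> g(T(k_2)
  k_1) and \<Sum> g(k_2 T(k_1)), and the flipped antipode identities of H reduce both to the counit
  of k times g(1). The factor g(1) is the counit of g.\<close>

lemma antipode_inv_conv:
  assumes g: "g \<in> carrier C"
  shows "tensor_lift R C (\<lambda>g1 g2. g2 \<otimes>\<^bsub>C\<^esub> antipode_inv g1) (comult C g) = g \<one>\<^bsub>H\<^esub> \<odot>\<^bsub>C\<^esub> \<one>\<^bsub>C\<^esub>" (is "?l1 = ?r")
    and "tensor_lift R C (\<lambda>g1 g2. antipode_inv g2 \<otimes>\<^bsub>C\<^esub> g1) (comult C g) = g \<one>\<^bsub>H\<^esub> \<odot>\<^bsub>C\<^esub> \<one>\<^bsub>C\<^esub>" (is "?l2 = ?r")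
proof -
  interpret C: module R C by (rule C)
  let ?T = "inv_into (carrier H) (antipode H)"
  note T = antipode_inverse[OF antipode_bij refl]
  note Tc = linear_mapsD(1)[OF T(1)]
  note RM = R.self_module
  have l1: "?l1 \<in> carrier C" by (rule linear_mapsD(1)[OF R.tensor_lift_linear[OF C C C antipode_inv_bil(1)]]) (simp add: g)
  have l2: "?l2 \<in> carrier C" by (rule linear_mapsD(1)[OF R.tensor_lift_linear[OF C C C antipode_inv_bil(2)]]) (simp add: g)
  have linT: "(\<lambda>x. f (?T x)) \<in> Dual" if "f \<in> carrier C" for f
    by (rule linear_maps_comp[OF C_Dual[OF that] T(1)])
  have r: "g (counit H k \<odot>\<^bsub>H\<^esub> \<one>\<^bsub>H\<^esub>) = ?r k" if k: "k \<in> carrier H" for k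
  proof -
    have "?r k = g \<one>\<^bsub>H\<^esub> \<otimes>\<^bsub>R\<^esub> \<one>\<^bsub>C\<^esub> k"
      using linear_mapsD(3)[OF C_eval[OF k], of "g \<one>\<^bsub>H\<^esub>" "\<one>\<^bsub>C\<^esub>"] g by simp
    then show ?thesis
      using k g linear_mapsD(3)[OF C_Dual[OF g], of "counit H k" "\<one>\<^bsub>H\<^esub>"] by (simp add: C_one R.m_comm)
  qed
  show "?l1 = ?r"
  proof (rule C_eqI[OF l1])
    fix k assume k: "k \<in> carrier H"
    let ?\<mu> = "\<lambda>g1 g2 k1 k2. g2 k1 \<otimes>\<^bsub>R\<^esub> g1 (?T k2)"
    have \<mu>1: "?\<mu> g1 g2 \<in> bilinear_maps R H H (self_module R)" if "g1 \<in> carrier C" "g2 \<in> carrier C" for g1 g2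
      by (intro bilinear_mapsI lin linT C_Dual; simp add: that Tc)
    have \<mu>2: "(\<lambda>g1 g2. ?\<mu> g1 g2 k1 k2) \<in> bilinear_maps R C C (self_module R)" if "k1 \<in> carrier H" "k2 \<in> carrier H" for k1 k2
      by (intro bilinear_mapsI lin C_eval; simp add: that Tc)
    have b: "(\<lambda>k1 k2. ?T k2 \<otimes>\<^bsub>H\<^esub> k1) \<in> bilinear_maps R H H H"
      by (intro bilinear_mapsI lin T(1); simp add: Tc)
    have "?l1 k = tensor_lift R (self_module R) (\<lambda>g1 g2. (g2 \<otimes>\<^bsub>C\<^esub> antipode_inv g1) k) (comult C g)"
      by (rule cw_linear[OF C RM antipode_inv_bil(1) C_eval[OF k] g])
    also have "\<dots> = tensor_lift R (self_module R) (\<lambda>g1 g2. tensor_lift R (self_module R) (?\<mu> g1 g2) (comult H k)) (comult C g)"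
    proof (rule cw_cong[OF RM bilinear_maps_linear[OF antipode_inv_bil(1) C_eval[OF k]] g])
      fix g1 g2 assume g12: "g1 \<in> carrier C" "g2 \<in> carrier C"
      show "(g2 \<otimes>\<^bsub>C\<^esub> antipode_inv g1) k = tensor_lift R (self_module R) (?\<mu> g1 g2) (comult H k)"
        unfolding C_mult_apply[OF g12(2) antipode_inv_closed[OF g12(1)] k]
        by (rule sw_cong2[OF RM \<mu>1[OF g12] k]) (simp add: antipode_inv_apply g12)
    qed
    also have "\<dots> = tensor_lift R (self_module R) (\<lambda>k1 k2. tensor_lift R (self_module R) (\<lambda>g1 g2. ?\<mu> g1 g2 k1 k2) (comult C g)) (comult H k)"
      by (rule R.tensor_lift_swap[OF C C H H RM]; (rule \<mu>1 \<mu>2; assumption)?; simp add: g k)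
    also have "\<dots> = tensor_lift R (self_module R) (\<lambda>k1 k2. g (?T k2 \<otimes>\<^bsub>H\<^esub> k1)) (comult H k)"
    proof (rule sw_cong2[OF RM bilinear_maps_linear[OF b C_Dual[OF g]] k])
      fix k1 k2 assume k12: "k1 \<in> carrier H" "k2 \<in> carrier H"
      have "tensor_lift R (self_module R) (\<lambda>g1 g2. ?\<mu> g1 g2 k1 k2) (comult C g) =
        tensor_lift R (self_module R) (\<lambda>g1 g2. g1 (?T k2) \<otimes>\<^bsub>R\<^esub> g2 k1) (comult C g)"
        by (rule cw_cong[OF RM \<mu>2[OF k12] g]) (simp add: R.m_comm k12 Tc)
      then show "tensor_lift R (self_module R) (\<lambda>g1 g2. ?\<mu> g1 g2 k1 k2) (comult C g) = g (?T k2 \<otimes>\<^bsub>H\<^esub> k1)"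
        using C_comult[OF g Tc[OF k12(2)] k12(1)] by simp
    qed
    also have "\<dots> = g (tensor_lift R H (\<lambda>k1 k2. ?T k2 \<otimes>\<^bsub>H\<^esub> k1) (comult H k))"
      by (rule sw_linear[OF H RM b C_Dual[OF g] k, symmetric])
    also have "\<dots> = ?r k" unfolding T(4)[OF k] by (rule r[OF k])
    finally show "?l1 k = ?r k" .
  qed (simp add: g)
  show "?l2 = ?r"
  proof (rule C_eqI[OF l2])
    fix k assume k: "k \<in> carrier H"
    let ?\<mu> = "\<lambda>g1 g2 k1 k2. g2 (?T k1) \<otimes>\<^bsub>R\<^esub> g1 k2"
    have \<mu>1: "?\<mu> g1 g2 \<in> bilinear_maps R H H (self_module R)" if "g1 \<in> carrier C" "g2 \<in> carrier C" for g1 g2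
      by (intro bilinear_mapsI lin linT C_Dual; simp add: that Tc)
    have \<mu>2: "(\<lambda>g1 g2. ?\<mu> g1 g2 k1 k2) \<in> bilinear_maps R C C (self_module R)" if "k1 \<in> carrier H" "k2 \<in> carrier H" for k1 k2
      by (intro bilinear_mapsI lin C_eval; simp add: that Tc)
    have b: "(\<lambda>k1 k2. k2 \<otimes>\<^bsub>H\<^esub> ?T k1) \<in> bilinear_maps R H H H"
      by (intro bilinear_mapsI lin T(1); simp add: Tc)
    have "?l2 k = tensor_lift R (self_module R) (\<lambda>g1 g2. (antipode_inv g2 \<otimes>\<^bsub>C\<^esub> g1) k) (comult C g)"
      by (rule cw_linear[OF C RM antipode_inv_bil(2) C_eval[OF k] g])
    also have "\<dots> = tensor_lift R (self_module R) (\<lambda>g1 g2. tensor_lift R (self_module R) (?\<mu> g1 g2) (comult H k)) (comult C g)"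
    proof (rule cw_cong[OF RM bilinear_maps_linear[OF antipode_inv_bil(2) C_eval[OF k]] g])
      fix g1 g2 assume g12: "g1 \<in> carrier C" "g2 \<in> carrier C"
      show "(antipode_inv g2 \<otimes>\<^bsub>C\<^esub> g1) k = tensor_lift R (self_module R) (?\<mu> g1 g2) (comult H k)"
        unfolding C_mult_apply[OF antipode_inv_closed[OF g12(2)] g12(1) k]
        by (rule sw_cong2[OF RM \<mu>1[OF g12] k]) (simp add: antipode_inv_apply g12)
    qed
    also have "\<dots> = tensor_lift R (self_module R) (\<lambda>k1 k2. tensor_lift R (self_module R) (\<lambda>g1 g2. ?\<mu> g1 g2 k1 k2) (comult C g)) (comult H k)"
      by (rule R.tensor_lift_swap[OF C C H H RM]; (rule \<mu>1 \<mu>2; assumption)?; simp add: g k)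
    also have "\<dots> = tensor_lift R (self_module R) (\<lambda>k1 k2. g (k2 \<otimes>\<^bsub>H\<^esub> ?T k1)) (comult H k)"
    proof (rule sw_cong2[OF RM bilinear_maps_linear[OF b C_Dual[OF g]] k])
      fix k1 k2 assume k12: "k1 \<in> carrier H" "k2 \<in> carrier H"
      have "tensor_lift R (self_module R) (\<lambda>g1 g2. ?\<mu> g1 g2 k1 k2) (comult C g) =
        tensor_lift R (self_module R) (\<lambda>g1 g2. g1 k2 \<otimes>\<^bsub>R\<^esub> g2 (?T k1)) (comult C g)"
        by (rule cw_cong[OF RM \<mu>2[OF k12] g]) (simp add: R.m_comm k12 Tc)
      then show "tensor_lift R (self_module R) (\<lambda>g1 g2. ?\<mu> g1 g2 k1 k2) (comult C g) = g (k2 \<otimes>\<^bsub>H\<^esub> ?T k1)"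
        using C_comult[OF g k12(2) Tc[OF k12(1)]] by simp
    qed
    also have "\<dots> = g (tensor_lift R H (\<lambda>k1 k2. k2 \<otimes>\<^bsub>H\<^esub> ?T k1) (comult H k))"
      by (rule sw_linear[OF H RM b C_Dual[OF g] k, symmetric])
    also have "\<dots> = ?r k" unfolding T(3)[OF k] by (rule r[OF k])
    finally show "?l2 k = ?r k" .
  qed (simp add: g)
qed

definition rho_lift_inv :: "('h \<Rightarrow> 'r) \<Rightarrow> ('h \<times> ('h \<Rightarrow> 'r) \<Rightarrow> 'r) set" where
  "rho_lift_inv f = rho_lift (antipode_inv f)"

lemma rho_lift_inv_linear: "rho_lift_inv \<in> linear_maps R C HC"
  unfolding rho_lift_inv_def[abs_def] by (rule linear_maps_comp[OF rho_lift_linear antipode_inv_linear])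

lemma rho_lift_inv_closed [simp]: "f \<in> carrier C \<Longrightarrow> rho_lift_inv f \<in> carrier HC"
  by (simp add: rho_lift_inv_def)

text \<open>Because the lift reverses products, w(g_1) v(g_2) is the lift of g_2 times the inverse
  antipode of g_1, with the factors in the order required by \<open>antipode_inv_conv\<close>; the
  second identity is similar.\<close>

lemma rho_lift_inv_conv:
  assumes g: "g \<in> carrier C"
  shows "tensor_lift R HC (\<lambda>g1 g2. rho_lift_inv g1 \<otimes>\<^bsub>B\<^esub> rho_lift g2) (comult C g) = g \<one>\<^bsub>H\<^esub> \<odot>\<^bsub>HC\<^esub> \<one>\<^bsub>B\<^esub>"
    and "tensor_lift R HC (\<lambda>g1 g2. rho_lift g1 \<otimes>\<^bsub>B\<^esub> rho_lift_inv g2) (comult C g) = g \<one>\<^bsub>H\<^esub> \<odot>\<^bsub>HC\<^esub> \<one>\<^bsub>B\<^esub>"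
proof -
  have *: "rho_lift (g \<one>\<^bsub>H\<^esub> \<odot>\<^bsub>C\<^esub> \<one>\<^bsub>C\<^esub>) = g \<one>\<^bsub>H\<^esub> \<odot>\<^bsub>HC\<^esub> \<one>\<^bsub>B\<^esub>"
    using linear_mapsD(3)[OF rho_lift_linear, of "g \<one>\<^bsub>H\<^esub>" "\<one>\<^bsub>C\<^esub>"] g by (simp add: rho_lift_one)
  have "tensor_lift R HC (\<lambda>g1 g2. rho_lift_inv g1 \<otimes>\<^bsub>B\<^esub> rho_lift g2) (comult C g) =
    tensor_lift R HC (\<lambda>g1 g2. rho_lift (g2 \<otimes>\<^bsub>C\<^esub> antipode_inv g1)) (comult C g)"
    by (rule cw_cong[OF HC bilinear_maps_linear[OF antipode_inv_bil(1) rho_lift_linear] g, symmetric])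
      (simp add: rho_lift_mult rho_lift_inv_def)
  then show "tensor_lift R HC (\<lambda>g1 g2. rho_lift_inv g1 \<otimes>\<^bsub>B\<^esub> rho_lift g2) (comult C g) = g \<one>\<^bsub>H\<^esub> \<odot>\<^bsub>HC\<^esub> \<one>\<^bsub>B\<^esub>"
    using cw_linear[OF C HC antipode_inv_bil(1) rho_lift_linear g] antipode_inv_conv(1)[OF g] * by simp
  have "tensor_lift R HC (\<lambda>g1 g2. rho_lift g1 \<otimes>\<^bsub>B\<^esub> rho_lift_inv g2) (comult C g) =
    tensor_lift R HC (\<lambda>g1 g2. rho_lift (antipode_inv g2 \<otimes>\<^bsub>C\<^esub> g1)) (comult C g)"
    by (rule cw_cong[OF HC bilinear_maps_linear[OF antipode_inv_bil(2) rho_lift_linear] g, symmetric])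
      (simp add: rho_lift_mult rho_lift_inv_def)
  then show "tensor_lift R HC (\<lambda>g1 g2. rho_lift g1 \<otimes>\<^bsub>B\<^esub> rho_lift_inv g2) (comult C g) = g \<one>\<^bsub>H\<^esub> \<odot>\<^bsub>HC\<^esub> \<one>\<^bsub>B\<^esub>"
    using cw_linear[OF C HC antipode_inv_bil(2) rho_lift_linear g] antipode_inv_conv(2)[OF g] * by simp
qed

end

section \<open>Tensor algebras and transport of algebra structure\<close>

context cring
begin

lemma tensor_algebra_assoc_algebra:
  assumes A: "assoc_algebra R A" and B: "assoc_algebra R B"
  shows "assoc_algebra R (tensor_algebra R A B)"
proof -
  interpret A: assoc_algebra R A by (rule A)
  interpret B: assoc_algebra R B by (rule B)
  note Am = A.module_axioms and Bm = B.module_axioms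
  let ?T = "tensor_algebra R A B" and ?M = "tensor_module R A B"
  note M = tensor_module_module[OF Am Bm]
  note T = tensor_algebra_mult[OF Am Bm A.mult_bilinear B.mult_bilinear]
  note bil = T(1) and pure = T(2)
  note closed = bilinear_mapsD(3)[OF bil] and tc = tensor_closed[OF Am Bm]
  note l = bilinear_mapsD(1,2)[OF bil]
  show ?thesis
  proof (rule assoc_algebraI)
    show "module R ?T" by (rule module_cong[OF M]) (simp_all add: tensor_algebra_simps)
    show "(\<lambda>x y. x \<otimes>\<^bsub>?T\<^esub> y) \<in> bilinear_maps R ?T ?T ?T"
      using bil by (simp add: bilinear_maps_def linear_maps_def tensor_algebra_simps)
    show "\<one>\<^bsub>?T\<^esub> \<in> carrier ?T" by (simp add: tensor_algebra_simps tc)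
    have o: "\<one>\<^bsub>?T\<^esub> \<in> carrier ?M" by (simp add: tensor_algebra_simps tc)
    fix x assume "x \<in> carrier ?T"
    then have x: "x \<in> carrier ?M" by (simp add: tensor_algebra_simps)
    show "\<one>\<^bsub>?T\<^esub> \<otimes>\<^bsub>?T\<^esub> x = x"
      by (rule tensor_ext[OF Am Bm M l(1)[OF o] linear_maps_id _ x]) (simp add: tensor_algebra_simps pure)
    show "x \<otimes>\<^bsub>?T\<^esub> \<one>\<^bsub>?T\<^esub> = x"
      by (rule tensor_ext[OF Am Bm M l(2)[OF o] linear_maps_id _ x]) (simp add: tensor_algebra_simps pure)
    fix y z assume "y \<in> carrier ?T" "z \<in> carrier ?T"
    then have y: "y \<in> carrier ?M" and z: "z \<in> carrier ?M" by (simp_all add: tensor_algebra_simps)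
    show "(x \<otimes>\<^bsub>?T\<^esub> y) \<otimes>\<^bsub>?T\<^esub> z = x \<otimes>\<^bsub>?T\<^esub> (y \<otimes>\<^bsub>?T\<^esub> z)"
    proof (rule tensor_ext2[OF Am Bm Am Bm M bilinear_maps_linear[OF bil l(2)[OF z]] bilinear_maps_comp[OF bil linear_maps_id l(2)[OF z]] _ x y])
      fix a b a' b' assume ab: "a \<in> carrier A" "b \<in> carrier B" "a' \<in> carrier A" "b' \<in> carrier B"
      have 1: "(\<lambda>z. tensor R A B a b \<otimes>\<^bsub>?T\<^esub> (tensor R A B a' b' \<otimes>\<^bsub>?T\<^esub> z)) \<in> linear_maps R ?M ?M"
        by (rule linear_maps_comp[OF l(1)[OF tc] l(1)[OF tc]]) (simp_all add: ab)
      show "(tensor R A B a b \<otimes>\<^bsub>?T\<^esub> tensor R A B a' b') \<otimes>\<^bsub>?T\<^esub> z = tensor R A B a b \<otimes>\<^bsub>?T\<^esub> (tensor R A B a' b' \<otimes>\<^bsub>?T\<^esub> z)"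
        by (rule tensor_ext[OF Am Bm M l(1)[OF closed[OF tc[OF ab(1,2)] tc[OF ab(3,4)]]] 1 _ z])
          (simp add: pure ab A.m_assoc B.m_assoc)
    qed
  qed
qed

text \<open>Associativity and the unit laws of S are pulled back from T along the injective
  multiplicative map, so a bijection that respects product and unit also certifies S as an
  algebra.\<close>

lemma algebras_isomorphicI:
  assumes S: "module R S" and T: "assoc_algebra R T"
    and mult: "(\<lambda>x y. x \<otimes>\<^bsub>S\<^esub> y) \<in> bilinear_maps R S S S" and one: "\<one>\<^bsub>S\<^esub> \<in> carrier S"
    and \<theta>: "\<theta> \<in> linear_maps R S T" "bij_betw \<theta> (carrier S) (carrier T)"
    and \<theta>_mult: "\<And>x y. x \<in> carrier S \<Longrightarrow> y \<in> carrier S \<Longrightarrow> \<theta> (x \<otimes>\<^bsub>S\<^esub> y) = \<theta> x \<otimes>\<^bsub>T\<^esub> \<theta> y"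
    and \<theta>_one: "\<theta> \<one>\<^bsub>S\<^esub> = \<one>\<^bsub>T\<^esub>"
  shows "algebras_isomorphic R S T"
proof -
  interpret T: assoc_algebra R T by (rule T)
  note \<theta>c [simp] = linear_mapsD(1)[OF \<theta>(1)] and mc [simp] = bilinear_mapsD(3)[OF mult]
  have inj: "x = y" if "\<theta> x = \<theta> y" "x \<in> carrier S" "y \<in> carrier S" for x y
    using that \<theta>(2) by (auto simp: bij_betw_def dest: inj_onD)
  have "assoc_algebra R S"
    by (rule assoc_algebraI[OF S mult one]; rule inj) (simp_all add: one \<theta>_mult \<theta>_one T.m_assoc)
  moreover have "\<theta> \<in> algebra_homs R S T"
    using \<theta>(1) by (auto simp: algebra_homs_def \<theta>_mult \<theta>_one linear_mapsD(2)[OF \<theta>(1)] intro!: ring_hom_memI)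
  ultimately show ?thesis
    using T \<theta>(2) by (auto simp: algebras_isomorphic_def)
qed

end

section \<open>The duality isomorphism\<close>

locale dual_comodule = dual_hopf R H C + A: right_comodule_algebra R C A coact
  for R :: "('r, 's) ring_scheme" (structure)
    and H :: "('r, 'h, 'x) hopf_scheme" (structure)
    and C :: "('r, 'h \<Rightarrow> 'r, 'z) hopf_scheme"
    and A :: "('r, 'a, 'y) module_scheme"
    and coact :: "'a \<Rightarrow> ('a \<times> ('h \<Rightarrow> 'r) \<Rightarrow> 'r) set" +
  assumes C_counit: "f \<in> carrier C \<Longrightarrow> counit C f = f \<one>\<^bsub>H\<^esub>"
begin

lemmas Am = A.module_axioms
abbreviation "AC \<equiv> tensor_module R A C"
abbreviation "AB \<equiv> tensor_module R A HC"
lemma AB: "module R AB" by (rule R.tensor_module_module[OF Am HC])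

lemma tensor_AB [simp]: "a \<in> carrier A \<Longrightarrow> x \<in> carrier HC \<Longrightarrow> tensor R A HC a x \<in> carrier AB"
  by (rule R.tensor_closed[OF Am HC])

lemma coact_linear: "coact \<in> linear_maps R A AC"
  using A.coact_hom unfolding algebra_homs_def R.linear_maps_tensor_algebra by simp

lemmas coact_closed [simp] = linear_mapsD(1)[OF coact_linear]

lemma aw_cong:
  assumes "module R P" "\<beta> \<in> bilinear_maps R A C P" "a \<in> carrier A"
    and "\<And>a0 a1. a0 \<in> carrier A \<Longrightarrow> a1 \<in> carrier C \<Longrightarrow> \<beta> a0 a1 = \<gamma> a0 a1"
  shows "tensor_lift R P \<beta> (coact a) = tensor_lift R P \<gamma> (coact a)"
  by (rule R.tensor_lift_cong[OF Am C assms(1,2,4)]) (simp_all add: assms(3))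

lemma aw_cong2:
  assumes "module R P" "\<gamma> \<in> bilinear_maps R A C P" "a \<in> carrier A"
    and "\<And>a0 a1. a0 \<in> carrier A \<Longrightarrow> a1 \<in> carrier C \<Longrightarrow> \<beta> a0 a1 = \<gamma> a0 a1"
  shows "tensor_lift R P \<beta> (coact a) = tensor_lift R P \<gamma> (coact a)"
  by (rule aw_cong[OF assms(1-3), symmetric]) (simp add: assms(4))

lemma aw_linear:
  assumes "module R P" "module R Q" "\<beta> \<in> bilinear_maps R A C P" "\<phi> \<in> linear_maps R P Q" "a \<in> carrier A"
  shows "\<phi> (tensor_lift R P \<beta> (coact a)) = tensor_lift R Q (\<lambda>a0 a1. \<phi> (\<beta> a0 a1)) (coact a)"
  by (rule linear_maps_tensor_lift[OF Am C assms(1-4)]) (simp add: assms(5))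

lemma aw_coassoc:
  assumes P: "module R P" and a: "a \<in> carrier A"
    and \<tau>: "\<And>x. x \<in> carrier A \<Longrightarrow> \<tau> x \<in> bilinear_maps R C C P"
      "\<And>y z. y \<in> carrier C \<Longrightarrow> z \<in> carrier C \<Longrightarrow> (\<lambda>x. \<tau> x y z) \<in> linear_maps R A P"
  shows "tensor_lift R P (\<lambda>x y. tensor_lift R P (\<lambda>x1 x2. \<tau> x1 x2 y) (coact x)) (coact a) =
    tensor_lift R P (\<lambda>x y. tensor_lift R P (\<tau> x) (comult C y)) (coact a)"
  by (rule R.coassoc_lift[OF Am C P coact_linear C_comult_linear a A.coact_coassoc[OF a] R.trilinear_mapsI[OF \<tau>]])

lemma aw_mult:
  assumes P: "module R P" and \<beta>: "\<beta> \<in> bilinear_maps R A C P" and ab: "a \<in> carrier A" "b \<in> carrier A"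
  shows "tensor_lift R P \<beta> (coact (a \<otimes>\<^bsub>A\<^esub> b)) = tensor_lift R P (\<lambda>a0 a1. tensor_lift R P
    (\<lambda>b0 b1. \<beta> (a0 \<otimes>\<^bsub>A\<^esub> b0) (a1 \<otimes>\<^bsub>C\<^esub> b1)) (coact b)) (coact a)"
proof -
  have "coact (a \<otimes>\<^bsub>A\<^esub> b) = coact a \<otimes>\<^bsub>tensor_algebra R A C\<^esub> coact b"
    using A.coact_hom ring_hom_mult[of coact A "tensor_algebra R A C" a b] ab by (simp add: algebra_homs_def)
  then show ?thesis
    using R.tensor_lift_tensor_algebra_mult[OF Am C P A.mult_bilinear C_mult_bil \<beta> coact_closed coact_closed] ab by simp
qed

lemma coact_one: "coact \<one>\<^bsub>A\<^esub> = tensor R A C \<one>\<^bsub>A\<^esub> \<one>\<^bsub>C\<^esub>"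
  using A.coact_hom ring_hom_one[of coact A "tensor_algebra R A C"]
  by (simp add: algebra_homs_def R.tensor_algebra_simps)

lemma lin_AB1: "\<phi> \<in> linear_maps R X A \<Longrightarrow> x \<in> carrier HC \<Longrightarrow> (\<lambda>z. tensor R A HC (\<phi> z) x) \<in> linear_maps R X AB"
  by (rule linear_maps_comp[OF bilinear_mapsD(2)[OF R.tensor_bilinear[OF Am HC]]])

lemma lin_AB2: "\<psi> \<in> linear_maps R X HC \<Longrightarrow> a \<in> carrier A \<Longrightarrow> (\<lambda>z. tensor R A HC a (\<psi> z)) \<in> linear_maps R X AB"
  by (rule linear_maps_comp[OF bilinear_mapsD(1)[OF R.tensor_bilinear[OF Am HC]]])

lemma lin_A1: "\<phi> \<in> linear_maps R X A \<Longrightarrow> b \<in> carrier A \<Longrightarrow> (\<lambda>x. \<phi> x \<otimes>\<^bsub>A\<^esub> b) \<in> linear_maps R X A"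
  by (rule linear_maps_comp[OF A.linear_right_mult])

lemma lin_A2: "\<phi> \<in> linear_maps R X A \<Longrightarrow> b \<in> carrier A \<Longrightarrow> (\<lambda>x. b \<otimes>\<^bsub>A\<^esub> \<phi> x) \<in> linear_maps R X A"
  by (rule linear_maps_comp[OF A.linear_left_mult])

lemma B_assoc: "x \<in> carrier HC \<Longrightarrow> y \<in> carrier HC \<Longrightarrow> z \<in> carrier HC \<Longrightarrow>
    (x \<otimes>\<^bsub>B\<^esub> y) \<otimes>\<^bsub>B\<^esub> z = x \<otimes>\<^bsub>B\<^esub> (y \<otimes>\<^bsub>B\<^esub> z)"
  by (rule lam_ext) (simp_all add: lam_mult)

lemma B_one_closed [simp]: "\<one>\<^bsub>B\<^esub> \<in> carrier HC"
  by (simp add: R.smash_product_simps)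

lemma B_one: "x \<in> carrier HC \<Longrightarrow> \<one>\<^bsub>B\<^esub> \<otimes>\<^bsub>B\<^esub> x = x"
  by (rule lam_ext) (simp_all add: lam_mult lam_one del: R.smash_product_simps)

text \<open>\<open>coact_mult u\<close> is \<open>a \<otimes> x \<mapsto> \<Sum>a\<^sub>0 \<otimes> u(a\<^sub>1) x\<close>. For \<open>u = rho_lift\<close> and \<open>u = rho_lift_inv\<close> these maps are
  inverse to each other.\<close>

definition coact_mult ::
  "(('h \<Rightarrow> 'r) \<Rightarrow> ('h \<times> ('h \<Rightarrow> 'r) \<Rightarrow> 'r) set) \<Rightarrow> ('a \<times> ('h \<times> ('h \<Rightarrow> 'r) \<Rightarrow> 'r) set \<Rightarrow> 'r) set
    \<Rightarrow> ('a \<times> ('h \<times> ('h \<Rightarrow> 'r) \<Rightarrow> 'r) set \<Rightarrow> 'r) set"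
where
  "coact_mult u = tensor_lift R AB (\<lambda>a x. tensor_lift R AB (\<lambda>a0 a1. tensor R A HC a0 (u a1 \<otimes>\<^bsub>B\<^esub> x)) (coact a))"

lemma coact_mult_inner:
  assumes u: "u \<in> linear_maps R C HC" and x: "x \<in> carrier HC"
  shows "(\<lambda>a0 a1. tensor R A HC a0 (u a1 \<otimes>\<^bsub>B\<^esub> x)) \<in> bilinear_maps R A C AB"
  by (intro bilinear_mapsI lin_AB1 lin_AB2 lin_B1 u linear_maps_id; simp add: x linear_mapsD(1)[OF u])

lemma coact_mult_bil:
  assumes u: "u \<in> linear_maps R C HC"
  shows "(\<lambda>a x. tensor_lift R AB (\<lambda>a0 a1. tensor R A HC a0 (u a1 \<otimes>\<^bsub>B\<^esub> x)) (coact a)) \<in> bilinear_maps R A HC AB"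
proof (rule bilinear_mapsI)
  show "(\<lambda>x. tensor_lift R AB (\<lambda>a0 a1. tensor R A HC a0 (u a1 \<otimes>\<^bsub>B\<^esub> x)) (coact a)) \<in> linear_maps R HC AB"
    if "a \<in> carrier A" for a
    by (rule R.tensor_lift_linear_param[OF HC Am C AB coact_mult_inner[OF u]])
      (simp_all add: that lin_AB2 lin_B2 linear_maps_id linear_mapsD(1)[OF u])
  show "(\<lambda>a. tensor_lift R AB (\<lambda>a0 a1. tensor R A HC a0 (u a1 \<otimes>\<^bsub>B\<^esub> x)) (coact a)) \<in> linear_maps R A AB"
    if "x \<in> carrier HC" for x
    by (rule linear_maps_comp[OF R.tensor_lift_linear[OF Am C AB coact_mult_inner[OF u that]] coact_linear])
qed

lemma coact_mult_linear: "u \<in> linear_maps R C HC \<Longrightarrow> coact_mult u \<in> linear_maps R AB AB"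
  unfolding coact_mult_def by (rule R.tensor_lift_linear[OF Am HC AB coact_mult_bil])

lemma coact_mult_tensor:
  assumes "u \<in> linear_maps R C HC" "a \<in> carrier A" "x \<in> carrier HC"
  shows "coact_mult u (tensor R A HC a x) = tensor_lift R AB (\<lambda>a0 a1. tensor R A HC a0 (u a1 \<otimes>\<^bsub>B\<^esub> x)) (coact a)"
  unfolding coact_mult_def by (rule R.tensor_lift_tensor[OF Am HC AB coact_mult_bil[OF assms(1)] assms(2,3)])

text \<open>Coassociativity of the coaction brings the composite into the form \<Sum> a_0 \<otimes>
  u(a_1) u'(a_2) x. The convolution hypothesis collapses u(a_1) u'(a_2) to the scalar a_1(1), which
  is the counit of a_1, and the counit axiom of the comodule returns a.\<close>

lemma coact_mult_inverse:
  assumes u: "u \<in> linear_maps R C HC" and u': "u' \<in> linear_maps R C HC"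
    and conv: "\<And>g. g \<in> carrier C \<Longrightarrow>
      tensor_lift R HC (\<lambda>g1 g2. u g1 \<otimes>\<^bsub>B\<^esub> u' g2) (comult C g) = g \<one>\<^bsub>H\<^esub> \<odot>\<^bsub>HC\<^esub> \<one>\<^bsub>B\<^esub>"
    and t: "t \<in> carrier AB"
  shows "coact_mult u (coact_mult u' t) = t"
proof (rule R.tensor_ext[OF Am HC AB linear_maps_comp[OF coact_mult_linear[OF u] coact_mult_linear[OF u']] linear_maps_id _ t])
  fix a x assume a: "a \<in> carrier A" and x: "x \<in> carrier HC"
  note uc [simp] = linear_mapsD(1)[OF u] linear_mapsD(1)[OF u']
  let ?\<tau> = "\<lambda>b0 b1 a1. tensor R A HC b0 (u b1 \<otimes>\<^bsub>B\<^esub> (u' a1 \<otimes>\<^bsub>B\<^esub> x))"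
  have "coact_mult u (coact_mult u' (tensor R A HC a x)) =
    tensor_lift R AB (\<lambda>a0 a1. coact_mult u (tensor R A HC a0 (u' a1 \<otimes>\<^bsub>B\<^esub> x))) (coact a)"
    unfolding coact_mult_tensor[OF u' a x]
    by (rule aw_linear[OF AB AB coact_mult_inner[OF u' x] coact_mult_linear[OF u] a])
  also have "\<dots> = tensor_lift R AB (\<lambda>a0 a1. tensor_lift R AB (\<lambda>b0 b1. ?\<tau> b0 b1 a1) (coact a0)) (coact a)"
    by (rule aw_cong[OF AB bilinear_maps_linear[OF coact_mult_inner[OF u' x] coact_mult_linear[OF u]] a])
      (simp add: coact_mult_tensor u x)
  also have "\<dots> = tensor_lift R AB (\<lambda>a0 a1. tensor_lift R AB (?\<tau> a0) (comult C a1)) (coact a)"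
    by (rule aw_coassoc[OF AB a]; (intro bilinear_mapsI lin_AB1 lin_AB2 lin_B1 lin_B2 u u' linear_maps_id)?; simp add: x)
  also have "\<dots> = tensor_lift R AB (\<lambda>a0 a1. tensor R A HC (a1 \<one>\<^bsub>H\<^esub> \<odot>\<^bsub>A\<^esub> a0) x) (coact a)"
  proof (rule aw_cong2[OF AB _ a])
    show "(\<lambda>a0 a1. tensor R A HC (a1 \<one>\<^bsub>H\<^esub> \<odot>\<^bsub>A\<^esub> a0) x) \<in> bilinear_maps R A C AB"
      by (intro bilinear_mapsI lin_AB1 lin_smult1 lin_smult2 C_eval Am linear_maps_id; simp add: x)
    fix a0 a1 assume a01: "a0 \<in> carrier A" "a1 \<in> carrier C"
    have b: "(\<lambda>g1 g2. u g1 \<otimes>\<^bsub>B\<^esub> u' g2) \<in> bilinear_maps R C C HC"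
      by (intro bilinear_mapsI lin_B1 lin_B2 u u'; simp)
    note l = lin_AB2[OF lin_B1[OF linear_maps_id x] a01(1)]
    have "tensor R A HC a0 ((a1 \<one>\<^bsub>H\<^esub> \<odot>\<^bsub>HC\<^esub> \<one>\<^bsub>B\<^esub>) \<otimes>\<^bsub>B\<^esub> x) =
      tensor_lift R AB (\<lambda>g1 g2. tensor R A HC a0 ((u g1 \<otimes>\<^bsub>B\<^esub> u' g2) \<otimes>\<^bsub>B\<^esub> x)) (comult C a1)"
      unfolding conv[OF a01(2), symmetric] by (rule cw_linear[OF HC AB b l a01(2)])
    also have "\<dots> = tensor_lift R AB (?\<tau> a0) (comult C a1)"
      by (rule cw_cong[OF AB bilinear_maps_linear[OF b l] a01(2)]) (simp add: B_assoc x)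
    finally have "tensor_lift R AB (?\<tau> a0) (comult C a1) = tensor R A HC a0 ((a1 \<one>\<^bsub>H\<^esub> \<odot>\<^bsub>HC\<^esub> \<one>\<^bsub>B\<^esub>) \<otimes>\<^bsub>B\<^esub> x)" ..
    also have "\<dots> = a1 \<one>\<^bsub>H\<^esub> \<odot>\<^bsub>AB\<^esub> tensor R A HC a0 x"
      using linear_mapsD(3)[OF l, of "a1 \<one>\<^bsub>H\<^esub>" "\<one>\<^bsub>B\<^esub>"] a01 x B_one by simp
    also have "\<dots> = tensor R A HC (a1 \<one>\<^bsub>H\<^esub> \<odot>\<^bsub>A\<^esub> a0) x"
      using linear_mapsD(3)[OF lin_AB1[OF linear_maps_id x], of "a1 \<one>\<^bsub>H\<^esub>" a0] a01 by simp
    finally show "tensor_lift R AB (?\<tau> a0) (comult C a1) = tensor R A HC (a1 \<one>\<^bsub>H\<^esub> \<odot>\<^bsub>A\<^esub> a0) x" .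
  qed
  also have "\<dots> = tensor R A HC (tensor_lift R A (\<lambda>a0 a1. a1 \<one>\<^bsub>H\<^esub> \<odot>\<^bsub>A\<^esub> a0) (coact a)) x"
    by (rule aw_linear[OF Am AB _ lin_AB1[OF linear_maps_id x] a, symmetric])
      (intro bilinear_mapsI lin_smult1 lin_smult2 C_eval Am linear_maps_id; simp)
  also have "tensor_lift R A (\<lambda>a0 a1. a1 \<one>\<^bsub>H\<^esub> \<odot>\<^bsub>A\<^esub> a0) (coact a) = tensor_lift R A (\<lambda>a0 a1. counit C a1 \<odot>\<^bsub>A\<^esub> a0) (coact a)"
    by (rule aw_cong[OF Am _ a], intro bilinear_mapsI lin_smult1 lin_smult2 C_eval Am linear_maps_id; simp add: C_counit)
  also have "\<dots> = a" by (rule A.coact_counit[OF a])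
  finally show "coact_mult u (coact_mult u' (tensor R A HC a x)) = tensor R A HC a x" .
qed

lemma AB_eq: "tensor_module R A B = AB" "tensor R A B = tensor R A HC"
  by (rule tensor_module_cong; simp add: R.smash_product_simps)+

text \<open>The multiplication of \<open>(A # H) # U\<close>, transported to \<open>A \<otimes> (H # U)\<close>.\<close>

definition star where
  "star s t = tensor_lift R AB (\<lambda>a x. tensor_lift R AB (\<lambda>b y. tensor_lift R AB
    (\<lambda>b0 b1. tensor R A HC (a \<otimes>\<^bsub>A\<^esub> b0) (twist x b1 \<otimes>\<^bsub>B\<^esub> y)) (coact b)) t) s"

lemma star_inner:
  assumes "a \<in> carrier A" "x \<in> carrier HC" "y \<in> carrier HC"
  shows "(\<lambda>b0 b1. tensor R A HC (a \<otimes>\<^bsub>A\<^esub> b0) (twist x b1 \<otimes>\<^bsub>B\<^esub> y)) \<in> bilinear_maps R A C AB"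
  by (intro bilinear_mapsI lin_AB1 lin_AB2 lin_A2 lin_B1 twist_linear2 linear_maps_id; simp add: assms)

lemma star_bil: "star \<in> bilinear_maps R AB AB AB"
  and star_tensor: "\<And>a x b y. a \<in> carrier A \<Longrightarrow> x \<in> carrier HC \<Longrightarrow> b \<in> carrier A \<Longrightarrow> y \<in> carrier HC \<Longrightarrow>
    star (tensor R A HC a x) (tensor R A HC b y) =
    tensor_lift R AB (\<lambda>b0 b1. tensor R A HC (a \<otimes>\<^bsub>A\<^esub> b0) (twist x b1 \<otimes>\<^bsub>B\<^esub> y)) (coact b)"
proof -
  define \<mu> where "\<mu> a x b y = tensor_lift R AB (\<lambda>b0 b1. tensor R A HC (a \<otimes>\<^bsub>A\<^esub> b0) (twist x b1 \<otimes>\<^bsub>B\<^esub> y)) (coact b)" for a x b y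
  have \<mu>1: "\<mu> a x \<in> bilinear_maps R A HC AB" if ax: "a \<in> carrier A" "x \<in> carrier HC" for a x
  proof (rule bilinear_mapsI)
    show "\<mu> a x b \<in> linear_maps R HC AB" if "b \<in> carrier A" for b
      unfolding \<mu>_def
      by (rule R.tensor_lift_linear_param[OF HC Am C AB star_inner[OF ax]])
        (simp_all add: that ax lin_AB2 lin_B2 linear_maps_id)
    show "(\<lambda>b. \<mu> a x b y) \<in> linear_maps R A AB" if "y \<in> carrier HC" for y
      unfolding \<mu>_def by (rule linear_maps_comp[OF R.tensor_lift_linear[OF Am C AB star_inner[OF ax that]] coact_linear])
  qed
  have \<mu>2: "(\<lambda>a x. \<mu> a x b y) \<in> bilinear_maps R A HC AB" if bk: "b \<in> carrier A" "y \<in> carrier HC" for b y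
  proof (rule bilinear_mapsI)
    show "(\<lambda>x. \<mu> a x b y) \<in> linear_maps R HC AB" if "a \<in> carrier A" for a
      unfolding \<mu>_def
      by (rule R.tensor_lift_linear_param[OF HC Am C AB star_inner[OF that _ bk(2)]])
        (simp_all add: that bk lin_AB2 lin_B1 twist_linear1)
    show "(\<lambda>a. \<mu> a x b y) \<in> linear_maps R A AB" if "x \<in> carrier HC" for x
      unfolding \<mu>_def
      by (rule R.tensor_lift_linear_param[OF Am Am C AB star_inner[OF _ that bk(2)]])
        (simp_all add: that bk lin_AB1 lin_A1 linear_maps_id)
  qed
  have star: "star = (\<lambda>s t. tensor_lift R AB (\<lambda>a x. tensor_lift R AB (\<mu> a x) t) s)"
    by (simp add: star_def[abs_def] \<mu>_def[abs_def])
  show "star \<in> bilinear_maps R AB AB AB"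
    unfolding star by (rule R.nested_lift_bilinear(1)[OF Am HC Am HC AB]) (rule \<mu>1 \<mu>2; assumption)+
  fix a x b y assume ax: "a \<in> carrier A" "x \<in> carrier HC" "b \<in> carrier A" "y \<in> carrier HC"
  show "star (tensor R A HC a x) (tensor R A HC b y) =
    tensor_lift R AB (\<lambda>b0 b1. tensor R A HC (a \<otimes>\<^bsub>A\<^esub> b0) (twist x b1 \<otimes>\<^bsub>B\<^esub> y)) (coact b)"
    unfolding star \<mu>_def[symmetric]
    by (rule R.nested_lift_bilinear(4)[where \<mu> = \<mu>, OF Am HC Am HC AB]) (rule \<mu>1 \<mu>2 ax; assumption?)+
qed

text \<open>On pure tensors the right side is \<Sum> a_0 b_0 \<otimes> ((v(a_1) x) \<leftharpoonup>
  b_1) v(b_2) y. By \<open>twist_rho_lift\<close> the second factor becomes v(b_1) v(a_1) x y, which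
  is v(a_1 b_1) x y because v reverses products. This is exactly the order in which the
  multiplicative coaction supplies the functionals for a b.\<close>

lemma coact_mult_star:
  assumes s: "s \<in> carrier AB" and t: "t \<in> carrier AB"
  shows "coact_mult rho_lift (s \<otimes>\<^bsub>tensor_algebra R A B\<^esub> t) = star (coact_mult rho_lift s) (coact_mult rho_lift t)"
proof -
  note Bm = assoc_algebra.axioms(1)[OF B_algebra] and Bbil = assoc_algebra.mult_bilinear[OF B_algebra]
  note T = R.tensor_algebra_mult[OF Am Bm A.mult_bilinear Bbil, unfolded AB_eq, unfolded R.smash_product_simps(1)]
  note \<Psi> = coact_mult_linear[OF rho_lift_linear]
  show ?thesis
  proof (rule R.tensor_ext2[OF Am HC Am HC AB bilinear_maps_linear[OF T(1) \<Psi>] R.bilinear_maps_comp[OF star_bil \<Psi> \<Psi>] _ s t])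
    fix a x b y assume ax: "a \<in> carrier A" "x \<in> carrier HC" and b: "b \<in> carrier A" "y \<in> carrier HC"
    let ?f = "\<lambda>a0 a1 b0 b1. tensor R A HC (a0 \<otimes>\<^bsub>A\<^esub> b0) (rho_lift (a1 \<otimes>\<^bsub>C\<^esub> b1) \<otimes>\<^bsub>B\<^esub> (x \<otimes>\<^bsub>B\<^esub> y))"
    let ?tv = "\<lambda>a0 a1. tensor R A HC a0 (rho_lift a1 \<otimes>\<^bsub>B\<^esub> x)" and ?tw = "\<lambda>b0 b1. tensor R A HC b0 (rho_lift b1 \<otimes>\<^bsub>B\<^esub> y)"
    note tv = coact_mult_inner[OF rho_lift_linear ax(2)] and tw = coact_mult_inner[OF rho_lift_linear b(2)]
    have \<Psi>b: "coact_mult rho_lift (tensor R A HC b y) \<in> carrier AB"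
      using linear_mapsD(1)[OF \<Psi>] b by simp
    have lf: "(\<lambda>c. rho_lift (a1 \<otimes>\<^bsub>C\<^esub> \<phi> c)) \<in> linear_maps R C HC" if "\<phi> \<in> linear_maps R C C" "a1 \<in> carrier C" for \<phi> a1
      by (rule linear_maps_comp[OF rho_lift_linear linear_maps_comp[OF linC_mult2 that(1)]]) (rule that)
    have "star (coact_mult rho_lift (tensor R A HC a x)) (coact_mult rho_lift (tensor R A HC b y)) =
      tensor_lift R AB (\<lambda>a0 a1. star (?tv a0 a1) (coact_mult rho_lift (tensor R A HC b y))) (coact a)"
      unfolding coact_mult_tensor[OF rho_lift_linear ax]
      by (rule aw_linear[OF AB AB tv bilinear_mapsD(2)[OF star_bil \<Psi>b] ax(1)])
    also have "\<dots> = tensor_lift R AB (\<lambda>a0 a1. tensor_lift R AB (?f a0 a1) (coact b)) (coact a)"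
    proof (rule aw_cong[OF AB bilinear_maps_linear[OF tv bilinear_mapsD(2)[OF star_bil \<Psi>b]] ax(1)])
      fix a0 a1 assume a01: "a0 \<in> carrier A" "a1 \<in> carrier C"
      let ?X = "rho_lift a1 \<otimes>\<^bsub>B\<^esub> x"
      have X: "?X \<in> carrier HC" using a01 ax by simp
      note l = bilinear_mapsD(1)[OF star_bil tensor_AB[OF a01(1) X]]
      let ?\<tau> = "\<lambda>c0 c1 b1. tensor R A HC (a0 \<otimes>\<^bsub>A\<^esub> c0) (twist ?X c1 \<otimes>\<^bsub>B\<^esub> (rho_lift b1 \<otimes>\<^bsub>B\<^esub> y))"
      have "star (tensor R A HC a0 ?X) (coact_mult rho_lift (tensor R A HC b y)) =
        tensor_lift R AB (\<lambda>b0 b1. star (tensor R A HC a0 ?X) (?tw b0 b1)) (coact b)"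
        unfolding coact_mult_tensor[OF rho_lift_linear b]
        by (rule aw_linear[OF AB AB tw l b(1)])
      also have "\<dots> = tensor_lift R AB (\<lambda>b0 b1. tensor_lift R AB (\<lambda>c0 c1. ?\<tau> c0 c1 b1) (coact b0)) (coact b)"
        by (rule aw_cong[OF AB bilinear_maps_linear[OF tw l] b(1)]) (simp add: star_tensor a01 ax b)
      \<comment> \<open>Coassociativity replaces the second coaction, applied to b_0, by the
        comultiplication of b_1; this is the shape to which \<open>twist_rho_lift\<close>
        applies.\<close>
      also have "\<dots> = tensor_lift R AB (\<lambda>b0 b1. tensor_lift R AB (?\<tau> b0) (comult C b1)) (coact b)"
        by (rule aw_coassoc[OF AB b(1)];
            (intro bilinear_mapsI lin_AB1 lin_AB2 lin_A2 lin_B1 lin_B2 twist_linear2 rho_lift_linear linear_maps_id)?;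
            simp add: X a01 b)
      also have "\<dots> = tensor_lift R AB (?f a0 a1) (coact b)"
      proof (rule aw_cong2[OF AB _ b(1)])
        show "?f a0 a1 \<in> bilinear_maps R A C AB"
          by (intro bilinear_mapsI lin_AB1 lin_AB2 lin_A2 lin_B1 lf linear_maps_id; simp add: ax a01 b)
        fix b0 b1 assume b01: "b0 \<in> carrier A" "b1 \<in> carrier C"
        note l2 = lin_AB2[OF lin_B1[OF linear_maps_id b(2)] A.m_closed[OF a01(1) b01(1)]]
        have "tensor_lift R AB (?\<tau> b0) (comult C b1) = tensor_lift R AB (\<lambda>g1 g2. tensor R A HC (a0 \<otimes>\<^bsub>A\<^esub> b0)
            ((twist ?X g1 \<otimes>\<^bsub>B\<^esub> rho_lift g2) \<otimes>\<^bsub>B\<^esub> y)) (comult C b1)"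
          by (rule cw_cong[OF AB bilinear_maps_linear[OF twist_rho_lift_bil[OF X] l2] b01(2), symmetric]) (simp add: B_assoc X b)
        also have "\<dots> = tensor R A HC (a0 \<otimes>\<^bsub>A\<^esub> b0) ((rho_lift b1 \<otimes>\<^bsub>B\<^esub> ?X) \<otimes>\<^bsub>B\<^esub> y)"
          unfolding twist_rho_lift[OF X b01(2), symmetric]
          by (rule cw_linear[OF HC AB twist_rho_lift_bil[OF X] l2 b01(2), symmetric])
        also have "\<dots> = ?f a0 a1 b0 b1" using a01 b01 ax b by (simp add: rho_lift_mult B_assoc)
        finally show "tensor_lift R AB (?\<tau> b0) (comult C b1) = ?f a0 a1 b0 b1" .
      qed
      finally show "star (tensor R A HC a0 ?X) (coact_mult rho_lift (tensor R A HC b y)) = tensor_lift R AB (?f a0 a1) (coact b)" .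
    qed
    also have "\<dots> = coact_mult rho_lift (tensor R A HC (a \<otimes>\<^bsub>A\<^esub> b) (x \<otimes>\<^bsub>B\<^esub> y))"
      unfolding coact_mult_tensor[OF rho_lift_linear A.m_closed[OF ax(1) b(1)] B_closed[OF ax(2) b(2)]]
      by (rule aw_mult[OF AB coact_mult_inner[OF rho_lift_linear B_closed[OF ax(2) b(2)]] ax(1) b(1), symmetric])
    finally show "coact_mult rho_lift (tensor R A HC a x \<otimes>\<^bsub>tensor_algebra R A B\<^esub> tensor R A HC b y) =
        star (coact_mult rho_lift (tensor R A HC a x)) (coact_mult rho_lift (tensor R A HC b y))"
      unfolding T(2)[OF ax b] by simp
  qed
qed

end

section \<open>The iterated smash product\<close>

context dual_comodule
begin

abbreviation "act \<equiv> coaction_action R A coact"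
abbreviation "AH \<equiv> tensor_module R A H"
abbreviation "AHC \<equiv> tensor_module R AH C"
abbreviation "A_H \<equiv> smash_product R A H act"
abbreviation "A_H_C \<equiv> smash_product R A_H C (\<lambda>f. tensor_map R A H (\<lambda>a. a) (hit_left R H f))"

lemma AH: "module R AH" by (rule R.tensor_module_module[OF Am H])
lemma AHC: "module R AHC" by (rule R.tensor_module_module[OF AH C])
lemma A_H: "module R A_H" by (rule R.smash_product_module[OF Am H])

lemma act_inner: "h \<in> carrier H \<Longrightarrow> (\<lambda>a0 a1. a1 h \<odot>\<^bsub>A\<^esub> a0) \<in> bilinear_maps R A C A"
  by (intro bilinear_mapsI lin_smult1 lin_smult2 C_eval Am linear_maps_id; simp)

lemma act_bil: "act \<in> bilinear_maps R H A A"
proof (rule bilinear_mapsI)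
  show "act h \<in> linear_maps R A A" if "h \<in> carrier H" for h
    unfolding coaction_action_def
    by (rule linear_maps_comp[OF R.tensor_lift_linear[OF Am C Am act_inner[OF that]] coact_linear])
  show "(\<lambda>h. act h a) \<in> linear_maps R H A" if "a \<in> carrier A" for a
    unfolding coaction_action_def
    by (rule R.tensor_lift_linear_param[OF H Am C Am act_inner]) (simp_all add: that lin_smult1 Am)
qed

lemmas A_H_smash = R.smash_product_mult[OF Am H A.mult_bilinear mult_bilinear comult_linear act_bil]

lemma A_H_bilinear_maps:
  "bilinear_maps R A_H A_H A_H = bilinear_maps R AH AH AH"
  "bilinear_maps R C A_H A_H = bilinear_maps R C AH AH"
  by (simp_all add: bilinear_maps_def linear_maps_def R.smash_product_simps)

lemma tensor_map_hit_tensor: "f \<in> carrier C \<Longrightarrow> b \<in> carrier A \<Longrightarrow> k \<in> carrier H \<Longrightarrow>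
    tensor_map R A H (\<lambda>a. a) (hit_left R H f) (tensor R A H b k) = tensor R A H b (hit_left R H f k)"
  by (rule R.tensor_map_tensor[OF Am H Am H linear_maps_id hit_left_linear]) simp_all

lemma tensor_map_hit_bil: "(\<lambda>f. tensor_map R A H (\<lambda>a. a) (hit_left R H f)) \<in> bilinear_maps R C AH AH"
proof (rule bilinear_mapsI)
  show "tensor_map R A H (\<lambda>a. a) (hit_left R H f) \<in> linear_maps R AH AH" if "f \<in> carrier C" for f
    by (rule R.tensor_map_linear[OF Am H Am H linear_maps_id hit_left_linear]) (simp add: that)
  show "(\<lambda>f. tensor_map R A H (\<lambda>a. a) (hit_left R H f) q) \<in> linear_maps R C AH" if "q \<in> carrier AH" for q
    unfolding tensor_map_def
    by (rule R.tensor_lift_linear_param[OF C Am H AH R.tensor_map_bilinear[OF Am H linear_maps_id hit_left_linear]])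
      (simp_all add: that linear_maps_comp[OF bilinear_mapsD(1)[OF R.tensor_bilinear[OF Am H]] linC_hit_left])
qed

lemma A_H_C_eq: "tensor_module R A_H C = AHC" "tensor R A_H C = tensor R AH C"
  by (rule tensor_module_cong; simp add: R.smash_product_simps)+

lemmas A_H_C_smash = R.smash_product_mult[OF A_H C A_H_smash(2)[folded A_H_bilinear_maps] C_mult_bil C_comult_linear
    tensor_map_hit_bil[folded A_H_bilinear_maps], unfolded A_H_C_eq R.smash_product_simps(1)]

abbreviation "assoc \<equiv> tensor_assoc R A H C"

lemmas assoc_linear = R.tensor_assoc(1)[OF Am H C]
lemmas assoc_tensor = R.tensor_assoc(2)[OF Am H C]

lemma tensor_AH [simp]: "a \<in> carrier A \<Longrightarrow> h \<in> carrier H \<Longrightarrow> tensor R A H a h \<in> carrier AH"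
  by (rule R.tensor_closed[OF Am H])

lemma tensor_AHC [simp]: "p \<in> carrier AH \<Longrightarrow> f \<in> carrier C \<Longrightarrow> tensor R AH C p f \<in> carrier AHC"
  by (rule R.tensor_closed[OF AH C])

text \<open>The action on A comes from the coaction, so \<Sum> h_1 b \<otimes> h_2 = \<Sum> b_0
  \<otimes> b_1(h_1) h_2 = \<Sum> b_0 \<otimes> (h \<leftharpoonup> b_1): the action of H on A turns
  into the right action of U on H. Both sides are then \<Sum> a b_0 \<otimes> ((h \<leftharpoonup>
  b_1) (f_1 \<rightharpoonup> k) \<otimes> f_2 g).\<close>

lemma assoc_mult_tensor:
  assumes ah: "a \<in> carrier A" "h \<in> carrier H" "f \<in> carrier C" and bk: "b \<in> carrier A" "k \<in> carrier H" "g \<in> carrier C"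
  shows "assoc (tensor R AH C (tensor R A H a h) f \<otimes>\<^bsub>A_H_C\<^esub> tensor R AH C (tensor R A H b k) g) =
    star (tensor R A HC a (tensor R H C h f)) (tensor R A HC b (tensor R H C k g))"
proof -
  let ?p = "tensor R A H a h" and ?q = "tensor R A H b k"
  let ?tm = "\<lambda>f. tensor_map R A H (\<lambda>a. a) (hit_left R H f)"
  let ?X = "\<lambda>f1 f2 z. tensor R H C (z \<otimes>\<^bsub>H\<^esub> hit_left R H f1 k) (f2 \<otimes>\<^bsub>C\<^esub> g)"
  let ?\<kappa> = "\<lambda>f1 f2 h1 h2 b0 b1. tensor R A HC (a \<otimes>\<^bsub>A\<^esub> (b1 h1 \<odot>\<^bsub>A\<^esub> b0)) (?X f1 f2 h2)"
  let ?\<kappa>2 = "\<lambda>f1 f2 b0 b1. tensor R A HC (a \<otimes>\<^bsub>A\<^esub> b0) (?X f1 f2 (hit_right R H h b1))"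
  have pq: "?p \<in> carrier AH" "?q \<in> carrier AH" using ah bk by simp_all
  have pq': "?p \<in> carrier A_H" "?q \<in> carrier A_H" using pq by (simp_all add: R.smash_product_simps)
  have X: "?X f1 f2 z \<in> carrier HC" if "f1 \<in> carrier C" "f2 \<in> carrier C" "z \<in> carrier H" for f1 f2 z
    using that bk by simp
  note actc = bilinear_mapsD(3)[OF act_bil]
  have "assoc (tensor R AH C ?p f \<otimes>\<^bsub>A_H_C\<^esub> tensor R AH C ?q g) =
    tensor_lift R AB (\<lambda>f1 f2. assoc (tensor R AH C (?p \<otimes>\<^bsub>A_H\<^esub> ?tm f1 ?q) (f2 \<otimes>\<^bsub>C\<^esub> g))) (comult C f)"
    unfolding A_H_C_smash(3)[OF pq(1) ah(3) pq(2) bk(3)]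
    by (rule cw_linear[OF AHC AB A_H_C_smash(1)[OF pq bk(3)] assoc_linear ah(3)])
  also have "\<dots> = tensor_lift R AB (\<lambda>f1 f2. tensor_lift R AB (?\<kappa>2 f1 f2) (coact b)) (comult C f)"
  proof (rule cw_cong[OF AB bilinear_maps_linear[OF A_H_C_smash(1)[OF pq bk(3)] assoc_linear] ah(3)])
    fix f1 f2 assume f12: "f1 \<in> carrier C" "f2 \<in> carrier C"
    have fk: "hit_left R H f1 k \<in> carrier H" "f2 \<otimes>\<^bsub>C\<^esub> g \<in> carrier C" using f12 bk by simp_all
    note in1 = A_H_smash(1)[OF ah(1) bk(1) fk(1)]
    have l: "(\<lambda>r. assoc (tensor R AH C r (f2 \<otimes>\<^bsub>C\<^esub> g))) \<in> linear_maps R AH AB"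
      by (rule linear_maps_comp[OF assoc_linear bilinear_mapsD(2)[OF R.tensor_bilinear[OF AH C] fk(2)]])
    have \<kappa>1: "?\<kappa> f1 f2 h1 h2 \<in> bilinear_maps R A C AB" if "h1 \<in> carrier H" "h2 \<in> carrier H" for h1 h2
      by (intro bilinear_mapsI lin_AB1 lin_A2 lin_smult1 lin_smult2 C_eval Am linear_maps_id; simp add: ah bk f12 that)
    have \<kappa>2: "(\<lambda>h1 h2. ?\<kappa> f1 f2 h1 h2 b0 b1) \<in> bilinear_maps R H H AB" if "b0 \<in> carrier A" "b1 \<in> carrier C" for b0 b1
      by (intro bilinear_mapsI lin_AB1 lin_AB2 lin_A2 lin_tensor1 lin_mult1 lin_smult1 C_Dual Am linear_maps_id;
          simp add: ah bk f12 that)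
    have "assoc (tensor R AH C (?p \<otimes>\<^bsub>A_H\<^esub> ?tm f1 ?q) (f2 \<otimes>\<^bsub>C\<^esub> g)) =
      tensor_lift R AB (\<lambda>h1 h2. assoc (tensor R AH C (tensor R A H (a \<otimes>\<^bsub>A\<^esub> act h1 b) (h2 \<otimes>\<^bsub>H\<^esub> hit_left R H f1 k)) (f2 \<otimes>\<^bsub>C\<^esub> g))) (comult H h)"
      unfolding tensor_map_hit_tensor[OF f12(1) bk(1,2)] A_H_smash(3)[OF ah(1,2) bk(1) fk(1)]
      by (rule sw_linear[OF AH AB in1 l ah(2)])
    also have "\<dots> = tensor_lift R AB (\<lambda>h1 h2. tensor_lift R AB (?\<kappa> f1 f2 h1 h2) (coact b)) (comult H h)"
    proof (rule sw_cong[OF AB bilinear_maps_linear[OF in1 l] ah(2)])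
      fix h1 h2 assume h12: "h1 \<in> carrier H" "h2 \<in> carrier H"
      have la: "(\<lambda>z. tensor R A HC (a \<otimes>\<^bsub>A\<^esub> z) (?X f1 f2 h2)) \<in> linear_maps R A AB"
        by (rule lin_AB1[OF lin_A2[OF linear_maps_id ah(1)] X[OF f12 h12(2)]])
      have "assoc (tensor R AH C (tensor R A H (a \<otimes>\<^bsub>A\<^esub> act h1 b) (h2 \<otimes>\<^bsub>H\<^esub> hit_left R H f1 k)) (f2 \<otimes>\<^bsub>C\<^esub> g)) =
        tensor R A HC (a \<otimes>\<^bsub>A\<^esub> act h1 b) (?X f1 f2 h2)"
        by (rule assoc_tensor) (simp_all add: ah bk f12 h12 actc)
      also have "\<dots> = tensor_lift R AB (?\<kappa> f1 f2 h1 h2) (coact b)"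
        unfolding coaction_action_def by (rule aw_linear[OF Am AB act_inner[OF h12(1)] la bk(1)])
      finally show "assoc (tensor R AH C (tensor R A H (a \<otimes>\<^bsub>A\<^esub> act h1 b) (h2 \<otimes>\<^bsub>H\<^esub> hit_left R H f1 k)) (f2 \<otimes>\<^bsub>C\<^esub> g)) =
        tensor_lift R AB (?\<kappa> f1 f2 h1 h2) (coact b)" .
    qed
    \<comment> \<open>The sum over h goes inside, so that \<Sum> b_1(h_1) h_2 can be contracted to h
      \<leftharpoonup> b_1.\<close>
    also have "\<dots> = tensor_lift R AB (\<lambda>b0 b1. tensor_lift R AB (\<lambda>h1 h2. ?\<kappa> f1 f2 h1 h2 b0 b1) (comult H h)) (coact b)"
      by (rule R.tensor_lift_swap[OF H H Am C AB]; (rule \<kappa>1 \<kappa>2; assumption)?; simp add: ah bk)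
    also have "\<dots> = tensor_lift R AB (?\<kappa>2 f1 f2) (coact b)"
    proof (rule aw_cong2[OF AB _ bk(1)])
      show "?\<kappa>2 f1 f2 \<in> bilinear_maps R A C AB"
        by (intro bilinear_mapsI lin_AB1 lin_AB2 lin_A2 lin_tensor1 lin_mult1 linC_hit_right linear_maps_id;
            simp add: ah bk f12)
      fix b0 b1 assume b01: "b0 \<in> carrier A" "b1 \<in> carrier C"
      have ab: "a \<otimes>\<^bsub>A\<^esub> b0 \<in> carrier A" using ah b01 by simp
      have lz: "(\<lambda>z. tensor R A HC (a \<otimes>\<^bsub>A\<^esub> b0) (?X f1 f2 z)) \<in> linear_maps R H AB"
        by (rule lin_AB2[OF lin_tensor1[OF lin_mult1[OF linear_maps_id fk(1)] fk(2)] ab])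
      have "?\<kappa>2 f1 f2 b0 b1 = tensor_lift R AB (\<lambda>h1 h2. b1 h1 \<odot>\<^bsub>AB\<^esub> tensor R A HC (a \<otimes>\<^bsub>A\<^esub> b0) (?X f1 f2 h2)) (comult H h)"
        by (rule linear_hit_right[OF C_Dual[OF b01(2)] AB lz ah(2)])
      also have "\<dots> = tensor_lift R AB (\<lambda>h1 h2. ?\<kappa> f1 f2 h1 h2 b0 b1) (comult H h)"
      proof (rule sw_cong2[OF AB \<kappa>2[OF b01] ah(2)])
        fix h1 h2 assume h12: "h1 \<in> carrier H" "h2 \<in> carrier H"
        show "b1 h1 \<odot>\<^bsub>AB\<^esub> tensor R A HC (a \<otimes>\<^bsub>A\<^esub> b0) (?X f1 f2 h2) = ?\<kappa> f1 f2 h1 h2 b0 b1"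
          using linear_mapsD(3)[OF lin_AB1[OF lin_A2[OF linear_maps_id ah(1)] X[OF f12 h12(2)]], of "b1 h1" b0] b01 h12
          by simp
      qed
      finally show "tensor_lift R AB (\<lambda>h1 h2. ?\<kappa> f1 f2 h1 h2 b0 b1) (comult H h) = ?\<kappa>2 f1 f2 b0 b1" ..
    qed
    finally show "assoc (tensor R AH C (?p \<otimes>\<^bsub>A_H\<^esub> ?tm f1 ?q) (f2 \<otimes>\<^bsub>C\<^esub> g)) = tensor_lift R AB (?\<kappa>2 f1 f2) (coact b)" .
  qed
  \<comment> \<open>Now the sum over f goes inside as well, where it is the sum that defines the
    product of \<open>B\<close>.\<close>
  also have "\<dots> = tensor_lift R AB (\<lambda>b0 b1. tensor_lift R AB (\<lambda>f1 f2. ?\<kappa>2 f1 f2 b0 b1) (comult C f)) (coact b)"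
  proof (rule R.tensor_lift_swap[OF C C Am C AB])
    show "?\<kappa>2 f1 f2 \<in> bilinear_maps R A C AB" if "f1 \<in> carrier C" "f2 \<in> carrier C" for f1 f2
      by (intro bilinear_mapsI lin_AB1 lin_AB2 lin_A2 lin_tensor1 lin_mult1 linC_hit_right linear_maps_id;
          simp add: ah bk that)
    show "(\<lambda>f1 f2. ?\<kappa>2 f1 f2 b0 b1) \<in> bilinear_maps R C C AB" if "b0 \<in> carrier A" "b1 \<in> carrier C" for b0 b1
      by (intro bilinear_mapsI lin_AB2 lin_tensor1 lin_tensor2 lin_mult2 linC_hit_left linC_mult1 linear_maps_id;
          simp add: ah bk that)
  qed (simp_all add: ah bk)
  also have "\<dots> = tensor_lift R AB (\<lambda>b0 b1. tensor R A HC (a \<otimes>\<^bsub>A\<^esub> b0) (twist (tensor R H C h f) b1 \<otimes>\<^bsub>B\<^esub> tensor R H C k g)) (coact b)"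
  proof (rule aw_cong2[OF AB star_inner bk(1)])
    fix b0 b1 assume b01: "b0 \<in> carrier A" "b1 \<in> carrier C"
    have ab: "a \<otimes>\<^bsub>A\<^esub> b0 \<in> carrier A" and hb: "hit_right R H h b1 \<in> carrier H" using ah b01 by simp_all
    show "tensor_lift R AB (\<lambda>f1 f2. ?\<kappa>2 f1 f2 b0 b1) (comult C f) =
      tensor R A HC (a \<otimes>\<^bsub>A\<^esub> b0) (twist (tensor R H C h f) b1 \<otimes>\<^bsub>B\<^esub> tensor R H C k g)"
      unfolding twist_tensor[OF ah(2,3) b01(2)] B_mult_tensor[OF hb ah(3) bk(2,3)]
      by (rule cw_linear[OF HC AB inner_bil[OF hb bk(2,3)] lin_AB2[OF linear_maps_id ab] ah(3), symmetric])
  qed (simp_all add: ah bk)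
  also have "\<dots> = star (tensor R A HC a (tensor R H C h f)) (tensor R A HC b (tensor R H C k g))"
    by (rule star_tensor[symmetric]) (simp_all add: ah bk)
  finally show ?thesis .
qed

lemma assoc_mult:
  assumes s: "s \<in> carrier AHC" and t: "t \<in> carrier AHC"
  shows "assoc (s \<otimes>\<^bsub>A_H_C\<^esub> t) = star (assoc s) (assoc t)"
proof -
  note F = bilinear_maps_linear[OF A_H_C_smash(2) assoc_linear]
  note G = R.bilinear_maps_comp[OF star_bil assoc_linear assoc_linear]
  show ?thesis
  proof (rule R.tensor_assoc_ext[OF Am H C AB bilinear_mapsD(2)[OF F t] bilinear_mapsD(2)[OF G t] _ s])
    fix a h f assume ah: "a \<in> carrier A" "h \<in> carrier H" "f \<in> carrier C"
    let ?s = "tensor R AH C (tensor R A H a h) f"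
    have s: "?s \<in> carrier AHC" using ah by simp
    show "assoc (?s \<otimes>\<^bsub>A_H_C\<^esub> t) = star (assoc ?s) (assoc t)"
      by (rule R.tensor_assoc_ext[OF Am H C AB bilinear_mapsD(1)[OF F s] bilinear_mapsD(1)[OF G s] _ t])
        (simp add: assoc_mult_tensor assoc_tensor ah)
  qed
qed

theorem duality: "algebras_isomorphic R A_H_C (tensor_algebra R A B)"
proof -
  let ?T = "tensor_algebra R A B"
  let ?\<theta> = "\<lambda>t. coact_mult rho_lift_inv (assoc t)"
  note \<Psi> = coact_mult_linear[OF rho_lift_linear] and \<Phi> = coact_mult_linear[OF rho_lift_inv_linear]
  note \<Psi>c = linear_mapsD(1)[OF \<Psi>] and \<Phi>c = linear_mapsD(1)[OF \<Phi>] and \<alpha>c = linear_mapsD(1)[OF assoc_linear]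
  have \<Psi>\<Phi>: "coact_mult rho_lift (coact_mult rho_lift_inv t) = t" if "t \<in> carrier AB" for t
    by (rule coact_mult_inverse[OF rho_lift_linear rho_lift_inv_linear rho_lift_inv_conv(2) that])
  have \<Phi>\<Psi>: "coact_mult rho_lift_inv (coact_mult rho_lift t) = t" if "t \<in> carrier AB" for t
    by (rule coact_mult_inverse[OF rho_lift_inv_linear rho_lift_linear rho_lift_inv_conv(1) that])
  have Tc: "carrier ?T = carrier AB" "add ?T = add AB" "smult ?T = smult AB"
    by (simp_all add: R.tensor_algebra_simps AB_eq)
  have Sc: "carrier A_H_C = carrier AHC" "add A_H_C = add AHC" "smult A_H_C = smult AHC"
    by (simp_all add: R.smash_product_simps A_H_C_eq)
  have T: "assoc_algebra R ?T"
    by (rule R.tensor_algebra_assoc_algebra[OF A.assoc_algebra_axioms B_algebra])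
  interpret T: assoc_algebra R ?T by (rule T)
  show ?thesis
  proof (rule R.algebras_isomorphicI[OF _ T])
    show "module R A_H_C" by (rule R.smash_product_module[OF A_H C])
    show "(\<lambda>x y. x \<otimes>\<^bsub>A_H_C\<^esub> y) \<in> bilinear_maps R A_H_C A_H_C A_H_C"
      using A_H_C_smash(2) by (simp add: bilinear_maps_def linear_maps_def Sc)
    show "\<one>\<^bsub>A_H_C\<^esub> \<in> carrier A_H_C"
      unfolding Sc by (simp add: R.smash_product_simps A_H_C_eq)
    show "?\<theta> \<in> linear_maps R A_H_C ?T"
      using linear_maps_comp[OF \<Phi> assoc_linear] by (simp add: linear_maps_def Sc Tc)
    have "bij_betw (coact_mult rho_lift_inv) (carrier AB) (carrier AB)"
      by (rule bij_betw_byWitness[where f' = "coact_mult rho_lift"]) (auto simp: \<Psi>\<Phi> \<Phi>\<Psi> \<Psi>c \<Phi>c)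
    from bij_betw_trans[OF R.tensor_assoc_bij[OF Am H C] this]
    show "bij_betw ?\<theta> (carrier A_H_C) (carrier ?T)" by (simp add: Sc Tc comp_def)
    fix x y assume "x \<in> carrier A_H_C" "y \<in> carrier A_H_C"
    then have xy: "x \<in> carrier AHC" "y \<in> carrier AHC" by (simp_all add: Sc)
    have m: "?\<theta> x \<otimes>\<^bsub>?T\<^esub> ?\<theta> y \<in> carrier AB"
      using T.m_closed[of "?\<theta> x" "?\<theta> y"] xy by (simp add: Tc \<Phi>c \<alpha>c)
    \<comment> \<open>\<open>coact_mult_star\<close> describes the map from the ordinary product to
      \<open>star\<close>, the inverse of the second step of \<open>?\<theta>\<close>.
      Multiplicativity is therefore verified after applying \<open>coact_mult rho_lift\<close>, and
      then pulled back.\<close>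
    have "coact_mult rho_lift (?\<theta> x \<otimes>\<^bsub>?T\<^esub> ?\<theta> y) = assoc (x \<otimes>\<^bsub>A_H_C\<^esub> y)"
      using xy by (simp add: coact_mult_star \<Phi>c \<alpha>c \<Psi>\<Phi> assoc_mult)
    then show "?\<theta> (x \<otimes>\<^bsub>A_H_C\<^esub> y) = ?\<theta> x \<otimes>\<^bsub>?T\<^esub> ?\<theta> y"
      using \<Phi>\<Psi>[OF m] by simp
  next
    have one: "\<one>\<^bsub>?T\<^esub> = tensor R A HC \<one>\<^bsub>A\<^esub> \<one>\<^bsub>B\<^esub>"
      by (simp add: R.tensor_algebra_simps AB_eq)
    have "coact_mult rho_lift \<one>\<^bsub>?T\<^esub> = tensor R A HC \<one>\<^bsub>A\<^esub> (rho_lift \<one>\<^bsub>C\<^esub> \<otimes>\<^bsub>B\<^esub> \<one>\<^bsub>B\<^esub>)"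
      unfolding one coact_mult_tensor[OF rho_lift_linear A.one_closed B_one_closed] coact_one
      by (rule R.tensor_lift_tensor[OF Am C AB coact_mult_inner[OF rho_lift_linear B_one_closed]]) simp_all
    also have "\<dots> = \<one>\<^bsub>?T\<^esub>" by (simp add: rho_lift_one B_one one)
    also have "\<one>\<^bsub>?T\<^esub> = assoc \<one>\<^bsub>A_H_C\<^esub>"
      by (simp add: one R.smash_product_simps A_H_C_eq assoc_tensor)
    finally have "coact_mult rho_lift \<one>\<^bsub>?T\<^esub> = assoc \<one>\<^bsub>A_H_C\<^esub>" .
    then show "?\<theta> \<one>\<^bsub>A_H_C\<^esub> = \<one>\<^bsub>?T\<^esub>"
      using \<Phi>\<Psi>[of "\<one>\<^bsub>?T\<^esub>"] T.one_closed by (simp add: Tc)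
  qed
qed

end

section \<open>Hopf subalgebras of the finite dual\<close>

lemma finite_dual_simps:
  "carrier (finite_dual R H) = finite_dual_set R H"
  "add (finite_dual R H) = add (function_module R (carrier H))"
  "zero (finite_dual R H) = zero (function_module R (carrier H))"
  "smult (finite_dual R H) = smult (function_module R (carrier H))"
  "one (finite_dual R H) = restrict (counit H) (carrier H)"
  "counit (finite_dual R H) f = f \<one>\<^bsub>H\<^esub>"
  "antipode (finite_dual R H) f = (\<lambda>h\<in>carrier H. f (antipode H h))"
  by (simp_all add: finite_dual_def Let_def)

lemma restrict_hopf_simps:
  "carrier (restrict_hopf R K U) = U" "add (restrict_hopf R K U) = add K" "zero (restrict_hopf R K U) = zero K"
  "smult (restrict_hopf R K U) = smult K" "mult (restrict_hopf R K U) = mult K" "one (restrict_hopf R K U) = one K"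
  "counit (restrict_hopf R K U) = counit K" "antipode (restrict_hopf R K U) = antipode K"
  by (simp_all add: restrict_hopf_def)

context hopf_algebra
begin

lemma finite_dual_mult: "f \<otimes>\<^bsub>finite_dual R H\<^esub> g = conv f g"
  by (simp add: finite_dual_def Let_def conv_def)

text \<open>Existence is \<open>finite_dual_comult_exists\<close> and uniqueness is separation by
  pairs of points. Together they justify the definite description in
  \<open>finite_dual\<close>.\<close>

lemma finite_dual_comult:
  assumes noeth: "noetherian_ring R" and pure: "pure_submodule R (finite_dual_set R H) fun_space"
    and f: "f \<in> finite_dual_set R H"
  defines "K \<equiv> finite_dual R H"
  shows "comult K f \<in> carrier (tensor_module R K K)"
    and "\<And>h k. h \<in> carrier H \<Longrightarrow> k \<in> carrier H \<Longrightarrow>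
      tensor_lift R (self_module R) (\<lambda>f1 f2. f1 h \<otimes>\<^bsub>R\<^esub> f2 k) (comult K f) = f (h \<otimes>\<^bsub>H\<^esub> k)"
proof -
  note F = R.function_module_module[of "carrier H"]
  define D where "D = fun_space\<lparr>carrier := finite_dual_set R H\<rparr>"
  have sub: "submodule (finite_dual_set R H) R fun_space" using pure by (simp add: pure_submodule_def)
  have D: "module R D" unfolding D_def by (rule submodule.submodule_is_module[OF sub F])
  have Dc: "carrier D = finite_dual_set R H" "add D = add fun_space" "smult D = smult fun_space"
    by (simp_all add: D_def)
  have KK: "tensor_module R K K = tensor_module R D D"
    by (rule tensor_module_cong(1)) (simp_all add: K_def finite_dual_simps Dc)
  let ?P = "\<lambda>t. t \<in> carrier (tensor_module R D D) \<and> (\<forall>h\<in>carrier H. \<forall>k\<in>carrier H.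
    f (h \<otimes>\<^bsub>H\<^esub> k) = tensor_lift R (self_module R) (\<lambda>f1 f2. f1 h \<otimes>\<^bsub>R\<^esub> f2 k) t)"
  have evD: "(\<lambda>f. f h) \<in> linear_maps R D (self_module R)" if "h \<in> carrier H" for h
    by (rule linear_mapsI)
      (use that finite_dual_setD(1) in \<open>auto simp: Dc R.function_module_simps\<close>)
  have ext: "carrier D \<subseteq> extensional (carrier H)" using finite_dual_setD(2) by (auto simp: Dc)
  have inj: "t = \<zero>\<^bsub>tensor_module R D D\<^esub>" if "t \<in> carrier (tensor_module R D D)"
    "\<And>x. x \<in> carrier H \<Longrightarrow> tensor_lift R D (\<lambda>f m. f x \<odot>\<^bsub>D\<^esub> m) t = \<zero>\<^bsub>D\<^esub>" for t
    by (rule R.function_submodule_tensor_inj[OF noeth pure D Dc that])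
  have "\<exists>t. ?P t" using finite_dual_comult_exists[OF noeth pure D_def f] by blast
  moreover have "s = t" if "?P s" "?P t" for s t
    by (rule R.function_eval_tensor_inj[OF D evD ext inj]) (use that in auto)
  ultimately have ex1: "\<exists>!t. ?P t" by blast
  have eq: "comult K f = (THE t. ?P t)"
    by (simp add: K_def D_def finite_dual_def Let_def)
  have *: "?P (comult K f)" unfolding eq by (rule theI'[OF ex1])
  show "comult K f \<in> carrier (tensor_module R K K)" unfolding KK using * by blast
  show "tensor_lift R (self_module R) (\<lambda>f1 f2. f1 h \<otimes>\<^bsub>R\<^esub> f2 k) (comult K f) = f (h \<otimes>\<^bsub>H\<^esub> k)"
    if "h \<in> carrier H" "k \<in> carrier H" for h k
    using * that by simp
qed

text \<open>The comultiplication of U and the embedding of H \<otimes> U into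
  \<open>H\<^sup>H\<close> rest on one separation property: evaluation at points of H is injective
  on U \<otimes> M for every module M. It comes from two applications of purity, of U in
  \<open>H\<^sup>\<circ>\<close> and of \<open>H\<^sup>\<circ>\<close> in \<open>R\<^sup>H\<close>,
  followed by the noetherian embedding.\<close>

lemma dual_hopf_restrict:
  assumes noeth: "noetherian_ring R" and pure: "pure_submodule R (finite_dual_set R H) fun_space"
    and U: "hopf_subalgebra R U (finite_dual R H)"
    and bij: "bijective_antipode H" "bijective_antipode (restrict_hopf R (finite_dual R H) U)"
    and RL: "RL_condition R H (restrict_hopf R (finite_dual R H) U)"
  shows "dual_hopf R H (restrict_hopf R (finite_dual R H) U)"
proof -
  define K where "K = finite_dual R H"
  define C where "C = restrict_hopf R K U"
  note H = module_axioms
  note F = R.function_module_module[of "carrier H"]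
  have subF: "submodule (finite_dual_set R H) R fun_space" using pure by (simp add: pure_submodule_def)
  have K: "module R K"
    by (rule module_cong[OF submodule.submodule_is_module[OF subF F]]) (simp_all add: K_def finite_dual_simps)
  have Kc: "carrier K = finite_dual_set R H" "add K = add fun_space" "smult K = smult fun_space"
    by (simp_all add: K_def finite_dual_simps)
  have pureU: "pure_submodule R U K" using U by (simp add: hopf_subalgebra_def K_def)
  then have subU: "submodule U R K" by (simp add: pure_submodule_def)
  have UK: "U \<subseteq> carrier K" by (rule module.submoduleE(1)[OF K subU])
  have Cc: "carrier C = U" "add C = add K" "smult C = smult K" "zero C = zero K"
    by (simp_all add: C_def restrict_hopf_simps)
  have C: "module R C"
    by (rule module_cong[OF submodule.submodule_is_module[OF subU K]]) (simp_all add: Cc)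
  have U_HD: "f \<in> finite_dual_set R H" if "f \<in> carrier C" for f using that UK by (auto simp: Cc Kc)
  note C_Dual = finite_dual_setD(1)[OF U_HD] and C_ext = finite_dual_setD(2)[OF U_HD]
  have C_eval: "(\<lambda>f. f h) \<in> linear_maps R C (self_module R)" if "h \<in> carrier H" for h
    by (rule linear_mapsI) (use that C_Dual in \<open>auto simp: Cc Kc R.function_module_simps\<close>)
  have incl: "(\<lambda>x. x) \<in> linear_maps R C K"
    by (rule linear_mapsI) (use UK in \<open>auto simp: Cc\<close>)
  have eval_bil: "(\<lambda>f m. f x \<odot>\<^bsub>M\<^esub> m) \<in> bilinear_maps R K M M"
    if "x \<in> carrier H" "module R M" for x and M :: "('r, 'q, 'w) module_scheme"
  proof -
    have "(\<lambda>x. x) \<in> linear_maps R K fun_space"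
      by (rule linear_mapsI) (use module.submoduleE(1)[OF F subF] in \<open>auto simp: Kc\<close>)
    from R.bilinear_maps_comp[OF R.function_eval_bilinear[OF that(2,1)] this linear_maps_id] show ?thesis .
  qed
  have inj: "t = \<zero>\<^bsub>tensor_module R C M\<^esub>"
    if M: "module R M" and t: "t \<in> carrier (tensor_module R C M)"
      and ev: "\<And>x. x \<in> carrier H \<Longrightarrow> tensor_lift R M (\<lambda>f m. f x \<odot>\<^bsub>M\<^esub> m) t = \<zero>\<^bsub>M\<^esub>"
    for t and M :: "('r, 'q, 'w) module_scheme"
  proof (rule R.pure_submodule_eval_inj[OF K pureU M Cc(1-3) t],
      rule R.function_submodule_tensor_inj[OF noeth pure M Kc])
    show "tensor_map R K M (\<lambda>x. x) (\<lambda>x. x) t \<in> carrier (tensor_module R K M)"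
      by (rule linear_mapsD(1)[OF R.tensor_map_linear[OF C M K M incl linear_maps_id] t])
    fix x assume x: "x \<in> carrier H"
    show "tensor_lift R M (\<lambda>f m. f x \<odot>\<^bsub>M\<^esub> m) (tensor_map R K M (\<lambda>x. x) (\<lambda>x. x) t) = \<zero>\<^bsub>M\<^esub>"
      unfolding R.tensor_lift_tensor_map[OF C M K M M incl linear_maps_id eval_bil[OF x M] t] by (rule ev[OF x])
  qed
  have ext: "carrier C \<subseteq> extensional (carrier H)" using C_ext by blast
  \<comment> \<open>Separation of U \<otimes> U by pairs of points gives the uniqueness for the
    definite description in \<open>restrict_hopf\<close>, and later the linearity of the
    corestricted comultiplication.\<close>
  have eqI: "s = t" if "s \<in> carrier (tensor_module R C C)" "t \<in> carrier (tensor_module R C C)"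
    "\<And>x y. x \<in> carrier H \<Longrightarrow> y \<in> carrier H \<Longrightarrow> tensor_lift R (self_module R) (\<lambda>f g. f x \<otimes>\<^bsub>R\<^esub> g y) s =
      tensor_lift R (self_module R) (\<lambda>f g. f x \<otimes>\<^bsub>R\<^esub> g y) t" for s t
    by (rule R.function_eval_tensor_inj[OF C C_eval ext inj[OF C] that])
  note CC = R.tensor_module_module[OF C C]
  have ev2: "(\<lambda>f1 f2. f1 h \<otimes>\<^bsub>R\<^esub> f2 k) \<in> bilinear_maps R K K (self_module R)" if "h \<in> carrier H" "k \<in> carrier H" for h k
  proof -
    have ev: "(\<lambda>f. f h) \<in> linear_maps R K (self_module R)" if "h \<in> carrier H" for h
      by (rule linear_mapsI) (use that finite_dual_setD(1) in \<open>auto simp: Kc R.function_module_simps\<close>)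
    show ?thesis
      using R.bilinear_maps_comp[OF eval_bil[OF that(1) R.self_module] linear_maps_id ev[OF that(2)]] by simp
  qed
  have ev2_map: "tensor_lift R (self_module R) (\<lambda>f1 f2. f1 h \<otimes>\<^bsub>R\<^esub> f2 k) (tensor_map R K K (\<lambda>u. u) (\<lambda>u. u) t) =
      tensor_lift R (self_module R) (\<lambda>f1 f2. f1 h \<otimes>\<^bsub>R\<^esub> f2 k) t"
    if "h \<in> carrier H" "k \<in> carrier H" "t \<in> carrier (tensor_module R C C)" for h k t
    by (rule R.tensor_lift_tensor_map[OF C C K K R.self_module incl incl ev2[OF that(1,2)] that(3)])
  have TC: "tensor_module R (K\<lparr>carrier := U\<rparr>) (K\<lparr>carrier := U\<rparr>) = tensor_module R C C"
    by (rule tensor_module_cong(1)) (simp_all add: Cc)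
  have comult: "comult C f \<in> carrier (tensor_module R C C)"
    "\<And>h k. h \<in> carrier H \<Longrightarrow> k \<in> carrier H \<Longrightarrow>
      tensor_lift R (self_module R) (\<lambda>f1 f2. f1 h \<otimes>\<^bsub>R\<^esub> f2 k) (comult C f) = f (h \<otimes>\<^bsub>H\<^esub> k)" if f: "f \<in> carrier C" for f
  proof -
    let ?P = "\<lambda>t. t \<in> carrier (tensor_module R C C) \<and> tensor_map R K K (\<lambda>u. u) (\<lambda>u. u) t = comult K f"
    have "comult K f \<in> tensor_map R K K (\<lambda>u. u) (\<lambda>u. u) ` carrier (tensor_module R C C)"
      using U f unfolding hopf_subalgebra_def K_def[symmetric] TC by (auto simp: Cc)
    then have "\<exists>t. ?P t" by auto
    moreover have "s = t" if "?P s" "?P t" for s t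
    proof (rule eqI)
      fix x y assume xy: "x \<in> carrier H" "y \<in> carrier H"
      show "tensor_lift R (self_module R) (\<lambda>f g. f x \<otimes>\<^bsub>R\<^esub> g y) s = tensor_lift R (self_module R) (\<lambda>f g. f x \<otimes>\<^bsub>R\<^esub> g y) t"
        using ev2_map[OF xy, of s] ev2_map[OF xy, of t] that by simp
    qed (use that in auto)
    ultimately have ex1: "\<exists>!t. ?P t" by blast
    have eq: "comult C f = (THE t. ?P t)"
      unfolding TC[symmetric] by (simp add: C_def restrict_hopf_def)
    have *: "?P (comult C f)" unfolding eq by (rule theI'[OF ex1])
    then show "comult C f \<in> carrier (tensor_module R C C)" by blast
    show "tensor_lift R (self_module R) (\<lambda>f1 f2. f1 h \<otimes>\<^bsub>R\<^esub> f2 k) (comult C f) = f (h \<otimes>\<^bsub>H\<^esub> k)"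
      if "h \<in> carrier H" "k \<in> carrier H" for h k
      using ev2_map[OF that, of "comult C f"] * finite_dual_comult(2)[OF noeth pure U_HD[OF f] that] by (simp add: K_def)
  qed
  note ev2C = R.bilinear_maps_comp[OF ev2 incl incl]
  note lin_ev2 = linear_mapsD[OF R.tensor_lift_linear[OF C C R.self_module ev2C]]
  note lin_ev = linear_mapsD[OF C_eval]
  interpret CC: module R "tensor_module R C C" by (rule CC)
  interpret C: module R C by (rule C)
  show "dual_hopf R H C"
    unfolding C_def[symmetric]
  proof (intro dual_hopf.intro dual_hopf_axioms.intro hopf_algebra_axioms C C_eval)
    fix f assume f: "f \<in> carrier C"
    show "f \<in> Dual" "f \<in> extensional (carrier H)" by (rule C_Dual[OF f], rule C_ext[OF f])
    fix g assume g: "g \<in> carrier C"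
    show "f \<otimes>\<^bsub>C\<^esub> g \<in> carrier C"
      using U f g by (simp add: hopf_subalgebra_def K_def C_def restrict_hopf_simps)
    show "f \<otimes>\<^bsub>C\<^esub> g = conv f g"
      by (simp add: C_def restrict_hopf_simps K_def finite_dual_mult)
  next
    show "\<one>\<^bsub>C\<^esub> \<in> carrier C"
      using U by (simp add: hopf_subalgebra_def K_def C_def restrict_hopf_simps)
    show "\<one>\<^bsub>C\<^esub> = restrict (counit H) (carrier H)"
      by (simp add: C_def restrict_hopf_simps K_def finite_dual_simps)
    show "comult C \<in> linear_maps R C (tensor_module R C C)"
    proof (rule linear_mapsI)
      fix f g assume fg: "f \<in> carrier C" "g \<in> carrier C"
      show "comult C (f \<oplus>\<^bsub>C\<^esub> g) = comult C f \<oplus>\<^bsub>tensor_module R C C\<^esub> comult C g"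
        by (rule eqI) (simp_all add: comult fg lin_ev2(2) lin_ev(2))
    next
      fix r f assume rf: "r \<in> carrier R" "f \<in> carrier C"
      show "comult C (r \<odot>\<^bsub>C\<^esub> f) = r \<odot>\<^bsub>tensor_module R C C\<^esub> comult C f"
        by (rule eqI) (simp_all add: comult rf lin_ev2(3) lin_ev(3))
    qed (rule comult(1))
  next
    fix f h k assume "f \<in> carrier C" "h \<in> carrier H" "k \<in> carrier H"
    then show "tensor_lift R (self_module R) (\<lambda>f1 f2. f1 h \<otimes>\<^bsub>R\<^esub> f2 k) (comult C f) = f (h \<otimes>\<^bsub>H\<^esub> k)"
      by (rule comult(2))
  next
    fix f h assume "f \<in> carrier C" "h \<in> carrier H"
    then show "antipode C f h = f (antipode H h)"
      by (simp add: C_def restrict_hopf_simps K_def finite_dual_simps)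
  next
    show "bij_betw (antipode C) (carrier C) (carrier C)"
      using bij(2) by (simp add: bijective_antipode_def C_def K_def)
    show "bij_betw (antipode H) (carrier H) (carrier H)"
      using bij(1) by (simp add: bijective_antipode_def)
  next
    fix t assume t: "t \<in> carrier (tensor_module R H C)"
      and ev: "\<And>k. k \<in> carrier H \<Longrightarrow> tensor_lift R H (\<lambda>h f. f k \<odot>\<^bsub>H\<^esub> h) t = \<zero>\<^bsub>H\<^esub>"
    \<comment> \<open>The separation property has U in the left factor; the flip carries it over to
      H \<otimes> U.\<close>
    let ?s = "R.tensor_flip H C t"
    have "?s = \<zero>\<^bsub>tensor_module R C H\<^esub>"
    proof (rule inj[OF H])
      show "?s \<in> carrier (tensor_module R C H)" by (rule linear_mapsD(1)[OF R.tensor_flip_linear[OF H C] t])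
      fix x assume x: "x \<in> carrier H"
      show "tensor_lift R H (\<lambda>f m. f x \<odot>\<^bsub>H\<^esub> m) ?s = \<zero>\<^bsub>H\<^esub>"
        unfolding R.tensor_lift_flip[OF H C H R.bilinear_maps_comp[OF eval_bil[OF x H] incl linear_maps_id] t]
        by (rule ev[OF x])
    qed
    then have "R.tensor_flip C H ?s = \<zero>\<^bsub>tensor_module R H C\<^esub>"
      using linear_maps_zero[OF R.tensor_module_module[OF C H] R.tensor_module_module[OF H C] R.tensor_flip_linear[OF C H]] by simp
    then show "t = \<zero>\<^bsub>tensor_module R H C\<^esub>" using R.tensor_flip_flip[OF H C t] by simp
  next
    fix f assume f: "f \<in> carrier C"
    have "smash_rho R H (tensor R C H f \<one>\<^bsub>H\<^esub>) \<in> smash_lambda R H ` carrier (tensor_module R H C)"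
      using RL f unfolding RL_condition_def K_def[symmetric] C_def[symmetric] R.smash_product_simps(1) by blast
    then obtain t where t: "t \<in> carrier (tensor_module R H C)" "smash_rho R H (tensor R C H f \<one>\<^bsub>H\<^esub>) = smash_lambda R H t"
      by blast
    have "tensor_lift R H (\<lambda>h g. h \<otimes>\<^bsub>H\<^esub> hit_left R H g k) t = hit_right R H k f" if k: "k \<in> carrier H" for k
    proof -
      have "(\<lambda>f. hit_right R H k f) \<in> linear_maps R C H"
        unfolding hit_right_def by (rule lin_sw2[OF C H k]) (simp_all add: hit_bil C_Dual lin_smult1[OF C_eval H])
      then have b: "(\<lambda>f h. hit_right R H k f \<otimes>\<^bsub>H\<^esub> h) \<in> bilinear_maps R C H H"
        by (intro bilinear_mapsI lin_mult1 lin_mult2 linear_maps_id) (simp_all add: k C_Dual)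
      have "tensor_lift R H (\<lambda>h g. h \<otimes>\<^bsub>H\<^esub> hit_left R H g k) t = smash_rho R H (tensor R C H f \<one>\<^bsub>H\<^esub>) k"
        unfolding t(2) using k by (simp add: smash_lambda_def)
      also have "\<dots> = hit_right R H k f"
        using R.tensor_lift_tensor[OF C H H b f one_closed] k f C_Dual by (simp add: smash_rho_def)
      finally show ?thesis .
    qed
    then show "\<exists>t\<in>carrier (tensor_module R H C). \<forall>k\<in>carrier H.
        tensor_lift R H (\<lambda>h g. h \<otimes>\<^bsub>H\<^esub> hit_left R H g k) t = hit_right R H k f"
      using t(1) by blast
  qed
qed

end

theorem theorem3p2:
  fixes R :: "('r, 's) ring_scheme"
    and H :: "('r, 'h, 'x) hopf_scheme"
    and U :: "('h \<Rightarrow> 'r) set"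
    and A :: "('r, 'a, 'y) module_scheme"
    and coact :: "'a \<Rightarrow> ('a \<times> ('h \<Rightarrow> 'r) \<Rightarrow> 'r) set"
  assumes "cring R" and "noetherian_ring R"
    and "hopf_algebra R H"
    and "pure_submodule R (finite_dual_set R H) (function_module R (carrier H))"
    and "hopf_subalgebra R U (finite_dual R H)"
    and "bijective_antipode H" and "bijective_antipode (restrict_hopf R (finite_dual R H) U)"
    and "RL_condition R H (restrict_hopf R (finite_dual R H) U)"
    and "right_comodule_algebra R (restrict_hopf R (finite_dual R H) U) A coact"
  shows "algebras_isomorphic R
           (smash_product R
              (smash_product R A H (coaction_action R A coact))
              (restrict_hopf R (finite_dual R H) U) (\<lambda>f. tensor_map R A H (\<lambda>a. a) (hit_left R H f)))
           (tensor_algebra R A (smash_product R H (restrict_hopf R (finite_dual R H) U) (hit_left R H)))"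
proof -
  interpret dual_comodule R H "restrict_hopf R (finite_dual R H) U" A coact
  proof (intro dual_comodule.intro dual_comodule_axioms.intro)
    show "dual_hopf R H (restrict_hopf R (finite_dual R H) U)"
      by (rule hopf_algebra.dual_hopf_restrict[OF assms(3,2,4-8)])
  qed (simp_all add: assms(9) restrict_hopf_simps finite_dual_simps)
  show ?thesis by (rule duality)
qed

end
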